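(* Let $\hat T=f_a\in\mathcal M$ and let $H$ be a hole in $[-1,1]$ satisfying (A1)–(A4), with the constants $r,m_0,\varepsilon_0,n_0,\delta,\varepsilon,\theta,D$ fixed as in the context. Let $t>0$, $H_t=H$, and let $\{H_s\}_{s\in(0,t]}$ be a family of holes with the following properties: (1) $m(H_s)\le s$, $H_s\subset H_t$, and each component of $H_t$ contains at most one component of $H_s$; (2) either $0,\delta,-\delta\notin H_t$, or $0,\delta,-\delta\in H_s$ for all $s\in(0,t]$. Let $\mu_s$ be the absolutely continuous conditionally invariant measure for the open system with hole $H_s$ obtained by projecting the conditionally invariant measure of the tower (as defined in the context). Then, as $s\to0$, $\mu_s$ converges weakly to the unique absolutely continuous invariant probability measure for $\hat T$ (with no holes).
   Context: $m$ and $|\cdot|$ denote Lebesgue measure (length). Class $\mathcal M$. For $0\le a\le2$ let $f_a(x)=1-ax^2$ on $[-1,1]$. The map $f=f_a$ is in $\mathcal M$ if there exists $\delta_0>0$ such that: (a) $\mathrm{dist}(f^n(0),0)>2\delta_0$ for all $n>0$; (b) there exist $\lambda_0>0$, $M_0\in\mathbb Z^+$, $0<c_0\le1$ such that (i) for all $n\ge M_0$, if $x,f(x),\dots,f^{n-1}(x)\notin(-\delta_0,\delta_0)$ then $|(f^n)'(x)|\ge e^{\lambda_0n}$; (ii) for any $n$, if $x,f(x),\dots,f^{n-1}(x)\notin(-\delta_0,\delta_0)$ and $f^n(x)\in(-\delta_0,\delta_0)$ then $|(f^n)'(x)|\ge c_0e^{\lambda_0n}$; (c) for all $x\in(-\delta_0,\delta_0)$,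 $x\neq 0$, there exists an integer $s_0(x)\sim\log\frac1{|x|}$ (comparable up to constant factors) such that $f^j(x)\notin(-\delta_0,\delta_0)$ for all $1\le j<s_0$ and $|(f^{s_0})'(x)|\ge c_0^{-1}e^{\frac13\lambda_0s_0}$. Open system. A hole $H$ is a finite union of open intervals $H_1,\dots,H_L$ (its components) in $\hat I=[-1,1]$. Put $I=\hat I\setminus H$, $T=\hat T|_{I\cap\hat T^{-1}I}$. "$T^n\omega$ is defined" means $\hat T^i\omega\subset I$ for $0\le i\le n$. A probability measure $\mu$ is conditionally invariant for $T$ if $\mu(T^{-1}A)/\mu(T^{-1}I)=\mu(A)$ for all Borel $A$. Assumptions on $H$. (A1) The critical orbit $\{\hat T^n(0):n\ge1\}$ is bounded away from $H$; $r$ is the minimum of this distance and $\delta_0$. (A2) For a fixed, sufficiently large $m_0\in\mathbb Z^+$ (depending on $\lambda_0$; $m_0=10$ suffices if $\lambda_0=\log1.9$) there is $\varepsilon_0>0$ such that for any interval $\omega\subset I$, if $|\hat T^i\omega|<\varepsilon_0$ for $0\le i\le m_0$, then there is at most one $i$ and one $j$ with $\hat T^i\omega\cap H_j\ne\emptyset$. (A3) $m(H)<\frac{(1-\sqrt\theta)^3}{3}\cdot\frac{\varepsilon^2}{D\theta}$, with $\varepsilon,\theta,D$ below. (A4) (a) $\hat T^iH_j\cap G_k=\emptyset$ for all $j,k$, $0\le i\le n_0$; (b) $\hat T^iH_j\cap H_k=\emptyset$ for all $j,k$, $1\le i\le n_0$. Here $G_k=-H_k$ and $n_0$ is such that $\hat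 T^{n_0}J\supseteq[1-a,1]$ for every interval $J\subseteq\hat I$ with $|J|\ge\varepsilon_0/2$. Constants, chosen in this order and depending only on $\hat T$, $r$, $m_0$, $\varepsilon_0$: $\delta=e^{-k_0}<\delta_0$ with $k_0\in\mathbb Z^+$ sufficiently large; $I_k=(e^{-(k+1)},e^{-k})$ for $k\ge k_0$, $I_k=-I_{-k}$ for $k\le-k_0$; $q(k)=\max\{n:|\hat T^j((0,e^{-k}))|\le r/2\ \forall j\le n\}$ for $k\ge k_0$ (analogously for $k\le-k_0$); $\varepsilon'>0$ is such that $|\hat T^{q(k)}I_k|\ge\varepsilon'$ for all $|k|\ge k_0$; $\tilde C>0$ (of order $\delta^{-2}$) is a constant such that $|(\hat T^S)'(x)/(\hat T^S)'(y)-1|\le\tilde C|\hat T^Sx-\hat T^Sy|$ for $x,y$ in one element of the partition $\mathcal Z$ with stopping time $S$ constructed below, and likewise for $R$ on elements of $\eta$; $\varepsilon$ is given by $4^8\varepsilon=\min\{\varepsilon',\varepsilon_0,\frac1{4\tilde C}\}$; $C''>0$, $\theta\in(0,1)$, $D>0$ are the constants of the bounds $m\{x\in\Lambda^{(j)}:R(x)>n\}\le C''\theta^n$ and $m\{x\in\Lambda^{(j)}:R(x)=n,\hat T^nx\in H\}\le D\,m(H)\theta^n$ for the return time $R$ constructed below. The same constants (those chosen for $H_t=H$) are used for every hole $H_s$. Construction of $\mathcal Z,S$. $\mathcal Q$ is the partition of $[-1,1]$ obtained by joining $\{I_k\}_{|k|\ge k_0}$ on $(-\delta,\delta)$ with the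 partition into the maximal intervals of $I$ and $H$. Let $\Omega\subset I$ be an interval with $\varepsilon\le|\Omega|\le3\varepsilon$ and either $\Omega\subset(-\delta,\delta)\setminus\{0\}$ or $\Omega\subset I\setminus(-\delta,\delta)$. $\Omega_0$ is the set of components of $\mathcal Q|\Omega$. Given $\Omega_{n-1}$ and $\omega\in\Omega_{n-1}$, let $t$ be the last time $\omega$ passed through $(-\delta,\delta)$, $\hat T^t\omega\subset I_k$ (set $t=q(k)=0$ if it has not yet passed). If $n>t+q(k)$: if $\hat T^n\omega\cap H=\emptyset$, then when $|\hat T^n\omega|\ge4^8\varepsilon$ put $\omega$ in $\mathcal Z$ with $S=n$ on $\omega$; otherwise partition $\omega$ by $\hat T^{-n}\mathcal Q|\omega$ and put the pieces in $\Omega_n$ (a piece of $\hat T^n\omega$ lying outside $(-\delta,\delta)$ adjacent to a piece in $I_{\pm k_0}$ is appended to the latter without a cut). If $\hat T^n\omega\cap H\neq\emptyset$, put the components of $\omega\cap\hat T^{-n}H$ in $\mathcal Z$ with $S=n$ and treat each remaining subinterval as in the previous sentence. If $n<t+q(k)$, put $\omega$ in $\Omega_n$. If $n=t+q(k)$ and $|\hat T^n\omega|<4^8\varepsilon$, put $\omega$ in $\Omega_n$. If $n=t+q(k)$ and $|\hat T^n\omega|\ge4^8\varepsilon$: when $\omega\in\Omega_{t-1}$ (not created by a cut at time $t$), put $\omega$ in $\mathcal Z$ with $S=n$; when $\omega$ was created at time $t$ by a cut between $I_k$ and $I_{k+1}$, with adjacent piece $\gamma$, $\hat T^t\gamma\subseteq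 I_{k+1}$, let $\omega'$ be the part of $\omega$ on the side of $\gamma$ which does not completely cover under $\hat T^n$ the last reference interval on that side, declare $S=n$ on $\omega\setminus\omega'$ and put $\omega'\cup\gamma$ into $\Omega_n$. Construction of $\eta,R$. Reference intervals $\Lambda^{(1)},\dots,\Lambda^{(N)}$ are intervals of the type $\Omega$ with $\varepsilon\le|\Lambda^{(i)}|\le2\varepsilon$ covering $[1-a,1]\setminus H$. Apply the previous construction to $\Lambda^{(j)}$ to get $\mathcal Z_1,S_1$. For $\omega_1\in\mathcal Z_1$: if $\hat T^{S_1}\omega_1\subset H$, put $\omega_1$ in $\eta$ with $R=S_1$. If $|\hat T^{S_1}\omega_1|\ge4^8\varepsilon$, then $\hat T^{S_1}\omega_1$ covers many $\Lambda^{(i)}$ plus at most one extra piece at each end; an end piece shorter than $\varepsilon$ is adjoined to the neighbouring covered $\Lambda^{(i)}$; for each covered $\Lambda^{(i)}$ not so adjoined put $\omega_1\cap T^{-S_1}\Lambda^{(i)}$ in $\eta$ with $R=S_1$. On the at most two remaining end pieces $\omega_1^\pm$, with $\varepsilon\le|\hat T^{S_1}\omega_1^\pm|\le3\varepsilon$, apply the construction of $S$ to $\hat T^{S_1}\omega_1^{\pm}$, set $S_2=S_1+S\circ\hat T^{S_1}$, and repeat inductively. Tower and $\mu_s$. Identify $\Lambda^{(i)}$ affinely with an interval $\Delta_0^{(i)}$ of unit length (disjoint interiors) via $\pi_0:\Delta_0^{(i)}\to\Lambda^{(i)}$; transport $\eta,R$ to $\Delta_0=\bigcup_i\Delta_0^{(i)}$.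 $\Delta=\{(z,l):z\in\Delta_0,\ 0\le l<R(z)\}$ with Lebesgue measure $m$ on each level; $F(z,l)=(z,l+1)$ if $l+1<R(z)$, $F(z,l)=(\pi_0^{-1}T^R\pi_0z,0)$ if $l+1=R(z)$ and the element returns, and $F$ is undefined if $l+1=R(z)$ and the element falls into $H$. $\pi(z,l)=T^l\pi_0z$, so $\pi\circ F=T\circ\pi$. The intervals $\Delta^{(i)}_{l,j}$ are the maximal intervals of level $l$ above $\Delta_0^{(i)}$ projecting onto elements of the dynamically defined collection of not yet returned pieces at time $l$ in the construction over $\Lambda^{(i)}$, except that each $\Delta_0^{(i)}$ is a single element. Let $\mathcal Pf(x)=\sum_{Fy=x}f(y)/|F'(y)|$, $\mathcal P_1f=\mathcal Pf/|\mathcal Pf|_{L^1}$, $\xi=-\frac12\log\theta$, $C=2\tilde C\varepsilon$, $M=\frac{1+C}{1-\sqrt\theta}$, $\|f\|=\max\{\sup_{i,l,j}e^{-\xi l}\sup_{\Delta^{(i)}_{l,j}}|f|,\ \sup_{i,l,j}e^{-\xi l}\sup_{x\in\Delta_{l,j}^{(i)},f(x)\ne0}|f'(x)/f(x)|\}$, and $X_M=\{f:\|f\|\le M,\ f\ge0,\ \int_\Delta f\,dm=1\}$. For the hole $H_s$ (in place of $H$) let $\varphi_s\in X_M$ with $\mathcal P_1\varphi_s=\varphi_s$ be the conditionally invariant density on the corresponding tower (it exists) and let $\mu_s(A)=\int_{\pi^{-1}A}\varphi_s\,dm$. This is the measure $\mu_s$ in the claim, regarded as a measure on $[-1,1]$.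 *)

theory Defs
  imports "HOL-Probability.Probability"
begin

section \<open>Logistic maps and holes\<close>

abbreviation len :: "real set \<Rightarrow> real" where
  "len A \<equiv> measure lborel A"

definition logistic :: "real \<Rightarrow> real \<Rightarrow> real" where
  "logistic a x = 1 - a * x\<^sup>2"

text \<open>Membership of \<open>logistic a\<close> in the class \<open>\<M>\<close>, with its constants made explicit.  The two
  positive constants \<open>A\<close>, \<open>B\<close> express that \<open>s\<close> is comparable to \<open>log (1/|x|)\<close>.\<close>

definition class_M :: "real \<Rightarrow> real \<Rightarrow> real \<Rightarrow> nat \<Rightarrow> real \<Rightarrow> bool" where
  "class_M a \<delta>0 lam0 M0 c0 \<longleftrightarrow>
     0 \<le> a \<and> a \<le> 2 \<and> 0 < \<delta>0 \<and> 0 < lam0 \<and> 0 < M0 \<and> 0 < c0 \<and> c0 \<le> 1 \<and>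
     (\<forall>n>0. dist ((logistic a ^^ n) 0) 0 > 2 * \<delta>0) \<and>
     (\<forall>n\<ge>M0. \<forall>x\<in>{-1..1}.
        (\<forall>i<n. (logistic a ^^ i) x \<notin> {-\<delta>0<..<\<delta>0}) \<longrightarrow>
        \<bar>deriv (logistic a ^^ n) x\<bar> \<ge> exp (lam0 * real n)) \<and>
     (\<forall>n. \<forall>x\<in>{-1..1}.
        (\<forall>i<n. (logistic a ^^ i) x \<notin> {-\<delta>0<..<\<delta>0}) \<and> (logistic a ^^ n) x \<in> {-\<delta>0<..<\<delta>0} \<longrightarrow>
        \<bar>deriv (logistic a ^^ n) x\<bar> \<ge> c0 * exp (lam0 * real n)) \<and>
     (\<exists>A>0. \<exists>B>0. \<forall>x\<in>{-\<delta>0<..<\<delta>0} - {0}. \<exists>s::nat.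
        A * ln (1 / \<bar>x\<bar>) \<le> real s \<and> real s \<le> B * ln (1 / \<bar>x\<bar>) \<and>
        (\<forall>j. 1 \<le> j \<and> j < s \<longrightarrow> (logistic a ^^ j) x \<notin> {-\<delta>0<..<\<delta>0}) \<and>
        \<bar>deriv (logistic a ^^ s) x\<bar> \<ge> (1 / c0) * exp (lam0 * real s / 3))"

definition is_hole :: "real set \<Rightarrow> bool" where
  "is_hole H \<longleftrightarrow> H \<subseteq> {-1..1} \<and> open H \<and> finite (components H)"

text \<open>The minimum of \<open>\<delta>0\<close> and the distance of the critical orbit to \<open>H\<close>; the infimum is taken in this
  form so that it is also correct for \<open>H = {}\<close>.\<close>

definition crit_dist :: "real \<Rightarrow> real \<Rightarrow> real set \<Rightarrow> real" where
  "crit_dist a \<delta>0 H = Inf (insert \<delta>0 {dist ((logistic a ^^ n) 0) x | n x. 1 \<le> n \<and> x \<in> H})"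

definition assm_A1 :: "real \<Rightarrow> real \<Rightarrow> real \<Rightarrow> real set \<Rightarrow> bool" where
  "assm_A1 a \<delta>0 r H \<longleftrightarrow> 0 < r \<and> r = crit_dist a \<delta>0 H"

definition assm_A2 :: "real \<Rightarrow> nat \<Rightarrow> real \<Rightarrow> real set \<Rightarrow> bool" where
  "assm_A2 a m0 \<epsilon>0 H \<longleftrightarrow> 0 < \<epsilon>0 \<and>
     (\<forall>\<omega>. is_interval \<omega> \<and> \<omega> \<subseteq> {-1..1} - H \<and> (\<forall>i\<le>m0. len ((logistic a ^^ i) ` \<omega>) < \<epsilon>0) \<longrightarrow>
        (\<forall>i\<le>m0. \<forall>i'\<le>m0. \<forall>J\<in>components H. \<forall>J'\<in>components H.
           (logistic a ^^ i) ` \<omega> \<inter> J \<noteq> {} \<and> (logistic a ^^ i') ` \<omega> \<inter> J' \<noteq> {} \<longrightarrow> i = i' \<and> J = J'))"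

definition assm_A3 :: "real \<Rightarrow> real \<Rightarrow> real \<Rightarrow> real set \<Rightarrow> bool" where
  "assm_A3 \<epsilon> \<theta> D H \<longleftrightarrow> len H < (1 - sqrt \<theta>) ^ 3 / 3 * (\<epsilon>\<^sup>2 / (D * \<theta>))"

definition covering_time :: "real \<Rightarrow> real \<Rightarrow> nat \<Rightarrow> bool" where
  "covering_time a \<epsilon>0 n0 \<longleftrightarrow>
     (\<forall>J. is_interval J \<and> J \<subseteq> {-1..1} \<and> \<epsilon>0 / 2 \<le> len J \<longrightarrow> {1 - a..1} \<subseteq> (logistic a ^^ n0) ` J)"

definition assm_A4 :: "real \<Rightarrow> nat \<Rightarrow> real set \<Rightarrow> bool" where
  "assm_A4 a n0 H \<longleftrightarrow>
     (\<forall>J\<in>components H. \<forall>K\<in>components H. \<forall>i\<le>n0. (logistic a ^^ i) ` J \<inter> uminus ` K = {}) \<and>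
     (\<forall>J\<in>components H. \<forall>K\<in>components H. \<forall>i. 1 \<le> i \<and> i \<le> n0 \<longrightarrow> (logistic a ^^ i) ` J \<inter> K = {})"


section \<open>The stopping time construction\<close>

text \<open>The data on which the construction depends: \<open>crit_par\<close> is \<open>a\<close>, \<open>rad\<close> is \<open>r\<close>, \<open>depth\<close> is \<open>k\<^sub>0\<close>
  (so \<open>\<delta> = exp (-k\<^sub>0)\<close>), \<open>eps\<close> is \<open>\<epsilon>\<close>, \<open>refs\<close> lists the reference intervals \<open>\<Lambda>\<close>.\<close>

record scheme =
  crit_par :: real
  rad :: real
  depth :: nat
  eps :: real
  hole :: "real set"
  refs :: "real set list"

abbreviation iter :: "scheme \<Rightarrow> nat \<Rightarrow> real \<Rightarrow> real" where
  "iter S n \<equiv> (logistic (crit_par S) ^^ n)"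

definition delta :: "scheme \<Rightarrow> real" where
  "delta S = exp (- real (depth S))"

abbreviation crit_nbhd :: "scheme \<Rightarrow> real set" where
  "crit_nbhd S \<equiv> {- delta S<..<delta S}"

text \<open>The cells \<open>I\<^sub>k\<close>, and the bound period \<open>q k\<close> for passages through \<open>I\<^sub>k\<close>.\<close>

definition cell :: "int \<Rightarrow> real set" where
  "cell k = (if 0 < k then {exp (- (real_of_int k + 1))<..<exp (- real_of_int k)}
             else {- exp (real_of_int k)<..<- exp (real_of_int k - 1)})"

definition bound_time :: "scheme \<Rightarrow> int \<Rightarrow> nat" where
  "bound_time S k = (GREATEST n. \<forall>j\<le>n.
     len (iter S j ` (if 0 < k then {0<..<exp (- real_of_int k)} else {- exp (real_of_int k)<..<0}))
       \<le> rad S / 2)"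

definition partition_Q :: "scheme \<Rightarrow> real set set" where
  "partition_Q S = (let Js = components ({-1..1} - hole S) \<union> components (hole S) in
     {cell k \<inter> J | k J. int (depth S) \<le> \<bar>k\<bar> \<and> J \<in> Js} \<union>
     (\<Union>J\<in>Js. components (J - crit_nbhd S)))"

text \<open>Admissible starting intervals \<open>\<Omega>\<close>.\<close>

definition start_interval :: "scheme \<Rightarrow> real set \<Rightarrow> bool" where
  "start_interval S \<Omega> \<longleftrightarrow>
     is_interval \<Omega> \<and> \<Omega> \<subseteq> {-1..1} - hole S \<and> eps S \<le> len \<Omega> \<and> len \<Omega> \<le> 3 * eps S \<and>
     (\<Omega> \<subseteq> crit_nbhd S - {0} \<or> \<Omega> \<inter> crit_nbhd S = {})"

text \<open>A piece is a subinterval of \<open>\<Omega>\<close> together with its last passage through \<open>(-\<delta>,\<delta>)\<close>, if any: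
  the time \<open>t\<close>, the index \<open>k\<close> with the image at time \<open>t\<close> in \<open>I\<^sub>k\<close>, and the interval of the
  collection at time \<open>t - 1\<close> from which the piece was cut at time \<open>t\<close>.\<close>

type_synonym piece = "real set \<times> (nat \<times> int \<times> real set) option"

definition large :: "scheme \<Rightarrow> nat \<Rightarrow> real set \<Rightarrow> bool" where
  "large S n \<omega> \<longleftrightarrow> 4 ^ 8 * eps S \<le> len (iter S n ` \<omega>)"

definition abut :: "real set \<Rightarrow> real set \<Rightarrow> bool" where
  "abut A B \<longleftrightarrow> closure A \<inter> closure B \<noteq> {}"

text \<open>Throughout, degenerate (one-point) pieces are discarded.\<close>

definition subcells :: "scheme \<Rightarrow> nat \<Rightarrow> real set \<Rightarrow> real set set" where
  "subcells S n \<omega> = {c. \<exists>A\<in>partition_Q S. c \<in> components {x\<in>\<omega>. iter S n x \<in> A} \<and> 0 < len c}"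

definition inner_at :: "scheme \<Rightarrow> nat \<Rightarrow> real set \<Rightarrow> int \<Rightarrow> bool" where
  "inner_at S n c k \<longleftrightarrow> int (depth S) \<le> \<bar>k\<bar> \<and> iter S n ` c \<subseteq> cell k"

definition outer_at :: "scheme \<Rightarrow> nat \<Rightarrow> real set \<Rightarrow> bool" where
  "outer_at S n c \<longleftrightarrow> iter S n ` c \<inter> crit_nbhd S = {}"

definition edge_pair :: "scheme \<Rightarrow> nat \<Rightarrow> real set \<Rightarrow> real set \<Rightarrow> bool" where
  "edge_pair S n c d \<longleftrightarrow>
     outer_at S n d \<and> abut c d \<and> (\<exists>k. \<bar>k\<bar> = int (depth S) \<and> inner_at S n c k)"

text \<open>Cutting \<open>v\<close>, a subinterval of the piece \<open>(\<omega>, p)\<close>, along \<open>Q\<close> at time \<open>n\<close>.  Convex hulls are used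
  to put back the common endpoint when two adjacent intervals are joined.\<close>

definition cut_pieces :: "scheme \<Rightarrow> nat \<Rightarrow> piece \<Rightarrow> real set \<Rightarrow> piece set" where
  "cut_pieces S n w v =
     {(convex hull (c \<union> \<Union>{d \<in> subcells S n v. edge_pair S n c d}), Some (n, k, fst w)) | c k.
        c \<in> subcells S n v \<and> inner_at S n c k} \<union>
     {(d, snd w) | d. d \<in> subcells S n v \<and> outer_at S n d \<and> \<not> (\<exists>c\<in>subcells S n v. edge_pair S n c d)}"

definition initial_pieces :: "scheme \<Rightarrow> real set \<Rightarrow> piece set" where
  "initial_pieces S \<Omega> =
     {(c, Some (0, k, \<Omega>)) | c k. c \<in> subcells S 0 \<Omega> \<and> inner_at S 0 c k} \<union>
     {(c, None) | c. c \<in> subcells S 0 \<Omega> \<and> outer_at S 0 c}"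

fun is_free :: "scheme \<Rightarrow> nat \<Rightarrow> piece \<Rightarrow> bool" where
  "is_free S n (\<omega>, None) = True"
| "is_free S n (\<omega>, Some (t, k, P)) = (t + bound_time S k < n)"

fun due_large :: "scheme \<Rightarrow> nat \<Rightarrow> piece \<Rightarrow> bool" where
  "due_large S n (\<omega>, None) = False"
| "due_large S n (\<omega>, Some (t, k, P)) = (n = t + bound_time S k \<and> large S n \<omega>)"

text \<open>\<open>deeper w g\<close>: at the same time \<open>t\<close>, \<open>w\<close> and \<open>g\<close> were separated by a cut between \<open>I\<^sub>k\<close> (containing
  the image of \<open>w\<close>) and the neighbouring cell closer to \<open>0\<close> (containing that of \<open>g\<close>).\<close>

fun deeper :: "piece \<Rightarrow> piece \<Rightarrow> bool" where
  "deeper (\<omega>, Some (t, k, P)) (\<gamma>, Some (t', k', P')) =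
     (t' = t \<and> k' = k + sgn k \<and> P' = P \<and> abut \<omega> \<gamma>)"
| "deeper _ _ = False"

text \<open>A piece that is large at the end of its bound period is released at that time.  If the
  bound periods of two neighbours end simultaneously, the shallower one is released and the
  deeper one absorbs its remainder.\<close>

definition released :: "scheme \<Rightarrow> nat \<Rightarrow> piece set \<Rightarrow> piece \<Rightarrow> bool" where
  "released S n W w \<longleftrightarrow> due_large S n w \<and> \<not> (\<exists>u\<in>W. due_large S n u \<and> deeper u w)"

definition covered :: "scheme \<Rightarrow> real set \<Rightarrow> real set set" where
  "covered S J = {L \<in> set (refs S). interior L \<subseteq> J}"

text \<open>The part of \<open>\<omega>\<close>, on the side of \<open>\<gamma>\<close>, beyond all reference intervals covered at time \<open>n\<close>.\<close>

definition remainder :: "scheme \<Rightarrow> nat \<Rightarrow> real set \<Rightarrow> real set \<Rightarrow> real set" where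
  "remainder S n \<omega> \<gamma> =
     {x\<in>\<omega>. \<forall>z\<in>\<omega>. iter S n z \<in> \<Union>(covered S (iter S n ` \<omega>)) \<longrightarrow> (\<forall>g\<in>\<gamma>. x \<in> open_segment z g)}"

text \<open>The transition from the collection \<open>W\<close> at time \<open>n - 1\<close> to time \<open>n\<close>: the pieces that
  continue, and the intervals on which the stopping time is \<open>n\<close>.\<close>

definition next_pieces :: "scheme \<Rightarrow> nat \<Rightarrow> piece set \<Rightarrow> piece set" where
  "next_pieces S n W =
     (\<Union>w\<in>{w\<in>W. is_free S n w}.
        \<Union>v\<in>{v \<in> components {x\<in>fst w. iter S n x \<notin> hole S}. \<not> large S n v}. cut_pieces S n w v) \<union>
     {(convex hull (fst w \<union> \<Union>{remainder S n (fst u) (fst w) | u. u \<in> W \<and> released S n W u \<and> deeper u w}),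
       snd w) | w. w \<in> W \<and> \<not> is_free S n w \<and> \<not> released S n W w}"

definition next_stopped :: "scheme \<Rightarrow> nat \<Rightarrow> piece set \<Rightarrow> real set set" where
  "next_stopped S n W =
     (\<Union>w\<in>{w\<in>W. is_free S n w}.
        components {x\<in>fst w. iter S n x \<in> hole S} \<union>
        {v \<in> components {x\<in>fst w. iter S n x \<notin> hole S}. large S n v}) \<union>
     ({fst w - \<Union>{remainder S n (fst w) (fst g) | g. g \<in> W \<and> deeper w g} | w.
         w \<in> W \<and> released S n W w} - {{}})"

primrec pieces :: "scheme \<Rightarrow> real set \<Rightarrow> nat \<Rightarrow> piece set" where
  "pieces S \<Omega> 0 = initial_pieces S \<Omega>"
| "pieces S \<Omega> (Suc n) = next_pieces S (Suc n) (pieces S \<Omega> n)"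

text \<open>The elements of \<open>\<Z>\<close> (over \<open>\<Omega>\<close>) on which \<open>S = n\<close>.\<close>

primrec stopped :: "scheme \<Rightarrow> real set \<Rightarrow> nat \<Rightarrow> real set set" where
  "stopped S \<Omega> 0 = {}"
| "stopped S \<Omega> (Suc n) = next_stopped S (Suc n) (pieces S \<Omega> n)"


section \<open>Reference intervals and the return time\<close>

text \<open>The point \<open>0\<close> cannot lie in a starting interval, so covering is meant up to finitely many points.
  The reference intervals are disjoint, as they have to induce a partition.\<close>

definition reference_family :: "scheme \<Rightarrow> bool" where
  "reference_family S \<longleftrightarrow>
     distinct (refs S) \<and> disjoint (set (refs S)) \<and>
     (\<forall>L\<in>set (refs S). start_interval S L \<and> len L \<le> 2 * eps S) \<and>
     finite ({1 - crit_par S..1} - hole S - \<Union>(set (refs S)))"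

text \<open>The Boolean argument selects the left (\<open>False\<close>) or right (\<open>True\<close>) end of the interval \<open>J\<close>.\<close>

definition beyond :: "bool \<Rightarrow> real \<Rightarrow> real \<Rightarrow> bool" where
  "beyond b y z \<longleftrightarrow> (if b then z < y else y < z)"

definition end_part :: "scheme \<Rightarrow> real set \<Rightarrow> bool \<Rightarrow> real set" where
  "end_part S J b = {y\<in>J. \<forall>L\<in>covered S J. \<forall>z\<in>L. beyond b y z}"

definition outermost :: "scheme \<Rightarrow> real set \<Rightarrow> bool \<Rightarrow> real set \<Rightarrow> bool" where
  "outermost S J b L \<longleftrightarrow>
     L \<in> covered S J \<and> (\<forall>L'\<in>covered S J - {L}. \<forall>y\<in>L. \<forall>z\<in>L'. beyond b y z)"

definition short_end :: "scheme \<Rightarrow> real set \<Rightarrow> bool \<Rightarrow> bool" where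
  "short_end S J b \<longleftrightarrow> 0 < len (end_part S J b) \<and> len (end_part S J b) < eps S"

definition end_piece :: "scheme \<Rightarrow> real set \<Rightarrow> bool \<Rightarrow> real set" where
  "end_piece S J b =
     (if short_end S J b
      then {y\<in>J. \<forall>L\<in>covered S J. \<not> outermost S J b L \<longrightarrow> (\<forall>z\<in>L. beyond b y z)}
      else end_part S J b)"

definition end_pieces :: "scheme \<Rightarrow> real set \<Rightarrow> real set set" where
  "end_pieces S J = {end_piece S J b | b. 0 < len (end_part S J b)}"

definition returning :: "scheme \<Rightarrow> real set \<Rightarrow> real set set" where
  "returning S J = {L \<in> covered S J. \<not> (\<exists>b. short_end S J b \<and> outermost S J b L)}"

text \<open>\<open>(V, \<tau>) \<in> stages S L\<close>: in the construction over the reference interval \<open>L\<close>, the stopping time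
  construction is (re)started at time \<open>\<tau>\<close> on the image of \<open>V\<close>.\<close>

inductive_set stages :: "scheme \<Rightarrow> real set \<Rightarrow> (real set \<times> nat) set" for S L where
  start: "(L, 0) \<in> stages S L"
| restart: "\<lbrakk>(V, \<tau>) \<in> stages S L; \<omega> \<in> stopped S (iter S \<tau> ` V) n; \<not> iter S n ` \<omega> \<subseteq> hole S;
     E \<in> end_pieces S (iter S n ` \<omega>)\<rbrakk> \<Longrightarrow>
     ({x\<in>V. iter S \<tau> x \<in> \<omega> \<and> iter S (\<tau> + n) x \<in> E}, \<tau> + n) \<in> stages S L"

text \<open>The elements \<open>A\<close> of the partition \<open>\<eta>\<close> of \<open>L\<close>, paired with the value of \<open>R\<close> on \<open>A\<close>.\<close>

definition eta :: "scheme \<Rightarrow> real set \<Rightarrow> (real set \<times> nat) set" where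
  "eta S L =
     {({x\<in>V. iter S \<tau> x \<in> \<omega>}, \<tau> + n) | V \<tau> \<omega> n.
        (V, \<tau>) \<in> stages S L \<and> \<omega> \<in> stopped S (iter S \<tau> ` V) n \<and> iter S n ` \<omega> \<subseteq> hole S} \<union>
     {({x\<in>V. iter S \<tau> x \<in> \<omega> \<and> iter S (\<tau> + n) x \<in> L'}, \<tau> + n) | V \<tau> \<omega> n L'.
        (V, \<tau>) \<in> stages S L \<and> \<omega> \<in> stopped S (iter S \<tau> ` V) n \<and> \<not> iter S n ` \<omega> \<subseteq> hole S \<and>
        L' \<in> returning S (iter S n ` \<omega>)}"

text \<open>\<open>R = \<infinity>\<close> off the elements of \<open>\<eta>\<close>.\<close>

definition return_time :: "scheme \<Rightarrow> real set \<Rightarrow> real \<Rightarrow> enat" where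
  "return_time S L x = Inf {enat n | A n. (A, n) \<in> eta S L \<and> x \<in> A}"

text \<open>The pieces of \<open>L\<close> that have not yet returned at time \<open>l\<close>.\<close>

definition active_pieces :: "scheme \<Rightarrow> real set \<Rightarrow> nat \<Rightarrow> real set set" where
  "active_pieces S L l =
     {{x\<in>V. iter S \<tau> x \<in> fst w} | V \<tau> w.
        (V, \<tau>) \<in> stages S L \<and> \<tau> \<le> l \<and> w \<in> pieces S (iter S \<tau> ` V) (l - \<tau>)}"


section \<open>The constants\<close>

definition growth_const :: "scheme \<Rightarrow> real \<Rightarrow> bool" where
  "growth_const S \<epsilon>' \<longleftrightarrow> 0 < \<epsilon>' \<and>
     (\<forall>k. int (depth S) \<le> \<bar>k\<bar> \<longrightarrow> \<epsilon>' \<le> len (iter S (bound_time S k) ` cell k))"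

definition distortion_on :: "scheme \<Rightarrow> real \<Rightarrow> nat \<Rightarrow> real set \<Rightarrow> bool" where
  "distortion_on S C n A \<longleftrightarrow>
     (\<forall>x\<in>A. \<forall>y\<in>A. \<bar>deriv (iter S n) x / deriv (iter S n) y - 1\<bar> \<le> C * \<bar>iter S n x - iter S n y\<bar>)"

definition distortion_const :: "scheme \<Rightarrow> real \<Rightarrow> bool" where
  "distortion_const S C \<longleftrightarrow> 0 < C \<and>
     (\<forall>\<Omega> n. start_interval S \<Omega> \<longrightarrow> (\<forall>\<omega>\<in>stopped S \<Omega> n. distortion_on S C n \<omega>)) \<and>
     (\<forall>L\<in>set (refs S). \<forall>(A, n)\<in>eta S L. distortion_on S C n A)"

definition tail_consts :: "scheme \<Rightarrow> real \<Rightarrow> real \<Rightarrow> real \<Rightarrow> bool" where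
  "tail_consts S C \<theta> D \<longleftrightarrow> 0 < C \<and> 0 < \<theta> \<and> \<theta> < 1 \<and> 0 < D \<and>
     (\<forall>L\<in>set (refs S). \<forall>n.
        len {x\<in>L. enat n < return_time S L x} \<le> C * \<theta> ^ n \<and>
        len {x\<in>L. return_time S L x = enat n \<and> iter S n x \<in> hole S} \<le> D * len (hole S) * \<theta> ^ n)"


section \<open>The tower\<close>

text \<open>The unit interval identified with the \<open>i\<close>-th reference interval is \<open>(i, i + 1)\<close>; endpoints are
  immaterial.\<close>

definition base_cell :: "nat \<Rightarrow> real set" where
  "base_cell i = {real i<..<real i + 1}"

definition base :: "scheme \<Rightarrow> real set" where
  "base S = (\<Union>i<length (refs S). base_cell i)"

definition base_ref :: "scheme \<Rightarrow> real \<Rightarrow> real set" where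
  "base_ref S z = refs S ! nat \<lfloor>z\<rfloor>"

definition base_proj :: "scheme \<Rightarrow> real \<Rightarrow> real" where
  "base_proj S z = Inf (base_ref S z) + (z - real_of_int \<lfloor>z\<rfloor>) * len (base_ref S z)"

definition base_return :: "scheme \<Rightarrow> real \<Rightarrow> enat" where
  "base_return S z = return_time S (base_ref S z) (base_proj S z)"

definition tower :: "scheme \<Rightarrow> (real \<times> nat) set" where
  "tower S = {(z, l). z \<in> base S \<and> enat l < base_return S z}"

definition tower_measure :: "scheme \<Rightarrow> (real \<times> nat) measure" where
  "tower_measure S = restrict_space (lborel \<Otimes>\<^sub>M count_space UNIV) (tower S)"

definition tower_proj :: "scheme \<Rightarrow> real \<times> nat \<Rightarrow> real" where
  "tower_proj S = (\<lambda>(z, l). iter S l (base_proj S z))"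

text \<open>\<open>None\<close> stands for ``undefined'': elements of \<open>\<eta>\<close> that fall into the hole never land in a
  reference interval.\<close>

definition tower_map :: "scheme \<Rightarrow> real \<times> nat \<Rightarrow> (real \<times> nat) option" where
  "tower_map S = (\<lambda>(z, l).
     if enat (l + 1) < base_return S z then Some (z, l + 1)
     else if \<exists>w\<in>base S. base_proj S w = iter S (l + 1) (base_proj S z)
     then Some (THE w. w \<in> base S \<and> base_proj S w = iter S (l + 1) (base_proj S z), 0)
     else None)"

definition tower_deriv :: "scheme \<Rightarrow> real \<times> nat \<Rightarrow> real" where
  "tower_deriv S = (\<lambda>(z, l). deriv (\<lambda>u. fst (the (tower_map S (u, l)))) z)"

definition transfer_op :: "scheme \<Rightarrow> (real \<times> nat \<Rightarrow> real) \<Rightarrow> real \<times> nat \<Rightarrow> real" where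
  "transfer_op S f x = (\<Sum>\<^sub>\<infinity>y\<in>{y \<in> tower S. tower_map S y = Some x}. f y / \<bar>tower_deriv S y\<bar>)"

definition transfer_normalized :: "scheme \<Rightarrow> (real \<times> nat \<Rightarrow> real) \<Rightarrow> real \<times> nat \<Rightarrow> real" where
  "transfer_normalized S f x =
     transfer_op S f x / (\<integral>y. \<bar>transfer_op S f y\<bar> \<partial>tower_measure S)"

text \<open>The intervals \<open>\<Delta>\<close> of level \<open>l\<close>, as sets of first coordinates.\<close>

definition tower_elements :: "scheme \<Rightarrow> nat \<Rightarrow> real set set" where
  "tower_elements S l =
     (if l = 0 then {base_cell i | i. i < length (refs S)}
      else {{z \<in> base_cell i. base_proj S z \<in> c} | i c.
              i < length (refs S) \<and> c \<in> active_pieces S (refs S ! i) l})"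

definition tower_norm :: "scheme \<Rightarrow> real \<Rightarrow> (real \<times> nat \<Rightarrow> real) \<Rightarrow> ereal" where
  "tower_norm S \<xi> f = max
     (SUP l. SUP J\<in>tower_elements S l. SUP z\<in>J. ereal (exp (- \<xi> * real l) * \<bar>f (z, l)\<bar>))
     (SUP l. SUP J\<in>tower_elements S l. SUP z\<in>{z\<in>J. f (z, l) \<noteq> 0}.
        ereal (exp (- \<xi> * real l) * \<bar>vector_derivative (\<lambda>u. f (u, l)) (at z within J) / f (z, l)\<bar>))"

text \<open>Finiteness of the norm presupposes that the derivative exists wherever it is evaluated.\<close>

definition density_class :: "scheme \<Rightarrow> real \<Rightarrow> real \<Rightarrow> (real \<times> nat \<Rightarrow> real) set" where
  "density_class S \<xi> M = {f.
     (\<forall>l. \<forall>J\<in>tower_elements S l. \<forall>z\<in>J. f (z, l) \<noteq> 0 \<longrightarrow>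
        (\<lambda>u. f (u, l)) differentiable (at z within J)) \<and>
     tower_norm S \<xi> f \<le> ereal M \<and> (\<forall>y\<in>tower S. 0 \<le> f y) \<and> (\<integral>y. f y \<partial>tower_measure S) = 1}"

definition cond_inv_density :: "scheme \<Rightarrow> real \<Rightarrow> real \<Rightarrow> (real \<times> nat \<Rightarrow> real) \<Rightarrow> bool" where
  "cond_inv_density S C \<theta> \<phi> \<longleftrightarrow>
     \<phi> \<in> density_class S (- ln \<theta> / 2) ((1 + 2 * C * eps S) / (1 - sqrt \<theta>)) \<and>
     (AE y in tower_measure S. transfer_normalized S \<phi> y = \<phi> y)"

definition projected_measure :: "scheme \<Rightarrow> (real \<times> nat \<Rightarrow> real) \<Rightarrow> real measure" where
  "projected_measure S \<phi> = distr (density (tower_measure S) (\<lambda>y. ennreal (\<phi> y))) borel (tower_proj S)"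


section \<open>Invariant measures and families of holes\<close>

text \<open>Measures on \<open>[-1,1]\<close> are represented as Borel measures on the line carried by \<open>[-1,1]\<close>.\<close>

definition acip :: "real \<Rightarrow> real measure \<Rightarrow> bool" where
  "acip a \<mu> \<longleftrightarrow> prob_space \<mu> \<and> sets \<mu> = sets borel \<and> emeasure \<mu> (- {-1..1}) = 0 \<and>
     absolutely_continuous lborel \<mu> \<and> distr \<mu> borel (logistic a) = \<mu>"

definition shrinking_family :: "real \<Rightarrow> real \<Rightarrow> real set \<Rightarrow> (real \<Rightarrow> real set) \<Rightarrow> bool" where
  "shrinking_family \<delta> t H Hs \<longleftrightarrow> 0 < t \<and> Hs t = H \<and>
     (\<forall>s\<in>{0<..t}. is_hole (Hs s) \<and> len (Hs s) \<le> s \<and> Hs s \<subseteq> H \<and>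
        (\<forall>J\<in>components H. \<forall>K\<in>components (Hs s). \<forall>K'\<in>components (Hs s).
           K \<subseteq> J \<and> K' \<subseteq> J \<longrightarrow> K = K')) \<and>
     ({0, \<delta>, -\<delta>} \<inter> H = {} \<or> (\<forall>s\<in>{0<..t}. {0, \<delta>, -\<delta>} \<subseteq> Hs s))"

end

theory Submission
 imports Defs
begin

text \<open>If two absolutely continuous invariant probability measures differ, the set where the density of one
exceeds that of the other has positive measure and is forward invariant up to a null set.  Almost
every orbit visits \<open>(-\<delta>0, \<delta>0)\<close> infinitely often, and the pullbacks of this interval have bounded
distortion (Koebe; the critical orbit avoids \<open>(-2\<delta>0, 2\<delta>0)\<close>).  If the set did not fill \<open>(-\<delta>0, \<delta>0)\<close> up
to a null set, it would therefore be porous, hence null.  The same holds with the two measures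
exchanged, but the two sets are disjoint.

For the convergence, all pieces of the construction are intervals on which the iterates are monotone,
and off a countable set every point lies in exactly one piece until it returns.  Changing variables
on the tower therefore shows that \<open>\<mu>\<^sub>s\<close> is invariant up to an error of order \<open>m(H\<^sub>s)\<close>.  As the norms of
the densities \<open>\<phi>\<^sub>s\<close> and the exponential tails of the return times are bounded uniformly in \<open>s\<close>, the
\<open>\<mu>\<^sub>s\<close> are uniformly absolutely continuous.  Hence every weak limit is an absolutely continuous invariant
probability measure, and there is only one.\<close>

section \<open>Expansion along orbits\<close>

text \<open>The delicate point is the release rule. A piece released at the end of its bound period
  hands a remainder to its deeper neighbour, which then contains points of the wrong depth. They
  must shadow the critical orbit within distance \<open>r\<close> until the neighbour's own, longer
  bound period ends: closeness \<open>r\<close> keeps them off the hole and off 0, and this is what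
  preserves monotonicity. It works because no reference interval fits into the remainder, so its
  image has size of order \<epsilon>, whereas the boundary point next to it is already at a distance
  comparable to \<open>r\<close> from the critical orbit. Hence \<epsilon> must be small against
  \<open>r\<close> and \<delta>, which is the origin of \<open>depth_bound\<close>.

  Uniqueness of pieces fails at endpoints and cut points only. Exactness is therefore proved off
  countable sets, and two pieces with overlapping interiors would share a point where it holds.

  The factor by which the transfer operator scales \<phi> is not estimated on its own: testing the
  duality identity with the constant 1 shows that it is one minus the escaped mass. Existence of the
  invariant measure is a by-product: it is the limit along one sequence of holes.\<close>

definition iter_deriv :: "real => nat => real => real" where
 "iter_deriv a n x = (\<Prod>i<n. - 2 * a * (logistic a ^^ i) x)"

lemma iter_deriv_0 [simp]: "iter_deriv a 0 x = 1"
 by (simp add: iter_deriv_def)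

lemma iter_deriv_Suc: "iter_deriv a (Suc n) x = - 2 * a * (logistic a ^^ n) x * iter_deriv a n x"
 by (simp add: iter_deriv_def)

lemma has_derivative_iter:
 "((logistic a ^^ n) has_real_derivative iter_deriv a n x) (at x within X)"
proof (induction n)
 case (Suc n)
 have "((\<lambda>y. 1 - a * ((logistic a ^^ n) y)\<^sup>2) has_real_derivative
   - 2 * a * (logistic a ^^ n) x * iter_deriv a n x) (at x within X)"
  by (rule derivative_eq_intros Suc | simp)+
 moreover have "logistic a ^^ Suc n = (\<lambda>y. 1 - a * ((logistic a ^^ n) y)\<^sup>2)"
  by (simp add: fun_eq_iff logistic_def[of a "(logistic a ^^ n) _"])
 ultimately show ?case
  by (simp add: iter_deriv_Suc)
qed (auto simp: id_def)

lemma deriv_iter: "deriv (logistic a ^^ n) x = iter_deriv a n x"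
 by (rule DERIV_imp_deriv) (rule has_derivative_iter)

lemma iter_deriv_add: "iter_deriv a (m + n) x = iter_deriv a m x * iter_deriv a n ((logistic a ^^ m) x)"
proof (induction n)
 case (Suc n)
 have "(logistic a ^^ (m + n)) x = (logistic a ^^ n) ((logistic a ^^ m) x)"
  by (subst add.commute) (simp add: funpow_add)
 thus ?case
  using Suc by (simp add: iter_deriv_Suc)
qed simp

lemma iter_add: "(logistic a ^^ (m + n)) x = (logistic a ^^ n) ((logistic a ^^ m) x)"
 by (subst add.commute) (simp add: funpow_add)

lemma iter_Suc': "(logistic a ^^ Suc n) x = (logistic a ^^ n) (logistic a x)"
 using iter_add[of 1 n a x] by simp

lemma continuous_iter [continuous_intros]: "continuous_on X (logistic a ^^ n)"
 by (meson DERIV_isCont continuous_at_imp_continuous_on has_derivative_iter)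

lemma measurable_iter [measurable]: "(logistic a ^^ n) \<in> borel_measurable borel"
 by (intro borel_measurable_continuous_onI continuous_iter)

lemma iter_deriv_eq_0_iff: "iter_deriv a n x = 0 \<longleftrightarrow> n > 0 \<and> a = 0 \<or> (\<exists>i<n. (logistic a ^^ i) x = 0)"
 by (auto simp: iter_deriv_def)

lemma iter_even: "n > 0 ==> (logistic a ^^ n) (- x) = (logistic a ^^ n) x"
 by (cases n) (simp_all only: iter_Suc', simp_all add: logistic_def)

lemma iter_abs: "n > 0 ==> (logistic a ^^ n) \<bar>x\<bar> = (logistic a ^^ n) x"
 using iter_even[of n a x] by (cases "x \<ge> 0") auto

lemma first_index: "P (n::nat) ==> \<exists>j\<le>n. P j \<and> (\<forall>i<j. \<not> P i)"
 by (metis (full_types) LeastI_ex Least_le not_less_Least)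

locale mis_map =
 fixes a \<delta>0 lam :: real and M0 :: nat and c0 :: real
 assumes class_M: "class_M a \<delta>0 lam M0 c0"
begin

abbreviation T :: "real => real" where "T \<equiv> logistic a"
abbreviation D :: "nat => real => real" where "D \<equiv> iter_deriv a"
abbreviation U :: "real set" where "U \<equiv> {-\<delta>0<..<\<delta>0}"

lemma a_le: "a \<le> 2" and \<delta>0_pos: "\<delta>0 > 0" and lam_pos: "lam > 0" and M0_pos: "M0 > 0"
 and c0_pos: "c0 > 0" and c0_le: "c0 \<le> 1"
 using class_M by (auto simp: class_M_def)

lemma crit_far: "n > 0 ==> \<bar>(T ^^ n) 0\<bar> > 2 * \<delta>0"
 using class_M by (auto simp: class_M_def)

lemma \<delta>0_lt: "\<delta>0 < 1/2"
 using crit_far[of 1] by (simp add: logistic_def)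

lemma growth_outside:
 "[|n \<ge> M0; x \<in> {-1..1}; \<And>i. i < n ==> (T ^^ i) x \<notin> U|] ==> \<bar>D n x\<bar> \<ge> exp (lam * real n)"
 using class_M by (auto simp: class_M_def deriv_iter)

lemma growth_visit:
 "[|x \<in> {-1..1}; \<And>i. i < n ==> (T ^^ i) x \<notin> U; (T ^^ n) x \<in> U|] ==> \<bar>D n x\<bar> \<ge> c0 * exp (lam * real n)"
 using class_M by (auto simp: class_M_def deriv_iter)

text \<open>For \<open>a = 0\<close> the fixed point 1 stays outside \<open>U\<close> for ever
  although every derivative vanishes, against the growth condition.\<close>

lemma a_pos: "a > 0"
proof (rule ccontr)
 assume "\<not> a > 0"
 hence "a = 0" using class_M by (auto simp: class_M_def)
 hence *: "(T ^^ i) 1 = 1" for i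
  by (induction i) (auto simp: logistic_def)
 have "\<bar>D M0 1\<bar> \<ge> exp (lam * real M0)"
  using \<delta>0_lt by (intro growth_outside) (auto simp: *)
 moreover have "D M0 1 = 0"
  using `a = 0` M0_pos by (simp add: iter_deriv_eq_0_iff)
 ultimately show False by (simp add: not_le[symmetric])
qed

lemma T_range: "x \<in> {-1..1} ==> T x \<in> {1 - a..1}"
 using a_pos by (auto simp: logistic_def abs_square_le_1 mult_left_le)

lemma iter_range: "x \<in> {-1..1} ==> (T ^^ n) x \<in> {-1..1}"
proof (induction n)
 case (Suc n)
 thus ?case using T_range[of "(T ^^ n) x"] a_le by auto
qed auto

lemma iter_range': "[|x \<in> {-1..1}; n > 0|] ==> (T ^^ n) x \<in> {1 - a..1}"
 using T_range iter_range by (cases n) auto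

lemma D_nz: "[|\<And>i. i < n ==> (T ^^ i) x \<noteq> 0|] ==> D n x \<noteq> 0"
 using a_pos by (auto simp: iter_deriv_eq_0_iff)

lemma D_lower_crude:
 assumes "\<And>i. i < n ==> (T ^^ i) x \<notin> {-\<delta><..<\<delta>}" "\<delta> > 0"
 shows "\<bar>D n x\<bar> \<ge> (2 * a * \<delta>) ^ n"
proof -
 have "(\<Prod>i<n. 2 * a * \<delta>) \<le> (\<Prod>i<n. \<bar>- 2 * a * (T ^^ i) x\<bar>)"
 proof (intro prod_mono conjI)
  fix i assume "i \<in> {..<n}"
  hence "(T ^^ i) x \<notin> {-\<delta><..<\<delta>}" using assms by simp
  hence "\<delta> \<le> \<bar>(T ^^ i) x\<bar>" by (simp add: abs_if) linarith
  thus "2 * a * \<delta> \<le> \<bar>- 2 * a * (T ^^ i) x\<bar>" using a_pos by (simp add: abs_mult)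
 qed (use a_pos assms in auto)
 thus ?thesis by (simp add: iter_deriv_def abs_prod)
qed

abbreviation U2 :: "real set" where "U2 \<equiv> {-\<delta>0/2<..<\<delta>0/2}"

text \<open>Orbits that end in \<open>U\<close>, or that stay away from the smaller neighbourhood \<open>U2\<close>, expand: by
 condition (c) every visit to \<open>U\<close> is recovered, and the time this takes is bounded outside \<open>U2\<close>.\<close>

lemma expansion:
 obtains \<kappa> where "\<kappa> > 0" "\<kappa> \<le> 1" "\<And>n x. [|x \<in> {-1..1}; (T ^^ n) x \<in> U \<or> (\<forall>i<n. (T ^^ i) x \<notin> U2)|] ==>
   \<bar>D n x\<bar> \<ge> \<kappa> * exp (lam * real n / 3)"
proof -
 from class_M obtain A B where AB: "A > 0" "B > 0" and rec: "\<forall>x\<in>U - {0}. \<exists>s::nat.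
    A * ln (1 / \<bar>x\<bar>) \<le> real s \<and> real s \<le> B * ln (1 / \<bar>x\<bar>) \<and>
    (\<forall>j. 1 \<le> j \<and> j < s --> (T ^^ j) x \<notin> U) \<and> \<bar>D s x\<bar> \<ge> (1 / c0) * exp (lam * real s / 3)"
  unfolding class_M_def deriv_iter by blast
 \<comment> \<open>A point of \<open>U\<close> outside \<open>U2\<close> recovers within
   \<open>B * ln (2 / \<delta>0)\<close> steps. A final stretch of at most \<open>N\<close> steps is
   estimated by the crude factor \<open>b ^ N\<close>; the factor
   \<open>exp (- lam * real N)\<close> in \<open>\<kappa>\<close> pays for the growth missing on
   it.\<close>
 define N where "N = M0 + nat \<lceil>B * ln (2 / \<delta>0)\<rceil>"
 define b where "b = min 1 (2 * a * (\<delta>0 / 2))"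
 define \<kappa> where "\<kappa> = c0 * b ^ N * exp (- lam * real N)"
 have b: "b > 0" "b \<le> 1" using a_pos \<delta>0_pos by (auto simp: b_def)
 have bN: "b ^ N > 0" "b ^ N \<le> 1" using b by (auto simp: power_le_one)
 have bE: "b ^ N * exp (- lam * real N) \<le> 1" using bN lam_pos by (intro mult_le_one) auto
 have \<kappa>: "\<kappa> > 0" "\<kappa> \<le> 1" "\<kappa> \<le> c0"
  using bE b c0_pos c0_le by (auto simp: \<kappa>_def mult.assoc mult_le_one mult_left_le)
 have crude: "\<bar>D n x\<bar> \<ge> b ^ N" if "n \<le> N" "\<And>i. i < n ==> (T ^^ i) x \<notin> U2" for n x
 proof -
  have "b ^ N \<le> b ^ n" using that b by (intro power_decreasing) auto
  also have "\<dots> \<le> (2 * a * (\<delta>0 / 2)) ^ n" using b by (intro power_mono) (auto simp: b_def)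
  also have "\<dots> \<le> \<bar>D n x\<bar>" using that \<delta>0_pos by (intro D_lower_crude) auto
  finally show ?thesis .
 qed
 have e3: "exp (lam * real j / 3) \<le> exp (lam * real j)" for j :: nat using lam_pos by simp
 have "\<bar>D n x\<bar> \<ge> \<kappa> * exp (lam * real n / 3)"
  if "x \<in> {-1..1}" "(T ^^ n) x \<in> U \<or> (\<forall>i<n. (T ^^ i) x \<notin> U2)" for n x
  using that
 proof (induction n arbitrary: x rule: less_induct)
  case (less n)
  have small: "\<kappa> * exp (lam * real n / 3) \<le> c0 * exp (lam * real j) * b ^ N" if "n \<le> N + j" for j
  proof -
   have "real n \<le> real N + real j" "0 \<le> lam * real n" using that lam_pos by simp_all
   hence "lam * real n \<le> lam * (real N + real j)" "0 \<le> lam * real n" using lam_pos by simp_all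
   hence "lam * real n / 3 \<le> lam * real N + lam * real j" by (simp add: algebra_simps)
   hence "\<kappa> * exp (lam * real n / 3) \<le> \<kappa> * (exp (lam * real N) * exp (lam * real j))"
    using \<kappa> by (simp add: exp_add[symmetric])
   also have "\<dots> = c0 * exp (lam * real j) * b ^ N * (exp (- lam * real N) * exp (lam * real N))"
    by (simp add: \<kappa>_def)
   also have "\<dots> = c0 * exp (lam * real j) * b ^ N" by (simp add: exp_add[symmetric])
   finally show ?thesis .
  qed
  show ?case
  proof (cases "\<exists>j<n. (T ^^ j) x \<in> U")
   case False
   consider "(T ^^ n) x \<in> U" | "n \<ge> M0" | "n < M0" "\<forall>i<n. (T ^^ i) x \<notin> U2" using less.prems(2) not_le by blast
   thus ?thesis
   proof cases
    case 1
    have "\<kappa> * exp (lam * real n / 3) \<le> c0 * exp (lam * real n)" using \<kappa> e3 by (intro mult_mono) auto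
    thus ?thesis using growth_visit[of x n] 1 False less.prems(1) by force
   next
    case 2
    have "\<kappa> * exp (lam * real n / 3) \<le> 1 * exp (lam * real n)" using \<kappa> e3 by (intro mult_mono) auto
    thus ?thesis using growth_outside[of n x] 2 False less.prems(1) by force
   next
    case 3
    have "c0 * exp (lam * real 0) * b ^ N \<le> b ^ N" using c0_le bN by simp
    also have "\<dots> \<le> \<bar>D n x\<bar>" using 3 by (intro crude) (auto simp: N_def)
    finally show ?thesis using small[of 0] 3(1) by (simp add: N_def)
   qed
  next
   case True
   then obtain j where j: "(T ^^ j) x \<in> U" "j < n" "\<And>i. i < j ==> (T ^^ i) x \<notin> U"
    using first_index[of "\<lambda>j. (T ^^ j) x \<in> U"] by (meson le_less_trans)
   define y where "y = (T ^^ j) x"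
   have y: "y \<in> U" "y \<in> {-1..1}" using j iter_range less.prems(1) by (auto simp: y_def)
   have it: "(T ^^ i) y = (T ^^ (j + i)) x" for i by (simp add: y_def iter_add)
   have gj: "\<bar>D j x\<bar> \<ge> c0 * exp (lam * real j)" using growth_visit[of x j] j less.prems(1) by blast
   have "y \<noteq> 0" using less.prems(2) j(2) it[of "n - j"] crit_far[of "n - j"] \<delta>0_pos by (auto simp: y_def)
   then obtain s where s: "A * ln (1 / \<bar>y\<bar>) \<le> real s" "real s \<le> B * ln (1 / \<bar>y\<bar>)"
     "\<And>j. 1 \<le> j ==> j < s ==> (T ^^ j) y \<notin> U" "\<bar>D s y\<bar> \<ge> (1 / c0) * exp (lam * real s / 3)"
    using rec y by blast
   have "\<bar>y\<bar> < 1" using y \<delta>0_lt by auto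
   hence "ln (1 / \<bar>y\<bar>) > 0" using `y \<noteq> 0` by simp
   hence "s > 0" using s(1) AB by (metis mult_pos_pos not_gr0 not_le of_nat_0)
   show ?thesis
   proof (cases "j + s \<le> n")
    \<comment> \<open>Recovery is complete before time \<open>n\<close>. The factor
      \<open>1 / c0\<close> it gains cancels the \<open>c0\<close> lost on the visit to
      \<open>U\<close>, so the induction does not deteriorate \<open>\<kappa>\<close>.\<close>
    case True
    define m where "m = n - j - s"
    have n_eq: "n = j + (s + m)" using True by (simp add: m_def)
    have its: "(T ^^ i) ((T ^^ s) y) = (T ^^ (j + (s + i))) x" for i by (simp add: y_def iter_add)
    have "(T ^^ m) ((T ^^ s) y) \<in> U \<or> (\<forall>i<m. (T ^^ i) ((T ^^ s) y) \<notin> U2)"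
     unfolding its n_eq[symmetric] using less.prems(2) n_eq by auto
    hence "\<bar>D m ((T ^^ s) y)\<bar> \<ge> \<kappa> * exp (lam * real m / 3)"
     using less.IH[of m "(T ^^ s) y"] `s > 0` n_eq iter_range[OF y(2), of s] by simp
    hence "\<bar>D j x\<bar> * (\<bar>D s y\<bar> * \<bar>D m ((T ^^ s) y)\<bar>) \<ge>
      (c0 * exp (lam * real j / 3)) * (((1 / c0) * exp (lam * real s / 3)) * (\<kappa> * exp (lam * real m / 3)))"
     using order_trans[OF mult_left_mono[OF e3[of j], of c0] gj] s(4) c0_pos \<kappa> by (intro mult_mono) auto
    also have "(c0 * exp (lam * real j / 3)) * (((1 / c0) * exp (lam * real s / 3)) * (\<kappa> * exp (lam * real m / 3)))
      = \<kappa> * exp (lam * real n / 3)"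
     using c0_pos by (simp add: n_eq exp_add[symmetric] algebra_simps add_divide_distrib)
    finally show ?thesis by (simp add: n_eq iter_deriv_add abs_mult y_def)
   next
    \<comment> \<open>The orbit breaks off before recovery, so its end lies outside \<open>U\<close>
      and only the alternative of avoiding \<open>U2\<close> remains. Then \<open>y\<close> is at
      least \<open>\<delta>0 / 2\<close> away from 0, which bounds \<open>s\<close> and with it the
      number of remaining steps by \<open>N\<close>.\<close>
    case False
    define m where "m = n - j"
    have n_eq: "n = j + m" using j by (simp add: m_def)
    have "(T ^^ n) x \<notin> U" using s(3)[of m] it[of m] False j(2) n_eq by simp
    hence "\<forall>i<n. (T ^^ i) x \<notin> U2" using less.prems(2) by blast
    hence avoid: "(T ^^ i) y \<notin> U2" if "i < m" for i unfolding it using that n_eq by (metis nat_add_left_cancel_less)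
    have "\<bar>y\<bar> \<ge> \<delta>0 / 2" using avoid[of 0] j(2) n_eq by (auto simp: abs_if)
    hence "1 / \<bar>y\<bar> \<le> 2 / \<delta>0" using `y \<noteq> 0` \<delta>0_pos by (simp add: divide_simps)
    hence "ln (1 / \<bar>y\<bar>) \<le> ln (2 / \<delta>0)" using `y \<noteq> 0` \<delta>0_pos by (subst ln_le_cancel_iff) auto
    hence "real s \<le> B * ln (2 / \<delta>0)" using s(2) AB by (meson mult_left_mono order_trans less_imp_le)
    hence mN: "m \<le> N" unfolding N_def using False n_eq by linarith
    have "c0 * exp (lam * real j) * b ^ N \<le> \<bar>D j x\<bar> * \<bar>D m y\<bar>"
     using gj crude[OF mN avoid] c0_pos bN by (intro mult_mono) auto
    thus ?thesis using small[of j] mN n_eq by (simp add: iter_deriv_add abs_mult y_def)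
   qed
  qed
 qed
 with \<kappa> show ?thesis using that by blast
qed

end

text \<open>Vitali: disjoint balls inside a tight open neighbourhood of \<open>S\<close> cover
  almost all of \<open>S\<close>, but each of them misses a proportion \<open>c\<close> of its own
  length. The balls need not be centred at the points of \<open>S\<close>, which suits images of
  inverse branches.\<close>

lemma porous_negligible:
 fixes S :: "real set"
 assumes S: "S \<in> lmeasurable" and c: "0 < c" and c1: "c < 1"
  and por: "\<And>x d. [|x \<in> S; d > 0|] ==>
   \<exists>z h. 0 < h \<and> h < d \<and> x \<in> ball z h \<and> measure lebesgue (ball z h \<inter> S) \<le> (1 - c) * (2 * h)"
 shows "negligible S"
proof (rule ccontr)
 assume "\<not> negligible S"
 define m where "m = measure lebesgue S"
 have m: "m > 0"
  using S `\<not> negligible S` by (simp add: m_def negligible_iff_measure zero_less_measure_iff)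
 \<comment> \<open>The surplus \<open>m * c\<close> is chosen because (1 - c)(1 + c) < 1: the balls
   have total length below m(1 + c), and \<open>S\<close> fills at most the fraction 1 - c of
   it.\<close>
 obtain V where V: "open V" "S \<subseteq> V" "V - S \<in> lmeasurable" "emeasure lebesgue (V - S) < ennreal (m * c)"
  using sets_lebesgue_outer_open[OF fmeasurableD[OF S], of "m * c"] m c by auto
 have "V = S \<union> (V - S)" using V by auto
 hence "V \<in> lmeasurable" using S V by (metis fmeasurable.Un)
 have "measure lebesgue (V - S) < m * c"
  using V m c by (simp add: emeasure_eq_measure2 ennreal_less_iff)
 note V = V(1,2) `V \<in> lmeasurable` this
 define K where "K = {(z, h). 0 < h \<and> ball z h \<subseteq> V \<and> measure lebesgue (ball z h \<inter> S) \<le> (1 - c) * (2 * h)}"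
 have "\<exists>i. i \<in> K \<and> x \<in> ball (fst i) (snd i) \<and> snd i < d" if "x \<in> S" "d > 0" for x d
 proof -
  obtain k where k: "k > 0" "ball x k \<subseteq> V"
   using V `x \<in> S` by (meson openE subsetD)
  obtain z h where z: "0 < h" "h < min d (k / 2)" "x \<in> ball z h"
    "measure lebesgue (ball z h \<inter> S) \<le> (1 - c) * (2 * h)"
   using por[OF `x \<in> S`, of "min d (k / 2)"] k `d > 0` by auto
  have "ball z h \<subseteq> ball x k"
  proof
   fix y assume "y \<in> ball z h"
   hence "dist x y < h + h" using z(3) by (metis dist_commute dist_triangle_less_add mem_ball)
   thus "y \<in> ball x k" using z by auto
  qed
  thus ?thesis using z k by (intro exI[of _ "(z, h)"]) (auto simp: K_def)
 qed
 then obtain C where C: "countable C" "C \<subseteq> K"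
   "pairwise (\<lambda>i j. disjnt (ball (fst i) (snd i)) (ball (fst j) (snd j))) C"
   "negligible (S - (\<Union>i\<in>C. ball (fst i) (snd i)))"
  by (rule Vitali_covering_theorem_balls) blast
 define B where "B = (\<Union>i\<in>C. ball (fst i) (snd i))"
 have dj: "disjoint_family_on (\<lambda>i. ball (fst i) (snd i)) C"
  using C(3) by (auto simp: disjoint_family_on_def pairwise_def disjnt_def)
 have "ball (fst i) (snd i) \<subseteq> V" if "i \<in> C" for i
  using subsetD[OF C(2) that] unfolding K_def by (simp add: case_prod_beta)
 hence B: "B \<in> sets lebesgue" "B \<subseteq> V" using C(1) by (auto simp: B_def)
 have Bl: "B \<in> lmeasurable" using B V by (meson fmeasurableI2 fmeasurableD)
 have "emeasure lebesgue (B \<inter> S) = emeasure lebesgue (\<Union>i\<in>C. ball (fst i) (snd i) \<inter> S)"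
  by (intro arg_cong[where f="emeasure lebesgue"]) (auto simp: B_def)
 also have "\<dots> = (\<integral>\<^sup>+i. emeasure lebesgue (ball (fst i) (snd i) \<inter> S) \<partial>count_space C)"
 proof (rule emeasure_UN_countable)
  show "disjoint_family_on (\<lambda>i. ball (fst i) (snd i) \<inter> S) C"
   using dj unfolding disjoint_family_on_def by blast
 qed (use S C in auto)
 also have "\<dots> \<le> (\<integral>\<^sup>+i. ennreal (1 - c) * emeasure lebesgue (ball (fst i) (snd i)) \<partial>count_space C)"
 proof (intro nn_integral_mono)
  fix i assume "i \<in> space (count_space C)"
  hence i: "i \<in> K" using C by auto
  hence "snd i > 0" and m_le: "measure lebesgue (ball (fst i) (snd i) \<inter> S) \<le> (1 - c) * (2 * snd i)"
   by (auto simp: K_def)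
  have "emeasure lebesgue (ball (fst i) (snd i)) = ennreal (2 * snd i)"
   using `snd i > 0` by (simp add: ball_eq_greaterThanLessThan)
  moreover have "emeasure lebesgue (ball (fst i) (snd i) \<inter> S) = ennreal (measure lebesgue (ball (fst i) (snd i) \<inter> S))"
   using S by (intro emeasure_eq_measure2) (auto intro: fmeasurable_Int_fmeasurable fmeasurableD)
  ultimately show "emeasure lebesgue (ball (fst i) (snd i) \<inter> S) \<le> ennreal (1 - c) * emeasure lebesgue (ball (fst i) (snd i))"
   using m_le c1 `snd i > 0` by (simp add: ennreal_mult[symmetric])
 qed
 also have "\<dots> = ennreal (1 - c) * (\<integral>\<^sup>+i. emeasure lebesgue (ball (fst i) (snd i)) \<partial>count_space C)"
  by (intro nn_integral_cmult) auto
 also have "(\<integral>\<^sup>+i. emeasure lebesgue (ball (fst i) (snd i)) \<partial>count_space C) = emeasure lebesgue B"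
  unfolding B_def using C dj by (intro emeasure_UN_countable[symmetric]) auto
 finally have "measure lebesgue (B \<inter> S) \<le> (1 - c) * measure lebesgue B"
  using Bl S c1 by (subst (asm) (1 2) emeasure_eq_measure2)
   (auto simp: ennreal_mult[symmetric] intro: fmeasurable_Int_fmeasurable fmeasurableD)
 moreover have "measure lebesgue (B \<inter> S) = m"
  unfolding m_def using C(4) S Bl
  by (intro measure_negligible_symdiff) (auto simp: B_def[symmetric] Diff_Int negligible_Un)
 moreover have "measure lebesgue B = measure lebesgue (B \<inter> S) + measure lebesgue (B - S)"
  using Bl S measure_Un2[of "B \<inter> S" lebesgue B]
  by (auto simp: Un_absorb1 Diff_Int intro: fmeasurable_Int_fmeasurable fmeasurableD)
 moreover have "measure lebesgue (B - S) \<le> measure lebesgue (V - S)"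
  using B V S by (intro measure_mono_fmeasurable) (auto intro: fmeasurableD fmeasurable.Diff)
 ultimately have "m \<le> (1 - c) * (m + measure lebesgue (V - S))"
  using c1 by (smt (verit) mult_left_mono)
 also have "\<dots> < (1 - c) * (m + m * c)" using V c1 by simp
 also have "\<dots> = m - m * c * c" by (simp add: algebra_simps)
 also have "\<dots> < m" using m c by simp
 finally show False .
qed

section \<open>Distortion away from the critical point, and orbits that never enter
  \<open>U\<close>\<close>

context mis_map
begin

text \<open>Both inverse branches are differentiable below the critical value 1 and so preserve null
  sets; the only preimage of 1 is 0, which is inserted by hand.\<close>

lemma negligible_vimage_T:
 assumes "negligible N" shows "negligible {x. T x \<in> N}"
proof -
 let ?g = "\<lambda>y. sqrt ((1 - y) / a)"
 have d: "?g differentiable_on (N \<inter> {..<1})"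
  unfolding differentiable_on_def
 proof
  fix y assume "y \<in> N \<inter> {..<1}"
  hence "0 < (1 - y) / a" using a_pos by simp
  hence "(?g has_real_derivative (- 1 / a) * (inverse (sqrt ((1 - y) / a)) / 2)) (at y within N \<inter> {..<1})"
   using a_pos by (auto intro!: derivative_eq_intros)
  thus "?g differentiable at y within N \<inter> {..<1}"
   by (auto simp: real_differentiable_def)
 qed
 have n: "negligible (N \<inter> {..<1})" using assms by (rule negligible_subset) auto
 have "negligible (?g ` (N \<inter> {..<1}))" "negligible ((\<lambda>y. - ?g y) ` (N \<inter> {..<1}))"
  using n d by (auto intro!: negligible_differentiable_image_negligible differentiable_on_minus)
 hence "negligible (insert 0 (?g ` (N \<inter> {..<1}) \<union> (\<lambda>y. - ?g y) ` (N \<inter> {..<1})))"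
  by (simp add: negligible_Un)
 thus ?thesis
 proof (rule negligible_subset, intro subsetI)
  fix x assume "x \<in> {x. T x \<in> N}"
  moreover have "(1 - T x) / a = x\<^sup>2" "x \<noteq> 0 ==> T x < 1" using a_pos by (auto simp: logistic_def)
  ultimately show "x \<in> insert 0 (?g ` (N \<inter> {..<1}) \<union> (\<lambda>y. - ?g y) ` (N \<inter> {..<1}))"
   by (cases "x = 0"; cases "x > 0") (auto simp: image_iff intro: bexI[of _ "T x"])
 qed
qed

lemma negligible_vimage_iter: "negligible N ==> negligible {x. (T ^^ n) x \<in> N}"
proof (induction n)
 case (Suc n)
 have "{x. (T ^^ Suc n) x \<in> N} = {x. T x \<in> {y. (T ^^ n) y \<in> N}}"
  by (simp only: iter_Suc' mem_Collect_eq)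
 thus ?case using negligible_vimage_T[OF Suc.IH[OF Suc.prems]] by simp
qed simp

lemma iter_mvt:
 obtains z where "z \<in> closed_segment x y" "(T ^^ n) y - (T ^^ n) x = (y - x) * D n z"
proof (cases x y rule: linorder_cases)
 case less
 thus ?thesis
  using MVT2[of x y "T ^^ n" "D n"] has_derivative_iter that
  by (smt (verit) closed_segment_eq_real_ivl atLeastAtMost_iff)
next
 case greater
 then obtain z where "y < z" "z < x" "(T ^^ n) x - (T ^^ n) y = (x - y) * D n z"
  using MVT2[of y x "T ^^ n" "D n"] has_derivative_iter by blast
 thus ?thesis using that[of z] by (auto simp: closed_segment_eq_real_ivl algebra_simps)
qed (use that in auto)

lemma iter_segment:
 assumes "\<xi> \<in> closed_segment ((T ^^ n) x) ((T ^^ n) y)"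
 obtains z where "z \<in> closed_segment x y" "(T ^^ n) z = \<xi>"
proof -
 have "connected ((T ^^ n) ` closed_segment x y)"
  by (intro connected_continuous_image continuous_iter) auto
 hence "closed_segment ((T ^^ n) x) ((T ^^ n) y) \<subseteq> (T ^^ n) ` closed_segment x y"
  by (intro closed_segment_subset) (auto simp: is_interval_convex_1[symmetric] is_interval_connected_1)
 thus ?thesis using assms that by auto
qed

lemma exp_sum_bound:
 assumes "\<gamma> > 0"
 shows "(\<Sum>j<n. exp (- \<gamma> * real (n - j))) \<le> 1 / (1 - exp (- \<gamma>))"
proof -
 have "(\<Sum>j<n. exp (- \<gamma> * real (n - j))) = (\<Sum>i<n. exp (- \<gamma>) ^ Suc i)"
  by (subst sum.nat_diff_reindex[symmetric]) (auto intro!: sum.cong simp: exp_of_nat_mult[symmetric] mult.commute Suc_diff_Suc)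
 also have "\<dots> \<le> (\<Sum>i<n. exp (- \<gamma>) ^ i)"
  using assms by (intro sum_mono) (auto simp: mult_left_le_one_le)
 also have "\<dots> \<le> (\<Sum>i. exp (- \<gamma>) ^ i)"
  using assms by (intro sum_le_suminf summable_geometric) auto
 also have "\<dots> = 1 / (1 - exp (- \<gamma>))"
  using assms by (intro suminf_geometric) auto
 finally show ?thesis .
qed

text \<open>The last n - j steps expand exponentially and the final distance is at most 2, so two
  orbits are exponentially close at time j. Off \<open>U2\<close> each factor of the derivative is
  bounded away from 0, hence the relative errors are summable uniformly in n.\<close>

lemma distortion_outside_half:
 obtains K where "K \<ge> 1"
  "\<And>n x y u v. [|u \<le> v; {u..v} \<subseteq> {-1..1}; \<And>z i. [|z \<in> {u..v}; i < n|] ==> (T ^^ i) z \<notin> U2;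
    x \<in> {u..v}; y \<in> {u..v}|] ==> \<bar>D n x\<bar> \<le> K * \<bar>D n y\<bar>"
proof -
 obtain \<kappa> where \<kappa>: "\<kappa> > 0" "\<And>n x. [|x \<in> {-1..1}; \<And>i. i < n ==> (T ^^ i) x \<notin> U2|] ==>
   \<bar>D n x\<bar> \<ge> \<kappa> * exp (lam * real n / 3)"
  by (rule expansion) blast
 define \<gamma> where "\<gamma> = lam / 3"
 have \<gamma>: "\<gamma> > 0" using lam_pos by (simp add: \<gamma>_def)
 define \<sigma> where "\<sigma> = 2 / \<kappa> * (1 / (1 - exp (- \<gamma>)))"
 have "\<bar>D n x\<bar> \<le> exp (2 / \<delta>0 * \<sigma>) * \<bar>D n y\<bar>"
  if uv: "u \<le> v" "{u..v} \<subseteq> {-1..1}" and out: "\<And>z i. [|z \<in> {u..v}; i < n|] ==> (T ^^ i) z \<notin> U2"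
   and xy: "x \<in> {u..v}" "y \<in> {u..v}" for n x y u v
 proof -
  have seg: "closed_segment x y \<subseteq> {u..v}" using xy by (auto simp: closed_segment_eq_real_ivl split: if_splits)
  have d: "\<bar>(T ^^ j) x - (T ^^ j) y\<bar> \<le> 2 / \<kappa> * exp (- \<gamma> * real (n - j))" if "j < n" for j
  proof -
   obtain \<xi> where \<xi>: "\<xi> \<in> closed_segment ((T ^^ j) x) ((T ^^ j) y)"
     "(T ^^ (n - j)) ((T ^^ j) y) - (T ^^ (n - j)) ((T ^^ j) x) = ((T ^^ j) y - (T ^^ j) x) * D (n - j) \<xi>"
    by (rule iter_mvt)
   then obtain z where z: "z \<in> closed_segment x y" "(T ^^ j) z = \<xi>" using iter_segment by metis
   hence zuv: "z \<in> {u..v}" using seg by auto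
   have "(T ^^ n) y - (T ^^ n) x = ((T ^^ j) y - (T ^^ j) x) * D (n - j) \<xi>"
    using \<xi>(2) that by (simp add: iter_add[symmetric])
   moreover have "(T ^^ n) y \<in> {-1..1}" "(T ^^ n) x \<in> {-1..1}"
    using xy uv iter_range by (meson subsetD)+
   ultimately have "\<bar>((T ^^ j) y - (T ^^ j) x) * D (n - j) \<xi>\<bar> \<le> 2"
    by (simp only: atLeastAtMost_iff) linarith
   hence "\<bar>(T ^^ j) y - (T ^^ j) x\<bar> * \<bar>D (n - j) \<xi>\<bar> \<le> 2"
    by (simp add: abs_mult)
   moreover have "\<bar>D (n - j) \<xi>\<bar> \<ge> \<kappa> * exp (lam * real (n - j) / 3)"
   proof (rule \<kappa>(2))
    show "\<xi> \<in> {-1..1}" using z zuv uv iter_range by auto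
    show "(T ^^ i) \<xi> \<notin> U2" if "i < n - j" for i
     using out[OF zuv, of "j + i"] that z by (simp add: iter_add)
   qed
   ultimately have "\<bar>(T ^^ j) y - (T ^^ j) x\<bar> * (\<kappa> * exp (lam * real (n - j) / 3)) \<le> 2"
    by (meson abs_ge_zero mult_left_mono order_trans)
   hence "\<bar>(T ^^ j) y - (T ^^ j) x\<bar> \<le> 2 / (\<kappa> * exp (lam * real (n - j) / 3))"
    using \<kappa>(1) by (subst pos_le_divide_eq) auto
   also have "\<dots> = 2 / \<kappa> * exp (- \<gamma> * real (n - j))"
    by (simp add: \<gamma>_def exp_minus field_simps)
   finally show ?thesis by (simp add: abs_minus_commute)
  qed
  have "\<bar>D n x\<bar> = (\<Prod>j<n. \<bar>- 2 * a * (T ^^ j) x\<bar>)" by (simp add: iter_deriv_def abs_prod)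
  also have "\<dots> \<le> (\<Prod>j<n. exp (2 / \<delta>0 * (2 / \<kappa> * exp (- \<gamma> * real (n - j)))) * \<bar>- 2 * a * (T ^^ j) y\<bar>)"
  proof (rule prod_mono)
   fix j assume "j \<in> {..<n}"
   hence j: "j < n" by simp
   let ?X = "(T ^^ j) x" and ?Y = "(T ^^ j) y"
   have Y: "\<bar>?Y\<bar> \<ge> \<delta>0 / 2" using out[OF xy(2) j] by (auto simp: abs_if split: if_splits)
   have "\<bar>?X\<bar> \<le> \<bar>?Y\<bar> + \<bar>?X - ?Y\<bar>" by linarith
   also have "\<bar>?X - ?Y\<bar> \<le> 2 / \<delta>0 * (2 / \<kappa> * exp (- \<gamma> * real (n - j))) * \<bar>?Y\<bar>"
   proof -
    have "\<bar>?X - ?Y\<bar> \<le> 2 / \<kappa> * exp (- \<gamma> * real (n - j)) * 1" using d[OF j] by simp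
    also have "\<dots> \<le> 2 / \<kappa> * exp (- \<gamma> * real (n - j)) * (2 / \<delta>0 * \<bar>?Y\<bar>)"
     using Y \<delta>0_pos \<kappa>(1) by (intro mult_left_mono) (auto simp: field_simps)
    finally show ?thesis by (simp add: algebra_simps)
   qed
   finally have "\<bar>?X\<bar> \<le> (1 + 2 / \<delta>0 * (2 / \<kappa> * exp (- \<gamma> * real (n - j)))) * \<bar>?Y\<bar>" by (simp add: algebra_simps)
   also have "\<dots> \<le> exp (2 / \<delta>0 * (2 / \<kappa> * exp (- \<gamma> * real (n - j)))) * \<bar>?Y\<bar>"
    by (intro mult_right_mono) auto
   finally show "0 \<le> \<bar>- 2 * a * ?X\<bar> \<and> \<bar>- 2 * a * ?X\<bar> \<le>
     exp (2 / \<delta>0 * (2 / \<kappa> * exp (- \<gamma> * real (n - j)))) * \<bar>- 2 * a * ?Y\<bar>"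
    using a_pos by (simp add: abs_mult mult.left_commute)
  qed
  also have "\<dots> = exp (\<Sum>j<n. 2 / \<delta>0 * (2 / \<kappa> * exp (- \<gamma> * real (n - j)))) * \<bar>D n y\<bar>"
   by (simp add: prod.distrib exp_sum iter_deriv_def abs_prod)
  also have "(\<Sum>j<n. 2 / \<delta>0 * (2 / \<kappa> * exp (- \<gamma> * real (n - j)))) = 2 / \<delta>0 * (2 / \<kappa> * (\<Sum>j<n. exp (- \<gamma> * real (n - j))))"
   by (simp only: sum_distrib_left)
  also have "exp \<dots> * \<bar>D n y\<bar> \<le> exp (2 / \<delta>0 * \<sigma>) * \<bar>D n y\<bar>"
   unfolding \<sigma>_def using \<delta>0_pos \<kappa>(1) exp_sum_bound[OF \<gamma>, of n]
   by (intro mult_right_mono, subst exp_le_cancel_iff, intro mult_left_mono) auto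
  finally show ?thesis .
 qed
 moreover have "exp (2 / \<delta>0 * \<sigma>) \<ge> 1" using \<delta>0_pos \<kappa>(1) \<gamma> by (auto simp: \<sigma>_def)
 ultimately show ?thesis using that by blast
qed

definition avoiding :: "real set" where
 "avoiding = {x \<in> {-1..1}. \<forall>n. (T ^^ n) x \<notin> U}"

lemma closed_avoiding: "closed avoiding"
proof -
 have "avoiding = {-1..1} \<inter> (\<Inter>n. (T ^^ n) -` (- U))" by (auto simp: avoiding_def)
 moreover have "closed ((T ^^ n) -` (- U))" for n
  by (intro closed_vimage) (auto intro: continuous_iter)
 ultimately show ?thesis by (auto intro!: closed_INT)
qed

text \<open>Porosity. At the first time a neighbourhood of \<open>x\<close> meets \<open>U2\<close>,
  the image of \<open>x\<close> is still outside \<open>U\<close>; the image therefore crosses the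
  strip between \<open>\<delta>0 / 2\<close> and \<open>\<delta>0\<close>. The preimage of this
  strip is a gap, and bounded distortion makes it a definite proportion of the
  neighbourhood.\<close>

lemma negligible_avoiding: "negligible avoiding"
proof -
 define S where "S = avoiding \<inter> {-1<..<1}"
 obtain K where K: "K \<ge> 1"
  "\<And>n x y u v. [|u \<le> v; {u..v} \<subseteq> {-1..1}; \<And>z i. [|z \<in> {u..v}; i < n|] ==> (T ^^ i) z \<notin> U2;
    x \<in> {u..v}; y \<in> {u..v}|] ==> \<bar>D n x\<bar> \<le> K * \<bar>D n y\<bar>"
  using distortion_outside_half by blast
 obtain \<kappa> where \<kappa>: "\<kappa> > 0" "\<And>n x. [|x \<in> {-1..1}; \<And>i. i < n ==> (T ^^ i) x \<notin> U2|] ==>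
   \<bar>D n x\<bar> \<ge> \<kappa> * exp (lam * real n / 3)"
  by (rule expansion) blast
 have Sm: "S \<in> lmeasurable"
  unfolding S_def using closed_avoiding
  by (intro bounded_set_imp_lmeasurable) (auto intro: bounded_subset[of "{-1<..<1}"] sets_completionI_sets borel_closed)
 have "negligible S"
 \<comment> \<open>The gap has length at least \<open>\<delta>0 * h / (2 * K\<^sup>2)\<close> inside
   an interval of length \<open>2 * h\<close>.\<close>
 proof (rule porous_negligible[OF Sm, of "\<delta>0 / (4 * K\<^sup>2)"])
  show "0 < \<delta>0 / (4 * K\<^sup>2)" using \<delta>0_pos K by simp
  have "\<delta>0 < 1 * 1 ^ 2" using \<delta>0_lt by simp
  also have "\<dots> \<le> 4 * K\<^sup>2" using K by (intro mult_mono power_mono) auto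
  finally show "\<delta>0 / (4 * K\<^sup>2) < 1" using K by simp
  fix x d :: real assume x: "x \<in> S" and d: "d > 0"
  define h where "h = min (d / 2) ((1 - \<bar>x\<bar>) / 2)"
  have h: "h > 0" "h < d" "{x - h..x + h} \<subseteq> {-1..1}"
   using x d by (auto simp: h_def S_def min_def field_simps abs_if split: if_splits)
  have xout: "(T ^^ i) x \<notin> U" for i using x by (auto simp: S_def avoiding_def)
  \<comment> \<open>Otherwise \<open>expansion\<close> applies for ever and the image of a segment
    of length \<open>h\<close> outgrows the interval from -1 to 1.\<close>
  have "\<exists>n. \<exists>y\<in>{x - h..x + h}. (T ^^ n) y \<in> U2"
  proof (rule ccontr)
   assume no: "\<not> ?thesis"
   have "h * (\<kappa> * exp (lam * real n / 3)) \<le> 2" for n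
   proof -
    obtain z where z: "z \<in> closed_segment x (x + h)" "(T ^^ n) (x + h) - (T ^^ n) x = (x + h - x) * D n z"
     by (rule iter_mvt)
    have zi: "z \<in> {x - h..x + h}" using z h by (auto simp: closed_segment_eq_real_ivl split: if_splits)
    have "\<kappa> * exp (lam * real n / 3) \<le> \<bar>D n z\<bar>"
     using no zi h by (intro \<kappa>) blast+
    hence "h * (\<kappa> * exp (lam * real n / 3)) \<le> h * \<bar>D n z\<bar>" using h by simp
    also have "\<dots> = \<bar>(T ^^ n) (x + h) - (T ^^ n) x\<bar>" using z h by (simp add: abs_mult)
    also have "(T ^^ n) (x + h) \<in> {-1..1}" "(T ^^ n) x \<in> {-1..1}"
     using iter_range[of "x + h" n] iter_range[of x n] h by auto
    hence "\<bar>(T ^^ n) (x + h) - (T ^^ n) x\<bar> \<le> 2" by auto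
    finally show ?thesis .
   qed
   hence "exp (lam / 3) ^ n \<le> 2 / (h * \<kappa>)" for n
    using h \<kappa> by (simp add: field_simps exp_of_nat_mult[symmetric])
   moreover have "\<exists>n. 2 / (h * \<kappa>) < exp (lam / 3) ^ n"
    using lam_pos by (intro real_arch_pow) simp
   ultimately show False by (meson not_le)
  qed
  then obtain n where n: "\<exists>y\<in>{x - h..x + h}. (T ^^ n) y \<in> U2"
    "\<And>i y. i < n ==> y \<in> {x - h..x + h} ==> (T ^^ i) y \<notin> U2"
   using first_index[of "\<lambda>n. \<exists>y\<in>{x - h..x + h}. (T ^^ n) y \<in> U2"] by blast
  then obtain y0 where y0: "y0 \<in> {x - h..x + h}" "(T ^^ n) y0 \<in> U2" by blast
  \<comment> \<open>The sign makes \<open>f x\<close> at least \<open>\<delta>0\<close>, while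
    \<open>f y0\<close> is below \<open>\<delta>0 / 2\<close>; so \<open>f\<close> takes both
    levels, at \<open>y1\<close> and \<open>y2\<close>.\<close>
  define \<tau> where "\<tau> = sgn ((T ^^ n) x)"
  define f where "f y = \<tau> * (T ^^ n) y" for y
  have \<tau>: "\<bar>\<tau>\<bar> = 1" using xout[of n] \<delta>0_pos by (auto simp: \<tau>_def sgn_if)
  have fx: "f x \<ge> \<delta>0" using xout[of n] \<delta>0_pos by (auto simp: f_def \<tau>_def sgn_if)
  have fy0: "f y0 < \<delta>0 / 2" using y0 \<tau> by (auto simp: f_def abs_if split: if_splits)
  have cf: "continuous_on X f" for X unfolding f_def by (intro continuous_intros)
  have seg: "closed_segment x y0 \<subseteq> {x - h..x + h}"
   using y0 h by (auto simp: closed_segment_eq_real_ivl split: if_splits)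
  have ivt: "\<exists>y\<in>closed_segment x y0. f y = c" if "\<delta>0 / 2 \<le> c" "c \<le> \<delta>0" for c
  proof -
   have "connected (f ` closed_segment x y0)" by (intro connected_continuous_image cf) auto
   hence "c \<in> f ` closed_segment x y0"
    using fx fy0 that by (elim connectedD_interval[of _ "f y0" "f x"]) auto
   thus ?thesis by auto
  qed
  obtain y1 y2 where y12: "y1 \<in> {x - h..x + h}" "f y1 = \<delta>0" "y2 \<in> {x - h..x + h}" "f y2 = \<delta>0 / 2"
   using ivt[of \<delta>0] ivt[of "\<delta>0 / 2"] seg \<delta>0_pos by (metis subsetD less_imp_le half_gt_zero_iff field_sum_of_halves less_add_same_cancel1 order_refl)
  have dist: "\<bar>D n y\<bar> \<le> K * \<bar>D n z\<bar>" if "y \<in> {x - h..x + h}" "z \<in> {x - h..x + h}" for y z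
   using n(2) h that by (intro K(2)[where u = "x - h" and v = "x + h"]) auto
  have Dnz: "D n y \<noteq> 0" if "y \<in> {x - h..x + h}" for y
   using n(2)[OF _ that] \<delta>0_pos by (intro D_nz) force
  have injf: "inj_on f {x - h..x + h}"
  proof (rule inj_onI)
   fix y z assume yz: "y \<in> {x - h..x + h}" "z \<in> {x - h..x + h}" "f y = f z"
   obtain w where w: "w \<in> closed_segment y z" "(T ^^ n) z - (T ^^ n) y = (z - y) * D n w" by (rule iter_mvt)
   have "w \<in> {x - h..x + h}" using w yz by (auto simp: closed_segment_eq_real_ivl split: if_splits)
   thus "y = z" using Dnz w yz \<tau> by (auto simp: f_def)
  qed
  define p q where "p = min y1 y2" and "q = max y1 y2"
  have "y1 \<noteq> y2" using y12 \<delta>0_pos by auto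
  hence pq: "p < q" "p \<in> {x - h..x + h}" "q \<in> {x - h..x + h}" using y12 \<delta>0_pos by (auto simp: p_def q_def min_def max_def)
  have notS: "y \<notin> S" if "y \<in> {p<..<q}" for y
  proof -
   have "(f p < f y \<and> f y < f q) \<or> (f q < f y \<and> f y < f p)"
    using that pq by (intro continuous_inj_imp_mono cf inj_on_subset[OF injf]) auto
   hence "\<delta>0 / 2 < f y \<and> f y < \<delta>0"
    using y12 \<delta>0_pos by (auto simp: p_def q_def min_def max_def split: if_splits)
   hence "(T ^^ n) y \<in> U" using \<tau> \<delta>0_pos by (auto simp: f_def abs_if split: if_splits)
   thus ?thesis by (auto simp: S_def avoiding_def)
  qed
  \<comment> \<open>The gap is mapped onto length \<open>\<delta>0 / 2\<close>, the whole
    neighbourhood onto length at most 2. Comparing both derivatives with the one at \<open>x\<close>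
    costs a factor \<open>K\<close> each time.\<close>
  have len_pq: "q - p \<ge> \<delta>0 / 2 / (K * \<bar>D n x\<bar>)"
  proof -
   obtain z where z: "z \<in> closed_segment y1 y2" "(T ^^ n) y2 - (T ^^ n) y1 = (y2 - y1) * D n z" by (rule iter_mvt)
   have "z \<in> {x - h..x + h}" using z y12 by (auto simp: closed_segment_eq_real_ivl split: if_splits)
   hence "\<bar>D n z\<bar> \<le> K * \<bar>D n x\<bar>" using h by (intro dist) auto
   moreover have "f y2 - f y1 = \<tau> * ((y2 - y1) * D n z)" using z(2) by (simp add: f_def right_diff_distrib[symmetric])
   hence "\<delta>0 / 2 = \<bar>y2 - y1\<bar> * \<bar>D n z\<bar>"
    using y12 \<tau> \<delta>0_pos by (metis abs_mult abs_minus_commute abs_of_pos field_sum_of_halves add_diff_cancel_right' half_gt_zero mult_1)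
   moreover have "\<bar>y2 - y1\<bar> = q - p" by (auto simp: p_def q_def)
   ultimately have "\<delta>0 / 2 \<le> (q - p) * (K * \<bar>D n x\<bar>)" using pq by (simp add: mult_left_mono)
   moreover have "K * \<bar>D n x\<bar> > 0" using K Dnz[of x] h by simp
   ultimately show ?thesis by (simp add: pos_divide_le_eq)
  qed
  have "h * \<bar>D n x\<bar> \<le> K"
  proof -
   obtain z where z: "z \<in> closed_segment (x - h) (x + h)" "(T ^^ n) (x + h) - (T ^^ n) (x - h) = (x + h - (x - h)) * D n z"
    by (rule iter_mvt)
   have zi: "z \<in> {x - h..x + h}" using z h by (auto simp: closed_segment_eq_real_ivl split: if_splits)
   have "(T ^^ n) (x + h) \<in> {-1..1}" "(T ^^ n) (x - h) \<in> {-1..1}"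
    using iter_range[of "x + h" n] iter_range[of "x - h" n] h by auto
   hence "\<bar>2 * h * D n z\<bar> \<le> 2" using z by auto
   hence "h * \<bar>D n z\<bar> \<le> 1" using h by (simp add: abs_mult)
   moreover have "h * \<bar>D n x\<bar> \<le> h * (K * \<bar>D n z\<bar>)" using dist[of x z] zi h by simp
   ultimately show ?thesis using K by (smt (verit) mult.left_commute mult_left_le)
  qed
  have "\<delta>0 * h / (2 * K\<^sup>2) \<le> \<delta>0 / 2 / (K * \<bar>D n x\<bar>)"
  proof -
   have "\<bar>D n x\<bar> > 0" using Dnz[of x] h by simp
   hence "\<delta>0 / 2 / (K * \<bar>D n x\<bar>) = \<delta>0 / (2 * K\<^sup>2) * (K / \<bar>D n x\<bar>)"
    using K by (simp add: field_simps power2_eq_square)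
   also have "\<dots> \<ge> \<delta>0 / (2 * K\<^sup>2) * h"
    using `\<bar>D n x\<bar> > 0` `h * \<bar>D n x\<bar> \<le> K` \<delta>0_pos by (intro mult_left_mono) (auto simp: pos_le_divide_eq)
   finally show ?thesis by simp
  qed
  with len_pq have gap: "\<delta>0 * h / (2 * K\<^sup>2) \<le> q - p" by simp
  have "measure lebesgue (ball x h \<inter> S) \<le> measure lebesgue ({x - h..x + h} - {p<..<q})"
   using notS Sm by (intro measure_mono_fmeasurable) (auto simp: dist_real_def abs_if intro!: fmeasurableD split: if_splits)
  also have "\<dots> = 2 * h - (q - p)"
   using h pq by (subst measure_Diff) auto
  also have "\<dots> \<le> (1 - \<delta>0 / (4 * K\<^sup>2)) * (2 * h)"
   using gap by (simp add: algebra_simps)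
  finally show "\<exists>z h. 0 < h \<and> h < d \<and> x \<in> ball z h \<and>
    measure lebesgue (ball z h \<inter> S) \<le> (1 - \<delta>0 / (4 * K\<^sup>2)) * (2 * h)"
   using h by (intro exI[of _ x] exI[of _ h]) auto
 qed
 hence "negligible (S \<union> {-1, 1})" by (intro negligible_Un) auto
 thus ?thesis by (rule negligible_subset) (auto simp: S_def avoiding_def)
qed

end

section \<open>Uniqueness of the absolutely continuous invariant measure\<close>

context mis_map
begin

text \<open>The inverse branch through \<open>x\<close> exists on all of \<open>(-2\<delta>0, 2\<delta>0)\<close> because the critical orbit
 avoids this interval.  The concavity of \<open>w = \<bar>g'\<bar> powr (-1/2)\<close> expresses the negative Schwarzian
 derivative; it yields the Koebe-type distortion bound below.\<close>

definition branch :: "nat => real => (real => real) => real => (real => real) => bool" where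
 "branch n x g s w \<longleftrightarrow> \<bar>s\<bar> = 1 \<and> g ((T ^^ n) x) = x \<and> (\<exists>w1 w2. \<forall>y\<in>{-2*\<delta>0<..<2*\<delta>0}.
   (T ^^ n) (g y) = y \<and> w y > 0 \<and> (g has_real_derivative s / (w y)\<^sup>2) (at y) \<and>
   (w has_real_derivative w1 y) (at y) \<and> (w1 has_real_derivative w2 y) (at y) \<and> w2 y \<le> 0)"

text \<open>Induction by composing with a square root. If \<open>g\<close> reached the critical
  value 1 at some \<open>y\<close>, the critical orbit would be at \<open>y\<close> at time
  \<open>Suc n\<close>, which \<open>crit_far\<close> forbids; so \<open>g\<close> stays below 1 and
  the root is smooth. The new weight is the product of the old one with a weight for the square
  root, and concavity survives.\<close>

lemma branch_exists:
 assumes "(T ^^ n) x \<in> {-2*\<delta>0<..<2*\<delta>0}"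
 shows "\<exists>g s w. branch n x g s w"
 using assms
proof (induction n arbitrary: x)
 case 0
 show ?case
  by (rule exI[of _ "\<lambda>y. y"], rule exI[of _ 1], rule exI[of _ "\<lambda>_. 1"])
   (auto simp: branch_def intro!: exI[of _ "\<lambda>_. 0"] derivative_eq_intros)
next
 case (Suc n)
 let ?V = "{-2*\<delta>0<..<2*\<delta>0}"
 have y1: "(T ^^ n) (T x) \<in> ?V" using Suc.prems by (simp only: iter_Suc')
 then obtain g s w where br: "branch n (T x) g s w" using Suc.IH by blast
 hence s: "\<bar>s\<bar> = 1" and gx: "g ((T ^^ n) (T x)) = T x" unfolding branch_def by blast+
 from br obtain w1 w2 where ww: "\<forall>y\<in>?V. (T ^^ n) (g y) = y \<and> w y > 0 \<and> (g has_real_derivative s / (w y)\<^sup>2) (at y) \<and>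
   (w has_real_derivative w1 y) (at y) \<and> (w1 has_real_derivative w2 y) (at y) \<and> w2 y \<le> 0"
  unfolding branch_def by blast
 have w: "\<And>y. y \<in> ?V ==> (T ^^ n) (g y) = y" "\<And>y. y \<in> ?V ==> w y > 0"
   "\<And>y. y \<in> ?V ==> (g has_real_derivative s / (w y)\<^sup>2) (at y)"
   "\<And>y. y \<in> ?V ==> (w has_real_derivative w1 y) (at y)"
   "\<And>y. y \<in> ?V ==> (w1 has_real_derivative w2 y) (at y)" "\<And>y. y \<in> ?V ==> w2 y \<le> 0"
  using ww by blast+
 have "x \<noteq> 0"
  using Suc.prems crit_far[of "Suc n"] by (auto simp del: funpow.simps)
 have gne: "g y \<noteq> 1" if "y \<in> ?V" for y
 proof
  assume "g y = 1"
  hence "(T ^^ Suc n) 0 = y" using w(1)[OF that] by (simp only: iter_Suc') (simp add: logistic_def)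
  thus False using crit_far[of "Suc n"] that by auto
 qed
 have "T x < 1" using `x \<noteq> 0` a_pos by (simp add: logistic_def)
 have glt: "g y < 1" if "y \<in> ?V" for y
 proof (rule ccontr)
  assume "\<not> g y < 1"
  have "continuous_on ?V g"
   using w(3) by (meson DERIV_isCont continuous_at_imp_continuous_on)
  hence "connected (g ` ?V)" by (intro connected_continuous_image) auto
  moreover have "T x \<in> g ` ?V" using y1 gx by force
  ultimately have "1 \<in> g ` ?V"
   using that `\<not> g y < 1` `T x < 1` by (elim connectedD_interval[of _ "T x" "g y"]) auto
  thus False using gne by auto
 qed
 \<comment> \<open>\<open>P\<close> is the square of 2a|G|, so \<open>v\<close>, its fourth root,
   satisfies v^2 = |T'(G)|. Hence |G'| = |g'| / v^2, which is why the new weight is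
   \<open>w * v\<close>.\<close>
 define P where "P y = 4 * a * (1 - g y)" for y
 have P: "P y > 0" if "y \<in> ?V" for y using glt[OF that] a_pos by (simp add: P_def)
 define v where "v y = sqrt (sqrt (P y))" for y
 have v: "v y > 0" "(v y)\<^sup>2 = sqrt (P y)" "(v y) ^ 4 = P y" if "y \<in> ?V" for y
 proof -
  show "v y > 0" "(v y)\<^sup>2 = sqrt (P y)" using P[OF that] by (auto simp: v_def)
  hence "((v y)\<^sup>2)\<^sup>2 = P y" using P[OF that] by simp
  thus "(v y) ^ 4 = P y" by simp
 qed
 define \<sigma> where "\<sigma> = sgn x"
 have \<sigma>: "\<bar>\<sigma>\<bar> = 1" "\<sigma> * \<sigma> = 1" using `x \<noteq> 0` by (auto simp: \<sigma>_def sgn_if)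
 define G where "G y = \<sigma> * sqrt ((1 - g y) / a)" for y
 define s' where "s' = - \<sigma> * s"
 define W where "W y = w y * v y" for y
 define v1 where "v1 y = - a * s / ((v y) ^ 3 * (w y)\<^sup>2)" for y
 define W1 where "W1 y = w1 y * v y - a * s / ((v y) ^ 3 * w y)" for y
 define W2 where "W2 y = w2 y * v y - 3 * a\<^sup>2 / ((v y) ^ 7 * (w y) ^ 3)" for y
 have ss: "s * s = 1" using s by (auto simp: abs_if split: if_splits)
 have dv: "(v has_real_derivative v1 y) (at y)" if y: "y \<in> ?V" for y
 proof -
  have "(v has_real_derivative (4 * a * (0 - s / (w y)\<^sup>2)) * (inverse (sqrt (P y)) / 2) * (inverse (sqrt (sqrt (P y))) / 2)) (at y)"
   unfolding v_def P_def
   using P[OF y] by (auto intro!: derivative_eq_intros w(3)[OF y] simp: P_def)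
  also have "(4 * a * (0 - s / (w y)\<^sup>2)) * (inverse (sqrt (P y)) / 2) * (inverse (sqrt (sqrt (P y))) / 2) = v1 y"
   unfolding v_def[of y, symmetric] unfolding v(2)[OF y, symmetric] v1_def using v[OF y] w(2)[OF y]
   by (simp add: field_simps power2_eq_square power3_eq_cube)
  finally show ?thesis .
 qed
 have "branch (Suc n) x G s' W"
  unfolding branch_def
 proof (intro conjI exI ballI)
  show "\<bar>s'\<bar> = 1" using s \<sigma> by (simp add: s'_def abs_mult)
  have "(1 - T x) / a = x\<^sup>2" using a_pos by (simp add: logistic_def)
  hence "sqrt ((1 - T x) / a) = \<bar>x\<bar>" by simp
  thus "G ((T ^^ Suc n) x) = x"
   by (simp only: iter_Suc' G_def gx) (simp add: \<sigma>_def sgn_if)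
  fix y assume y: "y \<in> ?V"
  have "(G y)\<^sup>2 = (\<sigma> * \<sigma>) * (sqrt ((1 - g y) / a))\<^sup>2" by (simp only: G_def power2_eq_square mult_ac)
  also have "\<dots> = (1 - g y) / a" using glt[OF y] a_pos \<sigma> by simp
  finally have "T (G y) = g y" using a_pos by (simp add: logistic_def)
  thus "(T ^^ Suc n) (G y) = y" using w(1)[OF y] by (simp only: iter_Suc')
  show "W y > 0" using v[OF y] w(2)[OF y] by (simp add: W_def)
  have pos: "(1 - g y) / a > 0" using glt[OF y] a_pos by simp
  have "(G has_real_derivative \<sigma> * ((0 - s / (w y)\<^sup>2) / a * (inverse (sqrt ((1 - g y) / a)) / 2))) (at y)"
   unfolding G_def using pos a_pos by (auto intro!: derivative_eq_intros w(3)[OF y] simp: mult_ac)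
  also have "2 * a * sqrt ((1 - g y) / a) = (v y)\<^sup>2"
  proof -
   have "(2 * a * sqrt ((1 - g y) / a))\<^sup>2 = P y"
    by (simp only: power_mult_distrib real_sqrt_pow2[OF less_imp_le[OF pos]])
     (use a_pos in \<open>simp add: P_def power2_eq_square\<close>)
   hence "2 * a * sqrt ((1 - g y) / a) = sqrt (P y)"
    using a_pos pos by (metis real_sqrt_unique mult_nonneg_nonneg less_imp_le real_sqrt_ge_zero zero_le_numeral)
   thus ?thesis using v(2)[OF y] by simp
  qed
  hence "sqrt ((1 - g y) / a) = (v y)\<^sup>2 / (2 * a)" using a_pos by (simp add: field_simps)
  hence "\<sigma> * ((0 - s / (w y)\<^sup>2) / a * (inverse (sqrt ((1 - g y) / a)) / 2)) = s' / (W y)\<^sup>2"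
   using a_pos v[OF y] w(2)[OF y] by (simp add: s'_def W_def field_simps power_mult_distrib)
  finally show "(G has_real_derivative s' / (W y)\<^sup>2) (at y)" .
  have "(W has_real_derivative w1 y * v y + v1 y * w y) (at y)"
   unfolding W_def by (rule derivative_eq_intros w(4)[OF y] dv[OF y] refl)+
  also have "w1 y * v y + v1 y * w y = W1 y"
   using v[OF y] w(2)[OF y] by (simp add: W1_def v1_def field_simps power2_eq_square)
  finally show "(W has_real_derivative W1 y) (at y)" .
  have nz: "v y \<noteq> 0" "w y \<noteq> 0" using v[OF y] w(2)[OF y] by auto
  \<comment> \<open>The two terms containing \<open>w1\<close> cancel, and s^2 = 1; what remains
    besides \<open>w2 y * v y\<close> is negative.\<close>
  have "(W1 has_real_derivative (w2 y * v y + v1 y * w1 y) -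
    (0 * ((v y) ^ 3 * w y) - a * s * ((3 * (v y)\<^sup>2 * v1 y) * w y + w1 y * (v y) ^ 3)) /
    (((v y) ^ 3 * w y) * ((v y) ^ 3 * w y))) (at y)"
   unfolding W1_def using nz
   by (auto intro!: derivative_eq_intros w(4,5)[OF y] dv[OF y] simp: numeral_2_eq_2)
  also have "(w2 y * v y + v1 y * w1 y) -
    (0 * ((v y) ^ 3 * w y) - a * s * ((3 * (v y)\<^sup>2 * v1 y) * w y + w1 y * (v y) ^ 3)) /
    (((v y) ^ 3 * w y) * ((v y) ^ 3 * w y)) = w2 y * v y - 3 * a\<^sup>2 * (s * s) / ((v y) ^ 7 * (w y) ^ 3)"
   using nz by (simp add: v1_def field_simps) (simp add: algebra_simps power_numeral_reduce)
  also have "\<dots> = W2 y" by (simp add: W2_def ss)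
  finally show "(W1 has_real_derivative W2 y) (at y)" .
  show "W2 y \<le> 0"
   using v[OF y] w(2)[OF y] w(6)[OF y] by (simp add: W2_def mult_nonpos_nonneg order_trans[of _ 0])
 qed
 thus ?case by blast
qed

text \<open>A positive concave function on an interval cannot drop much in the middle:
  \<open>u\<close> lies on the segment from \<open>v\<close> to a point \<open>e\<close> beyond it,
  and the value at \<open>e\<close> is positive.\<close>

lemma branch_koebe:
 assumes br: "branch n x g s w" and uv: "u \<in> U" "v \<in> U"
 shows "w v \<le> 4 * w u"
proof -
 let ?V = "{-2*\<delta>0<..<2*\<delta>0}"
 obtain w1 w2 where w: "\<And>y. y \<in> ?V ==> w y > 0"
   "\<And>y. y \<in> ?V ==> (w has_real_derivative w1 y) (at y)"
   "\<And>y. y \<in> ?V ==> (w1 has_real_derivative w2 y) (at y)" "\<And>y. y \<in> ?V ==> w2 y \<le> 0"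
  using br unfolding branch_def by metis
 have conv: "convex_on ?V (\<lambda>y. - w y)"
  by (rule f''_ge0_imp_convex[where f' = "\<lambda>y. - w1 y" and f'' = "\<lambda>y. - w2 y"])
   (use w in \<open>auto intro!: derivative_intros\<close>)
 have uvV: "u \<in> ?V" "v \<in> ?V" using uv \<delta>0_pos by auto
 \<comment> \<open>For \<open>u\<close>, \<open>v\<close> in \<open>U\<close> the choice 5/3 makes
   the weight \<open>t\<close> of \<open>e\<close> at most 3/4, whence the factor 4.\<close>
 define e where "e = (if u \<ge> v then 5 / 3 * \<delta>0 else - 5 / 3 * \<delta>0)"
 define t where "t = (u - v) / (e - v)"
 have eV: "e \<in> ?V" using \<delta>0_pos by (auto simp: e_def)
 have t: "0 \<le> t" "t \<le> 3 / 4" "u = (1 - t) * v + t * e"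
 proof -
  have "t * (e - v) = u - v" using uv by (auto simp: t_def e_def)
  thus "u = (1 - t) * v + t * e" by (simp add: algebra_simps)
  show "0 \<le> t" "t \<le> 3 / 4"
   using uv by (auto simp: t_def e_def zero_le_divide_iff pos_divide_le_eq neg_divide_le_eq)
 qed
 have "- w ((1 - t) * v + t * e) \<le> (1 - t) * - w v + t * - w e"
  using convex_onD[OF conv, of t v e] t uvV eV by auto
 hence "- w u \<le> (1 - t) * - w v + t * - w e" by (simp only: t(3)[symmetric])
 moreover have "0 \<le> t * w e" using t w(1)[OF eV] by simp
 ultimately have "(1 - t) * w v \<le> w u" by simp
 moreover have "1 / 4 * w v \<le> (1 - t) * w v" using t w(1)[OF uvV(2)] by (intro mult_right_mono) auto
 ultimately show ?thesis by simp
qed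

text \<open>Let \<open>Q\<close> be the missing part of \<open>U\<close>. At each visit of an orbit
  of \<open>P\<close> to \<open>U\<close> the inverse branch carries \<open>Q\<close> into the
  complement of \<open>P\<close>, because \<open>P\<close> is forward invariant, and fills there a
  fixed proportion of a small ball around the starting point. So the points of \<open>P\<close>
  visiting \<open>U\<close> infinitely often form a porous set; by
  \<open>negligible_avoiding\<close> these are almost all points of \<open>P\<close>.\<close>

lemma full_nbhd:
 assumes P: "P \<in> lmeasurable" "P \<subseteq> {-1..1}" and fwd: "\<And>x. x \<in> P ==> T x \<in> P" and nn: "\<not> negligible P"
 shows "negligible (U - P)"
proof (rule ccontr)
 assume "\<not> negligible (U - P)"
 let ?V = "{-2*\<delta>0<..<2*\<delta>0}"
 define Q where "Q = U - P"
 have Q: "Q \<in> lmeasurable" using P by (auto simp: Q_def intro: fmeasurable.Diff)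
 define m where "m = measure lebesgue Q"
 have m: "m > 0"
  using Q `\<not> negligible (U - P)` by (simp add: m_def Q_def negligible_iff_measure zero_less_measure_iff)
 have m_le: "m \<le> 2 * \<delta>0"
 proof -
  have "m \<le> measure lebesgue U" unfolding m_def Q_def using P by (intro measure_mono_fmeasurable) auto
  thus ?thesis using \<delta>0_pos by simp
 qed
 have fwdn: "(T ^^ n) x \<in> P" if "x \<in> P" for n x using that fwd by (induction n) auto
 define P1 where "P1 = {x \<in> P. \<forall>N. \<exists>n\<ge>N. (T ^^ n) x \<in> U}"
 have "P - P1 \<subseteq> (\<Union>N. {x. (T ^^ N) x \<in> avoiding})"
 proof
  fix x assume "x \<in> P - P1"
  then obtain N where "\<And>n. n \<ge> N ==> (T ^^ n) x \<notin> U" "x \<in> P" by (auto simp: P1_def)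
  hence "(T ^^ N) x \<in> avoiding"
   using fwdn[of x N] P by (auto simp: avoiding_def iter_add[symmetric] simp del: greaterThanLessThan_iff)
  thus "x \<in> (\<Union>N. {x. (T ^^ N) x \<in> avoiding})" by blast
 qed
 moreover have "negligible (\<Union>N. {x. (T ^^ N) x \<in> avoiding})"
  by (intro negligible_countable_Union) (auto intro: negligible_vimage_iter negligible_avoiding)
 ultimately have neg: "negligible (P - P1)" by (rule negligible_subset[rotated])
 have "P1 = P - (P - P1)" by (auto simp: P1_def)
 hence P1: "P1 \<in> lmeasurable"
  using P neg by (metis fmeasurable.Diff negligible_imp_measurable)
 obtain \<kappa> where \<kappa>: "\<kappa> > 0" "\<And>x n. [|x \<in> {-1..1}; (T ^^ n) x \<in> U|] ==> \<bar>D n x\<bar> \<ge> \<kappa> * exp (lam * real n / 3)"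
  by (rule expansion) blast
 have "negligible P1"
 \<comment> \<open>On \<open>U\<close> the derivative of the branch stays within a factor 16 of its
   value \<open>L\<close> at the image of \<open>x\<close>. So \<open>g\<close> maps
   \<open>Q\<close> onto measure at least L m / 16 and \<open>U\<close> into a ball of radius at
   most \<open>16 * \<delta>0 * L\<close>.\<close>
 proof (rule porous_negligible[OF P1, of "m / (1024 * \<delta>0)"])
  show "0 < m / (1024 * \<delta>0)" "m / (1024 * \<delta>0) < 1" using m m_le \<delta>0_pos by auto
  fix x d :: real assume x: "x \<in> P1" and d: "d > 0"
  have xP: "x \<in> P" using x by (simp add: P1_def)
  \<comment> \<open>For visits after time \<open>N\<close> expansion makes
    \<open>16 * \<delta>0 * L\<close>, the bound for the radius of the ball, smaller than
    \<open>d\<close>.\<close>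
  obtain N where N: "16 * \<delta>0 / (\<kappa> * d) < exp (lam / 3) ^ N"
   using real_arch_pow[of "exp (lam / 3)"] lam_pos by auto
  obtain n where n: "n \<ge> N" "(T ^^ n) x \<in> U" using x by (auto simp: P1_def simp del: greaterThanLessThan_iff)
  have "(T ^^ n) x \<in> ?V" using n \<delta>0_pos by auto
  then obtain g s w where br: "branch n x g s w" using branch_exists by blast
  hence s: "\<bar>s\<bar> = 1" and gx: "g ((T ^^ n) x) = x" unfolding branch_def by blast+
  have w: "\<And>y. y \<in> ?V ==> (T ^^ n) (g y) = y" "\<And>y. y \<in> ?V ==> w y > 0"
   "\<And>y. y \<in> ?V ==> (g has_real_derivative s / (w y)\<^sup>2) (at y)"
   "\<And>y. y \<in> ?V ==> \<exists>w1. (w has_real_derivative w1) (at y)"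
   using br unfolding branch_def by blast+
  define y1 where "y1 = (T ^^ n) x"
  have y1: "y1 \<in> U" "y1 \<in> ?V" using n \<delta>0_pos by (auto simp: y1_def)
  define L where "L = 1 / (w y1)\<^sup>2"
  have L: "L > 0" using w(2)[OF y1(2)] by (simp add: L_def)
  have UV: "y \<in> ?V" if "y \<in> U" for y using that \<delta>0_pos by auto
  have wb: "L / 16 \<le> 1 / (w y)\<^sup>2" "1 / (w y)\<^sup>2 \<le> 16 * L" if y: "y \<in> U" for y
  proof -
   have wp: "w y > 0" "w y1 > 0" using w(2) UV[OF y] y1 by auto
   have "(w y)\<^sup>2 \<le> (4 * w y1)\<^sup>2" "(w y1)\<^sup>2 \<le> (4 * w y)\<^sup>2"
    using branch_koebe[OF br y y1(1)] branch_koebe[OF br y1(1) y] wp by (intro power_mono; simp)+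
   thus "L / 16 \<le> 1 / (w y)\<^sup>2" "1 / (w y)\<^sup>2 \<le> 16 * L"
    using wp by (auto simp: L_def divide_simps power_mult_distrib)
  qed
  have "D n x * (s / (w y1)\<^sup>2) = 1"
  proof -
   have "((\<lambda>y. (T ^^ n) (g y)) has_real_derivative D n (g y1) * (s / (w y1)\<^sup>2)) (at y1)"
    by (rule DERIV_chain2[OF has_derivative_iter w(3)[OF y1(2)]])
   moreover have "((\<lambda>y. (T ^^ n) (g y)) has_real_derivative 1) (at y1)"
    by (rule DERIV_cong_ev[THEN iffD2, OF refl _ refl DERIV_ident])
     (use w(1) y1 in \<open>auto intro!: eventually_nhds_in_open eventually_mono[OF eventually_nhds_in_open[of ?V y1]]\<close>)
   ultimately show ?thesis using DERIV_unique gx by (metis y1_def)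
  qed
  hence "\<bar>D n x\<bar> * L = 1" using s by (metis L_def abs_mult abs_divide abs_one abs_power2)
  moreover have "\<bar>D n x\<bar> \<ge> \<kappa> * exp (lam * real n / 3)" using \<kappa>(2)[of x n] n(2) xP P by auto
  ultimately have "\<kappa> * exp (lam * real n / 3) * L \<le> 1" using L by (metis mult_right_mono less_imp_le)
  moreover have "exp (lam / 3) ^ N \<le> exp (lam * real n / 3)"
   using n(1) lam_pos by (simp add: exp_of_nat_mult[symmetric])
  ultimately have "\<kappa> * exp (lam / 3) ^ N * L \<le> 1"
   using \<kappa>(1) L by (smt (verit) mult_left_mono mult_right_mono)
  hence "16 * \<delta>0 / (\<kappa> * d) * (\<kappa> * L) < 1"
   using N \<kappa>(1) L by (smt (verit) mult.assoc mult.commute mult_pos_pos mult_strict_right_mono)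
  hence small: "16 * \<delta>0 * L < d" using \<kappa>(1) d by (simp add: field_simps)
  have mono: "s * g u < s * g v" if "u < v" "- \<delta>0 \<le> u" "v \<le> \<delta>0" for u v
  proof (rule DERIV_pos_imp_increasing[OF that(1)])
   fix y assume "u \<le> y" "y \<le> v"
   hence y: "y \<in> ?V" using that \<delta>0_pos by auto
   have "((\<lambda>y. s * g y) has_real_derivative s * (s / (w y)\<^sup>2)) (at y)"
    by (rule DERIV_cmult[OF w(3)[OF y]])
   moreover have "s * (s / (w y)\<^sup>2) > 0" using s w(2)[OF y] by (auto simp: abs_if split: if_splits)
   ultimately show "\<exists>z. ((\<lambda>y. s * g y) has_real_derivative z) (at y) \<and> z > 0" by blast
  qed
  define z where "z = (g (-\<delta>0) + g \<delta>0) / 2"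
  define h where "h = s * (g \<delta>0 - g (-\<delta>0)) / 2"
  have inball: "g y \<in> ball z h" if "y \<in> U" for y
  proof -
   have "s * g (-\<delta>0) < s * g y" "s * g y < s * g \<delta>0" using that mono by auto
   thus ?thesis using s by (auto simp: z_def h_def dist_real_def abs_if field_simps split: if_splits)
  qed
  have hpos: "h > 0" using mono[of "-\<delta>0" \<delta>0] \<delta>0_pos by (simp add: h_def algebra_simps)
  have hle: "h \<le> 16 * \<delta>0 * L"
  proof -
   obtain \<xi> where \<xi>: "-\<delta>0 < \<xi>" "\<xi> < \<delta>0" "g \<delta>0 - g (-\<delta>0) = (\<delta>0 - -\<delta>0) * (s / (w \<xi>)\<^sup>2)"
    using MVT2[of "-\<delta>0" \<delta>0 g "\<lambda>y. s / (w y)\<^sup>2"] w(3) \<delta>0_pos by auto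
   have "h = \<delta>0 * (1 / (w \<xi>)\<^sup>2)" using s by (auto simp: h_def \<xi>(3) abs_if split: if_splits)
   also have "\<dots> \<le> \<delta>0 * (16 * L)" using wb(2)[of \<xi>] \<xi> \<delta>0_pos by (intro mult_left_mono) auto
   finally show ?thesis by simp
  qed
  have QU: "Q \<subseteq> U" by (auto simp: Q_def)
  have inj: "inj_on g Q"
  proof (rule linorder_inj_onI)
   fix u v assume "u < v" "u \<in> Q" "v \<in> Q"
   thus "g u \<noteq> g v" using mono[of u v] QU by (force simp: subset_iff)
  qed auto
  have cw: "continuous_on Q w"
   using w(4) QU UV by (intro continuous_at_imp_continuous_on ballI) (meson DERIV_isCont subsetD)
  have ai: "(\<lambda>y. \<bar>s / (w y)\<^sup>2\<bar> * 1) absolutely_integrable_on Q"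
  proof (rule measurable_bounded_by_integrable_imp_absolutely_integrable)
   show "(\<lambda>y. \<bar>s / (w y)\<^sup>2\<bar> * 1) \<in> borel_measurable (lebesgue_on Q)"
   proof (intro continuous_imp_measurable_on_sets_lebesgue continuous_intros cw ballI)
    fix y assume "y \<in> Q"
    hence "w y > 0" using w(2) QU UV by blast
    thus "(w y)\<^sup>2 \<noteq> 0" by simp
   qed (use Q in \<open>auto intro: fmeasurableD\<close>)
   show "(\<lambda>_. 16 * L) integrable_on Q" using Q by (intro integrable_on_const)
   show "norm (\<bar>s / (w y)\<^sup>2\<bar> * 1) \<le> 16 * L" if "y \<in> Q" for y
    using wb(2)[of y] that QU s by (auto simp: abs_divide)
  qed (use Q in auto)
  \<comment> \<open>\<open>Q\<close> is merely measurable, so the size of its image comes from the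
    change of variables formula and not from endpoints.\<close>
  have cov: "(\<lambda>_. 1::real) absolutely_integrable_on g ` Q \<and>
    integral (g ` Q) (\<lambda>_. 1::real) = integral Q (\<lambda>y. \<bar>s / (w y)\<^sup>2\<bar> * 1)"
   using has_absolute_integral_change_of_variables_1'[of Q g "\<lambda>y. s / (w y)\<^sup>2" "\<lambda>_. 1" "integral Q (\<lambda>y. \<bar>s / (w y)\<^sup>2\<bar> * 1)"]
    Q w(3) QU UV inj ai by (meson fmeasurableD has_field_derivative_at_within subsetD)
  have gQ: "g ` Q \<in> lmeasurable"
   using cov by (simp add: lmeasurable_iff_integrable_on absolutely_integrable_on_def)
  have "L / 16 * m = integral Q (\<lambda>_. L / 16 * 1)"
   by (subst integral_mult_right) (simp add: m_def lmeasure_integral[OF Q])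
  also have "\<dots> = integral Q (\<lambda>_. L / 16)" by simp
  also have "\<dots> \<le> integral Q (\<lambda>y. \<bar>s / (w y)\<^sup>2\<bar> * 1)"
   using ai Q wb(1) QU s
   by (intro integral_le) (auto intro: integrable_on_const set_lebesgue_integral_eq_integral(1) simp: abs_divide)
  also have "\<dots> = measure lebesgue (g ` Q)" using cov gQ by (simp add: lmeasure_integral)
  finally have gQm: "L / 16 * m \<le> measure lebesgue (g ` Q)" .
  have disj: "g ` Q \<subseteq> ball z h - P1"
  proof
   fix v assume "v \<in> g ` Q"
   then obtain u where u: "u \<in> U" "u \<notin> P" "v = g u" by (auto simp: Q_def)
   have "(T ^^ n) v = u" using w(1) UV u by auto
   hence "v \<notin> P" using fwdn[of v n] u(2) by metis
   thus "v \<in> ball z h - P1" using inball u by (auto simp: P1_def)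
  qed
  have "measure lebesgue (ball z h \<inter> P1) \<le> measure lebesgue (ball z h - g ` Q)"
   using disj P1 gQ by (intro measure_mono_fmeasurable) (auto intro!: fmeasurableD fmeasurable.Diff)
  also have "\<dots> = 2 * h - measure lebesgue (g ` Q)"
   using disj gQ hpos by (subst measure_Diff) (auto simp: ball_eq_greaterThanLessThan intro: fmeasurableD)
  also have "\<dots> \<le> (1 - m / (1024 * \<delta>0)) * (2 * h)"
  proof -
   have "m / (1024 * \<delta>0) * (2 * h) \<le> m / (1024 * \<delta>0) * (2 * (16 * \<delta>0 * L))"
    using hle m \<delta>0_pos by (intro mult_left_mono) auto
   also have "\<dots> = L * m / 32" using \<delta>0_pos by (simp add: field_simps)
   also have "\<dots> \<le> measure lebesgue (g ` Q)" using gQm L m by (simp add: field_simps) (smt (verit) mult_pos_pos)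
   finally show ?thesis by (simp add: algebra_simps)
  qed
  finally show "\<exists>z h. 0 < h \<and> h < d \<and> x \<in> ball z h \<and>
    measure lebesgue (ball z h \<inter> P1) \<le> (1 - m / (1024 * \<delta>0)) * (2 * h)"
   using hpos hle small inball[OF y1(1)] gx by (intro exI[of _ z] exI[of _ h]) (auto simp: y1_def)
 qed
 hence "negligible (P1 \<union> (P - P1))" using neg by (intro negligible_Un)
 hence "negligible P" by (rule negligible_subset) auto
 thus False using nn by simp
qed

end

lemma negligible_borel_iff: "(S :: real set) \<in> sets borel ==> negligible S \<longleftrightarrow> S \<in> null_sets lborel"
 by (simp add: negligible_iff_null_sets null_sets_completion_iff)

section \<open>Comparing the densities of two invariant measures\<close>

context mis_map
begin

lemma measurable_T [measurable]: "T \<in> borel_measurable borel"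
 using measurable_iter[of 1 a] by simp

text \<open>The integral of \<open>f - g\<close> is maximal over \<open>P = {x. g x < f x}\<close> and equally large over the preimage of \<open>P\<close>;
 hence \<open>P\<close> is forward invariant up to a null set.\<close>

lemma excess_set:
 assumes \<mu>: "acip a \<mu>" "f \<in> borel_measurable borel" "density lborel f = \<mu>"
  and \<nu>: "acip a \<nu>" "g \<in> borel_measurable borel" "density lborel g = \<nu>" and ne: "\<mu> \<noteq> \<nu>"
 shows "negligible (U - {x. g x < f x})"
proof -
 interpret M: prob_space \<mu> using \<mu> by (simp add: acip_def)
 interpret N: prob_space \<nu> using \<nu> by (simp add: acip_def)
 note [measurable] = \<mu>(2) \<nu>(2)
 have sets_eq: "sets \<mu> = sets borel" "sets \<nu> = sets borel" using \<mu> \<nu> by (auto simp: acip_def)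
 have sp: "space \<mu> = UNIV" "space \<nu> = UNIV" using sets_eq[THEN sets_eq_imp_space_eq] by simp_all
 define P where "P = {x \<in> {-1..1}. g x < f x}"
 have P[measurable]: "P \<in> sets borel" unfolding P_def by measurable
 have em: "emeasure \<mu> B = (\<integral>\<^sup>+x. f x * indicator B x \<partial>lborel)" "emeasure \<nu> B = (\<integral>\<^sup>+x. g x * indicator B x \<partial>lborel)"
  if "B \<in> sets borel" for B
  using that by (auto simp: \<mu>(3)[symmetric] \<nu>(3)[symmetric] emeasure_density)
 have out: "measure \<mu> (B - {-1..1}) = 0" "measure \<nu> (B - {-1..1}) = 0" if "B \<in> sets borel" for B
 proof -
  have "emeasure \<mu> (B - {-1..1}) \<le> emeasure \<mu> (- {-1..1})" "emeasure \<nu> (B - {-1..1}) \<le> emeasure \<nu> (- {-1..1})"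
   using that by (auto intro!: emeasure_mono simp: sets_eq)
  thus "measure \<mu> (B - {-1..1}) = 0" "measure \<nu> (B - {-1..1}) = 0"
   using \<mu>(1) \<nu>(1) by (auto simp: acip_def measure_def)
 qed
 have le: "measure \<mu> B \<le> measure \<nu> B" if B[measurable]: "B \<in> sets borel" and "B \<inter> P = {}" for B
 proof -
  have "emeasure \<mu> (B \<inter> {-1..1}) \<le> emeasure \<nu> (B \<inter> {-1..1})"
   unfolding em[OF sets.Int[OF B borel_closed[OF closed_atLeastAtMost]]] using that
   by (intro nn_integral_mono) (auto simp: P_def indicator_def not_less[symmetric])
  hence "measure \<mu> (B \<inter> {-1..1}) \<le> measure \<nu> (B \<inter> {-1..1})"
   by (simp add: M.emeasure_eq_measure N.emeasure_eq_measure)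
  moreover have "measure \<mu> B = measure \<mu> (B \<inter> {-1..1}) + measure \<mu> (B - {-1..1})"
   "measure \<nu> B = measure \<nu> (B \<inter> {-1..1}) + measure \<nu> (B - {-1..1})"
   using M.finite_measure_Diff'[of B "{-1..1}"] N.finite_measure_Diff'[of B "{-1..1}"] B by (auto simp: sets_eq)
  ultimately show ?thesis using out[OF B] by simp
 qed
 have inv: "measure \<mu> (T -` P) = measure \<mu> P" "measure \<nu> (T -` P) = measure \<nu> P"
 proof -
  have "distr \<mu> borel T = \<mu>" "distr \<nu> borel T = \<nu>" using \<mu> \<nu> by (auto simp: acip_def)
  moreover have "measure (distr \<mu> borel T) P = measure \<mu> (T -` P)" "measure (distr \<nu> borel T) P = measure \<nu> (T -` P)"
   by (subst measure_distr; simp add: sp measurable_cong_sets[OF sets_eq(1) refl] measurable_cong_sets[OF sets_eq(2) refl])+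
  ultimately show "measure \<mu> (T -` P) = measure \<mu> P" "measure \<nu> (T -` P) = measure \<nu> P" by auto
 qed
 define R where "R = P - T -` P"
 have TP[measurable]: "T -` P \<in> sets borel" using measurable_sets[OF measurable_T P] by simp
 have R[measurable]: "R \<in> sets borel" by (simp add: R_def)
 have "measure \<mu> P = measure \<mu> (P \<inter> T -` P) + measure \<mu> R" "measure \<nu> P = measure \<nu> (P \<inter> T -` P) + measure \<nu> R"
  "measure \<mu> (T -` P) = measure \<mu> (P \<inter> T -` P) + measure \<mu> (T -` P - P)"
  "measure \<nu> (T -` P) = measure \<nu> (P \<inter> T -` P) + measure \<nu> (T -` P - P)"
  by (subst M.finite_measure_Union[symmetric] N.finite_measure_Union[symmetric];
    auto simp: sets_eq R_def intro!: arg_cong[where f="measure _"])+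
 \<comment> \<open>By invariance the part of \<open>P\<close> that leaves \<open>P\<close> has, for
   either measure, the same mass as the part of the preimage of \<open>P\<close> outside
   \<open>P\<close>; there \<mu> is at most \<nu>. But on \<open>R\<close> the density of \<mu> is
   the larger one, so \<open>R\<close> is null.\<close>
 with inv le[of "T -` P - P"] have Rle: "measure \<mu> R \<le> measure \<nu> R" by fastforce
 have gf: "g x \<le> f x" if "x \<in> R" for x using that by (auto simp: R_def P_def)
 have "(\<integral>\<^sup>+x. (f x * indicator R x - g x * indicator R x) \<partial>lborel) = emeasure \<mu> R - emeasure \<nu> R"
  unfolding em[OF R] using N.emeasure_finite[of R]
  by (intro nn_integral_diff) (auto simp: em[OF R] gf split: split_indicator intro!: AE_I2)
 also have "\<dots> = 0"
  using Rle by (simp add: M.emeasure_eq_measure N.emeasure_eq_measure ennreal_minus ennreal_neg)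
 finally have "AE x in lborel. f x * indicator R x - g x * indicator R x = 0"
  by (subst (asm) nn_integral_0_iff_AE) auto
 hence "AE x in lborel. x \<notin> R"
  by eventually_elim (auto simp: R_def P_def diff_eq_0_iff_ennreal split: split_indicator_asm)
 hence "negligible R" by (subst negligible_borel_iff) (auto simp: AE_iff_null_sets[symmetric])
 \<comment> \<open>Discarding the null set of points whose orbit ever leaves \<open>P\<close> turns
   almost forward invariance into exact forward invariance.\<close>
 define P' where "P' = {x \<in> P. \<forall>n. (T ^^ n) x \<in> P}"
 have "P - P' \<subseteq> (\<Union>n. {x. (T ^^ n) x \<in> R})"
 proof
  fix x assume x: "x \<in> P - P'"
  then obtain n where "(T ^^ n) x \<notin> P" by (auto simp: P'_def)
  then obtain j where j: "(T ^^ j) x \<notin> P" "\<forall>i<j. (T ^^ i) x \<in> P"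
   using first_index[of "\<lambda>n. (T ^^ n) x \<notin> P" n] by blast
  then obtain i where "j = Suc i" using x by (cases j) auto
  hence "(T ^^ i) x \<in> R" using j by (auto simp: R_def)
  thus "x \<in> (\<Union>n. {x. (T ^^ n) x \<in> R})" by blast
 qed
 moreover have "negligible (\<Union>n. {x. (T ^^ n) x \<in> R})"
  using `negligible R` by (intro negligible_countable_Union) (auto intro: negligible_vimage_iter)
 ultimately have neg: "negligible (P - P')" by (rule negligible_subset[rotated])
 have "P \<in> lmeasurable"
  using P by (intro bounded_set_imp_lmeasurable) (auto simp: P_def intro: bounded_subset[of "{-1..1}"])
 moreover have "P' = P - (P - P')" by (auto simp: P'_def)
 ultimately have P': "P' \<in> lmeasurable" using neg by (metis fmeasurable.Diff negligible_imp_measurable)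
 have "\<not> negligible P"
 proof
  assume "negligible P"
  hence nP: "P \<in> null_sets lborel" by (simp add: negligible_borel_iff)
  \<comment> \<open>If \<open>P\<close> were null, \<mu> would be dominated by \<nu> on every set.
    Applied to complements, with both masses equal to 1, this gives equality of the
    measures.\<close>
  have all_le: "measure \<mu> B \<le> measure \<nu> B" if B: "B \<in> sets borel" for B
  proof -
   have "emeasure \<mu> (B \<inter> P) = 0"
   proof -
    have "P \<in> null_sets \<mu>" using nP \<mu>(1) by (auto simp: acip_def absolutely_continuous_def)
    thus ?thesis using null_set_Int1[of P \<mu> B] B by (auto simp: sets_eq Int_commute null_sets_def)
   qed
   hence "measure \<mu> (B \<inter> P) = 0" by (simp add: measure_def)
   moreover have "measure \<mu> B = measure \<mu> (B \<inter> P) + measure \<mu> (B - P)"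
    using B by (subst M.finite_measure_Union[symmetric]) (auto simp: sets_eq intro!: arg_cong[where f="measure _"])
   moreover have "measure \<nu> (B - P) \<le> measure \<nu> B"
    using B by (intro N.finite_measure_mono) (auto simp: sets_eq)
   moreover have "measure \<mu> (B - P) \<le> measure \<nu> (B - P)" using B by (intro le) auto
   ultimately show ?thesis by simp
  qed
  have "\<mu> = \<nu>"
  proof (rule measure_eqI)
   show "sets \<mu> = sets \<nu>" by (simp add: sets_eq)
   fix B assume "B \<in> sets \<mu>"
   hence B: "B \<in> sets borel" by (simp add: sets_eq)
   hence "measure \<mu> (- B) \<le> measure \<nu> (- B)" by (intro all_le) auto
   hence "1 - measure \<mu> B \<le> 1 - measure \<nu> B"
    using B M.prob_compl[of B] N.prob_compl[of B] by (simp add: sets_eq sp Compl_eq_Diff_UNIV)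
   thus "emeasure \<mu> B = emeasure \<nu> B"
    using all_le[OF B] by (simp add: M.emeasure_eq_measure N.emeasure_eq_measure)
  qed
  thus False using ne by simp
 qed
 hence nn: "\<not> negligible P'"
  using neg negligible_subset[of "P' \<union> (P - P')" P] negligible_Un[of P' "P - P'"] by blast
 have "negligible (U - P')"
 proof (rule full_nbhd[OF P' _ _ nn])
  show "P' \<subseteq> {-1..1}" by (auto simp: P'_def P_def)
  show "T x \<in> P'" if "x \<in> P'" for x
  proof -
   have "(T ^^ n) (T x) \<in> P" for n using that unfolding P'_def iter_Suc'[of n a x, symmetric] by blast
   from this[of 0] this show ?thesis by (auto simp: P'_def)
  qed
 qed
 thus ?thesis by (rule negligible_subset) (auto simp: P'_def P_def)
qed

theorem acip_unique: "acip a \<mu> ==> acip a \<nu> ==> \<nu> = \<mu>"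
proof (rule ccontr)
 assume \<mu>: "acip a \<mu>" and \<nu>: "acip a \<nu>" and ne: "\<nu> \<noteq> \<mu>"
 obtain f where f: "f \<in> borel_measurable lborel" "density lborel f = \<mu>"
  using sigma_finite_measure.Radon_Nikodym[OF sigma_finite_lborel, of \<mu>] \<mu> by (auto simp: acip_def)
 obtain g where g: "g \<in> borel_measurable lborel" "density lborel g = \<nu>"
  using sigma_finite_measure.Radon_Nikodym[OF sigma_finite_lborel, of \<nu>] \<nu> by (auto simp: acip_def)
 have "negligible (U - {x. g x < f x})" "negligible (U - {x. f x < g x})"
  using excess_set[OF \<mu> _ f(2) \<nu> _ g(2)] excess_set[OF \<nu> _ g(2) \<mu> _ f(2)] f g ne by auto
 hence "negligible ((U - {x. g x < f x}) \<union> (U - {x. f x < g x}))" by (rule negligible_Un)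
 hence "negligible U" by (rule negligible_subset) auto
 thus False using \<delta>0_pos using open_not_negligible[of U] by auto
qed

end

section \<open>Bound periods\<close>

context mis_map
begin

abbreviation crit :: "nat => real" where "crit n \<equiv> (T ^^ n) 0"

definition gap :: "nat => real => real" where
 "gap n u = \<bar>(T ^^ n) u - crit n\<bar>"

text \<open>The bound of \<open>follows_gap_sum\<close>, divided by \<open>2 * \<delta>0\<close> and
  exponentiated: the distortion constant of \<open>follows_ratio\<close>.\<close>

definition shadow_const :: real where
 "shadow_const = exp ((real M0 + 1 / (1 - exp (- lam))) / 2)"

lemma shadow_const_ge: "shadow_const \<ge> 1"
 using lam_pos by (simp add: shadow_const_def)

text \<open>\<open>follows m v\<close>: up to time \<open>m\<close> the orbit of \<open>v\<close> (and then of all of \<open>[0, v]\<close>) follows the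
 critical orbit so closely that it stays on one side of the critical point.\<close>

definition follows :: "nat => real => bool" where
 "follows m v \<longleftrightarrow> 0 \<le> v \<and> v \<le> 1 \<and> (\<forall>j. 1 \<le> j \<and> j \<le> m --> gap j v \<le> \<delta>0)"

lemma T_diff: "T x - T y = - a * (x - y) * (x + y)"
 by (simp add: logistic_def algebra_simps power2_eq_square)

lemma iter_Suc_diff: "\<bar>(T ^^ Suc n) x - (T ^^ Suc n) y\<bar> = a * \<bar>(T ^^ n) x - (T ^^ n) y\<bar> * \<bar>(T ^^ n) x + (T ^^ n) y\<bar>"
 using a_pos by (simp add: T_diff abs_mult)

text \<open>The condition on the lengths keeps 0 out of the segment, so \<open>T\<close> is monotone
  on it.\<close>

lemma T_segment:
 assumes "x \<in> closed_segment p q" "\<bar>p - q\<bar> < \<bar>q\<bar>"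
 shows "T x \<in> closed_segment (T p) (T q)"
proof -
 have "\<bar>p\<bar> \<le> \<bar>x\<bar> \<and> \<bar>x\<bar> \<le> \<bar>q\<bar> \<or> \<bar>q\<bar> \<le> \<bar>x\<bar> \<and> \<bar>x\<bar> \<le> \<bar>p\<bar>"
  using assms by (auto simp: closed_segment_eq_real_ivl abs_if split: if_splits)
 hence "p\<^sup>2 \<le> x\<^sup>2 \<and> x\<^sup>2 \<le> q\<^sup>2 \<or> q\<^sup>2 \<le> x\<^sup>2 \<and> x\<^sup>2 \<le> p\<^sup>2"
  by (simp add: abs_le_square_iff)
 hence "a * p\<^sup>2 \<le> a * x\<^sup>2 \<and> a * x\<^sup>2 \<le> a * q\<^sup>2 \<or> a * q\<^sup>2 \<le> a * x\<^sup>2 \<and> a * x\<^sup>2 \<le> a * p\<^sup>2"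
  using a_pos by simp
 thus ?thesis by (auto simp: closed_segment_eq_real_ivl logistic_def)
qed

text \<open>A gap of at most \<open>\<delta>0\<close> is shorter than the distance of the critical
  orbit from 0, so \<open>T_segment\<close> applies at each of the times 1 to \<open>m\<close>. The
  conclusion reaches one step further than the hypothesis.\<close>

lemma follows_segment:
 assumes "follows m v" "0 \<le> u" "u \<le> v" "1 \<le> j" "j \<le> Suc m"
 shows "(T ^^ j) u \<in> closed_segment ((T ^^ j) v) (crit j)"
 using assms(4,5)
proof (induction j rule: dec_induct)
 case base
 have "u\<^sup>2 \<le> v\<^sup>2" using assms by (intro power_mono) auto
 thus ?case using a_pos by (auto simp: closed_segment_eq_real_ivl logistic_def)
next
 case (step j)
 have "gap j v \<le> \<delta>0" using assms step by (auto simp: follows_def)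
 hence "\<bar>(T ^^ j) v - crit j\<bar> < \<bar>crit j\<bar>" using crit_far[of j] step \<delta>0_pos by (auto simp: gap_def)
 thus ?case using T_segment[of "(T ^^ j) u" "(T ^^ j) v" "crit j"] step by simp
qed

lemma follows_gap_mono:
 assumes "follows m v" "0 \<le> u" "u \<le> v" "1 \<le> j" "j \<le> Suc m"
 shows "gap j u \<le> gap j v"
 using follows_segment[OF assms] by (auto simp: gap_def closed_segment_eq_real_ivl split: if_splits)

lemma follows_mono: "follows m v ==> 0 \<le> u ==> u \<le> v ==> follows m u"
 using follows_gap_mono[of m v u] by (force simp: follows_def)

lemma follows_le: "follows m v ==> n \<le> m ==> follows n v"
 by (auto simp: follows_def)

lemma follows_outside:
 assumes "follows m v" "0 \<le> u" "u \<le> v" "1 \<le> j" "j \<le> m"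
 shows "(T ^^ j) u \<notin> U" "\<bar>(T ^^ j) u + crit j\<bar> \<ge> 2 * \<delta>0"
proof -
 have "gap j u \<le> \<delta>0" using follows_mono[OF assms(1-3)] assms by (auto simp: follows_def)
 thus "(T ^^ j) u \<notin> U" "\<bar>(T ^^ j) u + crit j\<bar> \<ge> 2 * \<delta>0"
  using crit_far[of j] assms \<delta>0_pos by (auto simp: gap_def abs_if split: if_splits)
qed

text \<open>All intermediate points shadow the critical orbit and therefore avoid \<open>U\<close>,
  so the mean value theorem meets condition (b)(i). This is what bounds the length of bound periods
  and makes the gaps summable.\<close>

lemma follows_expand:
 assumes f: "follows m v" and j: "1 \<le> j" "j + M0 \<le> n" "n \<le> Suc m"
 shows "exp (lam * real (n - j)) * gap j v \<le> gap n v"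
proof -
 obtain \<xi> where \<xi>: "\<xi> \<in> closed_segment (crit j) ((T ^^ j) v)"
  "(T ^^ (n - j)) ((T ^^ j) v) - (T ^^ (n - j)) (crit j) = ((T ^^ j) v - crit j) * D (n - j) \<xi>"
  by (rule iter_mvt)
 then obtain z where z: "z \<in> closed_segment 0 v" "(T ^^ j) z = \<xi>" using iter_segment by metis
 hence z': "0 \<le> z" "z \<le> v" using f by (auto simp: closed_segment_eq_real_ivl follows_def split: if_splits)
 have "\<bar>D (n - j) \<xi>\<bar> \<ge> exp (lam * real (n - j))"
 proof (rule growth_outside)
  show "\<xi> \<in> {-1..1}" using z z' f iter_range[of z j] by (auto simp: follows_def)
  show "(T ^^ i) \<xi> \<notin> U" if "i < n - j" for i
   using follows_outside(1)[OF f z', of "j + i"] that j z by (auto simp: iter_add)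
 qed (use j in auto)
 hence "exp (lam * real (n - j)) * gap j v \<le> \<bar>((T ^^ j) v - crit j) * D (n - j) \<xi>\<bar>"
  unfolding gap_def by (simp add: abs_mult mult.commute mult_right_mono)
 also have "\<dots> = gap n v"
  using \<xi>(2) j by (simp add: gap_def iter_add[symmetric])
 finally show ?thesis .
qed

text \<open>Read backwards from time \<open>m\<close> the gaps decay exponentially, except for the
  last \<open>M0\<close> of them, which are at most \<open>\<delta>0\<close> each.\<close>

lemma follows_gap_sum:
 assumes f: "follows m v"
 shows "(\<Sum>j=1..m. gap j v) \<le> \<delta>0 * (real M0 + 1 / (1 - exp (- lam)))"
proof -
 have "(\<Sum>j=1..m. gap j v) \<le> (\<Sum>j=1..m. \<delta>0 * ((if m - j < M0 then 1 else 0) + exp (- lam * real (m - j))))"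
 proof (rule sum_mono)
  fix j assume "j \<in> {1..m}"
  hence j: "1 \<le> j" "j \<le> m" by auto
  have g: "gap j v \<le> \<delta>0" "gap m v \<le> \<delta>0" using f j by (auto simp: follows_def)
  show "gap j v \<le> \<delta>0 * ((if m - j < M0 then 1 else 0) + exp (- lam * real (m - j)))"
  proof (cases "m - j < M0")
   case True
   have "\<delta>0 * 1 \<le> \<delta>0 * (1 + exp (- lam * real (m - j)))" using \<delta>0_pos by (intro mult_left_mono) auto
   thus ?thesis using g True by simp
  next
   case False
   hence "exp (lam * real (m - j)) * gap j v \<le> \<delta>0"
    using follows_expand[OF f j(1), of m] j g(2) by linarith
   hence "gap j v \<le> \<delta>0 * exp (- lam * real (m - j))"
    by (simp add: exp_minus field_simps)
   thus ?thesis using False by simp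
  qed
 qed
 also have "\<dots> = \<delta>0 * (\<Sum>j=1..m. (if m - j < M0 then 1 else 0) + exp (- lam * real (m - j)))"
  by (simp add: sum_distrib_left)
 also have "(\<Sum>j=1..m. (if m - j < M0 then 1 else 0) + exp (- lam * real (m - j))) =
   (\<Sum>i<m. (if i < M0 then 1 else 0) + exp (- lam * real i))"
  by (rule sum.reindex_bij_witness[of _ "\<lambda>i. m - i" "\<lambda>j. m - j"]) auto
 also have "\<dots> = (\<Sum>i<m. if i < M0 then 1 else 0) + (\<Sum>i<m. exp (- lam) ^ i)"
  by (simp add: sum.distrib exp_of_nat_mult[symmetric] mult.commute)
 also have "(\<Sum>i<m. if i < M0 then 1 else 0) = real (card ({..<m} \<inter> {..<M0}))"
  by (simp add: sum.If_cases lessThan_def Collect_conj_eq[symmetric])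
 also have "\<dots> \<le> real M0" using card_mono[of "{..<M0}" "{..<m} \<inter> {..<M0}"] by simp
 also have "(\<Sum>i<m. exp (- lam) ^ i) \<le> (\<Sum>i. exp (- lam) ^ i)"
  using lam_pos by (intro sum_le_suminf summable_geometric) auto
 also have "\<dots> = 1 / (1 - exp (- lam))"
  using lam_pos by (intro suminf_geometric) auto
 finally show ?thesis using \<delta>0_pos by simp
qed

text \<open>For a quadratic map a difference is multiplied by \<open>a\<close> times the modulus of
  the sum. The distance from \<open>u\<close> to \<open>v\<close> and the distance from
  \<open>u\<close> to the critical orbit thus grow by nearly the same factor, with relative error at
  most \<open>gap n v / (2 * \<delta>0)\<close>, and these errors are summable.\<close>

lemma follows_ratio:
 assumes f: "follows m v" and u: "0 \<le> u" "u \<le> v" and ij: "1 \<le> i" "i \<le> j" "j \<le> Suc m"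
 shows "\<bar>(T ^^ j) u - (T ^^ j) v\<bar> * gap i u \<le> shadow_const * \<bar>(T ^^ i) u - (T ^^ i) v\<bar> * gap j u"
proof -
 let ?d = "\<lambda>n. \<bar>(T ^^ n) u - (T ^^ n) v\<bar>"
 have gap0: "gap n w \<ge> 0" for n w by (simp add: gap_def)
 have "?d j * gap i u \<le> exp ((\<Sum>l=i..<j. gap l v) / (2 * \<delta>0)) * ?d i * gap j u"
  using ij(2,3)
 proof (induction j rule: dec_induct)
  case (step n)
  have n: "1 \<le> n" "n \<le> m" using step ij by auto
  let ?X = "(T ^^ n) u" and ?Y = "(T ^^ n) v"
  have X: "\<bar>?X + crit n\<bar> \<ge> 2 * \<delta>0" using follows_outside(2)[OF f u n] .
  have "\<bar>?X + ?Y\<bar> \<le> \<bar>?X + crit n\<bar> + gap n v" by (auto simp: gap_def)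
  also have "gap n v \<le> gap n v / (2 * \<delta>0) * \<bar>?X + crit n\<bar>"
   using X \<delta>0_pos mult_left_mono[OF X gap0[of n v]] by (simp add: field_simps)
  finally have "\<bar>?X + ?Y\<bar> \<le> (1 + gap n v / (2 * \<delta>0)) * \<bar>?X + crit n\<bar>" by (simp add: algebra_simps)
  also have "\<dots> \<le> exp (gap n v / (2 * \<delta>0)) * \<bar>?X + crit n\<bar>" by (intro mult_right_mono) auto
  finally have XY: "\<bar>?X + ?Y\<bar> \<le> exp (gap n v / (2 * \<delta>0)) * \<bar>?X + crit n\<bar>" .
  have "?d (Suc n) * gap i u = a * \<bar>?X + ?Y\<bar> * (?d n * gap i u)"
   by (simp only: iter_Suc_diff mult_ac)
  also have "\<dots> \<le> a * (exp (gap n v / (2 * \<delta>0)) * \<bar>?X + crit n\<bar>) *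
    (exp ((\<Sum>l=i..<n. gap l v) / (2 * \<delta>0)) * ?d i * gap n u)"
  proof (rule mult_mono)
   show "a * \<bar>?X + ?Y\<bar> \<le> a * (exp (gap n v / (2 * \<delta>0)) * \<bar>?X + crit n\<bar>)"
    using XY a_pos by simp
  qed (use step a_pos gap0[of i u] in auto)
  also have "\<dots> = (exp ((\<Sum>l=i..<n. gap l v) / (2 * \<delta>0)) * exp (gap n v / (2 * \<delta>0))) * ?d i * (a * gap n u * \<bar>?X + crit n\<bar>)"
   by (simp only: mult_ac)
  also have "a * gap n u * \<bar>?X + crit n\<bar> = gap (Suc n) u"
   unfolding gap_def by (simp only: iter_Suc_diff)
  also have "exp ((\<Sum>l=i..<n. gap l v) / (2 * \<delta>0)) * exp (gap n v / (2 * \<delta>0)) = exp ((\<Sum>l=i..<Suc n. gap l v) / (2 * \<delta>0))"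
   using step by (simp add: exp_add[symmetric] add_divide_distrib)
  finally show ?case .
 qed simp
 also have "\<dots> \<le> shadow_const * ?d i * gap j u"
 proof (intro mult_right_mono gap0 abs_ge_zero)
  have "(\<Sum>l=i..<j. gap l v) \<le> (\<Sum>l=1..m. gap l v)"
   using ij gap0 by (intro sum_mono2) auto
  also have "\<dots> \<le> \<delta>0 * (real M0 + 1 / (1 - exp (- lam)))" by (rule follows_gap_sum[OF f])
  finally show "exp ((\<Sum>l=i..<j. gap l v) / (2 * \<delta>0)) \<le> shadow_const"
   using \<delta>0_pos by (simp add: shadow_const_def field_simps)
 qed
 finally show ?thesis .
qed

lemma gap_1: "gap 1 u = a * u\<^sup>2"
 using a_pos by (simp add: gap_def logistic_def)

lemma gap_Suc_le: "u \<in> {-1..1} ==> gap (Suc n) u \<le> 4 * gap n u"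
proof -
 assume u: "u \<in> {-1..1}"
 have "\<bar>(T ^^ n) u + crit n\<bar> \<le> 2" using iter_range[OF u, of n] iter_range[of 0 n] by auto
 hence "a * \<bar>(T ^^ n) u + crit n\<bar> \<le> 2 * 2" using a_pos a_le by (intro mult_mono) auto
 hence "gap n u * (a * \<bar>(T ^^ n) u + crit n\<bar>) \<le> gap n u * 4" by (intro mult_left_mono) (auto simp: gap_def)
 thus ?thesis unfolding gap_def by (simp only: iter_Suc_diff mult_ac)
qed

end

lemma fmeasurable_Icc [simp, intro]: "{x..y::real} \<in> fmeasurable lborel"
 by (cases "x \<le> y") (auto intro!: fmeasurableI)

text \<open>The last inequalities are the smallness that shadowing consumes:
  \<open>eps_delta\<close> serves \<open>shadow_outer\<close> and \<open>eps_rad\<close> serves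
  \<open>shadow_remainder\<close>. They are derived from a large \<open>depth\<close> in
  \<open>small_scheme\<close>, for every hole of a family with the same \<open>rad\<close> and
  \<open>eps\<close>.\<close>

locale mis_scheme = mis_map +
 fixes S :: scheme
 assumes crit_par_eq: "crit_par S = a"
  and rad_pos: "0 < rad S" and rad_le: "rad S \<le> \<delta>0"
  and hole_open: "open (hole S)" and hole_sub: "hole S \<subseteq> {-1..1}"
  and hole_fin: "finite (components (hole S))"
  and hole_far: "\<And>n x. n \<ge> 1 ==> x \<in> hole S ==> rad S \<le> \<bar>x - crit n\<bar>"
  and eps_pos: "0 < eps S" and depth_pos: "0 < depth S"
  and cell_growth: "\<And>k. int (depth S) \<le> \<bar>k\<bar> ==> 4 ^ 8 * eps S \<le> len ((T ^^ bound_time S k) ` cell k)"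
  and refs: "reference_family S"
  and delta_lt: "delta S < \<delta>0" and delta_rad: "8 * (delta S)\<^sup>2 < rad S" "delta S \<le> rad S / 2"
  and eps_delta: "3 * shadow_const * (4 ^ 8 * eps S) < delta S"
  and eps_rad: "576 * shadow_const\<^sup>2 * eps S < rad S"
begin

abbreviation H where "H \<equiv> hole S"
abbreviation r where "r \<equiv> rad S"
abbreviation k0 where "k0 \<equiv> depth S"
abbreviation \<delta> where "\<delta> \<equiv> delta S"
abbreviation \<epsilon> where "\<epsilon> \<equiv> eps S"
abbreviation e :: "nat => real" where "e k \<equiv> exp (- real k)"
abbreviation bt :: "nat => nat" where "bt k \<equiv> bound_time S (int k)"

lemma iter_T [simp]: "iter S n = T ^^ n"
 by (simp add: crit_par_eq)

lemma \<delta>_pos: "\<delta> > 0" by (simp add: delta_def)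
lemma \<delta>_eq: "\<delta> = e k0" by (simp add: delta_def)
lemma e_le_\<delta>: "k0 \<le> k ==> e k \<le> \<delta>" by (simp add: delta_def)

text \<open>The image of the closed interval is compact and differs from this one in at most two
  points. Measurability is needed because bound periods are defined through lengths of
  images.\<close>

lemma iter_image_borel: "(T ^^ n) ` {0<..<v} \<in> sets borel"
proof -
 have "finite ((T ^^ n) ` {0..v} - (T ^^ n) ` {0<..<v})"
 proof (rule finite_subset)
  show "(T ^^ n) ` {0..v} - (T ^^ n) ` {0<..<v} \<subseteq> {crit n, (T ^^ n) v}"
  proof
   fix y assume "y \<in> (T ^^ n) ` {0..v} - (T ^^ n) ` {0<..<v}"
   then obtain x where x: "x \<in> {0..v}" "y = (T ^^ n) x" "y \<notin> (T ^^ n) ` {0<..<v}" by blast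
   hence "x \<notin> {0<..<v}" by blast
   hence "x = 0 \<or> x = v" using x(1) by auto
   thus "y \<in> {crit n, (T ^^ n) v}" using x by auto
  qed
 qed simp
 moreover have "(T ^^ n) ` {0<..<v} = (T ^^ n) ` {0..v} - ((T ^^ n) ` {0..v} - (T ^^ n) ` {0<..<v})"
  by auto
 moreover have "compact ((T ^^ n) ` {0..v})" by (intro compact_continuous_image continuous_iter) auto
 ultimately show ?thesis by (metis borel_compact borel_closed finite_imp_closed sets.Diff)
qed

lemma iter_image_lm: "0 \<le> v ==> v \<le> 1 ==> (T ^^ n) ` {0<..<v} \<in> fmeasurable lborel"
proof -
 assume v: "0 \<le> v" "v \<le> 1"
 have "(T ^^ n) ` {0<..<v} \<subseteq> {-1..1}" using v by (intro image_subsetI iter_range) auto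
 thus ?thesis
  by (rule fmeasurableI2[rotated]) (simp_all add: iter_image_borel)
qed

text \<open>Together with \<open>len_le_gap\<close> this translates the definition of bound periods
  by lengths of images into distances from the critical orbit.\<close>

lemma gap_le_len:
 assumes "0 < v" "v \<le> 1"
 shows "gap n v \<le> len ((T ^^ n) ` {0<..<v})"
proof -
 have "open_segment (crit n) ((T ^^ n) v) \<subseteq> (T ^^ n) ` {0<..<v}"
 proof
  fix \<xi> assume \<xi>: "\<xi> \<in> open_segment (crit n) ((T ^^ n) v)"
  then obtain z where z: "z \<in> closed_segment 0 v" "(T ^^ n) z = \<xi>"
   using iter_segment[of \<xi> n 0 v] by (auto simp: open_segment_def)
  moreover have "z \<noteq> 0" "z \<noteq> v" using \<xi> z by (auto simp: open_segment_def)
  ultimately show "\<xi> \<in> (T ^^ n) ` {0<..<v}" using assms by (force simp: closed_segment_eq_real_ivl)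
 qed
 moreover have "len (open_segment (crit n) ((T ^^ n) v)) = gap n v"
  by (auto simp: open_segment_eq_real_ivl gap_def)
 ultimately show ?thesis
  using measure_mono_fmeasurable[of "open_segment (crit n) ((T ^^ n) v)", OF _ _ iter_image_lm[of v n]] assms
  by (auto simp: open_segment_eq_real_ivl)
qed

lemma len_le_gap:
 assumes "follows m v" "1 \<le> n" "n \<le> Suc m"
 shows "len ((T ^^ n) ` {0<..<v}) \<le> gap n v"
proof -
 have "(T ^^ n) ` {0<..<v} \<subseteq> closed_segment ((T ^^ n) v) (crit n)"
  using follows_segment[OF assms(1) _ _ assms(2,3)] by force
 hence "len ((T ^^ n) ` {0<..<v}) \<le> len (closed_segment ((T ^^ n) v) (crit n))"
  by (intro measure_mono_fmeasurable) (auto simp: closed_segment_eq_real_ivl iter_image_borel)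
 also have "\<dots> = gap n v" by (auto simp: closed_segment_eq_real_ivl gap_def)
 finally show ?thesis .
qed

definition slow :: "nat => nat => bool" where
 "slow k n \<longleftrightarrow> (\<forall>j\<le>n. len ((T ^^ j) ` {0<..<e k}) \<le> r / 2)"

lemma bound_time_eq: "k0 \<le> k ==> bt k = (GREATEST n. slow k n)"
 using depth_pos by (simp add: bound_time_def slow_def[abs_def])

lemma bound_time_neg: "k0 \<le> k ==> bound_time S (- int k) = bt k"
proof -
 assume k: "k0 \<le> k"
 have img: "(T ^^ j) ` {-v<..<0} = (T ^^ j) ` {0<..<v}" if "j > 0" for j and v :: real
 proof -
  have "{-v<..<0} = uminus ` {0<..<v}" by simp
  thus ?thesis by (simp only: image_image iter_even[OF that])
 qed
 have "len ((T ^^ j) ` {-v<..<0}) = len ((T ^^ j) ` {0<..<v})" if "v \<ge> 0" for j v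
  using that img[of j v] by (cases "j = 0") auto
 thus ?thesis using k depth_pos by (simp add: bound_time_def)
qed

lemma bound_time_abs: "int k0 \<le> \<bar>k\<bar> ==> bound_time S k = bt (nat \<bar>k\<bar>)"
 using bound_time_neg[of "nat \<bar>k\<bar>"] by (cases "k \<ge> 0") (auto simp: nat_le_iff le_nat_iff)

lemma follows_slow:
 assumes "k0 \<le> k" "slow k n"
 shows "follows n (e k)" "1 \<le> j ==> j \<le> n ==> gap j (e k) \<le> r / 2"
proof -
 have *: "gap j (e k) \<le> r / 2" if "j \<le> n" for j
  using gap_le_len[of "e k" j] assms(2) that by (force simp: slow_def)
 thus "1 \<le> j ==> j \<le> n ==> gap j (e k) \<le> r / 2" by simp
 show "follows n (e k)"
  using * rad_le rad_pos by (force simp: follows_def)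
qed

text \<open>By \<open>follows_expand\<close> the gap grows exponentially from its value at time 1.
  Boundedness is what gives \<open>GREATEST\<close> in \<open>bound_time\<close> its
  meaning.\<close>

lemma slow_bounded:
 assumes "k0 \<le> k"
 shows "\<exists>b. \<forall>n. slow k n --> n \<le> b"
proof -
 obtain N where N: "1 / (a * (e k)\<^sup>2) < exp lam ^ N"
  using real_arch_pow[of "exp lam"] lam_pos by auto
 have "n \<le> 1 + M0 + N" if "slow k n" for n
 proof (rule ccontr)
  assume n: "\<not> n \<le> 1 + M0 + N"
  have "exp (lam * real (n - 1)) * gap 1 (e k) \<le> gap n (e k)"
   using follows_slow[OF assms that] n by (intro follows_expand[of n]) auto
  also have "\<dots> \<le> 1" using follows_slow(2)[OF assms that, of n] n rad_le \<delta>0_lt by auto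
  finally have "exp (lam * real (n - 1)) * (a * (e k)\<^sup>2) \<le> 1" by (simp only: gap_1)
  moreover have "exp lam ^ N \<le> exp (lam * real (n - 1))"
   using n lam_pos by (simp add: exp_of_nat_mult[symmetric] mult.commute)
  ultimately have "exp lam ^ N * (a * (e k)\<^sup>2) \<le> 1"
   using a_pos by (meson mult_right_mono order_trans mult_nonneg_nonneg less_imp_le zero_le_power2)
  thus False using N a_pos by (simp add: field_simps)
 qed
 thus ?thesis by blast
qed

lemma slow_1: assumes "k0 \<le> k" shows "slow k 1"
proof -
 have ek: "e k \<le> \<delta>" using e_le_\<delta>[OF assms] .
 have "(e k)\<^sup>2 \<le> \<delta>\<^sup>2" using ek by (intro power_mono) auto
 hence "a * (e k)\<^sup>2 \<le> 2 * \<delta>\<^sup>2" using a_le a_pos by (intro mult_mono) auto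
 hence "gap 1 (e k) \<le> r / 2" using delta_rad rad_pos gap_1[of "e k"] by linarith
 moreover have "follows 0 (e k)" by (simp add: follows_def)
 ultimately have "len ((T ^^ 1) ` {0<..<e k}) \<le> r / 2" using len_le_gap[of 0 "e k" 1] by simp
 moreover have "len ((T ^^ 0) ` {0<..<e k}) \<le> r / 2" using ek delta_rad by simp
 ultimately show ?thesis by (auto simp: slow_def le_Suc_eq)
qed

lemma slow_bt: "k0 \<le> k ==> slow k (bt k)"
 using slow_bounded[of k] slow_1[of k] by (auto simp: bound_time_eq intro: GreatestI_nat)

lemma slow_imp_le: "k0 \<le> k ==> slow k n ==> n \<le> bt k"
 using slow_bounded[of k] by (auto simp: bound_time_eq intro: Greatest_le_nat)

lemma bt_pos: "k0 \<le> k ==> 1 \<le> bt k"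
 using slow_imp_le slow_1 by blast

lemma bt_mono: "k0 \<le> k ==> k \<le> l ==> bt k \<le> bt l"
proof (rule slow_imp_le)
 assume k: "k0 \<le> k" "k \<le> l"
 show "k0 \<le> l" using k by simp
 have "len ((T ^^ j) ` {0<..<e l}) \<le> len ((T ^^ j) ` {0<..<e k})" for j
  using k by (intro measure_mono_fmeasurable iter_image_lm image_mono)
   (use k in \<open>auto simp: iter_image_borel elim!: order_less_le_trans\<close>)
 thus "slow l (bt k)" using slow_bt[OF k(1)] by (meson slow_def order_trans)
qed

lemma follows_bt:
 assumes "k0 \<le> k" shows "follows (bt k) (e k)" "1 \<le> j ==> j \<le> bt k ==> gap j (e k) \<le> r / 2"
 using follows_slow[OF assms slow_bt[OF assms]] by auto

lemma gap_Suc_bt: assumes "k0 \<le> k" shows "gap (Suc (bt k)) (e k) > r / 2"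
proof (rule ccontr)
 assume "\<not> ?thesis"
 hence "len ((T ^^ Suc (bt k)) ` {0<..<e k}) \<le> r / 2"
  using len_le_gap[OF follows_bt(1)[OF assms], of "Suc (bt k)"] by simp
 hence "slow k (Suc (bt k))" using slow_bt[OF assms] by (auto simp: slow_def le_Suc_eq)
 thus False using slow_imp_le[OF assms] by fastforce
qed

text \<open>The points that a piece bound at \<open>I\<^sub>k\<close> may contain: those in or below \<open>I\<^sub>k\<close>, a short
 extension across \<open>\<plusminus>\<delta>\<close>, or the remainder received from the piece at \<open>I\<^sub>k\<^sub>-\<^sub>1\<close> (for \<open>k > 0\<close>).\<close>

definition bindable :: "int => real => bool" where
 "bindable k y \<longleftrightarrow> int k0 \<le> \<bar>k\<bar> \<and> sgn y = sgn (real_of_int k) \<and> e (Suc (nat \<bar>k\<bar>)) \<le> \<bar>y\<bar> \<and>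
   (\<bar>y\<bar> \<le> e (nat \<bar>k\<bar>) \<or>
   (nat \<bar>k\<bar> = k0 \<and> \<bar>y\<bar> < \<delta> + 4 ^ 8 * \<epsilon>) \<or>
   (k0 < nat \<bar>k\<bar> \<and> \<bar>y\<bar> \<le> e (nat \<bar>k\<bar> - 1) \<and>
    \<bar>(T ^^ bt (nat \<bar>k\<bar> - 1)) y - (T ^^ bt (nat \<bar>k\<bar> - 1)) (e (nat \<bar>k\<bar>))\<bar> \<le> 4 * \<epsilon>))"

lemma gap_abs: "n \<ge> 1 ==> gap n \<bar>y\<bar> = gap n y"
 by (simp add: gap_def iter_abs)

lemma follows_SucI:
 assumes "follows m v" "gap (Suc m) v \<le> \<delta>0" shows "follows (Suc m) v"
 using assms by (auto simp: follows_def le_Suc_eq)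

lemma eps_lt_delta: "4 ^ 8 * \<epsilon> < \<delta>"
proof -
 have "1 * (4 ^ 8 * \<epsilon>) \<le> 3 * shadow_const * (4 ^ 8 * \<epsilon>)"
  using shadow_const_ge eps_pos by (intro mult_right_mono) auto
 thus ?thesis using eps_delta by linarith
qed

text \<open>Compare with the orbit of \<delta>. At time 1 the difference relative to the gap of
  \<delta> is less than 3 * 4^8 \<epsilon> / \<delta>, and \<open>follows_ratio\<close> preserves
  this up to \<open>shadow_const\<close>; by \<open>eps_delta\<close> the extra distance stays below
  r/2.\<close>

lemma shadow_outer:
 assumes v: "\<delta> < v" "v < \<delta> + 4 ^ 8 * \<epsilon>" and n: "n \<le> bt k0"
 shows "follows n v \<and> (\<forall>j. 1 \<le> j \<and> j \<le> n --> gap j v < r)"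
 using n
proof (induction n)
 case 0
 have "v \<le> 1" using v eps_delta shadow_const_ge delta_lt \<delta>0_lt eps_pos
  eps_lt_delta by linarith
 thus ?case using v \<delta>_pos by (auto simp: follows_def)
next
 case (Suc n)
 hence IH: "follows n v" "\<And>j. 1 \<le> j ==> j \<le> n ==> gap j v < r" by auto
 note s8 = eps_lt_delta
 have "\<bar>(T ^^ Suc n) \<delta> - (T ^^ Suc n) v\<bar> * gap 1 \<delta> \<le> shadow_const * \<bar>(T ^^ 1) \<delta> - (T ^^ 1) v\<bar> * gap (Suc n) \<delta>"
  using v \<delta>_pos by (intro follows_ratio[OF IH(1)]) auto
 also have "\<bar>(T ^^ 1) \<delta> - (T ^^ 1) v\<bar> = a * ((v - \<delta>) * (v + \<delta>))"
  using v \<delta>_pos a_pos by (simp add: T_diff abs_mult)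
 also have "shadow_const * (a * ((v - \<delta>) * (v + \<delta>))) * gap (Suc n) \<delta> \<le>
   shadow_const * (a * ((4 ^ 8 * \<epsilon>) * (3 * \<delta>))) * (r / 2)"
  using v \<delta>_pos a_pos s8 shadow_const_ge eps_pos follows_bt(2)[of k0 "Suc n"] Suc.prems
  by (intro mult_mono) (auto simp: \<delta>_eq gap_def)
 also have "\<dots> = a * \<delta> * (3 * shadow_const * (4 ^ 8 * \<epsilon>)) * (r / 2)" by (simp only: mult_ac)
 also have "\<dots> < a * \<delta> * \<delta> * (r / 2)"
  using eps_delta a_pos \<delta>_pos rad_pos by (intro mult_strict_right_mono mult_strict_left_mono) auto
 also have "\<dots> = (r / 2) * gap 1 \<delta>" by (simp only: gap_1 power2_eq_square mult_ac)
 finally have "\<bar>(T ^^ Suc n) \<delta> - (T ^^ Suc n) v\<bar> < r / 2"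
  by (rule mult_right_less_imp_less) (simp add: gap_def)
 moreover have "gap (Suc n) \<delta> \<le> r / 2" using follows_bt(2)[of k0 "Suc n"] Suc.prems by (simp add: \<delta>_eq)
 ultimately have "gap (Suc n) v < r" unfolding gap_def by linarith
 thus ?case using IH rad_le follows_SucI[OF IH(1)] by (auto simp: le_Suc_eq)
qed

text \<open>One step after time \<open>bt k\<close> the gap of \<open>e k\<close> exceeds r/2 and a
  step multiplies it by at most 4, so it exceeds r/8 already. At time 1 the difference between the
  two endpoints of the cell is at most 8 times the gap of the inner one, since e^2 \<le> 9, and
  \<open>follows_ratio\<close> carries this comparison to time \<open>bt k\<close>.\<close>

lemma gap_bt_lower:
 assumes k: "k0 \<le> k"
 shows "r / (144 * shadow_const) \<le> gap (bt k) (e (Suc k))"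
proof -
 let ?p = "e (Suc k)" and ?v = "e k" and ?n = "bt k" and ?K = shadow_const
 note f = follows_bt(1)[OF k]
 have p: "0 \<le> ?p" "?p \<le> ?v" by auto
 have n1: "1 \<le> ?n" by (rule bt_pos[OF k])
 have "r / 2 < gap (Suc ?n) ?v" by (rule gap_Suc_bt[OF k])
 also have "\<dots> \<le> 4 * gap ?n ?v" by (rule gap_Suc_le) (auto intro: order_trans[of _ 0])
 finally have g: "r / 8 < gap ?n ?v" by simp
 have rat: "\<bar>(T ^^ ?n) ?p - (T ^^ ?n) ?v\<bar> * gap 1 ?p \<le> ?K * \<bar>(T ^^ 1) ?p - (T ^^ 1) ?v\<bar> * gap ?n ?p"
  using n1 by (intro follows_ratio[OF f p]) auto
 have "\<bar>(T ^^ 1) ?p - (T ^^ 1) ?v\<bar> = a * (?v\<^sup>2 - ?p\<^sup>2)"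
  using a_pos p by (simp add: logistic_def right_diff_distrib[symmetric] abs_mult power_mono)
 also have "\<dots> \<le> 8 * gap 1 ?p"
 proof -
  have "?v = exp 1 * ?p" by (simp add: exp_add[symmetric])
  hence "?v\<^sup>2 = (exp 1)\<^sup>2 * ?p\<^sup>2" by (simp add: power_mult_distrib)
  also have "(exp 1 :: real)\<^sup>2 \<le> 3\<^sup>2" using exp_le by (intro power_mono) auto
  finally have "?v\<^sup>2 - ?p\<^sup>2 \<le> 8 * ?p\<^sup>2" by simp
  hence "a * (?v\<^sup>2 - ?p\<^sup>2) \<le> a * (8 * ?p\<^sup>2)" using a_pos by (intro mult_left_mono) auto
  thus ?thesis by (simp only: gap_1 mult_ac)
 qed
 finally have "?K * \<bar>(T ^^ 1) ?p - (T ^^ 1) ?v\<bar> * gap ?n ?p \<le> ?K * (8 * gap 1 ?p) * gap ?n ?p"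
  using shadow_const_ge by (intro mult_right_mono mult_left_mono) (auto simp: gap_def)
 with rat have "\<bar>(T ^^ ?n) ?p - (T ^^ ?n) ?v\<bar> * gap 1 ?p \<le> (8 * ?K * gap ?n ?p) * gap 1 ?p"
  by (simp only: mult_ac)
 moreover have "gap 1 ?p > 0" using a_pos by (simp only: gap_1) simp
 ultimately have "\<bar>(T ^^ ?n) ?p - (T ^^ ?n) ?v\<bar> \<le> 8 * ?K * gap ?n ?p" by (meson mult_le_cancel_right_pos)
 hence "gap ?n ?v \<le> gap ?n ?p + 8 * ?K * gap ?n ?p" by (auto simp: gap_def)
 also have "\<dots> \<le> ?K * gap ?n ?p + 8 * ?K * gap ?n ?p"
  using shadow_const_ge mult_right_mono[of 1 ?K "gap ?n ?p"] by (simp add: gap_def)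
 finally have "r / 8 \<le> 9 * ?K * gap ?n ?p" using g by simp
 moreover have "gap ?n ?p * ?K \<ge> 0" using shadow_const_ge by (simp add: gap_def)
 moreover have "gap ?n ?p * (144 * ?K) = 144 * (gap ?n ?p * ?K)" "9 * ?K * gap ?n ?p = 9 * (gap ?n ?p * ?K)"
  by simp_all
 ultimately have "r \<le> gap ?n ?p * (144 * ?K)" using rad_pos by linarith
 thus ?thesis using shadow_const_ge by (simp add: pos_divide_le_eq)
qed

text \<open>From time \<open>bt k\<close> on, compare with the inner endpoint
  \<open>e (Suc k)\<close>: the two orbits are then at most 4 \<epsilon> apart, whereas the gap of
  that endpoint is already of order \<open>r\<close> by \<open>gap_bt_lower\<close>. With
  \<open>eps_rad\<close> the difference remains below r/2 until the bound period of the deeper cell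
  ends.\<close>

lemma shadow_remainder:
 assumes k: "k0 \<le> k" and v: "e (Suc k) \<le> v" "v \<le> e k"
  and near: "\<bar>(T ^^ bt k) v - (T ^^ bt k) (e (Suc k))\<bar> \<le> 4 * \<epsilon>" and n: "n \<le> bt (Suc k)"
 shows "follows n v \<and> (\<forall>j. 1 \<le> j \<and> j \<le> n --> gap j v < r)"
proof -
 let ?p = "e (Suc k)" and ?m = "bt k" and ?K = shadow_const
 have v0: "0 \<le> v" using v by (meson exp_ge_zero order_trans)
 have base: "follows ?m v" "\<And>j. 1 \<le> j ==> j \<le> ?m ==> gap j v < r"
 proof -
  show "follows ?m v" using follows_mono[OF follows_bt(1)[OF k]] v v0 by auto
  show "gap j v < r" if "1 \<le> j" "j \<le> ?m" for j
  proof -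
   have "gap j v \<le> gap j (e k)" using that v v0 by (intro follows_gap_mono[OF follows_bt(1)[OF k]]) auto
   also have "\<dots> \<le> r / 2" using follows_bt(2)[OF k that] .
   also have "\<dots> < r" using rad_pos by simp
   finally show ?thesis .
  qed
 qed
 have "follows (?m + i) v \<and> (\<forall>j. 1 \<le> j \<and> j \<le> ?m + i --> gap j v < r)" if "?m + i \<le> bt (Suc k)" for i
  using that
 proof (induction i)
  case 0
  thus ?case using base by simp
 next
  case (Suc i)
  hence IH: "follows (?m + i) v" "\<And>j. 1 \<le> j ==> j \<le> ?m + i ==> gap j v < r" by auto
  let ?n = "Suc (?m + i)"
  have gp: "gap ?n ?p \<le> r / 2" using follows_bt(2)[of "Suc k" ?n] k Suc.prems by simp
  have "\<bar>(T ^^ ?n) ?p - (T ^^ ?n) v\<bar> * gap ?m ?p \<le> ?K * \<bar>(T ^^ ?m) ?p - (T ^^ ?m) v\<bar> * gap ?n ?p"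
   using v bt_pos[OF k] by (intro follows_ratio[OF IH(1)]) auto
  also have "\<dots> \<le> ?K * (4 * \<epsilon>) * (r / 2)"
   using near gp shadow_const_ge eps_pos by (intro mult_mono) (auto simp: gap_def abs_minus_commute)
  also have "\<dots> < r / 2 * (r / (144 * ?K))"
  proof -
   have "?K * (4 * \<epsilon>) * (144 * ?K) < r"
    using eps_rad by (simp add: power2_eq_square mult_ac)
   hence "?K * (4 * \<epsilon>) < r / (144 * ?K)" using shadow_const_ge by (simp add: pos_less_divide_eq)
   thus ?thesis using rad_pos by (simp only: mult.commute[of "r/2"]) (rule mult_strict_right_mono, auto)
  qed
  also have "\<dots> \<le> r / 2 * gap ?m ?p"
   using gap_bt_lower[OF k] rad_pos by (intro mult_left_mono) auto
  finally have "\<bar>(T ^^ ?n) ?p - (T ^^ ?n) v\<bar> < r / 2"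
   by (rule mult_right_less_imp_less) (simp add: gap_def)
  hence "gap ?n v < r" using gp unfolding gap_def by linarith
  thus ?case using IH rad_le follows_SucI[OF IH(1)] by (auto simp: le_Suc_eq)
 qed
 note ext = this
 show ?thesis
 proof (cases "n \<le> ?m")
  case True
  thus ?thesis using base follows_le by auto
 next
  case False
  thus ?thesis using ext[of "n - ?m"] n by simp
 qed
qed

text \<open>A gap below \<open>r\<close> keeps the image off the hole by \<open>hole_far\<close>,
  and off 0 by \<open>crit_far\<close> since \<open>r\<close> is at most \<open>\<delta>0\<close>.
  Both facts are used for every bound piece.\<close>

lemma shadow:
 assumes b: "bindable k y" and n: "1 \<le> n" "n \<le> bound_time S k"
 shows "gap n y < r"
proof -
 define l where "l = nat \<bar>k\<bar>"
 have l: "k0 \<le> l" "bound_time S k = bt l"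
  using b bound_time_abs[of k] by (auto simp: bindable_def l_def le_nat_iff)
 have "gap n \<bar>y\<bar> < r"
  using b[unfolded bindable_def l_def[symmetric]]
 proof (elim conjE disjE)
  assume "\<bar>y\<bar> \<le> e l"
  hence "gap n \<bar>y\<bar> \<le> gap n (e l)"
   using n l by (intro follows_gap_mono[OF follows_bt(1)]) auto
  also have "\<dots> \<le> r / 2" using follows_bt(2) l n by simp
  also have "\<dots> < r" using rad_pos by simp
  finally show ?thesis .
 next
  assume *: "l = k0" "\<bar>y\<bar> < \<delta> + 4 ^ 8 * \<epsilon>"
  show ?thesis
  proof (cases "\<bar>y\<bar> \<le> e l")
   case True
   hence "gap n \<bar>y\<bar> \<le> gap n (e l)"
    using n l by (intro follows_gap_mono[OF follows_bt(1)]) auto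
   also have "\<dots> \<le> r / 2" using follows_bt(2) l n by simp
   also have "\<dots> < r" using rad_pos by simp
   finally show ?thesis .
  next
   case False
   thus ?thesis using shadow_outer[of "\<bar>y\<bar>" n] * n l by (auto simp: \<delta>_eq)
  qed
 next
  assume *: "k0 < l" "\<bar>y\<bar> \<le> e (l - 1)" "\<bar>(T ^^ bt (l - 1)) y - (T ^^ bt (l - 1)) (e l)\<bar> \<le> 4 * \<epsilon>"
  then obtain m where m: "l = Suc m" "k0 \<le> m" by (cases l) auto
  show ?thesis
  proof (cases "\<bar>y\<bar> \<le> e l")
   case True
   hence "gap n \<bar>y\<bar> \<le> gap n (e l)"
    using n l by (intro follows_gap_mono[OF follows_bt(1)]) auto
   also have "\<dots> \<le> r / 2" using follows_bt(2) l n by simp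
   also have "\<dots> < r" using rad_pos by simp
   finally show ?thesis .
  next
   case False
   thus ?thesis
    using shadow_remainder[of m "\<bar>y\<bar>" n] * n l m bt_pos[of m] by (simp add: iter_abs)
  qed
 qed
 thus ?thesis using gap_abs n by simp
qed

end

section \<open>Pieces are intervals of monotonicity\<close>

lemma interval_mem:
 fixes A :: "real set"
 shows "is_interval A ==> x \<in> A ==> z \<in> A ==> x \<le> y ==> y \<le> z ==> y \<in> A"
 by (meson is_interval_1)

lemma interval_Icc: "is_interval (A :: real set) ==> p \<in> A ==> q \<in> A ==> {p..q} \<subseteq> A"
 by (meson atLeastAtMost_iff interval_mem subsetI)

lemma interval_Ioo: "is_interval (A :: real set) ==> p \<in> A ==> q \<in> A ==> {p<..<q} \<subseteq> A"
 using interval_Icc[of A p q] greaterThanLessThan_subseteq_atLeastAtMost_iff[of p q p q] by auto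

lemma interval_finite_frontier: "is_interval (A :: real set) ==> finite (frontier A)"
proof -
 assume A: "is_interval A"
 have "frontier A \<subseteq> {Inf A, Sup A}"
 proof
  fix x assume x: "x \<in> frontier A"
  show "x \<in> {Inf A, Sup A}"
  proof (rule ccontr)
   assume ne: "x \<notin> {Inf A, Sup A}"
   have "A \<noteq> {}" using x by auto
   have "(\<forall>y\<in>A. x \<le> y) \<or> (\<forall>y\<in>A. y \<le> x)"
   proof (rule ccontr)
    assume "\<not> ?thesis"
    then obtain p q where "p \<in> A" "p < x" "q \<in> A" "x < q" by (auto simp: not_le)
    hence "{p<..<q} \<subseteq> A" "x \<in> {p<..<q}" using interval_Ioo[OF A] by auto
    hence "x \<in> interior A" by (meson interiorI open_greaterThanLessThan)
    thus False using x by (simp add: frontier_def)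
   qed
   moreover have "x \<in> closure A" using x by (simp add: frontier_def)
   ultimately show False
   proof (elim disjE)
    assume l: "\<forall>y\<in>A. x \<le> y"
    have "x = Inf A"
    proof (rule cInf_eq_non_empty[symmetric, OF `A \<noteq> {}`])
     fix y assume y: "\<And>z. z \<in> A ==> y \<le> z"
     hence "closure A \<subseteq> {y..}" by (intro closure_minimal) auto
     thus "y \<le> x" using `x \<in> closure A` by auto
    qed (use l in auto)
    thus False using ne by simp
   next
    assume l: "\<forall>y\<in>A. y \<le> x"
    have "x = Sup A"
    proof (rule cSup_eq_non_empty[symmetric, OF `A \<noteq> {}`])
     fix y assume y: "\<And>z. z \<in> A ==> z \<le> y"
     hence "closure A \<subseteq> {..y}" by (intro closure_minimal) auto
     thus "x \<le> y" using `x \<in> closure A` by auto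
    qed (use l in auto)
    thus False using ne by simp
   qed
  qed
 qed
 thus ?thesis by (rule finite_subset) simp
qed

definition nondeg :: "real set => bool" where
 "nondeg A \<longleftrightarrow> is_interval A \<and> interior A \<noteq> {}"

lemma nondeg_two:
 assumes "is_interval A" "x \<in> A" "y \<in> A" "x \<noteq> (y::real)"
 shows "nondeg A"
proof -
 have "{min x y<..<max x y} \<subseteq> A"
  using interval_Ioo[OF assms(1-3)] interval_Ioo[OF assms(1,3,2)] by (auto simp: min_def max_def)
 hence "{min x y<..<max x y} \<subseteq> interior A" by (simp add: interior_maximal)
 moreover have "(x + y) / 2 \<in> {min x y<..<max x y}" using assms(4) by (auto simp: min_def max_def)
 ultimately show ?thesis using assms(1) by (auto simp: nondeg_def)
qed

lemma nondeg_obtain: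
 assumes "nondeg A" obtains x y where "x < y" "{x<..<y} \<subseteq> A" "x \<in> A" "y \<in> A"
proof -
 obtain z where "z \<in> interior A" using assms unfolding nondeg_def by blast
 hence "\<exists>d>0. cball z d \<subseteq> A" by (simp only: mem_interior_cball)
 then obtain d where d: "d > 0" "cball z d \<subseteq> A" by blast
 hence sub: "{z - d..z + d} \<subseteq> A" by (simp add: cball_eq_atLeastAtMost)
 show ?thesis
 proof (rule that)
  show "z - d < z + d" using d by simp
  have "{z - d<..<z + d} \<subseteq> {z - d..z + d}" "z - d \<in> {z - d..z + d}" "z + d \<in> {z - d..z + d}" using d by auto
  thus "{z - d<..<z + d} \<subseteq> A" "z - d \<in> A" "z + d \<in> A" using sub by blast+
 qed
qed

lemma nondeg_len:
 assumes "is_interval A" "A \<subseteq> {-1..1}"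
 shows "nondeg A \<longleftrightarrow> 0 < len A"
proof
 assume "nondeg A"
 then obtain x y where xy: "x < y" "{x<..<y} \<subseteq> A" by (rule nondeg_obtain)
 have "A \<in> fmeasurable lborel"
  by (rule fmeasurableI2[OF _ assms(2)]) (auto intro: real_interval_borel_measurable[OF assms(1)])
 hence "len {x<..<y} \<le> len A"
  using xy by (intro measure_mono_fmeasurable) auto
 thus "0 < len A" using xy by simp
next
 assume l: "0 < len A"
 hence "A \<noteq> {}" by auto
 then obtain x where x: "x \<in> A" by blast
 have "\<exists>y\<in>A. y \<noteq> x"
 proof (rule ccontr)
  assume "\<not> ?thesis"
  hence "A = {x}" using x by blast
  thus False using l by simp
 qed
 thus "nondeg A" using nondeg_two[OF assms(1) x] by metis
qed

lemma closure_interval_cases: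
 assumes "is_interval A" "y \<in> A" "(p::real) \<in> closure A"
 shows "open_segment y p \<subseteq> A"
proof -
 show ?thesis
 proof -
  have "\<exists>q\<in>A. x < q" if "y < p" "x < p" for x
  proof (rule ccontr)
   assume "\<not> ?thesis"
   hence "closure A \<subseteq> {..x}" by (intro closure_minimal) auto
   thus False using assms(3) that by auto
  qed
  moreover have "\<exists>q\<in>A. q < x" if "p < y" "p < x" for x
  proof (rule ccontr)
   assume "\<not> ?thesis"
   hence "closure A \<subseteq> {x..}" by (intro closure_minimal) auto
   thus False using assms(3) that by auto
  qed
  ultimately show ?thesis
   using assms(1,2) by (cases y p rule: linorder_cases)
    (auto simp: open_segment_eq_real_ivl, (meson interval_mem less_imp_le)+)
 qed
qed

text \<open>Two intervals with a common closure point become connected once that point is added, and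
  a connected set of reals is convex. Hulls of joined pieces thus gain only points of
  \<open>F\<close>, which later consists of exceptional points.\<close>

lemma hull_touch:
 assumes A: "is_interval A" "A \<noteq> {}"
  and B: "\<And>B. B \<in> \<B> ==> is_interval B \<and> (B = {} \<or> (\<exists>p\<in>closure A \<inter> closure B. p \<in> F))"
 shows "convex hull (A \<union> \<Union>\<B>) \<subseteq> A \<union> \<Union>\<B> \<union> (F :: real set)"
proof -
 define Y where "Y B = (if B = {} then A else (A \<union> {SOME p. p \<in> closure A \<inter> closure B \<and> p \<in> F}) \<union> (B \<union> {SOME p. p \<in> closure A \<inter> closure B \<and> p \<in> F}))" for B
 have YB: "connected (Y B) \<and> A \<subseteq> Y B \<and> B \<subseteq> Y B \<and> Y B \<subseteq> A \<union> B \<union> F" if "B \<in> \<B>" for B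
 proof (cases "B = {}")
  case True
  thus ?thesis using A by (auto simp: Y_def is_interval_connected_1)
 next
  case False
  define p where "p = (SOME p. p \<in> closure A \<inter> closure B \<and> p \<in> F)"
  have p: "p \<in> closure A" "p \<in> closure B" "p \<in> F"
   using someI_ex[of "\<lambda>p. p \<in> closure A \<inter> closure B \<and> p \<in> F"] B[OF that] False by (auto simp: p_def)
  have "connected A" "connected B" using A B[OF that] by (auto simp: is_interval_connected_1)
  hence "connected (A \<union> {p})" "connected (B \<union> {p})"
   using p closure_subset[of A] closure_subset[of B]
   by (auto intro!: connected_intermediate_closure[of A "A \<union> {p}"] connected_intermediate_closure[of B "B \<union> {p}"] simp del: Un_insert_right)
  hence "connected ((A \<union> {p}) \<union> (B \<union> {p}))" by (rule connected_Un) auto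
  moreover have "Y B = (A \<union> {p}) \<union> (B \<union> {p})" unfolding Y_def p_def using False by simp
  ultimately show ?thesis using p by auto
 qed
 obtain x0 where "x0 \<in> A" using A by blast
 hence "x0 \<in> \<Inter>(insert A (Y ` \<B>))" using YB by blast
 hence "connected (\<Union>(insert A (Y ` \<B>)))"
  using YB A by (intro connected_Union) (auto simp: is_interval_connected_1)
 hence "convex (\<Union>(insert A (Y ` \<B>)))"
  by (simp add: is_interval_connected_1[symmetric] is_interval_convex_1)
 hence "convex hull (A \<union> \<Union>\<B>) \<subseteq> \<Union>(insert A (Y ` \<B>))"
  using YB by (intro hull_minimal) blast+
 also have "\<dots> \<subseteq> A \<union> \<Union>\<B> \<union> F" using YB by blast
 finally show ?thesis .
qed

lemma inj_between:
 fixes f :: "real => real"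
 assumes v: "is_interval v" "continuous_on v f" "inj_on f v" and xyz: "x \<in> v" "y \<in> v" "z \<in> v"
 shows "y \<in> open_segment x z \<longleftrightarrow> f y \<in> open_segment (f x) (f z)"
proof -
 have "strict_mono_on v f \<or> strict_antimono_on v f"
  using v injective_eq_monotone_map by blast
 thus ?thesis
 proof
  assume m: "strict_mono_on v f"
  have "p < q \<longleftrightarrow> f p < f q" if "p \<in> v" "q \<in> v" for p q
   using m that by (metis strict_mono_on_less)
  thus ?thesis using xyz by (auto simp: open_segment_eq_real_ivl not_le[symmetric])
 next
  assume m: "strict_antimono_on v f"
  have "p < q \<longleftrightarrow> f q < f p" if "p \<in> v" "q \<in> v" for p q
   using m that by (metis monotone_onD linorder_less_linear less_asym)
  thus ?thesis using xyz by (auto simp: open_segment_eq_real_ivl not_le[symmetric])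
 qed
qed

lemma interval_vimage:
 fixes f :: "real => real"
 assumes v: "is_interval v" "continuous_on v f" "inj_on f v" and X: "is_interval X"
 shows "is_interval {y\<in>v. f y \<in> X}"
 unfolding is_interval_1
proof (intro ballI allI impI)
 fix p q x assume pq: "p \<in> {y\<in>v. f y \<in> X}" "q \<in> {y\<in>v. f y \<in> X}" "p \<le> x \<and> x \<le> q"
 hence xv: "x \<in> v" using interval_mem[OF v(1)] by auto
 show "x \<in> {y\<in>v. f y \<in> X}"
 proof (cases "x = p \<or> x = q")
  case False
  hence "x \<in> open_segment p q" using pq by (auto simp: open_segment_eq_real_ivl)
  hence "f x \<in> open_segment (f p) (f q)" using inj_between[OF v] pq xv by auto
  hence "f x \<in> {f p..f q} \<union> {f q..f p}" by (auto simp: open_segment_eq_real_ivl split: if_splits)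
  thus ?thesis using xv pq interval_Icc[OF X, of "f p" "f q"] interval_Icc[OF X, of "f q" "f p"] by blast
 qed (use pq in auto)
qed

lemma component_at:
 assumes "x \<in> X" obtains c where "c \<in> components X" "x \<in> c"
 using assms Union_components by blast

lemma components_disjoint: "[|c \<in> components X; c' \<in> components X; x \<in> c; x \<in> c'|] ==> c = c'"
 using components_eq[of c X c'] by auto

context mis_map
begin

definition regular :: "nat => real set => bool" where
 "regular n v \<longleftrightarrow> is_interval v \<and> v \<subseteq> {-1..1} \<and> (\<forall>y\<in>v. \<forall>j<n. (T ^^ j) y \<noteq> 0)"

lemma regular_inj: assumes "regular n v" shows "inj_on (T ^^ n) v"
proof (rule inj_onI)
 fix x y assume xy: "x \<in> v" "y \<in> v" "(T ^^ n) x = (T ^^ n) y"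
 obtain z where z: "z \<in> closed_segment x y" "(T ^^ n) y - (T ^^ n) x = (y - x) * D n z" by (rule iter_mvt)
 have "z \<in> v"
  using z(1) xy assms interval_Icc[of v x y] interval_Icc[of v y x]
  by (auto simp: regular_def closed_segment_eq_real_ivl split: if_splits)
 hence "D n z \<noteq> 0" using assms by (intro D_nz) (auto simp: regular_def)
 thus "x = y" using z xy by simp
qed

lemma regular_subset: "regular n v ==> u \<subseteq> v ==> is_interval u ==> regular n u"
 by (auto simp: regular_def)

lemma interval_image_iter: "is_interval v ==> is_interval ((T ^^ n) ` v)"
 by (simp add: is_interval_connected_1 connected_continuous_image continuous_iter)

lemma regular_between:
 assumes "regular n v" "x \<in> v" "y \<in> v" "z \<in> v"
 shows "y \<in> open_segment x z \<longleftrightarrow> (T ^^ n) y \<in> open_segment ((T ^^ n) x) ((T ^^ n) z)"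
 using assms regular_inj[OF assms(1)] by (intro inj_between continuous_iter) (auto simp: regular_def)

lemma regular_vimage: "regular n v ==> is_interval X ==> is_interval {y\<in>v. (T ^^ n) y \<in> X}"
 using regular_inj by (intro interval_vimage continuous_iter) (auto simp: regular_def)

end

section \<open>Zones, and cutting a monotone image along them\<close>

context mis_scheme
begin

text \<open>The cells of \<open>partition_Q\<close> without their division by the hole, which has no
  effect on an interval whose image avoids the hole; see \<open>subcells_eq\<close>.\<close>

definition zones :: "real set set" where
 "zones = {cell k | k. int k0 \<le> \<bar>k\<bar>} \<union> {{\<delta>..}, {..-\<delta>}}"

lemma cell_interval: "is_interval (cell k)" by (simp add: cell_def is_interval_oo)

lemma zone_interval: "X \<in> zones ==> is_interval X"
 by (auto simp: zones_def cell_interval)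

lemma cell_bounds:
 assumes "int k0 \<le> \<bar>k\<bar>" "y \<in> cell k"
 shows "sgn y = sgn (real_of_int k)" "e (Suc (nat \<bar>k\<bar>)) < \<bar>y\<bar>" "\<bar>y\<bar> < e (nat \<bar>k\<bar>)" "\<bar>y\<bar> < \<delta>" "y \<noteq> 0"
proof -
 have "sgn y = sgn (real_of_int k) \<and> e (Suc (nat \<bar>k\<bar>)) < \<bar>y\<bar> \<and> \<bar>y\<bar> < e (nat \<bar>k\<bar>)"
 proof (cases "0 < k")
  case True
  hence "0 < y" using assms(2) by (auto simp: cell_def intro: less_trans[OF exp_gt_zero])
  thus ?thesis using True assms by (auto simp: cell_def algebra_simps)
 next
  case False
  hence k: "k < 0" using assms depth_pos by auto
  hence "y < 0" using assms(2) by (auto simp: cell_def) (smt (verit) exp_gt_zero)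
  thus ?thesis using k assms by (auto simp: cell_def algebra_simps)
 qed
 thus *: "sgn y = sgn (real_of_int k)" "e (Suc (nat \<bar>k\<bar>)) < \<bar>y\<bar>" "\<bar>y\<bar> < e (nat \<bar>k\<bar>)" by auto
 have "e (nat \<bar>k\<bar>) \<le> \<delta>" using assms by (intro e_le_\<delta>) (simp add: le_nat_iff)
 thus "\<bar>y\<bar> < \<delta>" using * by simp
 show "y \<noteq> 0" using *(2) by (auto simp: less_le_trans[OF exp_gt_zero])
qed

lemma cellI:
 assumes "int k0 \<le> \<bar>k\<bar>" "sgn y = sgn (real_of_int k)" "e (Suc (nat \<bar>k\<bar>)) < \<bar>y\<bar>" "\<bar>y\<bar> < e (nat \<bar>k\<bar>)"
 shows "y \<in> cell k"
proof (cases "0 < k")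
 case True
 hence "0 < y" using assms by (simp add: sgn_1_pos)
 thus ?thesis using True assms by (auto simp: cell_def algebra_simps)
next
 case False
 hence k: "k < 0" using assms depth_pos by auto
 hence "y < 0" using assms by (simp add: sgn_1_neg)
 thus ?thesis using k assms by (auto simp: cell_def algebra_simps)
qed

lemma cell_inj:
 assumes "int k0 \<le> \<bar>k\<bar>" "int k0 \<le> \<bar>l\<bar>" "y \<in> cell k" "y \<in> cell l"
 shows "k = l"
proof -
 note k = cell_bounds[OF assms(1,3)] and l = cell_bounds[OF assms(2,4)]
 have "nat \<bar>k\<bar> < Suc (nat \<bar>l\<bar>)" "nat \<bar>l\<bar> < Suc (nat \<bar>k\<bar>)"
  using less_trans[OF k(2) l(3)] less_trans[OF l(2) k(3)] by auto
 hence "\<bar>k\<bar> = \<bar>l\<bar>" by linarith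
 moreover have "sgn k = sgn l" using k(1) l(1) by (auto simp: sgn_if split: if_splits)
 ultimately show ?thesis by (auto simp: abs_if sgn_if split: if_splits)
qed

lemma zones_disjoint:
 assumes "X \<in> zones" "Y \<in> zones" "y \<in> X" "y \<in> Y" shows "X = Y"
 using assms \<delta>_pos unfolding zones_def
 by (auto dest: cell_inj) (auto dest!: cell_bounds(4))

definition cuts :: "real set" where
 "cuts = {0, \<delta>, -\<delta>} \<union> range e \<union> range (\<lambda>k. - e k)"

lemma countable_cuts: "countable cuts" by (simp add: cuts_def)

lemma zone_exists:
 assumes "y \<notin> cuts" obtains X where "X \<in> zones" "y \<in> interior X"
proof (cases "\<bar>y\<bar> < \<delta>")
 case False
 hence "y \<in> {\<delta><..} \<or> y \<in> {..<-\<delta>}" using assms by (auto simp: cuts_def)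
 thus ?thesis
  using that[of "{\<delta>..}"] that[of "{..-\<delta>}"] by (auto simp: zones_def)
next
 case True
 have y0: "y \<noteq> 0" using assms by (simp add: cuts_def)
 define m where "m = nat \<lfloor>- ln \<bar>y\<bar>\<rfloor>"
 have "exp (ln \<bar>y\<bar>) < exp (- real k0)" using True y0 by (simp add: delta_def)
 hence ly: "ln \<bar>y\<bar> < - real k0" by (simp only: exp_less_cancel_iff)
 hence fl: "\<lfloor>- ln \<bar>y\<bar>\<rfloor> \<ge> int k0" by linarith
 hence rm: "real m = of_int \<lfloor>- ln \<bar>y\<bar>\<rfloor>" by (simp add: m_def)
 have m: "real m \<le> - ln \<bar>y\<bar>" "- ln \<bar>y\<bar> < real m + 1" "k0 \<le> m"
  unfolding rm using fl by (linarith, linarith, simp add: m_def le_nat_iff)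
 have le: "\<bar>y\<bar> \<le> e m" "e (Suc m) < \<bar>y\<bar>"
 proof -
  have "\<bar>y\<bar> = exp (ln \<bar>y\<bar>)" using y0 by simp
  moreover have "exp (ln \<bar>y\<bar>) \<le> e m" "e (Suc m) < exp (ln \<bar>y\<bar>)" using m by auto
  ultimately show "\<bar>y\<bar> \<le> e m" "e (Suc m) < \<bar>y\<bar>" by auto
 qed
 have "y \<noteq> e m" "y \<noteq> - e m" using assms unfolding cuts_def by blast+
 hence "\<bar>y\<bar> \<noteq> e m" by linarith
 hence lt: "\<bar>y\<bar> < e m" using le by simp
 define k where "k = (if y > 0 then int m else - int m)"
 have k: "int k0 \<le> \<bar>k\<bar>" "nat \<bar>k\<bar> = m" using m by (auto simp: k_def)
 have "sgn y = sgn (real_of_int k)" using m depth_pos y0 by (auto simp: k_def sgn_if)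
 hence "y \<in> cell k" using cellI[of k y] k lt le by auto
 moreover have "open (cell k)" by (simp add: cell_def)
 ultimately show ?thesis using that[of "cell k"] k by (auto simp: zones_def interior_open)
qed

lemma components_minus_crit:
 assumes J: "is_interval J"
 shows "components (J - crit_nbhd S) = {J \<inter> {\<delta>..}, J \<inter> {..-\<delta>}} - {{}}"
proof -
 have conn: "connected (J \<inter> {\<delta>..})" "connected (J \<inter> {..-\<delta>})"
  using J by (auto simp: is_interval_connected_1[symmetric] intro!: is_interval_Int)
 have sub: "J \<inter> {\<delta>..} \<subseteq> J - crit_nbhd S" "J \<inter> {..-\<delta>} \<subseteq> J - crit_nbhd S" using \<delta>_pos by auto
 have A: "A = J \<inter> {\<delta>..} \<or> A = J \<inter> {..-\<delta>}" if "A \<in> components (J - crit_nbhd S)" for A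
 proof -
  have Ac: "is_interval A" "A \<subseteq> J - crit_nbhd S" "A \<noteq> {}"
   using in_components_connected[OF that] in_components_subset[OF that] in_components_nonempty[OF that] by (simp_all add: is_interval_connected_1)
  have "A \<subseteq> {\<delta>..} \<or> A \<subseteq> {..-\<delta>}"
  proof (rule ccontr)
   assume "\<not> ?thesis"
   then obtain p q where "p \<in> A" "q \<in> A" "p \<le> -\<delta>" "\<delta> \<le> q" using Ac(2) \<delta>_pos by (force simp: not_le)
   hence "0 \<in> A" using interval_mem[OF Ac(1), of p q 0] \<delta>_pos by auto
   thus False using Ac(2) \<delta>_pos by auto
  qed
  thus ?thesis
  proof
   assume h: "A \<subseteq> {\<delta>..}"
   hence "A \<inter> (J \<inter> {\<delta>..}) \<noteq> {}" "A \<subseteq> J \<inter> {\<delta>..}" using Ac by auto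
   thus ?thesis using components_maximal[OF that conn(1) sub(1)] by auto
  next
   assume h: "A \<subseteq> {..-\<delta>}"
   hence "A \<inter> (J \<inter> {..-\<delta>}) \<noteq> {}" "A \<subseteq> J \<inter> {..-\<delta>}" using Ac by auto
   thus ?thesis using components_maximal[OF that conn(2) sub(2)] by auto
  qed
 qed
 have B: "B \<in> components (J - crit_nbhd S)" if B: "B = J \<inter> {\<delta>..} \<or> B = J \<inter> {..-\<delta>}" "B \<noteq> {}" for B
 proof -
  obtain x where x: "x \<in> B" using B(2) by blast
  hence "x \<in> J - crit_nbhd S" using B(1) sub by blast
  then obtain A where "A \<in> components (J - crit_nbhd S)" "x \<in> A" by (rule component_at)
  thus ?thesis using A[of A] B x \<delta>_pos by auto
 qed
 show ?thesis using A B in_components_nonempty by blast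
qed

text \<open>The image of \<open>v\<close> is connected and misses the hole, so it lies in a single
  component of the complement, and intersecting with that component changes nothing. Preimages of
  zones under a monotone map are intervals, so passing to components does not split them
  either.\<close>

lemma subcells_eq:
 assumes v: "regular n v" and out: "\<And>y. y \<in> v ==> (T ^^ n) y \<notin> H"
 shows "subcells S n v = {c. \<exists>X\<in>zones. c = {y\<in>v. (T ^^ n) y \<in> X} \<and> 0 < len c}"
proof -
 let ?f = "T ^^ n"
 have vi: "is_interval v" "v \<subseteq> {-1..1}" using v by (auto simp: regular_def)
 have fv: "connected (?f ` v)" "?f ` v \<subseteq> {-1..1} - H"
  using vi out by (auto simp: is_interval_connected_1 intro!: connected_continuous_image continuous_iter iter_range simp del: atLeastAtMost_iff)
 have compX: "components {y\<in>v. ?f y \<in> X} \<subseteq> {{y\<in>v. ?f y \<in> X}}" if "is_interval X" for X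
  using regular_vimage[OF v that] by (simp add: is_interval_connected_1 connected_eq_components_subset_sing)
 have Jint: "is_interval J" if "J \<in> components X" for J and X :: "real set"
  using in_components_connected[OF that] by (simp add: is_interval_connected_1)
 show ?thesis
 proof (intro set_eqI iffI)
  fix c assume "c \<in> subcells S n v"
  then obtain A where A: "A \<in> partition_Q S" "c \<in> components {y\<in>v. ?f y \<in> A}" "0 < len c"
   unfolding subcells_def iter_T by blast
  then obtain y where y: "y \<in> c" using in_components_nonempty by blast
  hence yA: "y \<in> v" "?f y \<in> A" using A(2) in_components_subset by blast+
  let ?Js = "components ({-1..1} - H) \<union> components H"
  have Jv: "?f ` v \<subseteq> J" if "J \<in> ?Js" "?f y \<in> J" for J
  proof -
   have "J \<notin> components H" using that out[OF yA(1)] in_components_subset by blast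
   hence "J \<in> components ({-1..1} - H)" using that by auto
   thus ?thesis using components_maximal[OF _ fv] yA that by blast
  qed
  consider k J where "A = cell k \<inter> J" "int k0 \<le> \<bar>k\<bar>" "J \<in> ?Js" | J where "J \<in> ?Js" "A \<in> components (J - crit_nbhd S)"
   using A(1) unfolding partition_Q_def Let_def by blast
  thus "c \<in> {c. \<exists>X\<in>zones. c = {y\<in>v. ?f y \<in> X} \<and> 0 < len c}"
  proof cases
   case 1
   hence eq: "{y\<in>v. ?f y \<in> A} = {y\<in>v. ?f y \<in> cell k}" using Jv[OF 1(3)] yA by auto
   hence "c = {y\<in>v. ?f y \<in> cell k}" using A(2) compX[OF cell_interval[of k]] by auto
   thus ?thesis using 1 A(3) by (auto simp: zones_def)
  next
   case 2
   have "is_interval J" using 2 Jint by blast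
   hence A': "A = J \<inter> {\<delta>..} \<or> A = J \<inter> {..-\<delta>}" using 2 components_minus_crit by auto
   then obtain X where X: "X \<in> zones" "A = J \<inter> X" by (auto simp: zones_def)
   hence "{y\<in>v. ?f y \<in> A} = {y\<in>v. ?f y \<in> X}" using Jv[OF 2(1)] yA by auto
   hence "c = {y\<in>v. ?f y \<in> X}" using A(2) compX[OF zone_interval[OF X(1)]] by auto
   thus ?thesis using X A(3) by auto
  qed
 next
  fix c assume "c \<in> {c. \<exists>X\<in>zones. c = {y\<in>v. ?f y \<in> X} \<and> 0 < len c}"
  then obtain X where X: "X \<in> zones" "c = {y\<in>v. ?f y \<in> X}" "0 < len c" by blast
  hence "c \<noteq> {}" by (metis measure_empty less_irrefl)
  then obtain y where y: "y \<in> v" "?f y \<in> X" using X by blast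
  hence "?f y \<in> {-1..1} - H" using fv by blast
  then obtain J where J: "J \<in> components ({-1..1} - H)" "?f y \<in> J" by (rule component_at)
  hence Jv: "?f ` v \<subseteq> J" using components_maximal[OF J(1) fv] y by blast
  have "\<exists>A\<in>partition_Q S. A = X \<inter> J"
   using X(1) unfolding zones_def
  proof (elim UnE)
   assume "X \<in> {cell k | k. int k0 \<le> \<bar>k\<bar>}"
   thus ?thesis using J unfolding partition_Q_def Let_def by blast
  next
   assume "X \<in> {{\<delta>..}, {..-\<delta>}}"
   moreover have "X \<inter> J \<noteq> {}" using y J by auto
   ultimately have "X \<inter> J \<in> components (J - crit_nbhd S)"
    unfolding components_minus_crit[OF Jint[OF J(1)]] by auto
   thus ?thesis using J unfolding partition_Q_def Let_def by blast
  qed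
  then obtain A where A: "A \<in> partition_Q S" "A = X \<inter> J" by blast
  hence "{y\<in>v. ?f y \<in> A} = c" using Jv X by auto
  moreover have "connected c" using regular_vimage[OF v zone_interval[OF X(1)]] X by (simp add: is_interval_connected_1)
  ultimately have "c \<in> components {y\<in>v. ?f y \<in> A}" using `c \<noteq> {}` by (simp add: in_components_self)
  thus "c \<in> subcells S n v" unfolding subcells_def iter_T using A X by blast
 qed
qed

end

lemma open_minus_countable:
 assumes "open (X :: real set)" "X \<noteq> {}" "countable N" obtains x where "x \<in> X" "x \<notin> N"
proof -
 obtain x d where "d > 0" "ball x d \<subseteq> X" using assms(1,2) by (meson all_not_in_conv openE)
 hence "uncountable X" using uncountable_ball[of d x] countable_subset by blast
 thus ?thesis using that assms(3) by (meson countable_subset subsetI)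
qed

lemma interior_or_frontier: "x \<in> A ==> x \<notin> frontier A ==> x \<in> interior A"
 using closure_subset by (auto simp: frontier_def)

lemma Collect_singI: "w0 \<in> X ==> P w0 ==> (\<And>w. w \<in> X ==> P w ==> w = w0) ==> {w\<in>X. P w} = {w0}"
 by blast

context mis_map
begin

lemma countable_vimage_T: "countable C ==> countable {x. T x \<in> C}"
proof -
 assume C: "countable C"
 have "{x. T x \<in> C} \<subseteq> (\<lambda>c. sqrt ((1 - c) / a)) ` C \<union> (\<lambda>c. - sqrt ((1 - c) / a)) ` C"
 proof
  fix x assume x: "x \<in> {x. T x \<in> C}"
  have "(1 - T x) / a = x\<^sup>2" using a_pos by (simp add: logistic_def)
  hence "sqrt ((1 - T x) / a) = \<bar>x\<bar>" by simp
  hence "x = sqrt ((1 - T x) / a) \<or> x = - sqrt ((1 - T x) / a)" by linarith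
  thus "x \<in> (\<lambda>c. sqrt ((1 - c) / a)) ` C \<union> (\<lambda>c. - sqrt ((1 - c) / a)) ` C" using x by blast
 qed
 thus ?thesis by (rule countable_subset) (use C in auto)
qed

lemma countable_vimage_iter: "countable C ==> countable {x. (T ^^ n) x \<in> C}"
proof (induction n)
 case (Suc n)
 have "{x. (T ^^ Suc n) x \<in> C} = {x. T x \<in> {y. (T ^^ n) y \<in> C}}"
  by (simp only: iter_Suc' mem_Collect_eq)
 thus ?case using countable_vimage_T[OF Suc.IH[OF Suc.prems]] by simp
qed simp

end

section \<open>The invariants of pieces and of stopped intervals\<close>

context mis_scheme
begin

definition exc :: "nat => real set" where
 "exc m = (\<Union>t\<le>m. {x. (T ^^ t) x \<in> cuts})"

lemma countable_exc: "countable (exc m)"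
 unfolding exc_def by (intro countable_UN countable_vimage_iter countable_cuts) auto

text \<open>Besides monotonicity up to and including time \<open>n\<close> this records what
  absorption requires: absorbed points stay in the parent \<open>P\<close>, on which the iterate up
  to the passage is injective, and they are \<open>bindable\<close>. The last clause says that
  before the shallower neighbour can be released, nothing has been absorbed and the piece still lies
  strictly below the outer endpoint of its cell.\<close>

definition piece_ok :: "real set => nat => piece => bool" where
 "piece_ok Q n w \<longleftrightarrow> nondeg (fst w) \<and> fst w \<subseteq> Q \<and> regular (Suc n) (fst w) \<and>
  (\<forall>t k P. snd w = Some (t, k, P) --> t \<le> n \<and> P \<subseteq> Q \<and> fst w \<subseteq> P \<and> regular t P \<and> int k0 \<le> \<bar>k\<bar> \<and>
   (\<forall>y\<in>fst w. bindable k ((T ^^ t) y)) \<and>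
   (n \<le> t + bound_time S k --> (\<exists>y\<in>fst w. (T ^^ t) y \<in> cell k)) \<and>
   (k0 < nat \<bar>k\<bar> \<and> n < t + bt (nat \<bar>k\<bar> - 1) --> (\<forall>y\<in>fst w. \<bar>(T ^^ t) y\<bar> < e (nat \<bar>k\<bar>))))"

text \<open>\<open>4 ^ 6\<close> instead of \<open>4 ^ 8\<close>, and two distant points instead of
  a length, so that the bound survives the removal of a remainder.\<close>

definition stopped_ok :: "real set => nat => real set => bool" where
 "stopped_ok Q m s \<longleftrightarrow> nondeg s \<and> s \<subseteq> Q \<and> regular m s \<and> ((T ^^ m) ` s \<subseteq> H \<or>
   (T ^^ m) ` s \<inter> H = {} \<and> (\<exists>x\<in>s. \<exists>y\<in>s. 4 ^ 6 * \<epsilon> \<le> \<bar>(T ^^ m) x - (T ^^ m) y\<bar>))"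

definition exact_one :: "piece set => real set set => real => bool" where
 "exact_one X Y x \<longleftrightarrow> (\<exists>w. {w\<in>X. x \<in> fst w} = {w} \<and> {s\<in>Y. x \<in> s} = {}) \<or>
   ({w\<in>X. x \<in> fst w} = {} \<and> (\<exists>s. {s\<in>Y. x \<in> s} = {s}))"

text \<open>Choose a point more than 2 \<epsilon> away from both ends and off the finite set not
  covered by reference intervals; the reference interval containing it is at most 2 \<epsilon>
  long.\<close>

lemma ref_inside:
 assumes "{\<alpha><..<\<beta>} \<subseteq> {1 - a..1} - H" "4 * \<epsilon> < \<beta> - \<alpha>"
 obtains L where "L \<in> set (refs S)" "L \<subseteq> {\<alpha><..<\<beta>}" "nondeg L"
proof -
 define F where "F = {1 - a..1} - H - \<Union>(set (refs S))"
 have F: "finite F" using refs by (simp add: reference_family_def crit_par_eq F_def)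
 have "open {\<alpha> + 2 * \<epsilon><..<\<beta> - 2 * \<epsilon>}" "{\<alpha> + 2 * \<epsilon><..<\<beta> - 2 * \<epsilon>} \<noteq> {}" using assms by auto
 then obtain q where q: "q \<in> {\<alpha> + 2 * \<epsilon><..<\<beta> - 2 * \<epsilon>}" "q \<notin> F"
  using F by (metis open_minus_countable countable_finite)
 hence "q \<in> {\<alpha><..<\<beta>}" using eps_pos by auto
 hence "q \<in> {1 - a..1} - H" using assms by blast
 then obtain L where L: "L \<in> set (refs S)" "q \<in> L" using q by (auto simp: F_def)
 hence Lp: "is_interval L" "L \<subseteq> {-1..1}" "\<epsilon> \<le> len L" "len L \<le> 2 * \<epsilon>"
  using refs by (auto simp: reference_family_def start_interval_def)
 have close: "\<bar>q - y\<bar> \<le> 2 * \<epsilon>" if "y \<in> L" for y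
 proof -
  have "L \<in> fmeasurable lborel"
   by (rule fmeasurableI2[OF _ Lp(2)]) (auto intro: real_interval_borel_measurable Lp)
  moreover have "{min q y..max q y} \<subseteq> L"
   using interval_Icc[OF Lp(1), of q y] interval_Icc[OF Lp(1), of y q] that L by (auto simp: min_def max_def)
  ultimately have "len {min q y..max q y} \<le> len L" by (intro measure_mono_fmeasurable) auto
  thus ?thesis using Lp by (auto simp: min_def max_def split: if_splits)
 qed
 have "L \<subseteq> {\<alpha><..<\<beta>}"
 proof
  fix y assume "y \<in> L"
  from close[OF this] q show "y \<in> {\<alpha><..<\<beta>}" by auto
 qed
 moreover have "nondeg L" using nondeg_len[OF Lp(1,2)] Lp(3) eps_pos by simp
 ultimately show ?thesis using that L by blast
qed

lemma two_far:
 assumes "4 ^ 8 * \<epsilon> \<le> len A" "is_interval A" "x \<in> A"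
 obtains y where "y \<in> A" "4 ^ 7 * \<epsilon> \<le> \<bar>x - y\<bar>"
proof -
 have "\<exists>y\<in>A. 4 ^ 7 * \<epsilon> \<le> \<bar>x - y\<bar>"
 proof (rule ccontr)
  assume "\<not> ?thesis"
  hence "A \<subseteq> {x - 4 ^ 7 * \<epsilon>..x + 4 ^ 7 * \<epsilon>}" by (force simp: abs_less_iff not_le)
  hence "len A \<le> len {x - 4 ^ 7 * \<epsilon>..x + 4 ^ 7 * \<epsilon>}"
   using real_interval_borel_measurable[OF assms(2)] by (intro measure_mono_fmeasurable) auto
  also have "\<dots> = 2 * 4 ^ 7 * \<epsilon>" using eps_pos by simp
  finally show False using assms(1) eps_pos by simp
 qed
 thus ?thesis using that by blast
qed

lemma far_len:
 assumes "is_interval A" "A \<subseteq> {-1..1}" "x \<in> A" "y \<in> A"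
 shows "\<bar>x - y\<bar> \<le> len A"
proof -
 have "A \<in> fmeasurable lborel"
  by (rule fmeasurableI2[OF _ assms(2)]) (auto intro: real_interval_borel_measurable assms)
 moreover have "{min x y..max x y} \<subseteq> A"
  using interval_Icc[OF assms(1), of x y] interval_Icc[OF assms(1), of y x] assms by (auto simp: min_def max_def)
 ultimately have "len {min x y..max x y} \<le> len A" by (intro measure_mono_fmeasurable) auto
 thus ?thesis by (auto simp: min_def max_def split: if_splits)
qed

lemma nonhole_component:
 assumes "regular m \<omega>" "v \<in> components {x\<in>\<omega>. (T ^^ m) x \<notin> H}"
 shows "regular m v" "v \<subseteq> \<omega>" "\<And>y. y \<in> v ==> (T ^^ m) y \<notin> H"
proof -
 show v: "v \<subseteq> \<omega>" "\<And>y. y \<in> v ==> (T ^^ m) y \<notin> H"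
  using in_components_subset[OF assms(2)] by auto
 have "is_interval v" using in_components_connected[OF assms(2)] by (simp add: is_interval_connected_1)
 thus "regular m v" using regular_subset[OF assms(1) v(1)] by simp
qed

text \<open>A common closure point is mapped both into the closure of the cell and into a closed
  outer half-line, hence to \<delta> or -\<delta>. This fixes the depth and the side, and shows that
  the seam of the two pieces is exceptional.\<close>

lemma edge_pair_zone:
 assumes v: "regular m v" "\<And>y. y \<in> v ==> (T ^^ m) y \<notin> H"
  and c: "c \<in> subcells S m v" "inner_at S m c k" and d: "d \<in> subcells S m v" "edge_pair S m c d"
 shows "\<bar>k\<bar> = int k0" "d = {y\<in>v. (T ^^ m) y \<in> (if 0 < k then {\<delta>..} else {..-\<delta>})}"
  "\<exists>p\<in>closure c \<inter> closure d. (T ^^ m) p \<in> cuts"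
proof -
 let ?f = "T ^^ m"
 obtain X where X: "X \<in> zones" "c = {y\<in>v. ?f y \<in> X}" "0 < len c" using c subcells_eq[OF v] by blast
 obtain Y where Y: "Y \<in> zones" "d = {y\<in>v. ?f y \<in> Y}" "0 < len d" using d subcells_eq[OF v] by blast
 obtain y where y: "y \<in> c" using X(3) by (metis ex_in_conv less_irrefl measure_empty)
 obtain k' where k': "\<bar>k'\<bar> = int k0" "?f ` c \<subseteq> cell k'" using d(2) by (auto simp: edge_pair_def inner_at_def)
 have kk: "int k0 \<le> \<bar>k\<bar>" "?f ` c \<subseteq> cell k" using c(2) by (auto simp: inner_at_def)
 have "k = k'" using cell_inj[OF kk(1), of k' "?f y"] k' kk y by auto
 thus k: "\<bar>k\<bar> = int k0" using k' by simp
 obtain z where z: "z \<in> d" using Y(3) by (metis ex_in_conv less_irrefl measure_empty)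
 have out: "?f ` d \<inter> crit_nbhd S = {}" using d(2) by (simp add: edge_pair_def outer_at_def)
 have "Y \<in> {{\<delta>..}, {..-\<delta>}}"
 proof (rule ccontr)
  assume "Y \<notin> {{\<delta>..}, {..-\<delta>}}"
  then obtain l where l: "Y = cell l" "int k0 \<le> \<bar>l\<bar>" using Y(1) by (auto simp: zones_def)
  hence "\<bar>?f z\<bar> < \<delta>" using cell_bounds(4)[of l "?f z"] z Y by auto
  hence "?f z \<in> crit_nbhd S" by (simp add: abs_less_iff)
  thus False using out z by blast
 qed
 hence Yc: "Y = {\<delta>..} \<or> Y = {..-\<delta>}" by auto
 obtain p where p: "p \<in> closure c" "p \<in> closure d" using d(2) by (auto simp: edge_pair_def abut_def)
 have clos: "?f p \<in> closure Z" if "p \<in> closure C" "?f ` C \<subseteq> Z" for C Z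
 proof -
  have "?f ` closure C \<subseteq> closure (?f ` C)" by (intro continuous_image_closure_subset[OF continuous_iter[of UNIV]]) auto
  also have "\<dots> \<subseteq> closure Z" by (intro closure_mono that)
  finally show ?thesis using that by auto
 qed
 have "?f ` d \<subseteq> Y" "closure Y = Y" using Y(2) Yc by auto
 hence pY: "?f p \<in> Y" using clos[OF p(2), of Y] by simp
 have "?f p \<in> closure (cell k)" using clos[OF p(1), of "cell k"] kk by auto
 moreover have "closure (cell k) \<subseteq> (if 0 < k then {0..\<delta>} else {-\<delta>..0})"
 proof (intro closure_minimal subsetI)
  fix x assume x: "x \<in> cell k"
  show "x \<in> (if 0 < k then {0..\<delta>} else {-\<delta>..0})"
   using cell_bounds[OF kk(1) x] k depth_pos by (auto simp: sgn_if abs_if split: if_splits)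
 qed auto
 ultimately have fp: "?f p \<in> (if 0 < k then {0..\<delta>} else {-\<delta>..0})" by blast
 have Yeq: "Y = (if 0 < k then {\<delta>..} else {..-\<delta>})" using Yc pY fp \<delta>_pos by (auto split: if_splits)
 thus "d = {y\<in>v. ?f y \<in> (if 0 < k then {\<delta>..} else {..-\<delta>})}" using Y(2) by simp
 have "?f p \<in> cuts" using pY fp Yeq by (auto simp: cuts_def split: if_splits)
 thus "\<exists>p\<in>closure c \<inter> closure d. ?f p \<in> cuts" using p by blast
qed

lemma inner_zone:
 assumes "X \<in> zones" "c = {y\<in>v. (T ^^ m) y \<in> X}" "c \<noteq> {}" "inner_at S m c k" shows "X = cell k"
proof -
 obtain y where "y \<in> c" using assms by blast
 hence "(T ^^ m) y \<in> X" "(T ^^ m) y \<in> cell k" using assms by (auto simp: inner_at_def)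
 moreover have "cell k \<in> zones" using assms(4) by (auto simp: zones_def inner_at_def)
 ultimately show ?thesis using zones_disjoint assms(1) by blast
qed

lemma outer_zone:
 assumes "X \<in> zones" "c = {y\<in>v. (T ^^ m) y \<in> X}" "c \<noteq> {}"
 shows "outer_at S m c \<longleftrightarrow> X = {\<delta>..} \<or> X = {..-\<delta>}"
proof
 assume o: "outer_at S m c"
 obtain y where y: "y \<in> c" using assms by blast
 show "X = {\<delta>..} \<or> X = {..-\<delta>}"
 proof (rule ccontr)
  assume "\<not> ?thesis"
  then obtain l where l: "X = cell l" "int k0 \<le> \<bar>l\<bar>" using assms(1) by (auto simp: zones_def)
  hence "\<bar>(T ^^ m) y\<bar> < \<delta>" using cell_bounds(4)[of l] y assms by auto
  hence "(T ^^ m) y \<in> crit_nbhd S" by (simp add: abs_less_iff)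
  thus False using o y unfolding outer_at_def iter_T by blast
 qed
qed (use assms \<delta>_pos in \<open>auto simp: outer_at_def\<close>)

text \<open>An inner piece may have swallowed the adjacent outer one; since \<open>v\<close> is not
  large, it then reaches less than 4^8 \<epsilon> beyond \<delta> in modulus, which is the extension
  that \<open>bindable\<close> permits. For an outer piece the earlier bound period is over and the
  clauses about it hold vacuously.\<close>

lemma cut_pieces_ok:
 assumes w: "piece_ok Q n w" "is_free S (Suc n) w"
  and v: "v \<in> components {x\<in>fst w. (T ^^ Suc n) x \<notin> H}" "\<not> large S (Suc n) v"
  and w': "w' \<in> cut_pieces S (Suc n) w v"
 shows "piece_ok Q (Suc n) w'" "fst w' \<subseteq> v"
proof -
 define m where "m = Suc n"
 let ?f = "T ^^ m"
 have rw: "regular m (fst w)" "fst w \<subseteq> Q" using w by (auto simp: piece_ok_def m_def)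
 note vv = nonhole_component[OF rw(1) v(1)[folded m_def]]
 have vi: "is_interval v" "v \<subseteq> {-1..1}" using vv(1) by (auto simp: regular_def)
 have nzv: "\<forall>y\<in>v. \<forall>j<m. (T ^^ j) y \<noteq> 0" using vv(1) by (simp add: regular_def)
 note sc = subcells_eq[OF vv(1,3)]
 from w' consider (inner) c k where "w' = (convex hull (c \<union> \<Union>{d \<in> subcells S m v. edge_pair S m c d}), Some (m, k, fst w))"
   "c \<in> subcells S m v" "inner_at S m c k"
  | (outer) d where "w' = (d, snd w)" "d \<in> subcells S m v" "outer_at S m d"
  unfolding cut_pieces_def m_def[symmetric] by blast
 hence "piece_ok Q m w' \<and> fst w' \<subseteq> v"
 proof cases
  case inner
  let ?ds = "{d \<in> subcells S m v. edge_pair S m c d}"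
  obtain X where X: "X \<in> zones" "c = {y\<in>v. ?f y \<in> X}" "0 < len c" using inner sc by blast
  have cne: "c \<noteq> {}" using X(3) by auto
  have Xk: "X = cell k" using inner_zone[OF X(1,2) cne inner(3)] .
  have kk: "int k0 \<le> \<bar>k\<bar>" using inner(3) by (simp add: inner_at_def)
  have dsub: "d \<subseteq> v" if "d \<in> ?ds" for d using that sc by blast
  have hull_v: "convex hull (c \<union> \<Union>?ds) \<subseteq> v"
   using X(2) dsub vi by (intro hull_minimal) (auto simp: is_interval_convex_1)
  have c_hull: "c \<subseteq> convex hull (c \<union> \<Union>?ds)" by (meson Un_upper1 hull_subset order_trans)
  have ndc: "nondeg c" using nondeg_len[of c] regular_vimage[OF vv(1) zone_interval[OF X(1)]] X vi by auto
  have ndh: "nondeg (convex hull (c \<union> \<Union>?ds))"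
   using ndc interior_mono[OF c_hull] by (auto simp: nondeg_def is_interval_convex_1)
  have bnd: "bindable k (?f y) \<and> (k0 < nat \<bar>k\<bar> --> \<bar>?f y\<bar> < e (nat \<bar>k\<bar>))" if y: "y \<in> convex hull (c \<union> \<Union>?ds)" for y
  proof (cases "\<bar>k\<bar> = int k0")
   case False
   have ds: "?ds = {}" using edge_pair_zone(1)[OF vv(1,3) inner(2,3)] False by blast
   have "convex hull c = c" using ndc by (simp add: nondeg_def is_interval_convex_1 convex_hull_eq)
   hence "y \<in> c" using y unfolding ds by simp
   hence "?f y \<in> cell k" using X Xk by auto
   from cell_bounds[OF kk this] show ?thesis using kk by (auto simp: bindable_def)
  next
   case True
   hence nk: "nat \<bar>k\<bar> = k0" by simp
   \<comment> \<open>A half-line bounded away from 0 that contains the cell and the outer zone on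
     its side; the hull of the joined pieces stays in its preimage.\<close>
   define Z where "Z = (if 0 < k then {e (Suc k0)<..} else {..<- e (Suc k0)})"
   have Zint: "is_interval Z" by (auto simp: Z_def is_interval_convex_1)
   have cell_Z: "cell k \<subseteq> Z"
   proof
    fix x assume "x \<in> cell k"
    from cell_bounds[OF kk this] show "x \<in> Z" using nk True depth_pos
     by (auto simp: Z_def sgn_if abs_if split: if_splits)
   qed
   have "d \<subseteq> {y\<in>v. ?f y \<in> Z}" if "d \<in> ?ds" for d
   proof -
    have "e (Suc k0) < \<delta>" by (simp add: delta_def)
    thus ?thesis using edge_pair_zone(2)[OF vv(1,3) inner(2,3), of d] that by (auto simp: Z_def)
   qed
   hence "c \<union> \<Union>?ds \<subseteq> {y\<in>v. ?f y \<in> Z}" using cell_Z X Xk by auto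
   hence "convex hull (c \<union> \<Union>?ds) \<subseteq> {y\<in>v. ?f y \<in> Z}"
    using regular_vimage[OF vv(1) Zint] by (intro hull_minimal) (auto simp: is_interval_convex_1)
   hence yZ: "y \<in> v" "?f y \<in> Z" using y by auto
   obtain y0 where y0: "y0 \<in> c" using cne by blast
   have "\<bar>?f y0\<bar> < \<delta>" using cell_bounds(4)[OF kk] y0 X Xk by auto
   moreover have "\<bar>?f y0 - ?f y\<bar> \<le> len (?f ` v)"
    using vi y0 X yZ by (intro far_len interval_image_iter) (auto intro!: iter_range simp del: atLeastAtMost_iff)
   moreover have "len (?f ` v) < 4 ^ 8 * \<epsilon>" using v(2) by (simp add: large_def m_def del: funpow.simps)
   ultimately have "\<bar>?f y\<bar> < \<delta> + 4 ^ 8 * \<epsilon>" by linarith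
   moreover have "sgn (?f y) = sgn (real_of_int k) \<and> e (Suc k0) \<le> \<bar>?f y\<bar>"
    using yZ(2) True depth_pos less_trans[OF exp_gt_zero, of "- real (Suc k0)" "?f y"] less_trans[OF exp_gt_zero, of "- real (Suc k0)" "- ?f y"]
    by (auto simp: Z_def sgn_if abs_if split: if_splits)
   ultimately show ?thesis using nk kk by (auto simp: bindable_def)
  qed
  have bnz: "?f y \<noteq> 0" if "y \<in> convex hull (c \<union> \<Union>?ds)" for y
   using bnd[OF that] by (auto simp: bindable_def not_le[symmetric])
  have "regular (Suc m) (convex hull (c \<union> \<Union>?ds))"
   unfolding regular_def
  proof (intro conjI ballI allI impI)
   show "is_interval (convex hull (c \<union> \<Union>?ds))" by (simp add: is_interval_convex_1)
   show "convex hull (c \<union> \<Union>?ds) \<subseteq> {-1..1}" using hull_v vi by blast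
   fix y j assume y: "y \<in> convex hull (c \<union> \<Union>?ds)" and j: "j < Suc m"
   thus "(T ^^ j) y \<noteq> 0" using bnz[OF y] nzv hull_v by (cases "j = m") auto
  qed
  moreover obtain y0 where "y0 \<in> c" using cne by blast
  hence "\<exists>y\<in>convex hull (c \<union> \<Union>?ds). ?f y \<in> cell k" using c_hull X Xk by auto
  ultimately have "piece_ok Q m w'"
   unfolding piece_ok_def inner(1) fst_conv snd_conv
   using ndh hull_v vv(2) rw kk bnd by auto
  thus ?thesis using hull_v inner(1) by simp
 next
  case outer
  obtain X where X: "X \<in> zones" "d = {y\<in>v. ?f y \<in> X}" "0 < len d" using outer sc by blast
  have dv: "d \<subseteq> v" using X by auto
  have di: "is_interval d" using regular_vimage[OF vv(1) zone_interval[OF X(1)]] X by simp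
  have nd: "nondeg d" using nondeg_len[OF di] X(3) dv vi by auto
  have fz: "?f y \<noteq> 0" if "y \<in> d" for y using outer(3) that \<delta>_pos by (force simp: outer_at_def)
  have reg: "regular (Suc m) d"
   unfolding regular_def
  proof (intro conjI ballI allI impI)
   fix y j assume y: "y \<in> d" and j: "j < Suc m"
   thus "(T ^^ j) y \<noteq> 0" using fz[OF y] nzv dv by (cases "j = m") auto
  qed (use di dv vi in auto)
  have "piece_ok Q m w'"
   unfolding piece_ok_def outer(1) fst_conv snd_conv
  proof (intro conjI allI impI)
   show "nondeg d" by (rule nd)
   show "d \<subseteq> Q" using dv vv(2) rw by auto
   show "regular (Suc m) d" by (rule reg)
   fix t k P assume sw: "snd w = Some (t, k, P)"
   hence pw: "t \<le> n" "P \<subseteq> Q" "fst w \<subseteq> P" "regular t P" "int k0 \<le> \<bar>k\<bar>" "\<forall>y\<in>fst w. bindable k ((T ^^ t) y)"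
    using w(1) by (auto simp: piece_ok_def)
   have free: "t + bound_time S k < m" using w(2) sw by (cases w) (auto simp: m_def)
   show "t \<le> m" "P \<subseteq> Q" "d \<subseteq> P" "regular t P" "int k0 \<le> \<bar>k\<bar>" "\<forall>y\<in>d. bindable k ((T ^^ t) y)"
    using pw dv vv(2) by (auto simp: m_def)
   show "\<exists>y\<in>d. (T ^^ t) y \<in> cell k" if "m \<le> t + bound_time S k" using that free by simp
   show "\<forall>y\<in>d. \<bar>(T ^^ t) y\<bar> < e (nat \<bar>k\<bar>)" if h: "k0 < nat \<bar>k\<bar> \<and> m < t + bt (nat \<bar>k\<bar> - 1)"
   proof -
    have "bt (nat \<bar>k\<bar> - 1) \<le> bt (nat \<bar>k\<bar>)" using h by (intro bt_mono) auto
    hence False using h free bound_time_abs[OF pw(5)] by linarith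
    thus ?thesis ..
   qed
  qed
  thus ?thesis using dv outer(1) by simp
 qed
 thus "piece_ok Q (Suc n) w'" "fst w' \<subseteq> v" by (auto simp: m_def)
qed

definition free_pieces :: "nat => piece => piece set" where
 "free_pieces m w = (\<Union>v\<in>{v \<in> components {x\<in>fst w. (T ^^ m) x \<notin> H}. \<not> large S m v}. cut_pieces S m w v)"

definition free_stopped :: "nat => piece => real set set" where
 "free_stopped m w = components {x\<in>fst w. (T ^^ m) x \<in> H} \<union>
   {v \<in> components {x\<in>fst w. (T ^^ m) x \<notin> H}. large S m v}"

lemma nondeg_near:
 assumes "nondeg \<omega>" "x \<in> \<omega>" "d > 0"
 obtains y where "y \<in> \<omega>" "y \<noteq> x" "\<bar>y - x\<bar> < d"
proof -
 obtain p q where pq: "p < q" "p \<in> \<omega>" "q \<in> \<omega>" using assms(1) nondeg_obtain by metis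
 have int: "is_interval \<omega>" using assms(1) by (simp add: nondeg_def)
 obtain z where z: "z \<in> \<omega>" "z \<noteq> x" using pq by (cases "p = x") auto
 show ?thesis
 proof (cases "\<bar>z - x\<bar> < d")
  case True thus ?thesis using that z by blast
 next
  case False
  show ?thesis
  proof (cases "x < z")
   case True
   hence "x + d / 2 \<in> \<omega>" using False z assms interval_mem[OF int assms(2) z(1), of "x + d / 2"] by auto
   thus ?thesis using that[of "x + d / 2"] assms(3) by auto
  next
   case F2: False
   hence "x - d / 2 \<in> \<omega>" using False z assms interval_mem[OF int z(1) assms(2), of "x - d / 2"] by auto
   thus ?thesis using that[of "x - d / 2"] assms(3) by auto
  qed
 qed
qed

text \<open>Components of the preimage of the hole have interior because the hole is open and the
  piece is a nondegenerate interval. Large components get their two distant points from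
  \<open>two_far\<close>.\<close>

lemma free_stopped_ok:
 assumes w: "piece_ok Q n w" and s: "s \<in> free_stopped (Suc n) w"
 shows "stopped_ok Q (Suc n) s" "s \<subseteq> fst w"
proof -
 define m where "m = Suc n"
 let ?f = "T ^^ m"
 have rw: "regular m (fst w)" "fst w \<subseteq> Q" "nondeg (fst w)" using w by (auto simp: piece_ok_def m_def)
 have rwi: "is_interval (fst w)" using rw by (simp add: nondeg_def)
 from s consider (hole) "s \<in> components {x\<in>fst w. ?f x \<in> H}"
  | (large) "s \<in> components {x\<in>fst w. ?f x \<notin> H}" "large S m s"
  unfolding free_stopped_def m_def by blast
 hence "stopped_ok Q m s \<and> s \<subseteq> fst w"
 proof cases
  case hole
  have ss: "s \<subseteq> fst w" "\<And>y. y \<in> s ==> ?f y \<in> H" using in_components_subset[OF hole] by auto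
  have si: "is_interval s" using in_components_connected[OF hole] by (simp add: is_interval_connected_1)
  obtain x where x: "x \<in> s" using in_components_nonempty[OF hole] by blast
  have "open (?f -` H)" by (intro open_vimage hole_open continuous_iter)
  then obtain d where d: "d > 0" "ball x d \<subseteq> ?f -` H" using ss(2)[OF x] by (meson openE vimageI2)
  obtain y where y: "y \<in> fst w" "y \<noteq> x" "\<bar>y - x\<bar> < d" using nondeg_near[OF rw(3) _ d(1), of x] ss x by blast
  have "closed_segment x y \<subseteq> {z\<in>fst w. ?f z \<in> H}"
  proof
   fix z assume z: "z \<in> closed_segment x y"
   have "x \<in> fst w" using ss(1) x by blast
   hence "z \<in> fst w" using z interval_Icc[OF rwi, of x y] interval_Icc[OF rwi, of y x] y(1)
    by (auto simp: closed_segment_eq_real_ivl split: if_splits)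
   moreover have "z \<in> ball x d" using z y(3) by (auto simp: closed_segment_eq_real_ivl dist_real_def split: if_splits)
   ultimately show "z \<in> {z\<in>fst w. ?f z \<in> H}" using d(2) by blast
  qed
  hence "closed_segment x y \<subseteq> s"
   using components_maximal[OF hole] x by (metis connected_segment(1) disjoint_iff ends_in_segment(1))
  hence "nondeg s" using nondeg_two[OF si x, of y] y(2) by auto
  thus ?thesis using ss rw regular_subset[OF rw(1) ss(1) si] by (auto simp: stopped_ok_def)
 next
  case large
  note vv = nonhole_component[OF rw(1) large(1)]
  have vi: "is_interval s" using vv(1) by (simp add: regular_def)
  obtain x where x: "x \<in> s" using in_components_nonempty[OF large(1)] by blast
  obtain z where "z \<in> ?f ` s" "4 ^ 7 * \<epsilon> \<le> \<bar>?f x - z\<bar>"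
   using two_far[of "?f ` s" "?f x"] large(2) interval_image_iter[OF vi, of m] x by (auto simp: large_def)
  then obtain y where y: "y \<in> s" "4 ^ 7 * \<epsilon> \<le> \<bar>?f x - ?f y\<bar>" by blast
  hence "x \<noteq> y" using eps_pos by auto
  hence "nondeg s" using nondeg_two[OF vi x y(1)] by simp
  moreover have "4 ^ 6 * \<epsilon> \<le> \<bar>?f x - ?f y\<bar>" using y(2) eps_pos by simp
  ultimately show ?thesis using vv rw x y(1) by (auto simp: stopped_ok_def)
 qed
 thus "stopped_ok Q (Suc n) s" "s \<subseteq> fst w" by (auto simp: m_def)
qed

lemma subcell_at:
 assumes v: "regular m v" "\<And>y. y \<in> v ==> (T ^^ m) y \<notin> H"
  and x: "x \<in> interior v" "(T ^^ m) x \<notin> cuts"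
 shows "\<exists>X. X \<in> zones \<and> x \<in> {y\<in>v. (T ^^ m) y \<in> X} \<and> {y\<in>v. (T ^^ m) y \<in> X} \<in> subcells S m v \<and>
  (\<forall>c\<in>subcells S m v. x \<in> c --> c = {y\<in>v. (T ^^ m) y \<in> X})"
proof -
 let ?f = "T ^^ m"
 let ?c = "\<lambda>X. {y\<in>v. ?f y \<in> X}"
 have vi: "is_interval v" "v \<subseteq> {-1..1}" using v(1) by (auto simp: regular_def)
 note sc = subcells_eq[OF v]
 obtain X where X: "X \<in> zones" "?f x \<in> interior X" using zone_exists[OF x(2)] by blast
 have xc: "x \<in> ?c X" using X(2) x(1) interior_subset by auto
 have "open (interior v \<inter> ?f -` interior X)" by (intro open_Int open_vimage continuous_iter) auto
 hence "x \<in> interior (?c X)"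
  using x(1) X(2) by (intro interiorI[of "interior v \<inter> ?f -` interior X"]) (use interior_subset in \<open>auto\<close>)
 hence "nondeg (?c X)" using regular_vimage[OF v(1) zone_interval[OF X(1)]] by (auto simp: nondeg_def)
 hence "0 < len (?c X)" using nondeg_len[of "?c X"] vi by (auto simp: nondeg_def)
 hence cX: "?c X \<in> subcells S m v" using X(1) sc by blast
 show ?thesis
 proof (intro exI conjI ballI impI, rule X(1), rule xc, rule cX)
  fix c assume c: "c \<in> subcells S m v" "x \<in> c"
  then obtain Y where Y: "Y \<in> zones" "c = ?c Y" using sc by blast
  hence "Y = X" using zones_disjoint[of Y X "?f x"] X interior_subset c(2) by blast
  thus "c = ?c X" using Y by simp
 qed
qed

text \<open>Hulls add only points that are mapped into \<open>cuts\<close>. So \<open>x\<close> is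
  in its own subcell, or that subcell is an outer one swallowed by an adjoining innermost-numbered
  cell, of which there is at most one.\<close>

lemma cut_pieces_exact:
 assumes v: "regular m v" "\<And>y. y \<in> v ==> (T ^^ m) y \<notin> H"
  and x: "x \<in> interior v" "(T ^^ m) x \<notin> cuts"
 shows "\<exists>w'. {w'\<in>cut_pieces S m w v. x \<in> fst w'} = {w'}"
proof -
 let ?f = "T ^^ m"
 let ?c = "\<lambda>X. {y\<in>v. ?f y \<in> X}"
 note sc = subcells_eq[OF v]
 obtain X where X: "X \<in> zones" "x \<in> ?c X" "?c X \<in> subcells S m v"
  and sub_eq: "\<And>c. c \<in> subcells S m v ==> x \<in> c ==> c = ?c X" using subcell_at[OF v x] by auto
 let ?ds = "\<lambda>c. {d \<in> subcells S m v. edge_pair S m c d}"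
 let ?h = "\<lambda>c. convex hull (c \<union> \<Union>(?ds c))"
 have hull_sub: "x \<in> c \<or> edge_pair S m c (?c X)" if c: "c \<in> subcells S m v" "inner_at S m c k" "x \<in> ?h c" for c k
 proof -
  obtain Y where Y: "Y \<in> zones" "c = ?c Y" "0 < len c" using c(1) sc by blast
  have "?h c \<subseteq> c \<union> \<Union>(?ds c) \<union> {p. ?f p \<in> cuts}"
  proof (rule hull_touch)
   show "is_interval c" using regular_vimage[OF v(1) zone_interval[OF Y(1)]] Y by simp
   show "c \<noteq> {}" using Y(3) by auto
   fix d assume d: "d \<in> ?ds c"
   then obtain Z where Z: "Z \<in> zones" "d = ?c Z" using sc by blast
   hence "is_interval d" using regular_vimage[OF v(1) zone_interval[OF Z(1)]] by simp
   thus "is_interval d \<and> (d = {} \<or> (\<exists>p\<in>closure c \<inter> closure d. p \<in> {p. ?f p \<in> cuts}))"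
    using edge_pair_zone(3)[OF v c(1,2), of d] d by blast
  qed
  thus ?thesis using c(3) x(2) sub_eq by blast
 qed
 have hull_sup: "c \<union> \<Union>(?ds c) \<subseteq> ?h c" for c by (rule hull_subset)
 have cut_cases: "(\<exists>c k. w' = (?h c, Some (m, k, fst w)) \<and> inner_at S m c k \<and> c \<in> subcells S m v \<and> (c = ?c X \<or> edge_pair S m c (?c X))) \<or>
   (w' = (?c X, snd w) \<and> outer_at S m (?c X) \<and> \<not> (\<exists>c\<in>subcells S m v. edge_pair S m c (?c X)))"
  if w': "w' \<in> cut_pieces S m w v" "x \<in> fst w'" for w'
 proof -
  from w'(1) consider (i) c k where "w' = (?h c, Some (m, k, fst w))" "c \<in> subcells S m v" "inner_at S m c k"
   | (o) d where "w' = (d, snd w)" "d \<in> subcells S m v" "outer_at S m d" "\<not> (\<exists>c\<in>subcells S m v. edge_pair S m c d)"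
   unfolding cut_pieces_def by blast
  thus ?thesis
  proof cases
   case i
   hence "c = ?c X \<or> edge_pair S m c (?c X)" using hull_sub[OF i(2,3)] sub_eq[OF i(2)] w'(2) by auto
   thus ?thesis using i by blast
  next
   case o
   hence "d = ?c X" using sub_eq w'(2) by simp
   thus ?thesis using o by blast
  qed
 qed
 have ne: "?c X \<noteq> {}" using X(2) by blast
 consider (inner) k where "X = cell k" "int k0 \<le> \<bar>k\<bar>" | (outer) "X = {\<delta>..} \<or> X = {..-\<delta>}"
  using X(1) by (auto simp: zones_def)
 thus ?thesis
 proof cases
  case inner
  have inn: "inner_at S m (?c X) k" using inner by (auto simp: inner_at_def)
  have fx: "?f x \<in> cell k" using X(2) inner by simp
  have nout: "\<not> outer_at S m (?c X)"
   using outer_zone[OF X(1) refl ne] X(2) cell_bounds(4)[OF inner(2) fx] by auto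
  have "{w'\<in>cut_pieces S m w v. x \<in> fst w'} = {(?h (?c X), Some (m, k, fst w))}"
  proof (rule Collect_singI)
   show "(?h (?c X), Some (m, k, fst w)) \<in> cut_pieces S m w v" unfolding cut_pieces_def using X(3) inn by blast
   show "x \<in> fst (?h (?c X), Some (m, k, fst w))" unfolding fst_conv using hull_sup[of "?c X"] UnI1[OF X(2)] by (rule subsetD)
   fix w' assume "w' \<in> cut_pieces S m w v" "x \<in> fst w'"
   from cut_cases[OF this] obtain k' where k': "w' = (?h (?c X), Some (m, k', fst w))" "inner_at S m (?c X) k'"
    using nout unfolding edge_pair_def by blast
   hence "?f x \<in> cell k'" "int k0 \<le> \<bar>k'\<bar>" using X(2) by (auto simp: inner_at_def)
   thus "w' = (?h (?c X), Some (m, k, fst w))" using cell_inj[OF _ inner(2) _ fx] k'(1) by simp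
  qed
  thus ?thesis by blast
 next
  case outer
  have out: "outer_at S m (?c X)" using outer_zone[OF X(1) refl ne] outer by simp
  have nin: "\<not> inner_at S m (?c X) k" for k
   using cell_bounds(4)[of k "?f x"] outer X(2) by (auto simp: inner_at_def)
  show ?thesis
  proof (cases "\<exists>c\<in>subcells S m v. edge_pair S m c (?c X)")
   case True
   then obtain c k where c: "c \<in> subcells S m v" "inner_at S m c k" "edge_pair S m c (?c X)"
    unfolding edge_pair_def by blast
   \<comment> \<open>The sign of the image of \<open>x\<close> gives the side, and
     \<open>edge_pair_zone\<close> forces the depth \<open>k0\<close>; so the index and with it the
     subcell are determined.\<close>
   have same: "c' = c \<and> k' = k" if c': "c' \<in> subcells S m v" "inner_at S m c' k'" "edge_pair S m c' (?c X)" for c' k'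
   proof -
    have side: "0 < k \<longleftrightarrow> 0 < ?f x" if "c \<in> subcells S m v" "inner_at S m c k" "edge_pair S m c (?c X)" for c k
    proof -
     have "?f x \<in> (if 0 < k then {\<delta>..} else {..-\<delta>})"
      using edge_pair_zone(2)[OF v that(1,2) X(3) that(3)] X(2) by blast
     thus ?thesis using \<delta>_pos by (auto split: if_splits)
    qed
    have kk: "k' = k"
     using side[OF c] side[OF c'] edge_pair_zone(1)[OF v c(1,2) X(3) c(3)] edge_pair_zone(1)[OF v c'(1,2) X(3) c'(3)]
     by (auto simp: abs_if split: if_splits)
    obtain Y where Y: "Y \<in> zones" "c = ?c Y" "0 < len c" using c(1) sc by blast
    obtain Y' where Y': "Y' \<in> zones" "c' = ?c Y'" "0 < len c'" using c'(1) sc by blast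
    have ne: "c \<noteq> {}" "c' \<noteq> {}" using Y(3) Y'(3) by auto
    show ?thesis using inner_zone[OF Y(1,2) ne(1) c(2)] inner_zone[OF Y'(1,2) ne(2) c'(2)] Y Y' kk by simp
   qed
   have "{w'\<in>cut_pieces S m w v. x \<in> fst w'} = {(?h c, Some (m, k, fst w))}"
   proof (rule Collect_singI)
    show "(?h c, Some (m, k, fst w)) \<in> cut_pieces S m w v" unfolding cut_pieces_def using c by blast
    have "x \<in> \<Union>(?ds c)" using X c by blast
    thus "x \<in> fst (?h c, Some (m, k, fst w))" unfolding fst_conv using hull_sup[of c] by (meson UnI2 subsetD)
    fix w' assume "w' \<in> cut_pieces S m w v" "x \<in> fst w'"
    from cut_cases[OF this] obtain c' k' where c': "w' = (?h c', Some (m, k', fst w))" "inner_at S m c' k'"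
     "c' \<in> subcells S m v" "edge_pair S m c' (?c X)" using True nin by blast
    thus "w' = (?h c, Some (m, k, fst w))" using same[OF c'(3,2,4)] by simp
   qed
   thus ?thesis by blast
  next
   case False
   have "{w'\<in>cut_pieces S m w v. x \<in> fst w'} = {(?c X, snd w)}"
   proof (rule Collect_singI)
    show "(?c X, snd w) \<in> cut_pieces S m w v" unfolding cut_pieces_def using X(3) out False by blast
    show "x \<in> fst (?c X, snd w)" using X(2) by simp
    fix w' assume "w' \<in> cut_pieces S m w v" "x \<in> fst w'"
    from cut_cases[OF this] show "w' = (?c X, snd w)" using nin False by blast
   qed
   thus ?thesis by blast
  qed
 qed
qed

text \<open>Besides the cuts the frontier of the hole is excluded: then a whole neighbourhood of a
  surviving \<open>x\<close> survives, and \<open>x\<close> is interior to its component, as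
  \<open>cut_pieces_exact\<close> requires.\<close>

lemma free_exact:
 assumes w: "piece_ok Q n w" "is_free S (Suc n) w"
  and x: "x \<in> fst w" "x \<notin> frontier (fst w)" "x \<notin> exc (Suc n)" "(T ^^ Suc n) x \<notin> frontier H"
 shows "exact_one (free_pieces (Suc n) w) (free_stopped (Suc n) w) x"
proof -
 define m where "m = Suc n"
 let ?f = "T ^^ m"
 have rw: "regular m (fst w)" using w by (auto simp: piece_ok_def m_def)
 have xi: "x \<in> interior (fst w)" using x interior_or_frontier by blast
 have xcut: "?f x \<notin> cuts" using x(3) unfolding exc_def m_def by blast
 have pcs_sub: "\<exists>v\<in>components {x\<in>fst w. ?f x \<notin> H}. \<not> large S m v \<and> w' \<in> cut_pieces S m w v \<and> fst w' \<subseteq> v"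
  if "w' \<in> free_pieces m w" for w'
  using that cut_pieces_ok(2)[OF w] unfolding free_pieces_def m_def by blast
 have "exact_one (free_pieces m w) (free_stopped m w) x"
 proof (cases "?f x \<in> H")
  case True
  hence "x \<in> {x\<in>fst w. ?f x \<in> H}" using x(1) by simp
  then obtain c where c: "c \<in> components {x\<in>fst w. ?f x \<in> H}" "x \<in> c" by (rule component_at)
  have "{s \<in> free_stopped m w. x \<in> s} = {c}"
  proof -
   have "s = c" if "s \<in> free_stopped m w" "x \<in> s" for s
    using that True c components_disjoint[OF _ c(1)] in_components_subset unfolding free_stopped_def by blast
   thus ?thesis using c unfolding free_stopped_def by blast
  qed
  moreover have "{w' \<in> free_pieces m w. x \<in> fst w'} = {}"
   using pcs_sub True in_components_subset by blast
  ultimately show ?thesis unfolding exact_one_def by blast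
 next
  case False
  hence nc: "?f x \<notin> closure H"
   using x(4) hole_open unfolding m_def frontier_def by (simp add: interior_open)
  have "x \<in> {x\<in>fst w. ?f x \<notin> H}" using x(1) False by simp
  then obtain v where v: "v \<in> components {x\<in>fst w. ?f x \<notin> H}" "x \<in> v" by (rule component_at)
  have vu: "v' = v" if "v' \<in> components {x\<in>fst w. ?f x \<notin> H}" "x \<in> v'" for v'
   using components_disjoint[OF that(1) v(1) that(2) v(2)] .
  note vv = nonhole_component[OF rw v(1)]
  show ?thesis
  proof (cases "large S m v")
   case True
   have "{s \<in> free_stopped m w. x \<in> s} = {v}"
   proof -
    have "s = v" if "s \<in> free_stopped m w" "x \<in> s" for s
     using that False vu in_components_subset unfolding free_stopped_def by blast
    thus ?thesis using v True unfolding free_stopped_def by blast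
   qed
   moreover have "{w' \<in> free_pieces m w. x \<in> fst w'} = {}"
    using pcs_sub vu True by blast
   ultimately show ?thesis unfolding exact_one_def by blast
  next
   case nl: False
   have "open (interior (fst w) \<inter> ?f -` (- closure H))" by (intro open_Int open_vimage continuous_iter) auto
   moreover have "x \<in> interior (fst w) \<inter> ?f -` (- closure H)" using xi nc by blast
   ultimately obtain d where d: "d > 0" "ball x d \<subseteq> interior (fst w) \<inter> ?f -` (- closure H)"
    by (rule openE)
   have "ball x d \<subseteq> {x\<in>fst w. ?f x \<notin> H}"
   proof
    fix y assume "y \<in> ball x d"
    hence "y \<in> interior (fst w)" "?f y \<notin> closure H" using d(2) by blast+
    thus "y \<in> {x\<in>fst w. ?f x \<notin> H}" using interior_subset[of "fst w"] closure_subset[of H] by blast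
   qed
   hence "ball x d \<subseteq> v" using components_maximal[OF v(1), of "ball x d"] v(2) d(1) centre_in_ball[of x d] connected_ball by blast
   hence "x \<in> interior v" using d(1) by (meson centre_in_ball interiorI open_ball)
   then obtain w' where w': "{w'\<in>cut_pieces S m w v. x \<in> fst w'} = {w'}"
    using cut_pieces_exact[OF vv(1,3) _ xcut, of w] by blast
   have "{w'\<in>free_pieces m w. x \<in> fst w'} = {w'}"
   proof -
    have "w'' \<in> cut_pieces S m w v" if "w'' \<in> free_pieces m w" "x \<in> fst w''" for w''
    proof -
     obtain v' where v': "v' \<in> components {x\<in>fst w. ?f x \<notin> H}" "w'' \<in> cut_pieces S m w v'" "fst w'' \<subseteq> v'"
      using pcs_sub[OF `w'' \<in> free_pieces m w`] by blast
     hence "v' = v" using vu[OF v'(1)] `x \<in> fst w''` by blast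
     thus ?thesis using v' by simp
    qed
    moreover have "cut_pieces S m w v \<subseteq> free_pieces m w" unfolding free_pieces_def using v nl by blast
    ultimately show ?thesis using w' by blast
   qed
   moreover have "{s \<in> free_stopped m w. x \<in> s} = {}"
    using False vu nl in_components_subset unfolding free_stopped_def by blast
   ultimately show ?thesis unfolding exact_one_def by blast
  qed
 qed
 thus ?thesis by (simp add: m_def)
qed

lemma deeper_iff:
 "deeper u g \<longleftrightarrow> (\<exists>t k P. snd u = Some (t, k, P) \<and> snd g = Some (t, k + sgn k, P)) \<and> abut (fst u) (fst g)"
proof (cases u; cases g)
 fix \<omega> p F p' assume "u = (\<omega>, p)" "g = (F, p')"
 thus ?thesis by (cases p; cases p') auto
qed

lemma due_iff: "due_large S n u \<longleftrightarrow> (\<exists>t k P. snd u = Some (t, k, P) \<and> n = t + bound_time S k) \<and> large S n (fst u)"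
proof (cases u)
 fix \<omega> p assume "u = (\<omega>, p)"
 thus ?thesis by (cases p) auto
qed

lemma free_iff: "is_free S n u \<longleftrightarrow> (\<forall>t k P. snd u = Some (t, k, P) --> t + bound_time S k < n)"
proof (cases u)
 fix \<omega> p assume "u = (\<omega>, p)"
 thus ?thesis by (cases p) auto
qed

text \<open>The heart of the release rule. \<open>u\<close> and \<open>g\<close> meet at the point
  \<open>p\<close> lying over the common endpoint of their cells. The remainder is the part of
  \<open>u\<close> next to \<open>p\<close> that sees no covered reference interval; by
  \<open>ref_inside\<close> its image is within 4 \<epsilon> of that of \<open>p\<close>, and it
  cannot reach beyond the cell of \<open>u\<close>, whose image is long. Hence it is
  \<open>bindable\<close> at the deeper index, and what is left of \<open>u\<close> is still large
  enough to stop.\<close>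

lemma remainder_facts:
 assumes u: "piece_ok Q n u" and g: "piece_ok Q n g"
  and due: "due_large S (Suc n) u" and deep: "deeper u g"
  and su: "snd u = Some (t, k, P)"
 defines "R \<equiv> remainder S (Suc n) (fst u) (fst g)"
 shows "\<exists>p\<in>P. p \<in> closure (fst u) \<inter> closure (fst g) \<and> \<bar>(T ^^ t) p\<bar> = e (Suc (nat \<bar>k\<bar>)) \<and>
   sgn ((T ^^ t) p) = sgn (real_of_int k) \<and> (R \<noteq> {} --> p \<in> closure R)"
  and "is_interval R" "R \<subseteq> fst u"
  and "\<And>y. y \<in> R ==> bindable (k + sgn k) ((T ^^ t) y)"
  and "stopped_ok Q (Suc n) (fst u - R)"
  and "\<And>y. y \<in> fst g ==> \<bar>(T ^^ t) y\<bar> < e (Suc (nat \<bar>k\<bar>)) \<and> sgn ((T ^^ t) y) = sgn (real_of_int k)"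
proof -
 define m where "m = Suc n"
 define l where "l = nat \<bar>k\<bar>"
 define E where "E = fst u"
 define F where "F = fst g"
 define \<sigma> where "\<sigma> = sgn (real_of_int k)"
 \<comment> \<open>The modulus of the image at the time of the passage, written as a signed multiple
   so that it is monotone along the parent \<open>P\<close>; it separates \<open>E\<close> from
   \<open>F\<close> and orders points by depth.\<close>
 define s where "s y = \<sigma> * (T ^^ t) y" for y
 have sg: "snd g = Some (t, k + sgn k, P)" "abut E F" using deep su by (auto simp: deeper_iff E_def F_def)
 have m: "m = t + bound_time S k" "large S m E" using due su by (auto simp: due_iff m_def E_def)
 have uu: "nondeg E" "E \<subseteq> Q" "regular m E" "t \<le> n" "P \<subseteq> Q" "E \<subseteq> P" "regular t P" "int k0 \<le> \<bar>k\<bar>"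
   "\<And>y. y \<in> E ==> bindable k ((T ^^ t) y)"
  using u su by (auto simp: piece_ok_def m_def E_def)
 have gg: "nondeg F" "F \<subseteq> P" "int k0 \<le> \<bar>k + sgn k\<bar>"
   "\<And>y. y \<in> F ==> bindable (k + sgn k) ((T ^^ t) y)"
   "k0 < nat \<bar>k + sgn k\<bar> \<and> n < t + bt (nat \<bar>k + sgn k\<bar> - 1) --> (\<forall>y\<in>F. \<bar>(T ^^ t) y\<bar> < e (nat \<bar>k + sgn k\<bar>))"
  using g sg by (auto simp: piece_ok_def F_def)
 have l: "k0 \<le> l" "bound_time S k = bt l" "nat \<bar>k + sgn k\<bar> = Suc l" "sgn (k + sgn k) = sgn k"
  using uu(8) depth_pos bound_time_abs[OF uu(8)] by (auto simp: l_def le_nat_iff sgn_if abs_if split: if_splits)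
 have sgn': "sgn (real_of_int (k + sgn k)) = \<sigma>"
  using l(4) depth_pos uu(8) by (auto simp: \<sigma>_def sgn_if split: if_splits)
 have \<sigma>: "\<sigma> * \<sigma> = 1" "\<bar>\<sigma>\<bar> = 1" "\<sigma> = 1 \<or> \<sigma> = -1" using uu(8) depth_pos by (auto simp: \<sigma>_def sgn_if)
 have Pi: "is_interval P" "P \<subseteq> {-1..1}" using uu(7) by (auto simp: regular_def)
 have Ei: "is_interval E" using uu(1) by (simp add: nondeg_def)
 have Fi: "is_interval F" using gg(1) by (simp add: nondeg_def)
 have s_abs: "s y = \<bar>(T ^^ t) y\<bar>" if "sgn ((T ^^ t) y) = \<sigma>" for y
  unfolding s_def that[symmetric] by (simp add: sgn_if)
 have sE: "e (Suc l) \<le> s y" "sgn ((T ^^ t) y) = \<sigma>" if "y \<in> E" for y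
  using uu(9)[OF that] s_abs[of y] by (auto simp: bindable_def l_def \<sigma>_def)
 have Tm: "(T ^^ m) x = (T ^^ bt l) ((T ^^ t) x)" for x using m(1) l(2) by (simp add: iter_add)
 \<comment> \<open>The deeper piece has absorbed nothing yet, because this is only possible at the
   end of the bound period of its shallower neighbour. So the last clause of \<open>piece_ok\<close>
   applies to it at time \<open>n\<close>.\<close>
 have nlt: "n < t + bt l" using m l(2) by (simp add: m_def)
 have sF: "e (Suc (Suc l)) \<le> s y" "s y < e (Suc l)" "sgn ((T ^^ t) y) = \<sigma>" if "y \<in> F" for y
 proof -
  have b: "bindable (k + sgn k) ((T ^^ t) y)" using gg(4)[OF that] .
  thus sg: "sgn ((T ^^ t) y) = \<sigma>" using sgn' by (simp add: bindable_def)
  show "e (Suc (Suc l)) \<le> s y" using b s_abs[OF sg] unfolding bindable_def l(3) by simp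
  show "s y < e (Suc l)" using gg(5) nlt l that s_abs[OF sg] by simp
 qed
 have cs: "continuous_on X s" for X unfolding s_def by (intro continuous_intros)
 have sbet: "y \<in> open_segment x z \<longleftrightarrow> s y \<in> open_segment (s x) (s z)" if "x \<in> P" "y \<in> P" "z \<in> P" for x y z
 proof -
  have "(T ^^ t) y \<in> open_segment ((T ^^ t) x) ((T ^^ t) z) \<longleftrightarrow> s y \<in> open_segment (s x) (s z)"
   using \<sigma>(3) by (auto simp: s_def open_segment_eq_real_ivl split: if_splits)
  thus ?thesis using regular_between[OF uu(7) that] by simp
 qed
 obtain y1 where y1: "y1 \<in> E" using uu(1) nondeg_obtain by metis
 obtain y2 where y2: "y2 \<in> F" using gg(1) nondeg_obtain by metis
 obtain p where p: "p \<in> closure E" "p \<in> closure F" using sg(2) by (auto simp: abut_def)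
 have sp: "s p = e (Suc l)"
 proof (rule antisym)
  have "closed (s -` {..e (Suc l)})" "closed (s -` {e (Suc l)..})" by (intro closed_vimage cs closed_atMost closed_atLeast)+
  hence "closure F \<subseteq> s -` {..e (Suc l)}" "closure E \<subseteq> s -` {e (Suc l)..}"
   using sE sF by (intro closure_minimal; force)+
  thus "s p \<le> e (Suc l)" "e (Suc l) \<le> s p" using p by auto
 qed
 have disj: "y \<notin> F" if "y \<in> E" for y using sE(1)[OF that] sF(2)[of y] by auto
 \<comment> \<open>Were \<open>p\<close> outside the interval \<open>P\<close>, both
   \<open>E\<close> and \<open>F\<close> would approach it from the same side and one would contain
   a point of the other.\<close>
 have pP: "p \<in> P"
 proof (rule ccontr)
  assume np: "p \<notin> P"
  have "p \<notin> {y1..y2}" "p \<notin> {y2..y1}"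
   using interval_Icc[OF Pi(1), of y1 y2] interval_Icc[OF Pi(1), of y2 y1] y1 y2 uu(6) gg(2) np by blast+
  hence "y1 \<in> open_segment y2 p \<or> y2 \<in> open_segment y1 p \<or> y1 = y2"
   using np y1 y2 uu(6) gg(2) by (auto simp: open_segment_eq_real_ivl)
  thus False
   using closure_interval_cases[OF Fi y2 p(2)] closure_interval_cases[OF Ei y1 p(1)] disj y1 y2 by blast
 qed
 have Tp: "\<bar>(T ^^ t) p\<bar> = e (Suc l)" "sgn ((T ^^ t) p) = \<sigma>"
 proof -
  have "(T ^^ t) p = \<sigma> * e (Suc l)" using sp \<sigma>(1) by (metis mult.left_commute mult_1 s_def mult.commute)
  thus "\<bar>(T ^^ t) p\<bar> = e (Suc l)" "sgn ((T ^^ t) p) = \<sigma>" using \<sigma>(3) by (auto simp: abs_mult sgn_mult)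
 qed
 define Z where "Z = {z\<in>E. (T ^^ m) z \<in> \<Union>(covered S ((T ^^ m) ` E))}"
 have R: "R = {x\<in>E. \<forall>z\<in>Z. s x < s z}"
 proof -
  have "(\<forall>g\<in>F. x \<in> open_segment z g) \<longleftrightarrow> s x < s z" if "x \<in> E" "z \<in> E" for x z
  proof -
   have "x \<in> open_segment z g \<longleftrightarrow> s x < s z" if g: "g \<in> F" for g
    using sbet[of z x g] g `x \<in> E` `z \<in> E` uu(6) gg(2) sE(1)[of x] sE(1)[of z] sF(2)[of g]
    by (auto simp: open_segment_eq_real_ivl subset_iff)
   thus ?thesis using y2 by blast
  qed
  thus ?thesis unfolding R_def remainder_def iter_T m_def[symmetric] E_def[symmetric] F_def[symmetric] Z_def by blast
 qed
 have segE: "open_segment y p \<subseteq> E" if "y \<in> E" for y using closure_interval_cases[OF Ei that p(1)] .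
 have sseg: "s p < s x \<and> s x < s y" if "y \<in> E" "x \<in> open_segment y p" for x y
 proof -
  have "x \<in> E" using segE that by blast
  hence "s x \<in> open_segment (s y) (s p)" using sbet[of y x p] that uu(6) pP by blast
  thus ?thesis using sE(1)[OF that(1)] sp by (auto simp: open_segment_eq_real_ivl split: if_splits)
 qed
 have Rsub: "R \<subseteq> E" using R by blast
 have injs: "inj_on s E"
  using inj_on_subset[OF regular_inj[OF uu(7)] uu(6)] \<sigma>(3) by (auto simp: inj_on_def s_def)
 have Rint: "is_interval R" "is_interval (E - R)"
 proof -
  have "is_interval {v. \<forall>z\<in>Z. v < s z}" "is_interval (- {v. \<forall>z\<in>Z. v < s z})"
   unfolding is_interval_1 by (auto intro: le_less_trans simp: not_less) (meson order_trans)
  from this[THEN interval_vimage[OF Ei cs injs]] show "is_interval R" "is_interval (E - R)"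
   unfolding R by (simp_all add: set_diff_eq cong: conj_cong)
 qed
 have Rclos: "R \<noteq> {} --> p \<in> closure R"
 proof
  assume "R \<noteq> {}"
  then obtain x where x: "x \<in> R" by blast
  show "p \<in> closure R"
  proof (cases "x = p")
   case True thus ?thesis using x closure_subset by blast
  next
   case False
   have "open_segment x p \<subseteq> R"
    using segE[of x] sseg[of x] x unfolding R by force
   hence "closure (open_segment x p) \<subseteq> closure R" by (rule closure_mono)
   thus ?thesis using False by auto
  qed
 qed
 have img: "(T ^^ m) y \<notin> H" "(T ^^ m) y \<in> {1 - a..1}" if "y \<in> E" for y
 proof -
  have "gap (bt l) ((T ^^ t) y) < r"
   using shadow[OF uu(9)[OF that], of "bt l"] l bt_pos by simp
  hence "\<bar>(T ^^ m) y - crit (bt l)\<bar> < r" using m(1) l(2) by (simp add: gap_def iter_add)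
  thus "(T ^^ m) y \<notin> H" using hole_far[of "bt l" "(T ^^ m) y"] bt_pos[OF l(1)] by auto
  show "(T ^^ m) y \<in> {1 - a..1}" using that uu(6) Pi by (intro iter_range') (auto simp: m_def)
 qed
 \<comment> \<open>A reference interval in the image of points no higher than \<open>y\<close> would
   be covered and so put a point of \<open>Z\<close> no higher than \<open>y\<close>, against the
   definition of the remainder.\<close>
 have no_ref: False
  if y: "y \<in> R" and X: "X \<subseteq> E" "\<And>x. x \<in> X ==> s x \<le> s y" and \<alpha>\<beta>: "{\<alpha><..<\<beta>} \<subseteq> (T ^^ m) ` X" "4 * \<epsilon> < \<beta> - \<alpha>" for y X \<alpha> \<beta>
 proof -
  have "{\<alpha><..<\<beta>} \<subseteq> {1 - a..1} - H" using img X(1) \<alpha>\<beta>(1) by blast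
  then obtain L where L: "L \<in> set (refs S)" "L \<subseteq> {\<alpha><..<\<beta>}" "nondeg L" using ref_inside \<alpha>\<beta>(2) by blast
  then obtain \<zeta> where "\<zeta> \<in> L" using nondeg_obtain by metis
  then obtain x where x: "x \<in> X" "(T ^^ m) x = \<zeta>" using L(2) \<alpha>\<beta>(1) by blast
  have "L \<in> covered S ((T ^^ m) ` E)" using L(1,2) \<alpha>\<beta>(1) X(1) interior_subset[of L] unfolding covered_def by blast
  hence "x \<in> Z" using x `\<zeta> \<in> L` X(1) unfolding Z_def by blast
  hence "s y < s x" using y unfolding R by blast
  thus False using X(2)[OF x(1)] by simp
 qed
 have near: "\<bar>(T ^^ m) y - (T ^^ m) p\<bar> \<le> 4 * \<epsilon>" if y: "y \<in> R" for y
 proof (rule ccontr)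
  assume far: "\<not> ?thesis"
  let ?A = "(T ^^ m) y" and ?B = "(T ^^ m) p"
  have "{min ?A ?B<..<max ?A ?B} \<subseteq> (T ^^ m) ` open_segment y p"
  proof
   fix \<xi> assume \<xi>: "\<xi> \<in> {min ?A ?B<..<max ?A ?B}"
   hence "\<xi> \<in> closed_segment ?A ?B" by (auto simp: closed_segment_eq_real_ivl min_def max_def split: if_splits)
   then obtain z where z: "z \<in> closed_segment y p" "(T ^^ m) z = \<xi>" by (rule iter_segment)
   hence "z \<noteq> y" "z \<noteq> p" using \<xi> by (auto simp: min_def max_def split: if_splits)
   thus "\<xi> \<in> (T ^^ m) ` open_segment y p" using z by (auto simp: open_segment_def)
  qed
  moreover have "4 * \<epsilon> < max ?A ?B - min ?A ?B" using far by (auto simp: min_def max_def abs_if split: if_splits)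
  moreover have "y \<in> E" using y Rsub by blast
  moreover have "s x \<le> s y" if "x \<in> open_segment y p" for x using sseg[OF `y \<in> E` that] by simp
  ultimately show False
   using no_ref[OF y segE[OF `y \<in> E`]] by blast
 qed
 \<comment> \<open>If \<open>y\<close> were above the cell, the segment from \<open>y\<close> to
   \<open>p\<close> would contain the preimage of the whole cell, whose image at the end of the
   bound period has length at least 4^8 \<epsilon> and therefore contains a reference
   interval.\<close>
 have upper: "s y \<le> e l" if y: "y \<in> R" for y
 proof (rule ccontr)
  assume yl: "\<not> s y \<le> e l"
  have yE: "y \<in> E" using y Rsub by blast
  define X where "X = {x \<in> open_segment y p. (T ^^ t) x \<in> cell k}"
  have cellX: "\<exists>x\<in>X. (T ^^ t) x = c" if c: "c \<in> cell k" for c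
  proof -
   note cb = cell_bounds[OF uu(8) c]
   have "\<sigma> * c = \<bar>c\<bar>" using cb(1) by (simp add: \<sigma>_def[symmetric]) (metis abs_sgn mult.commute)
   hence "s p < \<sigma> * c" "\<sigma> * c < s y" using cb(2,3) sp yl by (auto simp: l_def)
   hence "c \<in> open_segment ((T ^^ t) y) ((T ^^ t) p)"
    using \<sigma>(3) by (auto simp: s_def open_segment_eq_real_ivl)
   hence c': "c \<in> closed_segment ((T ^^ t) y) ((T ^^ t) p)" "c \<noteq> (T ^^ t) y" "c \<noteq> (T ^^ t) p" by (auto simp: open_segment_def)
   from c'(1) obtain z where z: "z \<in> closed_segment y p" "(T ^^ t) z = c" by (rule iter_segment)
   hence "z \<in> X" using c' c by (auto simp: X_def open_segment_def)
   thus ?thesis using z by blast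
  qed
  have img_cell: "(T ^^ bt l) ` cell k \<subseteq> (T ^^ m) ` X" using cellX Tm by (force simp: image_iff)
  have ci: "is_interval ((T ^^ bt l) ` cell k)" by (intro interval_image_iter cell_interval)
  have big: "4 ^ 8 * \<epsilon> \<le> len ((T ^^ bt l) ` cell k)" using cell_growth[OF uu(8)] l(2) by simp
  hence "(T ^^ bt l) ` cell k \<noteq> {}" using eps_pos by auto
  then obtain A where A: "A \<in> (T ^^ bt l) ` cell k" by blast
  obtain B where B: "B \<in> (T ^^ bt l) ` cell k" "4 ^ 7 * \<epsilon> \<le> \<bar>A - B\<bar>" using two_far[OF big ci A] by blast
  have "{min A B<..<max A B} \<subseteq> (T ^^ bt l) ` cell k"
   using interval_Ioo[OF ci A B(1)] interval_Ioo[OF ci B(1) A] by (auto simp: min_def max_def)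
  moreover have "4 * \<epsilon> < max A B - min A B" using B(2) eps_pos by (auto simp: min_def max_def abs_if split: if_splits)
  moreover have "X \<subseteq> E" using segE[OF yE] unfolding X_def by blast
  moreover have "s x \<le> s y" if "x \<in> X" for x using sseg[OF yE, of x] that unfolding X_def by simp
  ultimately show False
   using no_ref[OF y, of X "min A B" "max A B"] img_cell by (meson subset_trans)
 qed
 have bnd: "bindable (k + sgn k) ((T ^^ t) y)" if y: "y \<in> R" for y
 proof -
  have yE: "y \<in> E" using y Rsub by blast
  have ay: "\<bar>(T ^^ t) y\<bar> = s y" using s_abs[OF sE(2)[OF yE]] by simp
  have "(T ^^ m) p = (T ^^ bt l) \<bar>(T ^^ t) p\<bar>" using bt_pos[OF l(1)] by (simp only: Tm) (simp add: iter_abs)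
  hence mp: "(T ^^ m) p = (T ^^ bt l) (e (Suc l))" using Tp by simp
  have "e (Suc (Suc l)) \<le> s y" using sE(1)[OF yE] by (rule order_trans[rotated]) simp
  thus ?thesis
   unfolding bindable_def l(3) ay using gg(3) sE(2)[OF yE] sgn' upper[OF y] near[OF y] l(1) mp Tm by simp
 qed
 have "stopped_ok Q m (E - R)"
 proof -
  have big: "4 ^ 8 * \<epsilon> \<le> len ((T ^^ m) ` E)" using m(2) by (simp add: large_def)
  obtain B where B: "B \<in> (T ^^ m) ` E" "4 ^ 7 * \<epsilon> \<le> \<bar>(T ^^ m) y1 - B\<bar>"
   using two_far[OF big interval_image_iter[OF Ei], of "(T ^^ m) y1"] y1 by blast
  then obtain x2 where x2: "x2 \<in> E" "4 ^ 7 * \<epsilon> \<le> \<bar>(T ^^ m) y1 - (T ^^ m) x2\<bar>" by blast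
  have step: "\<exists>x\<in>E - R. \<exists>y\<in>E - R. 4 ^ 6 * \<epsilon> \<le> \<bar>(T ^^ m) x - (T ^^ m) y\<bar>"
   if xy: "x \<in> E" "y \<in> E" "4 ^ 7 * \<epsilon> \<le> \<bar>(T ^^ m) x - (T ^^ m) y\<bar>" "y \<notin> R" for x y
  proof (cases "x \<in> R")
   case False
   thus ?thesis using xy eps_pos by (intro bexI[of _ x] bexI[of _ y]) auto
  next
   case True
   define \<tau> where "\<tau> = sgn ((T ^^ m) y - (T ^^ m) x)"
   \<comment> \<open>All images of the remainder lie within 4 \<epsilon> of that of
     \<open>p\<close>, so 13 \<epsilon> towards the other end is outside it, and 4^7 \<epsilon> - 13
     \<epsilon> still exceeds 4^6 \<epsilon>.\<close>
   define \<xi> where "\<xi> = (T ^^ m) x + \<tau> * (13 * \<epsilon>)"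
   have \<xi>: "\<xi> \<in> closed_segment A B \<and> \<bar>\<xi> - A\<bar> = 13 * \<epsilon> \<and> 4 ^ 6 * \<epsilon> \<le> \<bar>\<xi> - B\<bar>"
    if "\<xi> = A + sgn (B - A) * (13 * \<epsilon>)" "4 ^ 7 * \<epsilon> \<le> \<bar>A - B\<bar>" for \<xi> A B :: real
   proof -
    have "4 ^ 6 * \<epsilon> = 4096 * \<epsilon>" "4 ^ 7 * \<epsilon> = 16384 * \<epsilon>" by simp_all
    moreover have "A \<noteq> B" using that(2) eps_pos by auto
    ultimately show ?thesis
     using that eps_pos by (cases "A < B") (auto simp: closed_segment_eq_real_ivl abs_if split: if_splits)
   qed
   from \<xi>[OF \<xi>_def[unfolded \<tau>_def] xy(3)]
   have "\<xi> \<in> closed_segment ((T ^^ m) x) ((T ^^ m) y)" "\<bar>\<xi> - (T ^^ m) x\<bar> = 13 * \<epsilon>"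
     "4 ^ 6 * \<epsilon> \<le> \<bar>\<xi> - (T ^^ m) y\<bar>" by blast+
   moreover from this(1) obtain z where z: "z \<in> closed_segment x y" "(T ^^ m) z = \<xi>" by (rule iter_segment)
   ultimately have zf: "\<bar>(T ^^ m) z - (T ^^ m) x\<bar> = 13 * \<epsilon>" "4 ^ 6 * \<epsilon> \<le> \<bar>(T ^^ m) z - (T ^^ m) y\<bar>" by auto
   have "z \<in> E" using z(1) interval_Icc[OF Ei xy(1,2)] interval_Icc[OF Ei xy(2,1)]
    by (auto simp: closed_segment_eq_real_ivl split: if_splits)
   moreover have "z \<notin> R"
   proof
    assume "z \<in> R"
    from near[OF this] near[OF True] zf(1) eps_pos show False by linarith
   qed
   ultimately show ?thesis using zf(2) xy(2,4) by blast
  qed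
  have ex: "\<exists>x\<in>E - R. \<exists>y\<in>E - R. 4 ^ 6 * \<epsilon> \<le> \<bar>(T ^^ m) x - (T ^^ m) y\<bar>"
  proof (cases "x2 \<in> R")
   case False
   thus ?thesis using step[OF y1 x2] by blast
  next
   case True
   have "y1 \<notin> R"
   proof
    assume "y1 \<in> R"
    have "4 ^ 7 * \<epsilon> = 16384 * \<epsilon>" by simp
    with near[OF `y1 \<in> R`] near[OF True] x2(2) eps_pos show False by linarith
   qed
   thus ?thesis using step[OF x2(1) y1] x2(2) by (simp add: abs_minus_commute)
  qed
  then obtain x y where xy: "x \<in> E - R" "y \<in> E - R" "4 ^ 6 * \<epsilon> \<le> \<bar>(T ^^ m) x - (T ^^ m) y\<bar>" by blast
  hence "x \<noteq> y" using eps_pos by auto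
  hence "nondeg (E - R)" using nondeg_two[OF Rint(2) xy(1,2)] by simp
  moreover have "(T ^^ m) ` (E - R) \<inter> H = {}" using img by blast
  ultimately show ?thesis
   using ex uu(2) regular_subset[OF uu(3) _ Rint(2)] by (auto simp: stopped_ok_def)
 qed
 thus "stopped_ok Q (Suc n) (fst u - R)" by (simp add: m_def E_def)
 show "\<exists>p\<in>P. p \<in> closure (fst u) \<inter> closure (fst g) \<and> \<bar>(T ^^ t) p\<bar> = e (Suc (nat \<bar>k\<bar>)) \<and>
   sgn ((T ^^ t) p) = sgn (real_of_int k) \<and> (R \<noteq> {} --> p \<in> closure R)"
  using pP p Tp Rclos by (auto simp: E_def F_def l_def \<sigma>_def)
 show "is_interval R" by (rule Rint(1))
 show "R \<subseteq> fst u" using Rsub by (simp add: E_def)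
 show "\<And>y. y \<in> R ==> bindable (k + sgn k) ((T ^^ t) y)" by (rule bnd)
 show "\<bar>(T ^^ t) y\<bar> < e (Suc (nat \<bar>k\<bar>)) \<and> sgn ((T ^^ t) y) = sgn (real_of_int k)" if "y \<in> fst g" for y
  using sF[of y] s_abs[of y] that by (simp add: F_def l_def \<sigma>_def)
qed

end

lemma open_open_segment: "open (open_segment x (y::real))"
 by (auto simp: open_segment_eq_real_ivl)

lemma segments_overlap:
 assumes "(p::real) \<notin> open_segment y y'" "y \<noteq> p" "y' \<noteq> p"
 shows "open_segment y p \<inter> open_segment y' p \<noteq> {}"
proof (cases "y < p")
 case True
 hence "y' < p" using assms by (cases "y' < p") (auto simp: open_segment_eq_real_ivl)
 hence "(max y y' + p) / 2 \<in> open_segment y p" "(max y y' + p) / 2 \<in> open_segment y' p"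
  using True by (auto simp: open_segment_eq_real_ivl)
 thus ?thesis by blast
next
 case False
 hence "p < y" using assms by simp
 hence "p < y'" using assms by (cases "p < y'") (auto simp: open_segment_eq_real_ivl)
 hence "(min y y' + p) / 2 \<in> open_segment y p" "(min y y' + p) / 2 \<in> open_segment y' p"
  using `p < y` by (auto simp: open_segment_eq_real_ivl)
 thus ?thesis by blast
qed

section \<open>One time step: absorption, exactness, preservation of the invariants\<close>

context mis_scheme
begin

lemma finite_frontier_hole: "finite (frontier H)"
proof -
 have "H = \<Union>(components H)" by simp
 hence "frontier H \<subseteq> (\<Union>c\<in>components H. frontier c)"
  using frontier_Union_subset[OF hole_fin] by simp
 moreover have "finite (frontier c)" if "c \<in> components H" for c
  using in_components_connected[OF that] by (intro interval_finite_frontier) (simp add: is_interval_connected_1)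
 ultimately show ?thesis using hole_fin by (meson finite_UN_I finite_subset)
qed

definition inv_pieces :: "real set => nat => piece set => bool" where
 "inv_pieces Q n W \<longleftrightarrow> (\<forall>w\<in>W. piece_ok Q n w) \<and>
   (\<forall>w\<in>W. \<forall>w'\<in>W. w \<noteq> w' --> interior (fst w) \<inter> interior (fst w') = {})"

lemma inv_countable: assumes "inv_pieces Q n W" shows "countable W"
proof -
 have ne: "interior (fst w) \<noteq> {}" if "w \<in> W" for w
  using assms that by (auto simp: inv_pieces_def piece_ok_def nondeg_def)
 have inj: "inj_on (\<lambda>w. interior (fst w)) W"
 proof (rule inj_onI, rule ccontr)
  fix w w' assume "w \<in> W" "w' \<in> W" "interior (fst w) = interior (fst w')" "w \<noteq> w'"
  hence "interior (fst w) \<inter> interior (fst w) = {}" using assms unfolding inv_pieces_def by metis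
  thus False using ne[OF `w \<in> W`] by simp
 qed
 have "pairwise disjnt ((\<lambda>w. interior (fst w)) ` W)"
  unfolding pairwise_def disjnt_def
 proof (intro ballI impI)
  fix X Y assume "X \<in> (\<lambda>w. interior (fst w)) ` W" "Y \<in> (\<lambda>w. interior (fst w)) ` W" "X \<noteq> Y"
  then obtain w w' where "w \<in> W" "w' \<in> W" "w \<noteq> w'" "X = interior (fst w)" "Y = interior (fst w')" by blast
  thus "X \<inter> Y = {}" using assms unfolding inv_pieces_def by simp
 qed
 hence "countable ((\<lambda>w. interior (fst w)) ` W)"
  by (intro countable_disjoint_open_subsets) auto
 thus ?thesis using countable_image_inj_on inj by blast
qed

lemma piece_data:
 assumes "piece_ok Q n w" "snd w = Some (t, k, P)"
 shows "t \<le> n" "P \<subseteq> Q" "fst w \<subseteq> P" "regular t P" "int k0 \<le> \<bar>k\<bar>"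
 using assms by (simp_all add: piece_ok_def)

lemma piece_nondeg: "piece_ok Q n w ==> nondeg (fst w)"
 by (simp add: piece_ok_def)

lemma piece_interval: "piece_ok Q n w ==> is_interval (fst w)"
 by (simp add: piece_ok_def nondeg_def)

lemma exact_one_unique:
 assumes "exact_one A B x"
 shows "w \<in> A ==> w' \<in> A ==> x \<in> fst w ==> x \<in> fst w' ==> w = w'"
  and "s \<in> B ==> s' \<in> B ==> x \<in> s ==> x \<in> s' ==> s = s'"
  and "w \<in> A ==> x \<in> fst w ==> s \<in> B ==> x \<notin> s"
  and "(\<exists>w\<in>A. x \<in> fst w) \<or> (\<exists>s\<in>B. x \<in> s)"
proof -
 define X where "X = {w\<in>A. x \<in> fst w}"
 define Y where "Y = {s\<in>B. x \<in> s}"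
 have XY: "(\<exists>w. X = {w} \<and> Y = {}) \<or> (X = {} \<and> (\<exists>s. Y = {s}))"
  using assms unfolding exact_one_def X_def Y_def .
 have X: "w \<in> X" if "w \<in> A" "x \<in> fst w" for w using that by (simp add: X_def)
 have Y: "s \<in> Y" if "s \<in> B" "x \<in> s" for s using that by (simp add: Y_def)
 show "w \<in> A ==> w' \<in> A ==> x \<in> fst w ==> x \<in> fst w' ==> w = w'"
  using XY X[of w] X[of w'] by auto
 show "s \<in> B ==> s' \<in> B ==> x \<in> s ==> x \<in> s' ==> s = s'"
  using XY Y[of s] Y[of s'] by auto
 show "w \<in> A ==> x \<in> fst w ==> s \<in> B ==> x \<notin> s"
  using XY X[of w] Y[of s] by auto
 have "X \<noteq> {} \<or> Y \<noteq> {}" using XY by auto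
 thus "(\<exists>w\<in>A. x \<in> fst w) \<or> (\<exists>s\<in>B. x \<in> s)" unfolding X_def Y_def by blast
qed

definition ext_piece :: "nat => piece set => piece => piece" where
 "ext_piece m W w = (convex hull (fst w \<union>
   \<Union>{remainder S m (fst u) (fst w) | u. u \<in> W \<and> released S m W u \<and> deeper u w}), snd w)"

definition rest :: "nat => piece set => piece => real set" where
 "rest m W w = fst w - \<Union>{remainder S m (fst w) (fst g) | g. g \<in> W \<and> deeper w g}"

lemma next_pieces_eq: "next_pieces S m W = (\<Union>w\<in>{w\<in>W. is_free S m w}. free_pieces m w) \<union>
  {ext_piece m W w | w. w \<in> W \<and> \<not> is_free S m w \<and> \<not> released S m W w}"
 unfolding next_pieces_def free_pieces_def ext_piece_def iter_T by blast

lemma next_stopped_eq: "next_stopped S m W = (\<Union>w\<in>{w\<in>W. is_free S m w}. free_stopped m w) \<union>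
  ({rest m W w | w. w \<in> W \<and> released S m W w} - {{}})"
 unfolding next_stopped_def free_stopped_def rest_def iter_T by blast

lemma released_not_free: "released S m W w ==> \<not> is_free S m w"
 by (auto simp: released_def due_iff free_iff)

text \<open>Deeper cells have longer bound periods, and \<open>released\<close> gives the shallower
  of two simultaneous candidates precedence. So the piece meant to absorb the remainder does
  continue.\<close>

lemma deeper_target:
 assumes W: "inv_pieces Q n W" and u: "u \<in> W" "released S (Suc n) W u" and g: "g \<in> W" "deeper u g"
 shows "\<not> is_free S (Suc n) g" "\<not> released S (Suc n) W g"
proof -
 obtain t k P where s: "snd u = Some (t, k, P)" "snd g = Some (t, k + sgn k, P)" using g by (auto simp: deeper_iff)
 have due: "Suc n = t + bound_time S k" using u s by (auto simp: released_def due_iff)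
 have k: "int k0 \<le> \<bar>k\<bar>" using W u s by (auto simp: inv_pieces_def piece_ok_def)
 have k': "int k0 \<le> \<bar>k + sgn k\<bar>" "nat \<bar>k\<bar> \<le> nat \<bar>k + sgn k\<bar>" using k by (auto simp: sgn_if abs_if)
 have "bound_time S k \<le> bound_time S (k + sgn k)"
  using bt_mono[of "nat \<bar>k\<bar>" "nat \<bar>k + sgn k\<bar>"] k k' bound_time_abs[OF k] bound_time_abs[OF k'(1)]
  by (simp add: le_nat_iff)
 thus "\<not> is_free S (Suc n) g" using due s by (auto simp: free_iff)
 show "\<not> released S (Suc n) W g" using u g by (auto simp: released_def)
qed

text \<open>Two such neighbours would touch \<open>u\<close> at the same point, as the iterate at
  the passage is injective on the parent, and would lie on the same side of it; their interiors
  would overlap.\<close>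

lemma deeper_unique:
 assumes W: "inv_pieces Q n W" and u: "u \<in> W" "released S (Suc n) W u"
  and g: "g \<in> W" "deeper u g" "g' \<in> W" "deeper u g'"
 shows "g = g'"
proof (rule ccontr)
 assume ne: "g \<noteq> g'"
 obtain t k P where su: "snd u = Some (t, k, P)" using g by (auto simp: deeper_iff)
 have ok: "piece_ok Q n u" "piece_ok Q n g" "piece_ok Q n g'" using W u g by (auto simp: inv_pieces_def)
 have due: "due_large S (Suc n) u" using u by (simp add: released_def)
 note f = remainder_facts[OF ok(1,2) due g(2) su] and f' = remainder_facts[OF ok(1,3) due g(4) su]
 obtain p where p: "p \<in> P" "p \<in> closure (fst g)" "\<bar>(T ^^ t) p\<bar> = e (Suc (nat \<bar>k\<bar>))" "sgn ((T ^^ t) p) = sgn (real_of_int k)"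
  using f(1) by blast
 obtain p' where p': "p' \<in> P" "p' \<in> closure (fst g')" "\<bar>(T ^^ t) p'\<bar> = e (Suc (nat \<bar>k\<bar>))" "sgn ((T ^^ t) p') = sgn (real_of_int k)"
  using f'(1) by blast
 have reg: "regular t P" by (rule piece_data(4)[OF ok(1) su])
 have "(T ^^ t) p = (T ^^ t) p'" using p(3,4) p'(3,4) by (metis sgn_mult_abs)
 hence pp: "p' = p" using regular_inj[OF reg] p(1) p'(1) by (auto dest: inj_onD)
 obtain y where y: "y \<in> fst g" using nondeg_obtain[OF piece_nondeg[OF ok(2)]] by metis
 obtain y' where y': "y' \<in> fst g'" using nondeg_obtain[OF piece_nondeg[OF ok(3)]] by metis
 have sg: "snd g = Some (t, k + sgn k, P)" "snd g' = Some (t, k + sgn k, P)"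
  using g(2,4) su by (auto simp: deeper_iff)
 have "fst g \<subseteq> P" "fst g' \<subseteq> P"
  using piece_data(3)[OF ok(2) sg(1)] piece_data(3)[OF ok(3) sg(2)] .
 hence yP: "y \<in> P" "y' \<in> P" using y y' by blast+
 have T: "\<bar>(T ^^ t) y\<bar> < \<bar>(T ^^ t) p\<bar>" "sgn ((T ^^ t) y) = sgn ((T ^^ t) p)"
  "\<bar>(T ^^ t) y'\<bar> < \<bar>(T ^^ t) p\<bar>" "sgn ((T ^^ t) y') = sgn ((T ^^ t) p)"
  using f(6)[OF y] f'(6)[OF y'] p by auto
 have "(T ^^ t) p \<notin> open_segment ((T ^^ t) y) ((T ^^ t) y')"
  using T by (auto simp: open_segment_eq_real_ivl sgn_if abs_if split: if_splits)
 hence "p \<notin> open_segment y y'" using regular_between[OF reg yP(1) p(1) yP(2)] by blast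
 moreover have "y \<noteq> p" "y' \<noteq> p" using T by auto
 ultimately have "open_segment y p \<inter> open_segment y' p \<noteq> {}" 
  by (rule segments_overlap)
 moreover have "open_segment y p \<subseteq> interior (fst g)" "open_segment y' p \<subseteq> interior (fst g')"
  using closure_interval_cases[OF piece_interval[OF ok(2)] y p(2)]
   closure_interval_cases[OF piece_interval[OF ok(3)] y' p'(2)] pp
  using interior_maximal open_open_segment by blast+
 ultimately have "interior (fst g) \<inter> interior (fst g') \<noteq> {}" by blast
 thus False using W g ne unfolding inv_pieces_def by blast
qed

lemma released_alone:
 assumes u: "piece_ok Q n u" and due: "due_large S (Suc n) u"
 shows "stopped_ok Q (Suc n) (fst u)"
proof -
 obtain t k P where su: "snd u = Some (t, k, P)" "Suc n = t + bound_time S k" "large S (Suc n) (fst u)"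
  using due by (auto simp: due_iff)
 have uu: "nondeg (fst u)" "fst u \<subseteq> Q" "regular (Suc n) (fst u)" "int k0 \<le> \<bar>k\<bar>"
   "\<And>y. y \<in> fst u ==> bindable k ((T ^^ t) y)"
  using u su(1) by (auto simp: piece_ok_def)
 have b1: "1 \<le> bound_time S k" using bound_time_abs[OF uu(4)] bt_pos[of "nat \<bar>k\<bar>"] uu(4) by (simp add: le_nat_iff)
 have img: "(T ^^ Suc n) y \<notin> H" if "y \<in> fst u" for y
 proof -
  have "gap (bound_time S k) ((T ^^ t) y) < r" using shadow[OF uu(5)[OF that] b1] by simp
  hence "\<bar>(T ^^ Suc n) y - crit (bound_time S k)\<bar> < r"
   unfolding su(2) gap_def iter_add .
  thus ?thesis using hole_far[OF b1, of "(T ^^ Suc n) y"] by auto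
 qed
 obtain x where x: "x \<in> fst u" using uu(1) nondeg_obtain by metis
 have "4 ^ 8 * \<epsilon> \<le> len ((T ^^ Suc n) ` fst u)" using su(3) unfolding large_def iter_T .
 then obtain B where B: "B \<in> (T ^^ Suc n) ` fst u" "4 ^ 7 * \<epsilon> \<le> \<bar>(T ^^ Suc n) x - B\<bar>"
  using two_far interval_image_iter[OF piece_interval[OF u]] x by blast
 then obtain y where y: "y \<in> fst u" "4 ^ 7 * \<epsilon> \<le> \<bar>(T ^^ Suc n) x - (T ^^ Suc n) y\<bar>" by blast
 hence "4 ^ 6 * \<epsilon> \<le> \<bar>(T ^^ Suc n) x - (T ^^ Suc n) y\<bar>" using eps_pos by simp
 moreover have "(T ^^ Suc n) ` fst u \<inter> H = {}" using img by blast
 ultimately show ?thesis using uu x y(1) unfolding stopped_ok_def by blast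
qed

text \<open>\<open>hull_touch\<close> with \<open>F\<close> the points lying over the outer endpoint
  of the cell of \<open>w\<close>. All points of the hull are \<open>bindable\<close>, so
  \<open>shadow\<close> keeps them off 0 while the piece is bound; the added seams belong to
  \<open>exc\<close>.\<close>

lemma ext_piece_ok:
 assumes W: "inv_pieces Q n W" and w: "w \<in> W" "\<not> is_free S (Suc n) w"
 shows "piece_ok Q (Suc n) (ext_piece (Suc n) W w)"
  and "x \<in> fst (ext_piece (Suc n) W w) ==> x \<notin> exc (Suc n) ==>
   x \<in> fst w \<or> (\<exists>u\<in>W. released S (Suc n) W u \<and> deeper u w \<and> x \<in> remainder S (Suc n) (fst u) (fst w))"
proof -
 define m where "m = Suc n"
 obtain t k P where sw: "snd w = Some (t, k, P)" "m \<le> t + bound_time S k"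
  using w(2) by (auto simp: free_iff m_def not_less)
 have ok: "piece_ok Q n w" using W w by (simp add: inv_pieces_def)
 have ww: "nondeg (fst w)" "fst w \<subseteq> Q" "regular m (fst w)" "t \<le> n" "P \<subseteq> Q" "fst w \<subseteq> P" "regular t P" "int k0 \<le> \<bar>k\<bar>"
   "\<And>y. y \<in> fst w ==> bindable k ((T ^^ t) y)" "\<exists>y\<in>fst w. (T ^^ t) y \<in> cell k"
   "k0 < nat \<bar>k\<bar> ==> n < t + bt (nat \<bar>k\<bar> - 1) ==> \<forall>y\<in>fst w. \<bar>(T ^^ t) y\<bar> < e (nat \<bar>k\<bar>)"
  using ok sw by (auto simp: piece_ok_def m_def)
 define \<R> where "\<R> = {remainder S m (fst u) (fst w) | u. u \<in> W \<and> released S m W u \<and> deeper u w}"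
 define F where "F = {p\<in>P. \<bar>(T ^^ t) p\<bar> = e (nat \<bar>k\<bar>) \<and> sgn ((T ^^ t) p) = sgn (real_of_int k)}"
 have Rf: "is_interval R \<and> R \<subseteq> P \<and> (\<forall>y\<in>R. bindable k ((T ^^ t) y)) \<and>
   (R = {} \<or> (\<exists>p\<in>closure (fst w) \<inter> closure R. p \<in> F)) \<and> k0 < nat \<bar>k\<bar> \<and> m = t + bt (nat \<bar>k\<bar> - 1)" if R: "R \<in> \<R>" for R
 proof -
  obtain u where u: "u \<in> W" "released S m W u" "deeper u w" "R = remainder S m (fst u) (fst w)" using R by (auto simp: \<R>_def)
  obtain k' where k': "snd u = Some (t, k', P)" "k = k' + sgn k'" using u(3) sw by (auto simp: deeper_iff)
  have uok: "piece_ok Q n u" using W u by (simp add: inv_pieces_def)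
  have due: "due_large S (Suc n) u" using u(2) by (simp add: released_def m_def)
  note f = remainder_facts[OF uok ok due u(3) k'(1), folded m_def, folded u(4)]
  have kk: "int k0 \<le> \<bar>k'\<bar>" "fst u \<subseteq> P" using uok k' by (auto simp: piece_ok_def)
  have ek: "Suc (nat \<bar>k'\<bar>) = nat \<bar>k\<bar>" "sgn (real_of_int k') = sgn (real_of_int k)"
   using k'(2) kk depth_pos by (auto simp: sgn_if abs_if split: if_splits)
  have "m = t + bt (nat \<bar>k'\<bar>)" using due k' bound_time_abs[OF kk(1)] by (auto simp: due_iff m_def)
  moreover have "nat \<bar>k'\<bar> = nat \<bar>k\<bar> - 1" "k0 < nat \<bar>k\<bar>" using ek(1) kk(1) by linarith+
  moreover have "R = {} \<or> (\<exists>p\<in>closure (fst w) \<inter> closure R. p \<in> F)"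
   using f(1) unfolding F_def ek by blast
  ultimately show ?thesis using f(2,3,4) kk(2) k'(2) by auto
 qed
 have E: "ext_piece m W w = (convex hull (fst w \<union> \<Union>\<R>), snd w)" by (simp add: ext_piece_def \<R>_def)
 have wi: "is_interval (fst w)" using ww(1) by (simp add: nondeg_def)
 obtain y0 where y0: "y0 \<in> fst w" "(T ^^ t) y0 \<in> cell k" using ww(10) by blast
 have hull: "convex hull (fst w \<union> \<Union>\<R>) \<subseteq> fst w \<union> \<Union>\<R> \<union> F"
  using Rf wi y0 by (intro hull_touch) blast+
 have w_hull: "fst w \<subseteq> convex hull (fst w \<union> \<Union>\<R>)" by (meson Un_upper1 hull_subset order_trans)
 have hP: "convex hull (fst w \<union> \<Union>\<R>) \<subseteq> P" using hull Rf ww(6) unfolding F_def by blast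
 have hb: "bindable k ((T ^^ t) y)" if y: "y \<in> convex hull (fst w \<union> \<Union>\<R>)" for y
 proof -
  have "y \<in> fst w \<or> (\<exists>R\<in>\<R>. y \<in> R) \<or> y \<in> F" using hull y by blast
  thus ?thesis
  proof (elim disjE bexE)
   assume "y \<in> F" thus ?thesis using ww(8) by (auto simp: F_def bindable_def)
  qed (use ww(9) Rf in blast)+
 qed
 have "piece_ok Q m (ext_piece m W w)"
  unfolding piece_ok_def E fst_conv snd_conv
 proof (intro conjI allI impI)
  show "nondeg (convex hull (fst w \<union> \<Union>\<R>))"
   using ww(1) interior_mono[OF w_hull] by (auto simp: nondeg_def is_interval_convex_1)
  show "convex hull (fst w \<union> \<Union>\<R>) \<subseteq> Q" using hP ww(5) by blast
  show "regular (Suc m) (convex hull (fst w \<union> \<Union>\<R>))"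
   unfolding regular_def
  proof (intro conjI ballI allI impI)
   show "is_interval (convex hull (fst w \<union> \<Union>\<R>))" by (simp add: is_interval_convex_1)
   show "convex hull (fst w \<union> \<Union>\<R>) \<subseteq> {-1..1}" using hP ww(7) by (auto simp: regular_def)
   fix y j assume y: "y \<in> convex hull (fst w \<union> \<Union>\<R>)" and j: "j < Suc m"
   show "(T ^^ j) y \<noteq> 0"
   proof (cases "j < t")
    case True
    thus ?thesis using y hP ww(7) by (auto simp: regular_def)
   next
    case False
    show ?thesis
    proof (cases "j = t")
     case True
     have "0 < e (Suc (nat \<bar>k\<bar>))" by simp
     thus ?thesis using hb[OF y] True unfolding bindable_def by (metis abs_zero not_le)
    next
     case nt: False
     have "gap (j - t) ((T ^^ t) y) < r"
      using False nt j sw(2) by (intro shadow[OF hb[OF y]]) auto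
     hence "\<bar>(T ^^ j) y - crit (j - t)\<bar> < r"
      using False by (simp add: gap_def iter_add[symmetric])
     thus ?thesis using crit_far[of "j - t"] False nt rad_le \<delta>0_pos by auto
    qed
   qed
  qed
  fix t' k' P' assume "snd w = Some (t', k', P')"
  hence eq: "t' = t" "k' = k" "P' = P" using sw by auto
  show "t' \<le> m" "P' \<subseteq> Q" "convex hull (fst w \<union> \<Union>\<R>) \<subseteq> P'" "regular t' P'" "int k0 \<le> \<bar>k'\<bar>"
   "\<forall>y\<in>convex hull (fst w \<union> \<Union>\<R>). bindable k' ((T ^^ t') y)"
   using eq ww hP hb by (auto simp: m_def)
  show "\<exists>y\<in>convex hull (fst w \<union> \<Union>\<R>). (T ^^ t') y \<in> cell k'" using y0 w_hull eq by blast
  \<comment> \<open>By \<open>Rf\<close> a remainder arrives only at the end of the bound period of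
    the shallower neighbour. Earlier the hull is the piece itself and the old bound
    persists.\<close>
  assume h: "k0 < nat \<bar>k'\<bar> \<and> m < t' + bt (nat \<bar>k'\<bar> - 1)"
  hence "\<R> = {}" using Rf eq by fastforce
  moreover have "convex hull (fst w) = fst w" using wi by (simp add: convex_hull_eq is_interval_convex_1)
  ultimately have "convex hull (fst w \<union> \<Union>\<R>) = fst w" by simp
  thus "\<forall>y\<in>convex hull (fst w \<union> \<Union>\<R>). \<bar>(T ^^ t') y\<bar> < e (nat \<bar>k'\<bar>)"
  proof -
   have "k0 < nat \<bar>k\<bar>" "n < t + bt (nat \<bar>k\<bar> - 1)" using h unfolding eq m_def by linarith+
   from ww(11)[OF this] show ?thesis unfolding eq `convex hull (fst w \<union> \<Union>\<R>) = fst w` .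
  qed
 qed
 thus "piece_ok Q (Suc n) (ext_piece (Suc n) W w)" by (simp add: m_def)
 assume x: "x \<in> fst (ext_piece (Suc n) W w)" "x \<notin> exc (Suc n)"
 have "y \<in> exc m" if "y \<in> F" for y
 proof -
  have "(T ^^ t) y = e (nat \<bar>k\<bar>) \<or> (T ^^ t) y = - e (nat \<bar>k\<bar>)" using that by (auto simp: F_def abs_if split: if_splits)
  hence "(T ^^ t) y \<in> cuts" unfolding cuts_def by blast
  thus ?thesis using ww(4) by (auto simp: exc_def m_def)
 qed
 hence "x \<in> fst w \<union> \<Union>\<R>" using x hull E by (auto simp: m_def[symmetric])
 thus "x \<in> fst w \<or> (\<exists>u\<in>W. released S (Suc n) W u \<and> deeper u w \<and> x \<in> remainder S (Suc n) (fst u) (fst w))"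
  by (auto simp: \<R>_def m_def)
qed

definition step_exc :: "nat => piece set => real set" where
 "step_exc m W = (\<Union>w\<in>W. frontier (fst w)) \<union> exc m \<union> {x. (T ^^ m) x \<in> frontier H}"

lemma countable_step_exc:
 assumes "inv_pieces Q n W" shows "countable (step_exc m W)"
proof -
 have "finite (frontier (fst w))" if "w \<in> W" for w
  using assms that by (intro interval_finite_frontier piece_interval) (auto simp: inv_pieces_def)
 thus ?thesis
  unfolding step_exc_def
  by (intro countable_Un countable_UN inv_countable[OF assms] countable_exc countable_vimage_iter)
   (simp_all add: countable_finite finite_frontier_hole)
qed

text \<open>A good point lies in exactly one old piece. A free piece is settled by
  \<open>free_exact\<close>, a bound one continues. A point of a released piece either stops or, if
  it lies in the remainder, passes to the unique deeper neighbour.\<close>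

lemma step_exact:
 assumes W: "inv_pieces Q n W" and x: "x \<notin> step_exc (Suc n) W"
 shows "x \<in> (\<Union>w\<in>W. fst w) ==> exact_one (next_pieces S (Suc n) W) (next_stopped S (Suc n) W) x"
  and "x \<notin> (\<Union>w\<in>W. fst w) ==> {w \<in> next_pieces S (Suc n) W. x \<in> fst w} = {} \<and> {s \<in> next_stopped S (Suc n) W. x \<in> s} = {}"
proof -
 define m where "m = Suc n"
 have ok: "piece_ok Q n w" if "w \<in> W" for w using W that by (simp add: inv_pieces_def)
 have xe: "x \<notin> exc m" "(T ^^ m) x \<notin> frontier H" "\<And>w. w \<in> W ==> x \<notin> frontier (fst w)"
  using x by (auto simp: step_exc_def m_def)
 have uniq: "w = w'" if "w \<in> W" "w' \<in> W" "x \<in> fst w" "x \<in> fst w'" for w w'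
 proof (rule ccontr)
  assume "w \<noteq> w'"
  moreover have "x \<in> interior (fst w)" "x \<in> interior (fst w')" using that xe(3) interior_or_frontier by blast+
  ultimately show False using W that(1,2) unfolding inv_pieces_def by blast
 qed
 let ?N = "next_pieces S m W" and ?St = "next_stopped S m W"
 let ?R = "\<lambda>u g. remainder S m (fst u) (fst g)"
 have R_sub: "?R u g \<subseteq> fst u" for u g by (auto simp: remainder_def)
 have NX: "(\<exists>w\<in>W. is_free S m w \<and> w' \<in> free_pieces m w \<and> x \<in> fst w) \<or>
   (\<exists>w\<in>W. \<not> is_free S m w \<and> \<not> released S m W w \<and> w' = ext_piece m W w \<and>
     (x \<in> fst w \<or> (\<exists>u\<in>W. released S m W u \<and> deeper u w \<and> x \<in> ?R u w)))"
  if w': "w' \<in> ?N" "x \<in> fst w'" for w'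
 proof -
  from w'(1) consider w where "w \<in> W" "is_free S m w" "w' \<in> free_pieces m w"
   | w where "w \<in> W" "\<not> is_free S m w" "\<not> released S m W w" "w' = ext_piece m W w"
   unfolding next_pieces_eq by blast
  thus ?thesis
  proof cases
   case 1
   then obtain v where v: "v \<in> components {x\<in>fst w. (T ^^ m) x \<notin> H}" "\<not> large S m v" "w' \<in> cut_pieces S m w v"
    unfolding free_pieces_def by blast
   have "fst w' \<subseteq> v" using cut_pieces_ok(2)[OF ok[OF 1(1)] 1(2)[unfolded m_def] v[unfolded m_def]] .
   hence "x \<in> fst w" using w'(2) in_components_subset[OF v(1)] by blast
   thus ?thesis using 1 by blast
  next
   case 2
   thus ?thesis using ext_piece_ok(2)[OF W 2(1) 2(2)[unfolded m_def], of x] w'(2) xe(1) unfolding m_def by blast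
  qed
 qed
 have SX: "(\<exists>w\<in>W. is_free S m w \<and> s \<in> free_stopped m w \<and> x \<in> fst w) \<or>
   (\<exists>w\<in>W. released S m W w \<and> s = rest m W w \<and> x \<in> fst w \<and> (\<forall>g\<in>W. deeper w g --> x \<notin> ?R w g))"
  if s: "s \<in> ?St" "x \<in> s" for s
 proof -
  from s(1) consider w where "w \<in> W" "is_free S m w" "s \<in> free_stopped m w"
   | w where "w \<in> W" "released S m W w" "s = rest m W w"
   unfolding next_stopped_eq by blast
  thus ?thesis
  proof cases
   case 1
   thus ?thesis using free_stopped_ok(2)[OF ok[OF 1(1)]] s(2) unfolding m_def by blast
  next
   case 2
   thus ?thesis using s(2) unfolding rest_def by blast
  qed
 qed
 {
  assume "x \<in> (\<Union>w\<in>W. fst w)"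
  then obtain w where w: "w \<in> W" "x \<in> fst w" by blast
  have wu: "w' = w" if "w' \<in> W" "x \<in> fst w'" for w' using uniq[OF that(1) w(1) that(2) w(2)] .
  consider (free) "is_free S m w" | (rel) "released S m W w" | (bound) "\<not> is_free S m w" "\<not> released S m W w" by blast
  hence "exact_one ?N ?St x"
  proof cases
   case free
   have "{w'\<in>?N. x \<in> fst w'} = {w'\<in>free_pieces m w. x \<in> fst w'}"
   proof (intro set_eqI iffI)
    fix w' assume w': "w' \<in> {w'\<in>?N. x \<in> fst w'}"
    hence "w' \<in> free_pieces m w"
     using NX[of w'] wu R_sub released_not_free free by blast
    thus "w' \<in> {w'\<in>free_pieces m w. x \<in> fst w'}" using w' by simp
   qed (use w free next_pieces_eq in blast)
   moreover have "{s\<in>?St. x \<in> s} = {s\<in>free_stopped m w. x \<in> s}"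
   proof (intro set_eqI iffI)
    fix s assume s: "s \<in> {s\<in>?St. x \<in> s}"
    hence "s \<in> free_stopped m w"
     using SX[of s] wu released_not_free free by blast
    thus "s \<in> {s\<in>free_stopped m w. x \<in> s}" using s by simp
   qed (use w free next_stopped_eq in blast)
   moreover have "exact_one (free_pieces m w) (free_stopped m w) x"
    using free_exact[OF ok[OF w(1)] _ w(2) xe(3)[OF w(1)]] free xe unfolding m_def by blast
   ultimately show ?thesis unfolding exact_one_def by simp
  next
   case rel
   have nf: "\<not> is_free S m w" using released_not_free rel .
   show ?thesis
   proof (cases "\<exists>g\<in>W. deeper w g \<and> x \<in> ?R w g")
    case True
    then obtain g where g: "g \<in> W" "deeper w g" "x \<in> ?R w g" by blast
    note gt = deeper_target[OF W w(1) rel[unfolded m_def] g(1,2), folded m_def]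
    have "{w'\<in>?N. x \<in> fst w'} = {ext_piece m W g}"
    proof (intro set_eqI iffI)
     fix w' assume w': "w' \<in> {w'\<in>?N. x \<in> fst w'}"
     hence "\<exists>g'\<in>W. w' = ext_piece m W g' \<and> deeper w g'"
      using NX[of w'] wu R_sub nf rel by blast
     thus "w' \<in> {ext_piece m W g}"
      using deeper_unique[OF W w(1) rel[unfolded m_def]] g(1,2) by blast
    next
     fix w' assume "w' \<in> {ext_piece m W g}"
     hence w': "w' = ext_piece m W g" by simp
     have "x \<in> \<Union>{remainder S m (fst u) (fst g) | u. u \<in> W \<and> released S m W u \<and> deeper u g}"
      using g w rel by blast
     hence "x \<in> fst w'" unfolding w' ext_piece_def fst_conv by (meson UnI2 hull_subset subsetD)
     thus "w' \<in> {w'\<in>?N. x \<in> fst w'}" unfolding next_pieces_eq using w' g gt by blast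
    qed
    moreover have "{s\<in>?St. x \<in> s} = {}" using SX wu nf g by blast
    ultimately show ?thesis unfolding exact_one_def by blast
   next
    case False
    have "{w'\<in>?N. x \<in> fst w'} = {}" using NX wu R_sub nf rel False by blast
    moreover have "{s\<in>?St. x \<in> s} = {rest m W w}"
    proof (intro set_eqI iffI)
     fix s assume "s \<in> {s\<in>?St. x \<in> s}"
     thus "s \<in> {rest m W w}" using SX[of s] wu nf by blast
    next
     fix s assume "s \<in> {rest m W w}"
     hence s: "s = rest m W w" by simp
     have "x \<in> s" unfolding s rest_def using w(2) False by blast
     thus "s \<in> {s\<in>?St. x \<in> s}" unfolding next_stopped_eq using s w(1) rel by blast
    qed
    ultimately show ?thesis unfolding exact_one_def by blast
   qed
  next
   case bound
   have "{w'\<in>?N. x \<in> fst w'} = {ext_piece m W w}"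
   proof (intro set_eqI iffI)
    fix w' assume "w' \<in> {w'\<in>?N. x \<in> fst w'}"
    thus "w' \<in> {ext_piece m W w}" using NX[of w'] wu R_sub bound by blast
   next
    fix w' assume "w' \<in> {ext_piece m W w}"
    hence w': "w' = ext_piece m W w" by simp
    have "x \<in> fst w'" unfolding w' ext_piece_def fst_conv using w(2) by (meson UnI1 hull_subset subsetD)
    thus "w' \<in> {w'\<in>?N. x \<in> fst w'}" unfolding next_pieces_eq using w' w(1) bound by blast
   qed
   moreover have "{s\<in>?St. x \<in> s} = {}" using SX wu bound by blast
   ultimately show ?thesis unfolding exact_one_def by blast
  qed
  thus "exact_one (next_pieces S (Suc n) W) (next_stopped S (Suc n) W) x" by (simp add: m_def)
 }
 {
  assume nx: "x \<notin> (\<Union>w\<in>W. fst w)"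
  have "{w \<in> ?N. x \<in> fst w} = {}" using NX nx R_sub by blast
  moreover have "{s \<in> ?St. x \<in> s} = {}" using SX nx by blast
  ultimately show "{w \<in> next_pieces S (Suc n) W. x \<in> fst w} = {} \<and> {s \<in> next_stopped S (Suc n) W. x \<in> s} = {}"
   by (simp add: m_def)
 }
qed

text \<open>Disjointness of the new interiors comes from exactness: an open overlap is uncountable
  and so contains a point outside the countable exceptional set.\<close>

lemma step_ok:
 assumes W: "inv_pieces Q n W"
 shows "inv_pieces Q (Suc n) (next_pieces S (Suc n) W)"
  and "s \<in> next_stopped S (Suc n) W ==> stopped_ok Q (Suc n) s"
proof -
 have ok: "piece_ok Q n w" if "w \<in> W" for w using W that by (simp add: inv_pieces_def)
 show "inv_pieces Q (Suc n) (next_pieces S (Suc n) W)"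
  unfolding inv_pieces_def
 proof (intro conjI ballI impI)
  fix w' assume "w' \<in> next_pieces S (Suc n) W"
  then consider w where "w \<in> W" "is_free S (Suc n) w" "w' \<in> free_pieces (Suc n) w"
   | w where "w \<in> W" "\<not> is_free S (Suc n) w" "w' = ext_piece (Suc n) W w"
   unfolding next_pieces_eq by blast
  thus "piece_ok Q (Suc n) w'"
  proof cases
   case 1
   thus ?thesis using cut_pieces_ok(1)[OF ok[OF 1(1)] 1(2)] unfolding free_pieces_def by blast
  next
   case 2
   thus ?thesis using ext_piece_ok(1)[OF W 2(1,2)] by simp
  qed
 next
  fix w w' assume w: "w \<in> next_pieces S (Suc n) W" "w' \<in> next_pieces S (Suc n) W" "w \<noteq> w'"
  show "interior (fst w) \<inter> interior (fst w') = {}"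
  proof (rule ccontr)
   assume ne: "interior (fst w) \<inter> interior (fst w') \<noteq> {}"
   obtain x where x: "x \<in> interior (fst w) \<inter> interior (fst w')" "x \<notin> step_exc (Suc n) W"
    by (rule open_minus_countable[OF _ ne countable_step_exc[OF W]]) auto
   hence xx: "x \<in> fst w" "x \<in> fst w'" using interior_subset by blast+
   show False
   proof (cases "x \<in> (\<Union>w\<in>W. fst w)")
    case True
    thus ?thesis using exact_one_unique(1)[OF step_exact(1)[OF W x(2) True]] w xx by blast
   next
    case False
    thus ?thesis using step_exact(2)[OF W x(2) False] w xx by blast
   qed
  qed
 qed
 assume "s \<in> next_stopped S (Suc n) W"
 then consider w where "w \<in> W" "is_free S (Suc n) w" "s \<in> free_stopped (Suc n) w"
  | w where "w \<in> W" "released S (Suc n) W w" "s = rest (Suc n) W w"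
  unfolding next_stopped_eq by blast
 thus "stopped_ok Q (Suc n) s"
 proof cases
  case 1
  thus ?thesis using free_stopped_ok(1)[OF ok[OF 1(1)]] by blast
 next
  case 2
  have due: "due_large S (Suc n) w" using 2(2) by (simp add: released_def)
  show ?thesis
  proof (cases "\<exists>g\<in>W. deeper w g")
   case True
   then obtain g where g: "g \<in> W" "deeper w g" by blast
   obtain t k P where sw: "snd w = Some (t, k, P)" using g(2) by (auto simp: deeper_iff)
   have "{remainder S (Suc n) (fst w) (fst g') | g'. g' \<in> W \<and> deeper w g'} = {remainder S (Suc n) (fst w) (fst g)}"
    using deeper_unique[OF W 2(1,2) _ _ g] g by blast
   hence "s = fst w - remainder S (Suc n) (fst w) (fst g)" using 2(3) by (simp add: rest_def)
   thus ?thesis using remainder_facts(5)[OF ok[OF 2(1)] ok[OF g(1)] due g(2) sw] by simp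
  next
   case False
   hence "s = fst w" using 2(3) unfolding rest_def by blast
   thus ?thesis using released_alone[OF ok[OF 2(1)] due] by simp
  qed
 qed
qed

end

section \<open>The piece containing a given point\<close>

lemma Collect_singD: "{w\<in>X. P w} = {w0} ==> w \<in> X ==> P w ==> w = w0"
 by auto

context mis_scheme
begin

lemma piece_sub: "piece_ok Q n w ==> fst w \<subseteq> Q"
 by (simp add: piece_ok_def)

definition start_ok :: "real set => bool" where
 "start_ok Q \<longleftrightarrow> nondeg Q \<and> Q \<subseteq> {-1..1} - H"

lemma initial_pieces_ok:
 assumes Q: "start_ok Q" and w: "w \<in> initial_pieces S Q"
 shows "piece_ok Q 0 w"
proof -
 have reg: "regular 0 Q" "\<And>y. y \<in> Q ==> (T ^^ 0) y \<notin> H"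
  using Q by (auto simp: start_ok_def regular_def nondeg_def)
 note sc = subcells_eq[OF reg]
 have props: "nondeg c \<and> c \<subseteq> Q \<and> is_interval c \<and> c \<subseteq> {-1..1} \<and> (\<exists>X\<in>zones. c \<subseteq> X)" if c: "c \<in> subcells S 0 Q" for c
 proof -
  obtain X where X: "X \<in> zones" "c = {y\<in>Q. (T ^^ 0) y \<in> X}" "0 < len c" using c sc by blast
  have ci: "is_interval c" using regular_vimage[OF reg(1) zone_interval[OF X(1)]] X(2) by simp
  have c1: "c \<subseteq> {-1..1}" using X(2) Q by (auto simp: start_ok_def)
  show ?thesis using nondeg_len[OF ci c1] X ci c1 by auto
 qed
 have nz: "y \<noteq> 0" if "X \<in> zones" "y \<in> X" for X y
  using that \<delta>_pos cell_bounds(5) by (auto simp: zones_def)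
 have regc: "regular (Suc 0) c" if "c \<in> subcells S 0 Q" for c
 proof -
  have "y \<noteq> 0" if "y \<in> c" for y using props[OF `c \<in> subcells S 0 Q`] nz that by blast
  thus ?thesis using props[OF that] by (simp add: regular_def)
 qed
 from w consider c k where "w = (c, Some (0, k, Q))" "c \<in> subcells S 0 Q" "inner_at S 0 c k"
  | c where "w = (c, None)" "c \<in> subcells S 0 Q"
  unfolding initial_pieces_def by blast
 thus ?thesis
 proof cases
  case 1
  have kk: "int k0 \<le> \<bar>k\<bar>" "c \<subseteq> cell k" using 1(3) by (auto simp: inner_at_def)
  have ne: "c \<noteq> {}" using props[OF 1(2)] by (auto simp: nondeg_def)
  have "bindable k y \<and> \<bar>y\<bar> < e (nat \<bar>k\<bar>)" if "y \<in> c" for y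
  proof -
   have "y \<in> cell k" using that kk by blast
   from cell_bounds[OF kk(1) this] show ?thesis using kk by (auto simp: bindable_def)
  qed
  thus ?thesis
   unfolding piece_ok_def 1(1) fst_conv snd_conv using props[OF 1(2)] regc[OF 1(2)] kk ne reg(1) by auto
 next
  case 2
  thus ?thesis using props[OF 2(2)] regc[OF 2(2)] by (simp add: piece_ok_def)
 qed
qed

lemma initial_exact:
 assumes Q: "start_ok Q" and x: "x \<notin> frontier Q" "x \<notin> exc 0"
 shows "x \<in> Q ==> \<exists>w. {w\<in>initial_pieces S Q. x \<in> fst w} = {w}"
  and "x \<notin> Q ==> {w\<in>initial_pieces S Q. x \<in> fst w} = {}"
proof -
 have reg: "regular 0 Q" "\<And>y. y \<in> Q ==> (T ^^ 0) y \<notin> H"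
  using Q by (auto simp: start_ok_def regular_def nondeg_def)
 show "x \<notin> Q ==> {w\<in>initial_pieces S Q. x \<in> fst w} = {}"
  using piece_sub[OF initial_pieces_ok[OF Q]] by blast
 assume "x \<in> Q"
 hence xi: "x \<in> interior Q" using x(1) interior_or_frontier by blast
 have "(T ^^ 0) x \<notin> cuts" using x(2) by (simp add: exc_def)
 note at = subcell_at[OF reg xi this]
 let ?c = "\<lambda>X. {y\<in>Q. (T ^^ 0) y \<in> X}"
 obtain X where X: "X \<in> zones" "x \<in> ?c X" "?c X \<in> subcells S 0 Q"
  and sub_eq: "\<And>c. c \<in> subcells S 0 Q ==> x \<in> c ==> c = ?c X" using at by auto
 have cases0: "(\<exists>k. w = (?c X, Some (0, k, Q)) \<and> inner_at S 0 (?c X) k) \<or> (w = (?c X, None) \<and> outer_at S 0 (?c X))"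
  if "w \<in> initial_pieces S Q" "x \<in> fst w" for w
 proof -
  from that(1) obtain c where c: "c \<in> subcells S 0 Q"
   "(\<exists>k. w = (c, Some (0, k, Q)) \<and> inner_at S 0 c k) \<or> (w = (c, None) \<and> outer_at S 0 c)"
   unfolding initial_pieces_def by blast
  hence "c = ?c X" using sub_eq[OF c(1)] that(2) by auto
  thus ?thesis using c(2) by simp
 qed
 have ne: "?c X \<noteq> {}" using X(2) by blast
 consider (inner) k where "X = cell k" "int k0 \<le> \<bar>k\<bar>" | (outer) "X = {\<delta>..} \<or> X = {..-\<delta>}"
  using X(1) by (auto simp: zones_def)
 thus "\<exists>w. {w\<in>initial_pieces S Q. x \<in> fst w} = {w}"
 proof cases
  case inner
  have inn: "inner_at S 0 (?c X) k" using inner by (auto simp: inner_at_def)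
  have fx: "x \<in> cell k" using X(2) inner by simp
  have nout: "\<not> outer_at S 0 (?c X)"
   using outer_zone[OF X(1) refl ne] X(2) cell_bounds(4)[OF inner(2) fx] by auto
  have "{w\<in>initial_pieces S Q. x \<in> fst w} = {(?c X, Some (0, k, Q))}"
  proof (rule Collect_singI)
   show "(?c X, Some (0, k, Q)) \<in> initial_pieces S Q" unfolding initial_pieces_def using X(3) inn by blast
   fix w assume "w \<in> initial_pieces S Q" "x \<in> fst w"
   from cases0[OF this] obtain k' where k': "w = (?c X, Some (0, k', Q))" "inner_at S 0 (?c X) k'"
    using nout by blast
   hence "x \<in> cell k'" "int k0 \<le> \<bar>k'\<bar>" using X(2) by (auto simp: inner_at_def)
   thus "w = (?c X, Some (0, k, Q))" using cell_inj[OF _ inner(2) _ fx] k'(1) by simp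
  qed (use X(2) in simp)
  thus ?thesis by blast
 next
  case outer
  have out: "outer_at S 0 (?c X)" using outer_zone[OF X(1) refl ne] outer by simp
  have "{w\<in>initial_pieces S Q. x \<in> fst w} = {(?c X, None)}"
  proof (rule Collect_singI)
   show "(?c X, None) \<in> initial_pieces S Q" unfolding initial_pieces_def using X(3) out by blast
   fix w assume "w \<in> initial_pieces S Q" "x \<in> fst w"
   moreover have "\<not> inner_at S 0 (?c X) k" for k
    using cell_bounds(4)[of k x] outer X(2) by (auto simp: inner_at_def)
   ultimately show "w = (?c X, None)" using cases0 by blast
  qed (use X(2) in simp)
  thus ?thesis by blast
 qed
qed

lemma pieces_inv: "start_ok Q ==> inv_pieces Q n (pieces S Q n)"
proof (induction n)
 case 0
 have "interior (fst w) \<inter> interior (fst w') = {}"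
  if w: "w \<in> initial_pieces S Q" "w' \<in> initial_pieces S Q" "w \<noteq> w'" for w w'
 proof (rule ccontr)
  assume ne: "interior (fst w) \<inter> interior (fst w') \<noteq> {}"
  have "countable (frontier Q \<union> exc 0)"
   using 0 by (auto simp: start_ok_def nondeg_def intro!: countable_exc countable_finite interval_finite_frontier)
  then obtain x where x: "x \<in> interior (fst w) \<inter> interior (fst w')" "x \<notin> frontier Q \<union> exc 0"
   by (rule open_minus_countable[OF _ ne, rotated]) auto
  hence "x \<in> fst w" "x \<in> fst w'" using interior_subset by blast+
  moreover from this(1) have "x \<in> Q" using piece_sub[OF initial_pieces_ok[OF 0 w(1)]] by blast
  then obtain w0 where "{w\<in>initial_pieces S Q. x \<in> fst w} = {w0}" using initial_exact(1)[OF 0] x(2) by blast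
  ultimately show False using Collect_singD[of "initial_pieces S Q" "\<lambda>w. x \<in> fst w"] w by metis
 qed
 thus ?case using initial_pieces_ok[OF 0] by (auto simp: inv_pieces_def)
next
 case (Suc n)
 thus ?case using step_ok(1) by simp
qed

lemma stopped_stopped_ok: "start_ok Q ==> s \<in> stopped S Q n ==> n \<ge> 1 \<and> stopped_ok Q n s"
 by (cases n) (auto intro: step_ok(2)[OF pieces_inv])

definition start_exc :: "real set => real set" where
 "start_exc Q = frontier Q \<union> exc 0 \<union> (\<Union>n. step_exc (Suc n) (pieces S Q n))"

lemma countable_start_exc: "start_ok Q ==> countable (start_exc Q)"
 unfolding start_exc_def
 using countable_step_exc[OF pieces_inv]
 by (intro countable_Un countable_UN countable_exc)
  (auto simp: start_ok_def nondeg_def intro!: countable_finite interval_finite_frontier)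

lemma countable_stopped:
 assumes Q: "start_ok Q" shows "countable (stopped S Q n)"
proof (cases n)
 case (Suc m)
 note inv = pieces_inv[OF Q, of m]
 have ok: "nondeg s" if "s \<in> stopped S Q n" for s using stopped_stopped_ok[OF Q that] by (simp add: stopped_ok_def)
 have disj: "interior s \<inter> interior s' = {}" if s: "s \<in> stopped S Q n" "s' \<in> stopped S Q n" "s \<noteq> s'" for s s'
 proof (rule ccontr)
  assume ne: "interior s \<inter> interior s' \<noteq> {}"
  obtain x where x: "x \<in> interior s \<inter> interior s'" "x \<notin> step_exc (Suc m) (pieces S Q m)"
   by (rule open_minus_countable[OF _ ne countable_step_exc[OF inv]]) auto
  hence xx: "x \<in> s" "x \<in> s'" using interior_subset by blast+
  have s': "s \<in> next_stopped S (Suc m) (pieces S Q m)" "s' \<in> next_stopped S (Suc m) (pieces S Q m)"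
   using s Suc by auto
  show False
  proof (cases "x \<in> (\<Union>w\<in>pieces S Q m. fst w)")
   case True
   thus ?thesis using exact_one_unique(2)[OF step_exact(1)[OF inv x(2) True] s' xx] s by blast
  next
   case False
   thus ?thesis using step_exact(2)[OF inv x(2) False] s' xx by blast
  qed
 qed
 have "inj_on interior (stopped S Q n)"
 proof (rule inj_onI, rule ccontr)
  fix s s' assume "s \<in> stopped S Q n" "s' \<in> stopped S Q n" "interior s = interior s'" "s \<noteq> s'"
  thus False using disj[of s s'] ok[of s] by (auto simp: nondeg_def)
 qed
 moreover have "countable (interior ` stopped S Q n)"
 proof (rule countable_disjoint_open_subsets)
  show "pairwise disjnt (interior ` stopped S Q n)"
   unfolding pairwise_def disjnt_def
  proof (intro ballI impI)
   fix X Y assume "X \<in> interior ` stopped S Q n" "Y \<in> interior ` stopped S Q n" "X \<noteq> Y"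
   then obtain s s' where "s \<in> stopped S Q n" "s' \<in> stopped S Q n" "s \<noteq> s'" "X = interior s" "Y = interior s'" by blast
   thus "X \<inter> Y = {}" using disj by simp
  qed
 qed auto
 ultimately show ?thesis using countable_image_inj_on by blast
qed simp

section \<open>Landing intervals: returns and end pieces\<close>

definition landing :: "real set => bool" where
 "landing J \<longleftrightarrow> is_interval J \<and> J \<subseteq> {1 - a..1} - H \<and> J \<subseteq> {-1..1} \<and> (\<exists>x\<in>J. \<exists>y\<in>J. 4 ^ 6 * \<epsilon> \<le> \<bar>x - y\<bar>)"

lemma beyond_interval:
 assumes "is_interval J" shows "is_interval {y\<in>J. \<forall>z\<in>Z. beyond b y z}"
 unfolding is_interval_1
proof (intro ballI allI impI)
 fix x y q assume h: "x \<in> {y\<in>J. \<forall>z\<in>Z. beyond b y z}" "y \<in> {y\<in>J. \<forall>z\<in>Z. beyond b y z}" "x \<le> q \<and> q \<le> y"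
 hence "q \<in> J" using interval_mem[OF assms, of x y q] by blast
 moreover have "beyond b q z" if "z \<in> Z" for z
 proof -
  have "beyond b x z" "beyond b y z" using h(1,2) that by blast+
  thus ?thesis using h(3) by (auto simp: beyond_def split: if_splits)
 qed
 ultimately show "q \<in> {y\<in>J. \<forall>z\<in>Z. beyond b y z}" by blast
qed

lemma end_part_interval: "is_interval J ==> is_interval (end_part S J b)"
proof -
 have "end_part S J b = {y\<in>J. \<forall>z\<in>\<Union>(covered S J). beyond b y z}" unfolding end_part_def by blast
 thus "is_interval J ==> is_interval (end_part S J b)" using beyond_interval by (simp only:)
qed

lemma end_piece_interval:
 assumes "is_interval J" shows "is_interval (end_piece S J b)"
proof (cases "short_end S J b")
 case True
 have "{y\<in>J. \<forall>L\<in>covered S J. \<not> outermost S J b L --> (\<forall>z\<in>L. beyond b y z)} =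
  {y\<in>J. \<forall>z\<in>\<Union>{L\<in>covered S J. \<not> outermost S J b L}. beyond b y z}" by blast
 hence "end_piece S J b = {y\<in>J. \<forall>z\<in>\<Union>{L\<in>covered S J. \<not> outermost S J b L}. beyond b y z}"
  using True by (simp only: end_piece_def if_True)
 thus ?thesis using beyond_interval[OF assms] by (simp only:)
qed (simp add: end_piece_def end_part_interval[OF assms])

lemma end_part_subset: "end_part S J b \<subseteq> end_piece S J b" "end_piece S J b \<subseteq> J"
 by (auto simp: end_piece_def end_part_def)

lemma end_pieces_ok:
 assumes J: "landing J" and E: "E \<in> end_pieces S J"
 shows "start_ok E" "E \<subseteq> J"
proof -
 obtain b where b: "E = end_piece S J b" "0 < len (end_part S J b)" using E by (auto simp: end_pieces_def)
 have Ji: "is_interval J" "J \<subseteq> {-1..1}" "J \<inter> H = {}" using J by (auto simp: landing_def)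
 have sub: "end_part S J b \<subseteq> E" "E \<subseteq> J" using end_part_subset b by auto
 have "nondeg (end_part S J b)"
  using nondeg_len[OF end_part_interval[OF Ji(1)]] b(2) sub Ji(2) by (meson order_trans)
 hence "nondeg E" using interior_mono[OF sub(1)] end_piece_interval[OF Ji(1)] b(1) by (auto simp: nondeg_def)
 thus "start_ok E" "E \<subseteq> J" using sub Ji by (auto simp: start_ok_def)
qed

text \<open>An end part of length zero need not be empty, yet \<open>end_pieces\<close> drops it;
  its single point is exceptional, as are the points missed by the reference intervals.\<close>

definition landing_exc :: "real set => real set" where
 "landing_exc J = ({1 - a..1} - H - \<Union>(set (refs S))) \<union> \<Union>{end_part S J b | b. len (end_part S J b) = 0}"

lemma countable_landing_exc: assumes J: "landing J" shows "countable (landing_exc J)"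
proof -
 have *: "countable (end_part S J b)" if "len (end_part S J b) = 0" for b
 proof -
  have i: "is_interval (end_part S J b)" using J end_part_interval by (auto simp: landing_def)
  have "end_part S J b \<subseteq> {-1..1}" using end_part_subset(1)[of J b] end_part_subset(2)[of J b] J unfolding landing_def by blast
  hence "\<not> nondeg (end_part S J b)" using nondeg_len[OF i] that by simp
  hence "x = y" if "x \<in> end_part S J b" "y \<in> end_part S J b" for x y using nondeg_two[OF i that] by blast
  hence "finite (end_part S J b)" by (metis finite.emptyI finite.insertI is_singletonI' is_singleton_def)
  thus ?thesis by (rule countable_finite)
 qed
 have "{end_part S J b | b. len (end_part S J b) = 0} \<subseteq> range (end_part S J)" by auto
 hence c: "countable {end_part S J b | b. len (end_part S J b) = 0}"
  by (rule countable_subset) (simp add: countable_finite)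
 have "countable (\<Union>{end_part S J b | b. len (end_part S J b) = 0})"
  using countable_UN[OF c, of id] * by auto
 moreover have "finite ({1 - a..1} - H - \<Union>(set (refs S)))" using refs by (simp add: reference_family_def crit_par_eq)
 ultimately show ?thesis unfolding landing_exc_def by (simp only: countable_Un_iff countable_finite)
qed

lemma ref_props:
 assumes "L \<in> set (refs S)"
 shows "is_interval L" "L \<subseteq> {-1..1} - H" "\<epsilon> \<le> len L" "nondeg L" "len L \<le> 2 * \<epsilon>"
proof -
 show *: "is_interval L" "L \<subseteq> {-1..1} - H" "\<epsilon> \<le> len L" "len L \<le> 2 * \<epsilon>"
  using refs assms by (auto simp: reference_family_def start_interval_def)
 thus "nondeg L" using nondeg_len[of L] eps_pos by auto
qed

lemma refs_disjoint:
 assumes "L \<in> set (refs S)" "L' \<in> set (refs S)" "y \<in> L" "y \<in> L'" shows "L = L'"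
proof -
 have "disjoint (set (refs S))" using refs by (simp add: reference_family_def)
 thus ?thesis using assms by (auto simp: disjoint_def)
qed

text \<open>Three consecutive windows of length 5 \<epsilon> each contain a covered reference
  interval, and the middle one is outermost on neither side. It separates the two end pieces from
  each other.\<close>

lemma landing_middle:
 assumes J: "landing J" shows "\<exists>L\<in>covered S J. \<forall>b. \<not> outermost S J b L"
proof -
 obtain x y where xy: "x \<in> J" "y \<in> J" "4 ^ 6 * \<epsilon> \<le> \<bar>x - y\<bar>" using J by (auto simp: landing_def)
 define \<alpha> where "\<alpha> = min x y"
 have Ji: "is_interval J" using J by (simp add: landing_def)
 have "{\<alpha>..max x y} \<subseteq> J" using interval_Icc[OF Ji xy(1,2)] interval_Icc[OF Ji xy(2,1)] by (auto simp: \<alpha>_def min_def max_def)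
 moreover have "\<alpha> + 15 * \<epsilon> \<le> max x y"
 proof -
  have "4 ^ 6 * \<epsilon> = 4096 * \<epsilon>" by simp
  moreover have "\<bar>x - y\<bar> = max x y - \<alpha>" by (auto simp: \<alpha>_def)
  ultimately show ?thesis using xy(3) eps_pos by linarith
 qed
 ultimately have sub: "{\<alpha>..\<alpha> + 15 * \<epsilon>} \<subseteq> J" by (meson atLeastatMost_subset_iff order_refl order_trans)
 have ex: "\<exists>L\<in>covered S J. L \<subseteq> {p<..<q} \<and> L \<noteq> {}" if "\<alpha> \<le> p" "q \<le> \<alpha> + 15 * \<epsilon>" "q - p = 5 * \<epsilon>" for p q
 proof -
  have pq: "{p<..<q} \<subseteq> J" using sub that by auto
  have "{p<..<q} \<subseteq> {1 - a..1} - H" using pq J by (auto simp: landing_def)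
  moreover have "4 * \<epsilon> < q - p" using that eps_pos by simp
  ultimately obtain L where L: "L \<in> set (refs S)" "L \<subseteq> {p<..<q}" "nondeg L" by (rule ref_inside)
  hence "interior L \<subseteq> J" using pq interior_subset[of L] by blast
  hence "L \<in> covered S J" using L(1) by (simp add: covered_def)
  moreover have "L \<noteq> {}" using nondeg_obtain[OF L(3)] by blast
  ultimately show ?thesis using L(2) by blast
 qed
 obtain L1 where L1: "L1 \<in> covered S J" "L1 \<subseteq> {\<alpha><..<\<alpha> + 5 * \<epsilon>}" "L1 \<noteq> {}"
  using ex[of \<alpha> "\<alpha> + 5 * \<epsilon>"] eps_pos by auto
 obtain L2 where L2: "L2 \<in> covered S J" "L2 \<subseteq> {\<alpha> + 5 * \<epsilon><..<\<alpha> + 10 * \<epsilon>}" "L2 \<noteq> {}"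
  using ex[of "\<alpha> + 5 * \<epsilon>" "\<alpha> + 10 * \<epsilon>"] eps_pos by auto
 obtain L3 where L3: "L3 \<in> covered S J" "L3 \<subseteq> {\<alpha> + 10 * \<epsilon><..<\<alpha> + 15 * \<epsilon>}" "L3 \<noteq> {}"
  using ex[of "\<alpha> + 10 * \<epsilon>" "\<alpha> + 15 * \<epsilon>"] eps_pos by auto
 obtain z1 z2 z3 where z: "z1 \<in> L1" "z2 \<in> L2" "z3 \<in> L3" using L1 L2 L3 by blast
 have zz: "z1 < \<alpha> + 5 * \<epsilon>" "\<alpha> + 5 * \<epsilon> < z2" "z2 < \<alpha> + 10 * \<epsilon>" "\<alpha> + 10 * \<epsilon> < z3"
  using subsetD[OF L1(2) z(1)] subsetD[OF L2(2) z(2)] subsetD[OF L3(2) z(3)] by simp_all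
 have "z1 \<notin> L2" "z3 \<notin> L2" using L2(2) zz by force+
 hence ne: "L1 \<in> covered S J - {L2}" "L3 \<in> covered S J - {L2}" using z L1(1) L3(1) by blast+
 have "\<not> outermost S J b L2" for b
 proof
  assume "outermost S J b L2"
  hence "beyond b z2 z1" "beyond b z2 z3" using ne z unfolding outermost_def by blast+
  thus False using zz by (simp add: beyond_def split: if_splits)
 qed
 thus ?thesis using L2(1) by blast
qed

text \<open>Consider the reference interval through \<open>y\<close>. If it is covered, it either
  returns or has been adjoined to a short end. If not, it sticks out of \<open>J\<close>, and
  disjointness of the reference intervals puts \<open>y\<close> beyond all covered ones on that
  side.\<close>

lemma landing_exact:
 assumes J: "landing J" and y: "y \<in> J" "y \<notin> landing_exc J"
 shows "((\<exists>L. {L\<in>returning S J. y \<in> L} = {L}) \<and> {E\<in>end_pieces S J. y \<in> E} = {}) \<or>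
  ({L\<in>returning S J. y \<in> L} = {} \<and> (\<exists>E. {E\<in>end_pieces S J. y \<in> E} = {E}))"
proof -
 have Ji: "is_interval J" using J by (simp add: landing_def)
 obtain M where M: "M \<in> covered S J" "\<And>b. \<not> outermost S J b M" using landing_middle[OF J] by blast
 have Mref: "M \<in> set (refs S)" using M(1) by (simp add: covered_def)
 obtain z where z: "z \<in> M" using nondeg_obtain[OF ref_props(4)[OF Mref]] by blast
 have bM: "beyond b y z" if "y \<in> end_piece S J b" for b
  using that M z by (auto simp: end_piece_def end_part_def split: if_splits)
 have Esame: "b = b'" if "y \<in> end_piece S J b" "y \<in> end_piece S J b'" for b b'
  using bM[OF that(1)] bM[OF that(2)] by (cases b; cases b') (auto simp: beyond_def)
 have Eu: "E = E'" if "E \<in> end_pieces S J" "E' \<in> end_pieces S J" "y \<in> E" "y \<in> E'" for E E'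
  using that Esame unfolding end_pieces_def by blast
 have Lu: "L = L'" if "L \<in> returning S J" "L' \<in> returning S J" "y \<in> L" "y \<in> L'" for L L'
  using that refs_disjoint by (auto simp: returning_def covered_def)
 have LE: False if L: "L \<in> returning S J" "y \<in> L" and E: "E \<in> end_pieces S J" "y \<in> E" for L E
 proof -
  obtain b where b: "E = end_piece S J b" using E(1) by (auto simp: end_pieces_def)
  have Lc: "L \<in> covered S J" using L(1) by (simp add: returning_def)
  have "beyond b y y"
  proof (cases "short_end S J b")
   case True
   hence "\<not> outermost S J b L" using L(1) by (auto simp: returning_def)
   thus ?thesis using E(2) b True Lc L(2) by (auto simp: end_piece_def)
  next
   case False
   thus ?thesis using E(2) b Lc L(2) by (auto simp: end_piece_def end_part_def)
  qed
  thus False by (simp add: beyond_def split: if_splits)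
 qed
 have ex: "(\<exists>L\<in>returning S J. y \<in> L) \<or> (\<exists>E\<in>end_pieces S J. y \<in> E)"
 proof -
  have "y \<in> {1 - a..1} - H" using J y(1) by (auto simp: landing_def)
  then obtain L where L: "L \<in> set (refs S)" "y \<in> L" using y(2) unfolding landing_exc_def by blast
  note Lp = ref_props[OF L(1)]
  show ?thesis
  proof (cases "L \<in> covered S J")
   case True
   show ?thesis
   proof (cases "L \<in> returning S J")
    case False
    then obtain b where b: "short_end S J b" "outermost S J b L" using True by (auto simp: returning_def)
    have "y \<in> end_piece S J b"
    proof -
     have "beyond b y z'" if "L' \<in> covered S J" "\<not> outermost S J b L'" "z' \<in> L'" for L' z'
     proof -
      have "L' \<noteq> L" using that b by auto
      thus ?thesis using b(2) that L(2) unfolding outermost_def by blast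
     qed
     thus ?thesis using b(1) y(1) by (auto simp: end_piece_def)
    qed
    thus ?thesis using b(1) by (auto simp: end_pieces_def short_end_def)
   qed (use L in blast)
  next
   case False
   then obtain p where p: "p \<in> interior L" "p \<notin> J" using L(1) by (auto simp: covered_def)
   have pL: "p \<in> L" using p(1) interior_subset by blast
   define b where "b \<longleftrightarrow> y < p"
   have yp: "y \<noteq> p" using y(1) p(2) by auto
   have "y \<in> end_part S J b"
    unfolding end_part_def
   proof (intro CollectI conjI ballI y(1))
    fix L' z' assume L': "L' \<in> covered S J" "z' \<in> L'"
    have ne: "L' \<noteq> L" using L' False by auto
    have L'r: "L' \<in> set (refs S)" using L' by (simp add: covered_def)
    \<comment> \<open>Covering concerns interiors only, so a covered reference interval is contained
      in the closure of \<open>J\<close> but perhaps not in \<open>J\<close>.\<close>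
    have zcl: "z' \<in> closure J"
    proof -
     have "interior L' \<subseteq> J" using L' by (simp add: covered_def)
     hence "closure (interior L') \<subseteq> closure J" by (rule closure_mono)
     moreover have "closure (interior L') = closure L'"
      using ref_props(1,4)[OF L'r] by (intro convex_closure_interior) (auto simp: is_interval_convex_1 nondeg_def)
     ultimately show ?thesis using L'(2) closure_subset by blast
    qed
    have znL: "z' \<notin> L" using refs_disjoint[OF L'r L(1) L'(2)] ne by blast
    show "beyond b y z'"
    proof (cases "y < p")
     case True
     have "J \<subseteq> {..p}" 
     proof
      fix q assume "q \<in> J"
      thus "q \<in> {..p}" using interval_mem[OF Ji y(1), of q p] True p(2) by (cases "q \<le> p") auto
     qed
     hence "closure J \<subseteq> {..p}" by (intro closure_minimal) auto
     hence "z' \<le> p" using zcl by auto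
     hence "z' < y" using interval_mem[OF Lp(1) L(2) pL, of z'] znL by (cases "z' < y") auto
     thus ?thesis using True by (simp add: beyond_def b_def)
    next
     case F2: False
     hence py: "p < y" using yp by simp
     have "J \<subseteq> {p..}" 
     proof
      fix q assume "q \<in> J"
      thus "q \<in> {p..}" using interval_mem[OF Ji _ y(1), of q p] py p(2) by (cases "p \<le> q") auto
     qed
     hence "closure J \<subseteq> {p..}" by (intro closure_minimal) auto
     hence "p \<le> z'" using zcl by auto
     hence "y < z'" using interval_mem[OF Lp(1) pL L(2), of z'] znL by (cases "y < z'") auto
     thus ?thesis using F2 by (simp add: beyond_def b_def)
    qed
   qed
   moreover from this have "len (end_part S J b) \<noteq> 0" using y(2) unfolding landing_exc_def by blast
   hence "0 < len (end_part S J b)" using measure_nonneg[of lborel "end_part S J b"] by linarith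
   ultimately show ?thesis using end_part_subset(1)[of J b] unfolding end_pieces_def by blast
  qed
 qed
 show ?thesis
 proof (cases "\<exists>L\<in>returning S J. y \<in> L")
  case True
  then obtain L where L: "L \<in> returning S J" "y \<in> L" by blast
  hence "{L\<in>returning S J. y \<in> L} = {L}" using Lu by blast
  moreover have "{E\<in>end_pieces S J. y \<in> E} = {}" using LE L by blast
  ultimately show ?thesis by blast
 next
  case False
  then obtain E where E: "E \<in> end_pieces S J" "y \<in> E" using ex by blast
  hence "{E\<in>end_pieces S J. y \<in> E} = {E}" using Eu by blast
  thus ?thesis using False by blast
 qed
qed

section \<open>Stages of the construction and the elements of the return partition\<close>

definition stage_ok :: "real set => real set => nat => bool" where
 "stage_ok L V i \<longleftrightarrow> V \<subseteq> L \<and> regular i V \<and> start_ok ((T ^^ i) ` V)"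

lemma stage_stop:
 assumes V: "stage_ok L V i" and Z: "Z \<in> stopped S ((T ^^ i) ` V) n"
 defines "A \<equiv> {x\<in>V. (T ^^ i) x \<in> Z}"
 shows "n \<ge> 1" "regular (i + n) A" "(T ^^ (i + n)) ` A = (T ^^ n) ` Z"
  "A \<subseteq> L" "nondeg A" "\<not> (T ^^ n) ` Z \<subseteq> H ==> landing ((T ^^ n) ` Z)"
proof -
 have so: "start_ok ((T ^^ i) ` V)" using V by (simp add: stage_ok_def)
 note st = stopped_stopped_ok[OF so Z]
 thus n: "n \<ge> 1" by simp
 have ok: "nondeg Z" "Z \<subseteq> (T ^^ i) ` V" "regular n Z" using st by (auto simp: stopped_ok_def)
 have wi: "is_interval Z" using ok(1) by (simp add: nondeg_def)
 have Vr: "regular i V" using V by (simp add: stage_ok_def)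
 have Ai: "is_interval A" unfolding A_def by (rule regular_vimage[OF Vr wi])
 have AV: "A \<subseteq> V" by (auto simp: A_def)
 thus "A \<subseteq> L" using V by (auto simp: stage_ok_def)
 have "(T ^^ j) y \<noteq> 0" if y: "y \<in> A" and j: "j < i + n" for y j
 proof (cases "j < i")
  case True
  thus ?thesis using Vr AV y by (auto simp: regular_def)
 next
  case False
  hence "(T ^^ (j - i)) ((T ^^ i) y) \<noteq> 0" using ok(3) y j by (auto simp: regular_def A_def)
  thus ?thesis using False iter_add[of i "j - i" a y] by simp
 qed
 thus reg: "regular (i + n) A" using Ai AV Vr by (auto simp: regular_def)
 have im: "(T ^^ i) ` A = Z" using ok(2) by (auto simp: A_def)
 have "(T ^^ (i + n)) ` A = (T ^^ n) ` (T ^^ i) ` A"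
  unfolding image_image by (intro image_cong refl iter_add)
 thus "(T ^^ (i + n)) ` A = (T ^^ n) ` Z" using im by simp
 obtain p q where pq: "p < q" "p \<in> Z" "q \<in> Z" by (rule nondeg_obtain[OF ok(1)])
 then obtain p' q' where "p' \<in> A" "q' \<in> A" "(T ^^ i) p' = p" "(T ^^ i) q' = q" unfolding im[symmetric] by blast
 hence "p' \<in> A" "q' \<in> A" "p' \<noteq> q'" using pq(1) by auto
 thus "nondeg A" by (rule nondeg_two[OF Ai])
 show "landing ((T ^^ n) ` Z)" if h: "\<not> (T ^^ n) ` Z \<subseteq> H"
 proof -
  have far: "(T ^^ n) ` Z \<inter> H = {}" "\<exists>x\<in>Z. \<exists>y\<in>Z. 4 ^ 6 * \<epsilon> \<le> \<bar>(T ^^ n) x - (T ^^ n) y\<bar>"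
   using st h by (auto simp: stopped_ok_def)
  have sub: "Z \<subseteq> {-1..1}" using ok(3) by (simp add: regular_def)
  have "(T ^^ n) y \<in> {1 - a..1} \<and> (T ^^ n) y \<in> {-1..1}" if "y \<in> Z" for y
  proof -
   have y: "y \<in> {-1..1}" using sub that by blast
   thus ?thesis using iter_range'[OF y, of n] iter_range[OF y, of n] n by simp
  qed
  thus ?thesis unfolding landing_def
   using far interval_image_iter[OF wi] by (auto simp del: atLeastAtMost_iff)
 qed
qed

lemma end_stage:
 assumes V: "stage_ok L V i" and Z: "Z \<in> stopped S ((T ^^ i) ` V) n"
  and J: "\<not> (T ^^ n) ` Z \<subseteq> H" and E: "E \<in> end_pieces S ((T ^^ n) ` Z)"
 defines "V' \<equiv> {x\<in>V. (T ^^ i) x \<in> Z \<and> (T ^^ (i + n)) x \<in> E}"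
 shows "stage_ok L V' (i + n)" "(T ^^ (i + n)) ` V' = E"
proof -
 let ?A = "{x\<in>V. (T ^^ i) x \<in> Z}"
 note s = stage_stop[OF V Z]
 note e = end_pieces_ok[OF s(6)[OF J] E]
 have V': "V' = {x\<in>?A. (T ^^ (i + n)) x \<in> E}" by (auto simp: V'_def)
 show im: "(T ^^ (i + n)) ` V' = E" unfolding V' using e(2) s(3) by auto
 have Ei: "is_interval E" using e(1) by (simp add: start_ok_def nondeg_def)
 have sub: "V' \<subseteq> ?A" unfolding V' by blast
 have "regular (i + n) V'" by (rule regular_subset[OF s(2) sub]) (unfold V', rule regular_vimage[OF s(2) Ei])
 thus "stage_ok L V' (i + n)" unfolding stage_ok_def im using e(1) s(4) sub by blast
qed

lemma stages_ok:
 assumes L: "L \<in> set (refs S)" and "(V, i) \<in> stages S L" shows "stage_ok L V i"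
 using assms(2)
proof induction
 case start
 thus ?case using ref_props[OF L] by (auto simp: stage_ok_def regular_def start_ok_def)
next
 case (restart V i Z n E)
 thus ?case using end_stage(1)[of L V i Z n E] by simp
qed

text \<open>Stopping times are at least 1, so a stage started at time \<open>i\<close> comes from a
  strictly earlier one through countably many choices; strong induction on the starting
  time.\<close>

lemma countable_stages:
 assumes L: "L \<in> set (refs S)" shows "countable (stages S L)"
proof -
 have "countable {V. (V, i) \<in> stages S L}" for i
 proof (induction i rule: less_induct)
  case (less i)
  define B where "B = (\<Union>\<sigma><i. \<Union>V\<in>{V. (V, \<sigma>) \<in> stages S L}.
   \<Union>Z\<in>stopped S ((T ^^ \<sigma>) ` V) (i - \<sigma>). \<Union>b\<in>UNIV.
    {{x\<in>V. (T ^^ \<sigma>) x \<in> Z \<and> (T ^^ i) x \<in> end_piece S ((T ^^ (i - \<sigma>)) ` Z) b}})"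
  have "countable B" unfolding B_def
  proof (intro countable_UN)
   show "countable {..<i}" by (rule countable_finite) simp
   show "countable {V. (V, \<sigma>) \<in> stages S L}" if "\<sigma> \<in> {..<i}" for \<sigma> using less that by simp
   show "countable (stopped S ((T ^^ \<sigma>) ` V) (i - \<sigma>))" if "V \<in> {V. (V, \<sigma>) \<in> stages S L}" for \<sigma> V
    using stages_ok[OF L, of V \<sigma>] that by (intro countable_stopped) (simp add: stage_ok_def)
  qed auto
  moreover have "V \<in> insert L B" if "(V, i) \<in> stages S L" for V
   using that
  proof cases
   case (restart V' \<sigma> Z n E)
   have "n \<ge> 1" using stage_stop(1)[OF stages_ok[OF L restart(3)]] restart(4) by simp
   hence n: "i - \<sigma> = n" "\<sigma> < i" using restart(2) by auto
   obtain b where b: "E = end_piece S ((T ^^ n) ` Z) b" using restart(6) by (auto simp: end_pieces_def)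
   have V: "V = {x\<in>V'. (T ^^ \<sigma>) x \<in> Z \<and> (T ^^ i) x \<in> end_piece S ((T ^^ (i - \<sigma>)) ` Z) b}"
    unfolding n(1) using restart(1) b restart(2) by simp
   have "Z \<in> stopped S ((T ^^ \<sigma>) ` V') (i - \<sigma>)" unfolding n(1) using restart(4) by simp
   moreover have "V' \<in> {V. (V, \<sigma>) \<in> stages S L}" "\<sigma> \<in> {..<i}" using restart(3) n(2) by auto
   ultimately have "V \<in> B" unfolding B_def V by (intro UN_I[of \<sigma>] UN_I[of V'] UN_I[of Z] UN_I[of b] singletonI UNIV_I)
   thus ?thesis by simp
  qed simp
  hence sub: "{V. (V, i) \<in> stages S L} \<subseteq> insert L B" by blast
  ultimately show ?case using countable_subset[OF sub] by simp
 qed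
 moreover have sub: "stages S L \<subseteq> (\<Union>i. (\<lambda>V. (V, i)) ` {V. (V, i) \<in> stages S L})" by auto
 moreover have "countable (\<Union>i. (\<lambda>V. (V, i)) ` {V. (V, i) \<in> stages S L})"
  by (intro countable_UN countable_image calculation(1)) simp
 ultimately show ?thesis using countable_subset[OF sub] by simp
qed

lemma eta_cases:
 assumes "(A, m) \<in> eta S L"
 obtains (hole) V i Z n where "A = {x\<in>V. (T ^^ i) x \<in> Z}" "m = i + n" "(V, i) \<in> stages S L"
   "Z \<in> stopped S ((T ^^ i) ` V) n" "(T ^^ n) ` Z \<subseteq> H"
  | (return) V i Z n L' where "A = {x\<in>V. (T ^^ i) x \<in> Z \<and> (T ^^ (i + n)) x \<in> L'}" "m = i + n" "(V, i) \<in> stages S L"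
   "Z \<in> stopped S ((T ^^ i) ` V) n" "\<not> (T ^^ n) ` Z \<subseteq> H" "L' \<in> returning S ((T ^^ n) ` Z)"
 using assms unfolding eta_def iter_T
 by (elim UnE CollectE exE conjE Pair_inject) (rule hole return; assumption)+

lemma countable_eta:
 assumes L: "L \<in> set (refs S)" shows "countable (eta S L)"
proof -
 \<comment> \<open>With \<open>UNIV\<close> for \<open>X\<close> this is the form of an element
   falling into the hole, so both kinds of elements are enumerated together.\<close>
 define W where "W V i Z n X = ({x\<in>V. (T ^^ i) x \<in> Z \<and> (T ^^ (i + n)) x \<in> X}, i + n)" for V i Z n X
 define B where "B = (\<Union>p\<in>stages S L. \<Union>n. \<Union>Z\<in>stopped S ((T ^^ snd p) ` fst p) n. W (fst p) (snd p) Z n ` insert UNIV (set (refs S)))"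
 have "countable B" unfolding B_def
  using stages_ok[OF L] by (intro countable_UN countable_stages[OF L] countable_stopped countable_image countable_finite[of "insert _ _"])
   (auto simp: stage_ok_def)
 moreover have "eta S L \<subseteq> B"
 proof
  fix z assume z: "z \<in> eta S L"
  have B: "W V i Z n X \<in> B" if "(V, i) \<in> stages S L" "Z \<in> stopped S ((T ^^ i) ` V) n" "X \<in> insert UNIV (set (refs S))" for V i Z n X
   unfolding B_def by (intro UN_I[of "(V, i)"] UN_I[of n] UN_I[of Z] imageI) (use that in auto)
  obtain A m where Am: "z = (A, m)" "(A, m) \<in> eta S L" using z by (cases z) auto
  from Am(2) show "z \<in> B"
  proof (cases rule: eta_cases)
   case (hole V i Z n)
   thus ?thesis using B[of V i Z n UNIV] Am(1) by (simp add: W_def)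
  next
   case (return V i Z n L')
   thus ?thesis using B[of V i Z n L'] Am(1) by (simp add: W_def returning_def covered_def)
  qed
 qed
 ultimately show ?thesis by (rule countable_subset[rotated])
qed

lemma eta_props:
 assumes L: "L \<in> set (refs S)" and A: "(A, m) \<in> eta S L"
 shows "m \<ge> 1" "A \<subseteq> L" "regular m A" "nondeg A"
  "(T ^^ m) ` A \<subseteq> H \<or> (\<exists>L'\<in>set (refs S). (T ^^ m) ` A \<subseteq> L')"
proof -
 have "m \<ge> 1 \<and> A \<subseteq> L \<and> regular m A \<and> nondeg A \<and> ((T ^^ m) ` A \<subseteq> H \<or> (\<exists>L'\<in>set (refs S). (T ^^ m) ` A \<subseteq> L'))"
  using A
 proof (cases rule: eta_cases)
  case (hole V i Z n)
  note s = stage_stop[OF stages_ok[OF L hole(3)] hole(4)]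
  thus ?thesis using hole by simp
 next
  case (return V i Z n L')
  note s = stage_stop[OF stages_ok[OF L return(3)] return(4)]
  let ?A = "{x\<in>V. (T ^^ i) x \<in> Z}"
  have L': "L' \<in> set (refs S)" "interior L' \<subseteq> (T ^^ n) ` Z" using return(6) by (auto simp: returning_def covered_def)
  have A: "A = {x\<in>?A. (T ^^ m) x \<in> L'}" using return(1,2) by auto
  have Ai: "is_interval A" unfolding A return(2) by (rule regular_vimage[OF s(2) ref_props(1)[OF L'(1)]])
  have sub: "A \<subseteq> ?A" using A by blast
  have reg: "regular m A" unfolding return(2) by (rule regular_subset[OF s(2) sub Ai])
  obtain p q where pq: "p < q" "{p<..<q} \<subseteq> L'" by (rule nondeg_obtain[OF ref_props(4)[OF L'(1)]])
  obtain v where v: "p < v" "v < q" using dense[OF pq(1)] by blast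
  obtain u where u: "p < u" "u < v" using dense[OF v(1)] by blast
  have uv: "u \<in> {p<..<q}" "v \<in> {p<..<q}" "u < v" using u v by auto
  have "{p<..<q} \<subseteq> interior L'" by (rule interior_maximal[OF pq(2)]) simp
  hence "u \<in> (T ^^ m) ` ?A" "v \<in> (T ^^ m) ` ?A" using subsetD[OF L'(2), folded s(3) return(2)] uv(1,2) by blast+
  then obtain u' v' where "u' \<in> ?A" "v' \<in> ?A" "(T ^^ m) u' = u" "(T ^^ m) v' = v" by (elim imageE) simp
  hence "u' \<in> A" "v' \<in> A" "u' \<noteq> v'" using uv pq(2) A by auto
  hence "nondeg A" by (rule nondeg_two[OF Ai])
  thus ?thesis using s(1,4) sub reg A L'(1) return(2) by auto
 qed
 thus "m \<ge> 1" "A \<subseteq> L" "regular m A" "nondeg A"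
  "(T ^^ m) ` A \<subseteq> H \<or> (\<exists>L'\<in>set (refs S). (T ^^ m) ` A \<subseteq> L')" by auto
qed

definition stage_exc :: "real set => real set" where
 "stage_exc L = (\<Union>p\<in>stages S L. {x. (T ^^ snd p) x \<in> start_exc ((T ^^ snd p) ` fst p)} \<union>
   (\<Union>n. \<Union>Z\<in>{Z \<in> stopped S ((T ^^ snd p) ` fst p) n. \<not> (T ^^ n) ` Z \<subseteq> H}.
    {x. (T ^^ (snd p + n)) x \<in> landing_exc ((T ^^ n) ` Z)}))"

lemma stage_excD:
 assumes "x \<notin> stage_exc L" "(V, i) \<in> stages S L"
 shows "(T ^^ i) x \<notin> start_exc ((T ^^ i) ` V)"
  "Z \<in> stopped S ((T ^^ i) ` V) n ==> \<not> (T ^^ n) ` Z \<subseteq> H ==> (T ^^ (i + n)) x \<notin> landing_exc ((T ^^ n) ` Z)"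
 using assms unfolding stage_exc_def by (fastforce simp del: iter_add)+

lemma countable_stage_exc:
 assumes L: "L \<in> set (refs S)" shows "countable (stage_exc L)"
 unfolding stage_exc_def
proof (rule countable_UN[OF countable_stages[OF L]], rule countable_Un)
 fix p assume p: "p \<in> stages S L"
 have st: "stage_ok L (fst p) (snd p)" using stages_ok[OF L] p by simp
 hence so: "start_ok ((T ^^ snd p) ` fst p)" by (simp add: stage_ok_def)
 show "countable {x. (T ^^ snd p) x \<in> start_exc ((T ^^ snd p) ` fst p)}"
  by (rule countable_vimage_iter[OF countable_start_exc[OF so]])
 show "countable (\<Union>n. \<Union>Z\<in>{Z \<in> stopped S ((T ^^ snd p) ` fst p) n. \<not> (T ^^ n) ` Z \<subseteq> H}.
    {x. (T ^^ (snd p + n)) x \<in> landing_exc ((T ^^ n) ` Z)})"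
 proof (rule countable_UN[OF countableI_type], rule countable_UN)
  fix n show "countable {Z \<in> stopped S ((T ^^ snd p) ` fst p) n. \<not> (T ^^ n) ` Z \<subseteq> H}"
   by (rule countable_subset[OF _ countable_stopped[OF so]]) blast
  fix Z assume "Z \<in> {Z \<in> stopped S ((T ^^ snd p) ` fst p) n. \<not> (T ^^ n) ` Z \<subseteq> H}"
  thus "countable {x. (T ^^ (snd p + n)) x \<in> landing_exc ((T ^^ n) ` Z)}"
   by (intro countable_vimage_iter countable_landing_exc stage_stop(6)[OF st]) auto
 qed
qed

lemma eta_holeI:
 assumes "(V, i) \<in> stages S L" "Z \<in> stopped S ((T ^^ i) ` V) n" "(T ^^ n) ` Z \<subseteq> H"
 shows "({x\<in>V. (T ^^ i) x \<in> Z}, i + n) \<in> eta S L"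
 unfolding eta_def iter_T
 by (rule UnI1, rule CollectI, intro exI conjI, rule refl) (rule assms)+

lemma eta_returnI:
 assumes "(V, i) \<in> stages S L" "Z \<in> stopped S ((T ^^ i) ` V) n" "\<not> (T ^^ n) ` Z \<subseteq> H"
  "L' \<in> returning S ((T ^^ n) ` Z)"
 shows "({x\<in>V. (T ^^ i) x \<in> Z \<and> (T ^^ (i + n)) x \<in> L'}, i + n) \<in> eta S L"
 unfolding eta_def iter_T
 by (rule UnI2, rule CollectI, intro exI conjI, rule refl) (rule assms)+

text \<open>Labels of the construction attached to a point: its stage and piece if it is active, its
  element if it has returned (\<open>ret\<close>). Counting labels instead of sets makes uniqueness
  an induction on time.\<close>

definition act :: "real set => real => nat => (real set \<times> nat \<times> piece) set" where
 "act L x l = {(V, i, w). (V, i) \<in> stages S L \<and> i \<le> l \<and> w \<in> pieces S ((T ^^ i) ` V) (l - i) \<and>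
   x \<in> V \<and> (T ^^ i) x \<in> fst w}"

definition ret :: "real set => real => nat => (real set \<times> nat) set" where
 "ret L x l = {(A, n). (A, n) \<in> eta S L \<and> n \<le> l \<and> x \<in> A}"

lemma stage_step:
 assumes L: "L \<in> set (refs S)" and x: "x \<notin> stage_exc L" and V: "(V, i) \<in> stages S L"
 defines "Q \<equiv> (T ^^ i) ` V" and "y \<equiv> (T ^^ i) x"
 shows "w \<in> pieces S Q m ==> y \<in> fst w ==> exact_one (pieces S Q (Suc m)) (stopped S Q (Suc m)) y"
  and "w' \<in> pieces S Q (Suc m) ==> y \<in> fst w' ==> \<exists>w\<in>pieces S Q m. y \<in> fst w"
  and "Z \<in> stopped S Q (Suc m) ==> y \<in> Z ==> \<exists>w\<in>pieces S Q m. y \<in> fst w"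
  and "y \<in> Q ==> \<exists>w. {w\<in>pieces S Q 0. y \<in> fst w} = {w}"
proof -
 have so: "start_ok Q" using stages_ok[OF L V] by (simp add: stage_ok_def Q_def)
 have y: "y \<notin> start_exc Q" using stage_excD(1)[OF x V] by (simp add: Q_def y_def)
 hence ym: "y \<notin> step_exc (Suc m) (pieces S Q m)" "y \<notin> frontier Q" "y \<notin> exc 0" unfolding start_exc_def by blast+
 note se = step_exact[OF pieces_inv[OF so, of m] ym(1)]
 show "w \<in> pieces S Q m ==> y \<in> fst w ==> exact_one (pieces S Q (Suc m)) (stopped S Q (Suc m)) y"
  using se(1) by auto
 show "w' \<in> pieces S Q (Suc m) ==> y \<in> fst w' ==> \<exists>w\<in>pieces S Q m. y \<in> fst w"
  using se(2) by (simp only: pieces.simps) blast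
 show "Z \<in> stopped S Q (Suc m) ==> y \<in> Z ==> \<exists>w\<in>pieces S Q m. y \<in> fst w"
  using se(2) by (simp only: stopped.simps) blast
 show "y \<in> Q ==> \<exists>w. {w\<in>pieces S Q 0. y \<in> fst w} = {w}"
  using initial_exact(1)[OF so ym(2,3)] by simp
qed

definition exits :: "real set => real => nat => (real set \<times> nat \<times> real set) set" where
 "exits L x m = {(V, i, Z). i < m \<and> (V, i) \<in> stages S L \<and> x \<in> V \<and> (T ^^ i) x \<in> Z \<and>
   Z \<in> stopped S ((T ^^ i) ` V) (m - i)}"

lemma exits_act:
 assumes L: "L \<in> set (refs S)" and x: "x \<notin> stage_exc L" and e: "(V, i, Z) \<in> exits L x (Suc l)"
 shows "\<exists>w. (V, i, w) \<in> act L x l"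
proof -
 have V: "(V, i) \<in> stages S L" "i \<le> l" "x \<in> V" "(T ^^ i) x \<in> Z" "Z \<in> stopped S ((T ^^ i) ` V) (Suc (l - i))"
  using e by (auto simp: exits_def Suc_diff_le)
 show ?thesis using stage_step(3)[OF L x V(1) V(5,4)] V by (auto simp: act_def)
qed

lemma act_Suc_old:
 assumes L: "L \<in> set (refs S)" and x: "x \<notin> stage_exc L"
  and p: "(V, i, w) \<in> act L x (Suc l)" "i \<le> l"
 shows "\<exists>w. (V, i, w) \<in> act L x l"
proof -
 have V: "(V, i) \<in> stages S L" "x \<in> V" "(T ^^ i) x \<in> fst w" "w \<in> pieces S ((T ^^ i) ` V) (Suc (l - i))"
  using p by (auto simp: act_def Suc_diff_le)
 show ?thesis using stage_step(2)[OF L x V(1) V(4,3)] V p(2) by (auto simp: act_def)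
qed

lemma act_new:
 assumes L: "L \<in> set (refs S)" and p: "(V', Suc l, w) \<in> act L x (Suc l)"
 obtains V i Z E where "(V, i, Z) \<in> exits L x (Suc l)" "\<not> (T ^^ (Suc l - i)) ` Z \<subseteq> H"
  "E \<in> end_pieces S ((T ^^ (Suc l - i)) ` Z)" "(T ^^ Suc l) x \<in> E"
  "V' = {x\<in>V. (T ^^ i) x \<in> Z \<and> (T ^^ Suc l) x \<in> E}"
proof -
 have V': "(V', Suc l) \<in> stages S L" "x \<in> V'" using p by (auto simp: act_def)
 from V'(1) show ?thesis
 proof cases
  case (restart V i Z n E)
  have n: "n \<ge> 1" using stage_stop(1)[OF stages_ok[OF L restart(3)]] restart(4) by simp
  hence tn: "i < Suc l" "Suc l - i = n" using restart(2) by auto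
  have V'eq: "V' = {x\<in>V. (T ^^ i) x \<in> Z \<and> (T ^^ Suc l) x \<in> E}" using restart(1) unfolding iter_T restart(2)[symmetric] .
  have "(V, i, Z) \<in> exits L x (Suc l)" unfolding exits_def using tn restart(3,4) V'(2) V'eq by simp
  thus ?thesis using that[of V i Z E] V'eq V'(2) restart(5,6) tn(2) by (simp del: funpow.simps)
 qed
qed

lemma ret_new:
 assumes L: "L \<in> set (refs S)" and A: "(A, m) \<in> eta S L" "x \<in> A"
 obtains V i Z where "(V, i, Z) \<in> exits L x m" "(T ^^ (m - i)) ` Z \<subseteq> H" "A = {x\<in>V. (T ^^ i) x \<in> Z}"
  | V i Z L' where "(V, i, Z) \<in> exits L x m" "\<not> (T ^^ (m - i)) ` Z \<subseteq> H"
   "L' \<in> returning S ((T ^^ (m - i)) ` Z)" "(T ^^ m) x \<in> L'"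
   "A = {x\<in>V. (T ^^ i) x \<in> Z \<and> (T ^^ m) x \<in> L'}"
 using A(1)
proof (cases rule: eta_cases)
 case (hole V i Z n)
 have n: "n \<ge> 1" using stage_stop(1)[OF stages_ok[OF L hole(3)]] hole(4) by simp
 hence tn: "i < m" "m - i = n" using hole(2) by auto
 have "(V, i, Z) \<in> exits L x m" unfolding exits_def using tn hole(1,3,4) A(2) by simp
 thus ?thesis using that(1)[of V i Z] hole(1,5) tn(2) by simp
next
 case (return V i Z n L')
 have n: "n \<ge> 1" using stage_stop(1)[OF stages_ok[OF L return(3)]] return(4) by simp
 hence tn: "i < m" "m - i = n" using return(2) by auto
 have A': "A = {x\<in>V. (T ^^ i) x \<in> Z \<and> (T ^^ m) x \<in> L'}" using return(1) unfolding return(2)[symmetric] .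
 have "(V, i, Z) \<in> exits L x m" unfolding exits_def using tn A' return(3,4) A(2) by simp
 thus ?thesis using that(2)[of V i Z L'] A' A(2) return(5,6) tn(2) by simp
qed

lemma act_0: "L \<in> set (refs S) ==> (V, 0) \<in> stages S L ==> V = L"
proof -
 assume L: "L \<in> set (refs S)" and "(V, 0) \<in> stages S L"
 from this(2) show ?thesis
 proof cases
  case (restart V' i Z n E)
  have "n \<ge> 1" using stage_stop(1)[OF stages_ok[OF L restart(3)]] restart(4) by simp
  thus ?thesis using restart(2) by simp
 qed
qed

text \<open>At every time a good point has exactly one label. Within a stage the label persists or
  ends by \<open>exact_one\<close>; when it ends, the point falls into the hole, returns, or enters
  one end piece and starts a new stage, and \<open>landing_exact\<close> makes these alternatives
  exclusive. A returned point produces no further labels.\<close>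

lemma tag_exact:
 assumes L: "L \<in> set (refs S)" and x: "x \<in> L" "x \<notin> stage_exc L"
 shows "((\<exists>p. act L x l = {p}) \<and> ret L x l = {}) \<or> (act L x l = {} \<and> (\<exists>p. ret L x l = {p}))"
proof (induction l)
 case 0
 have st: "(L, 0) \<in> stages S L" by (rule stages.start)
 obtain w where w: "{w\<in>pieces S ((T ^^ 0) ` L) 0. (T ^^ 0) x \<in> fst w} = {w}"
  using stage_step(4)[OF L x(2) st] x(1) by auto
 have "act L x 0 = {(L, 0, w)}"
 proof (intro set_eqI iffI)
  fix p assume "p \<in> act L x 0"
  then obtain V w' where p: "p = (V, 0, w')" "(V, 0) \<in> stages S L" "w' \<in> pieces S ((T ^^ 0) ` V) 0" "(T ^^ 0) x \<in> fst w'"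
   by (auto simp: act_def)
  have "V = L" using act_0[OF L p(2)] .
  hence "w' \<in> {w}" using p unfolding w[symmetric] by blast
  thus "p \<in> {(L, 0, w)}" using p(1) `V = L` by simp
 next
  fix p :: "real set \<times> nat \<times> piece" assume p: "p \<in> {(L, 0, w)}"
  have "w \<in> {w\<in>pieces S ((T ^^ 0) ` L) 0. (T ^^ 0) x \<in> fst w}" unfolding w by blast
  thus "p \<in> act L x 0" using p st x(1) by (simp add: act_def)
 qed
 moreover have "ret L x 0 = {}" using eta_props(1)[OF L] by (fastforce simp: ret_def)
 ultimately show ?case by blast
next
 case (Suc l)
 show ?case
 proof (cases "act L x l = {}")
  case True
  then obtain q where q: "ret L x l = {q}" using Suc by blast
  have noex: "exits L x (Suc l) = {}"
   using exits_act[OF L x(2), of _ _ _ l] True by (auto simp only:)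
  have "act L x (Suc l) = {}"
  proof (rule ccontr)
   assume "act L x (Suc l) \<noteq> {}"
   then obtain V i w where p: "(V, i, w) \<in> act L x (Suc l)" by auto
   show False
   proof (cases "i \<le> l")
    case False
    hence "i = Suc l" using p by (auto simp: act_def)
    thus False using p noex by (auto elim!: act_new[OF L])
   qed (use act_Suc_old[OF L x(2) p] True in auto)
  qed
  moreover have "ret L x (Suc l) = ret L x l"
  proof -
   have "n \<noteq> Suc l" if "(A, n) \<in> eta S L" "x \<in> A" for A n
    using ret_new[OF L that] noex by (metis empty_iff)
   thus ?thesis unfolding ret_def le_Suc_eq by blast
  qed
  ultimately show ?thesis using q by blast
 next
  case False
  then obtain V i w where vw: "act L x l = {(V, i, w)}" "ret L x l = {}" using Suc by (metis prod_cases3)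
  hence "(V, i, w) \<in> act L x l" by simp
  hence V: "(V, i) \<in> stages S L" "i \<le> l" "w \<in> pieces S ((T ^^ i) ` V) (l - i)" "x \<in> V" "(T ^^ i) x \<in> fst w"
   by (auto simp: act_def)
  let ?Q = "(T ^^ i) ` V" and ?n = "Suc l - i"
  have sn: "Suc (l - i) = ?n" using V(2) by simp
  have sel: "(V', i') = (V, i)" if "(V', i', Z) \<in> exits L x (Suc l)" for V' i' Z
   using exits_act[OF L x(2) that] vw(1) by simp
  have one: "exact_one (pieces S ?Q ?n) (stopped S ?Q ?n) ((T ^^ i) x)"
   using stage_step(1)[OF L x(2) V(1,3,5)] unfolding sn .
  have old: "(V', i') = (V, i)" if "(V', i', w') \<in> act L x (Suc l)" "i' \<le> l" for V' i' w'
   using act_Suc_old[OF L x(2) that] vw(1) by simp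
  from one[unfolded exact_one_def] show ?thesis
  proof (elim disjE exE conjE)
   fix w' assume w': "{w\<in>pieces S ?Q ?n. (T ^^ i) x \<in> fst w} = {w'}" and no: "{s\<in>stopped S ?Q ?n. (T ^^ i) x \<in> s} = {}"
   have noex: "exits L x (Suc l) = {}"
   proof (rule ccontr)
    assume "exits L x (Suc l) \<noteq> {}"
    then obtain V' i' Z where e: "(V', i', Z) \<in> exits L x (Suc l)" by auto
    have "Z \<in> {s\<in>stopped S ?Q ?n. (T ^^ i) x \<in> s}" using sel[OF e] e by (simp add: exits_def)
    thus False using no by blast
   qed
   have "act L x (Suc l) = {(V, i, w')}"
   proof (intro set_eqI iffI)
    fix p assume p: "p \<in> act L x (Suc l)"
    obtain V1 i1 w1 where p1: "p = (V1, i1, w1)" by (rule prod_cases3)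
    have "i1 \<le> l"
    proof (rule ccontr)
     assume "\<not> i1 \<le> l"
     hence "i1 = Suc l" using p p1 by (auto simp: act_def)
     thus False using p p1 noex by (auto elim!: act_new[OF L])
    qed
    hence eq: "V1 = V" "i1 = i" using old p p1 by auto
    hence "w1 \<in> {w\<in>pieces S ?Q ?n. (T ^^ i) x \<in> fst w}" using p p1 by (simp add: act_def)
    thus "p \<in> {(V, i, w')}" unfolding w' using p1 eq by simp
   next
    fix p assume p: "p \<in> {(V, i, w')}"
    have "w' \<in> {w\<in>pieces S ?Q ?n. (T ^^ i) x \<in> fst w}" unfolding w' by simp
    thus "p \<in> act L x (Suc l)" using p V by (simp add: act_def)
   qed
   moreover have "ret L x (Suc l) = {}"
   proof -
    have "n \<noteq> Suc l" if "(A, n) \<in> eta S L" "x \<in> A" for A n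
     using ret_new[OF L that] noex by (metis empty_iff)
    thus ?thesis using vw(2) unfolding ret_def le_Suc_eq by blast
   qed
   ultimately show ?thesis by blast
  next
   fix Z assume Z1: "{s\<in>stopped S ?Q ?n. (T ^^ i) x \<in> s} = {Z}" and no: "{w\<in>pieces S ?Q ?n. (T ^^ i) x \<in> fst w} = {}"
   have Z: "Z \<in> stopped S ?Q ?n" "(T ^^ i) x \<in> Z" using Z1 by blast+
   have ex: "exits L x (Suc l) = {(V, i, Z)}"
   proof (intro set_eqI iffI)
    fix p assume p: "p \<in> exits L x (Suc l)"
    obtain V1 i1 w1 where p1: "p = (V1, i1, w1)" by (rule prod_cases3)
    hence eq: "V1 = V" "i1 = i" using sel p by auto
    hence "w1 \<in> {s\<in>stopped S ?Q ?n. (T ^^ i) x \<in> s}" using p p1 by (simp add: exits_def)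
    thus "p \<in> {(V, i, Z)}" unfolding Z1 using p1 eq by simp
   next
    fix p assume "p \<in> {(V, i, Z)}"
    thus "p \<in> exits L x (Suc l)" using V(1,2,4) Z by (simp add: exits_def)
   qed
   let ?J = "(T ^^ ?n) ` Z"
   have tn: "i + ?n = Suc l" using V(2) by simp
   \<comment> \<open>The piece of the current stage has just stopped, so activity at the next time
     can only belong to a stage started at that time.\<close>
   have young: "i' = Suc l" if "(V', i', w') \<in> act L x (Suc l)" for V' i' w'
   proof (rule ccontr)
    assume "i' \<noteq> Suc l"
    hence "i' \<le> l" using that by (auto simp: act_def)
    hence eq: "V' = V" "i' = i" using old[OF that] by auto
    hence "w' \<in> {w\<in>pieces S ?Q ?n. (T ^^ i) x \<in> fst w}" using that by (simp add: act_def)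
    thus False using no by blast
   qed
   have act_E: "\<exists>E. \<not> ?J \<subseteq> H \<and> E \<in> {E\<in>end_pieces S ?J. (T ^^ Suc l) x \<in> E} \<and> i' = Suc l \<and>
     V' = {x\<in>V. (T ^^ i) x \<in> Z \<and> (T ^^ Suc l) x \<in> E}" if p: "(V', i', w') \<in> act L x (Suc l)" for V' i' w'
   proof -
    have "(V', Suc l, w') \<in> act L x (Suc l)" using p young[OF p] by simp
    thus ?thesis
    proof (rule act_new[OF L])
     fix V1 i1 Z1 E assume h: "(V1, i1, Z1) \<in> exits L x (Suc l)" "\<not> (T ^^ (Suc l - i1)) ` Z1 \<subseteq> H"
      "E \<in> end_pieces S ((T ^^ (Suc l - i1)) ` Z1)" "(T ^^ Suc l) x \<in> E"
      "V' = {x\<in>V1. (T ^^ i1) x \<in> Z1 \<and> (T ^^ Suc l) x \<in> E}"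
     have "V1 = V" "i1 = i" "Z1 = Z" using ex h(1) by simp_all
     thus ?thesis using h young[OF p] by blast
    qed
   qed
   have retl: "n = Suc l" if "(A, n) \<in> ret L x (Suc l)" for A n
   proof (rule ccontr)
    assume "n \<noteq> Suc l"
    hence "(A, n) \<in> ret L x l" using that by (auto simp: ret_def)
    thus False using vw(2) by blast
   qed
   show ?thesis
   proof (cases "?J \<subseteq> H")
    case hole: True
    have "act L x (Suc l) = {}" using act_E hole by (auto simp only:)
    moreover have "ret L x (Suc l) = {({x\<in>V. (T ^^ i) x \<in> Z}, Suc l)}"
    proof (intro set_eqI iffI)
     fix p assume p: "p \<in> ret L x (Suc l)"
     obtain A n where An: "p = (A, n)" by (cases p)
     have n: "n = Suc l" using retl p An by simp
     have "(A, Suc l) \<in> eta S L" "x \<in> A" using p An n by (auto simp: ret_def)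
     hence "A = {x\<in>V. (T ^^ i) x \<in> Z}"
     proof (cases rule: ret_new[OF L, consumes 2])
      case (1 V1 i1 Z1)
      thus ?thesis using ex by simp
     next
      case (2 V1 i1 Z1 L')
      thus ?thesis using ex hole by simp
     qed
     thus "p \<in> {({x\<in>V. (T ^^ i) x \<in> Z}, Suc l)}" using An n by simp
    next
     fix p assume p: "p \<in> {({x\<in>V. (T ^^ i) x \<in> Z}, Suc l)}"
     have "({x\<in>V. (T ^^ i) x \<in> Z}, i + ?n) \<in> eta S L"
      by (rule eta_holeI[OF V(1) Z(1) hole])
     thus "p \<in> ret L x (Suc l)" using p V(4) Z(2) unfolding tn ret_def by simp
    qed
    ultimately show ?thesis by blast
   next
    case J: False
    note st = stage_stop[OF stages_ok[OF L V(1)] Z(1)]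
    have land: "landing ?J" by (rule st(6)[OF J])
    have xJ: "(T ^^ Suc l) x \<in> ?J" using Z(2) iter_add[of i ?n a x] unfolding tn by (simp del: funpow.simps)
    have xne: "(T ^^ Suc l) x \<notin> landing_exc ?J" using stage_excD(2)[OF x(2) V(1) Z(1) J] unfolding tn .
    from landing_exact[OF land xJ xne] show ?thesis
    proof (elim disjE exE conjE)
     fix L' assume L': "{L\<in>returning S ?J. (T ^^ Suc l) x \<in> L} = {L'}" and noE: "{E\<in>end_pieces S ?J. (T ^^ Suc l) x \<in> E} = {}"
     let ?A = "{x\<in>V. (T ^^ i) x \<in> Z \<and> (T ^^ Suc l) x \<in> L'}"
     have L1: "L' \<in> returning S ?J" "(T ^^ Suc l) x \<in> L'" using L' by blast+
     have "act L x (Suc l) = {}" using act_E noE by (auto simp only:)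
     moreover have "ret L x (Suc l) = {(?A, Suc l)}"
     proof (intro set_eqI iffI)
      fix p assume p: "p \<in> ret L x (Suc l)"
      obtain A n where An: "p = (A, n)" by (cases p)
      have n: "n = Suc l" using retl p An by simp
      have "(A, Suc l) \<in> eta S L" "x \<in> A" using p An n by (auto simp: ret_def)
      hence "A = ?A"
      proof (cases rule: ret_new[OF L, consumes 2])
       case (1 V1 i1 Z1)
       thus ?thesis using ex J by simp
      next
       case (2 V1 i1 Z1 L2)
       hence eq: "V1 = V" "i1 = i" "Z1 = Z" using ex by simp_all
       have "L2 \<in> {L\<in>returning S ?J. (T ^^ Suc l) x \<in> L}" using 2(3,4) unfolding eq by simp
       hence "L2 = L'" unfolding L' by simp
       thus ?thesis using 2(5) unfolding eq by simp
      qed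
      thus "p \<in> {(?A, Suc l)}" using An n by simp
     next
      fix p assume p: "p \<in> {(?A, Suc l)}"
      have "({x\<in>V. (T ^^ i) x \<in> Z \<and> (T ^^ (i + ?n)) x \<in> L'}, i + ?n) \<in> eta S L"
       by (rule eta_returnI[OF V(1) Z(1) J L1(1)])
      thus "p \<in> ret L x (Suc l)" using p V(4) Z(2) L1(2) unfolding tn ret_def by simp
     qed
     ultimately show ?thesis by blast
    next
     fix E assume E: "{E\<in>end_pieces S ?J. (T ^^ Suc l) x \<in> E} = {E}" and noL: "{L\<in>returning S ?J. (T ^^ Suc l) x \<in> L} = {}"
     let ?V = "{x\<in>V. (T ^^ i) x \<in> Z \<and> (T ^^ Suc l) x \<in> E}"
     have E1: "E \<in> end_pieces S ?J" "(T ^^ Suc l) x \<in> E" using E by blast+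
     have "({x\<in>V. (T ^^ i) x \<in> Z \<and> (T ^^ (i + ?n)) x \<in> E}, i + ?n) \<in> stages S L"
      by (rule stages.restart[OF V(1), of Z ?n E, unfolded iter_T, OF Z(1) J E1(1)])
     hence V': "(?V, Suc l) \<in> stages S L" unfolding tn .
     have xV: "x \<in> ?V" using V(4) Z(2) E1(2) by blast
     hence "(T ^^ Suc l) x \<in> (T ^^ Suc l) ` ?V" by blast
     then obtain w' where w': "{w\<in>pieces S ((T ^^ Suc l) ` ?V) 0. (T ^^ Suc l) x \<in> fst w} = {w'}"
      using stage_step(4)[OF L x(2) V'] by blast
     have "act L x (Suc l) = {(?V, Suc l, w')}"
     proof (intro set_eqI iffI)
      fix p assume p: "p \<in> act L x (Suc l)"
      obtain V1 i1 w1 where p1: "p = (V1, i1, w1)" by (rule prod_cases3)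
      obtain E2 where E2: "E2 \<in> {E\<in>end_pieces S ?J. (T ^^ Suc l) x \<in> E}" "i1 = Suc l"
       "V1 = {x\<in>V. (T ^^ i) x \<in> Z \<and> (T ^^ Suc l) x \<in> E2}" using act_E p p1 by blast
      have t1: "i1 = Suc l" by (rule E2(2))
      have p2: "(V1, Suc l, w1) \<in> act L x (Suc l)" using p p1 t1 by simp
      have "E2 = E" using E2(1) unfolding E by simp
      hence "V1 = ?V" using E2(3) by simp
      moreover from this have "w1 \<in> {w\<in>pieces S ((T ^^ Suc l) ` ?V) 0. (T ^^ Suc l) x \<in> fst w}"
       using p2 unfolding act_def by (simp del: funpow.simps pieces.simps)
      hence "w1 = w'" unfolding w' by simp
      ultimately show "p \<in> {(?V, Suc l, w')}" using p1 t1 by simp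
     next
      fix p assume p: "p \<in> {(?V, Suc l, w')}"
      have "w' \<in> {w\<in>pieces S ((T ^^ Suc l) ` ?V) 0. (T ^^ Suc l) x \<in> fst w}" unfolding w' by simp
      thus "p \<in> act L x (Suc l)" using p V' xV unfolding act_def by (simp del: funpow.simps pieces.simps)
     qed
     moreover have "ret L x (Suc l) = {}"
     proof (rule ccontr)
      assume "ret L x (Suc l) \<noteq> {}"
      then obtain A n where p: "(A, n) \<in> ret L x (Suc l)" by auto
      have "(A, Suc l) \<in> eta S L" "x \<in> A" using p retl[OF p] by (auto simp: ret_def)
      thus False
      proof (cases rule: ret_new[OF L, consumes 2])
       case (1 V1 i1 Z1)
       thus ?thesis using ex J by simp
      next
       case (2 V1 i1 Z1 L2)
       hence eq: "V1 = V" "i1 = i" "Z1 = Z" using ex by simp_all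
       have "L2 \<in> {L\<in>returning S ?J. (T ^^ Suc l) x \<in> L}" using 2(3,4) unfolding eq by simp
       thus False using noL by blast
      qed
     qed
     ultimately show ?thesis by blast
    qed
   qed
  qed
 qed
qed

end

lemma enat_less_Inf_iff: "enat l < Inf X \<longleftrightarrow> (\<forall>u\<in>X. enat l < u)"
proof
 assume h: "\<forall>u\<in>X. enat l < u"
 show "enat l < Inf X"
 proof (cases "X = {}")
  case False
  thus ?thesis using h wellorder_InfI by blast
 qed (simp add: top_enat_def)
qed (meson Inf_lower less_le_trans)

section \<open>Return times in terms of elements and active pieces\<close>

context mis_scheme
begin

abbreviation Rt where "Rt \<equiv> return_time S"

lemma return_gt_iff: "enat l < Rt L x \<longleftrightarrow> (\<forall>A n. (A, n) \<in> eta S L --> x \<in> A --> l < n)"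
 unfolding return_time_def enat_less_Inf_iff
proof
 assume h: "\<forall>u\<in>{enat n |A n. (A, n) \<in> eta S L \<and> x \<in> A}. enat l < u"
 show "\<forall>A n. (A, n) \<in> eta S L --> x \<in> A --> l < n"
 proof (intro allI impI)
  fix A n assume "(A, n) \<in> eta S L" "x \<in> A"
  hence "enat l < enat n" using h by blast
  thus "l < n" by simp
 qed
qed auto

lemma return_gt_ret: "enat l < Rt L x \<longleftrightarrow> ret L x l = {}"
 unfolding return_gt_iff ret_def by (auto simp: not_less[symmetric])

lemma return_eqD: assumes "Rt L x = enat n" obtains A where "(A, n) \<in> eta S L" "x \<in> A"
proof -
 define X where "X = {enat n |A n. (A, n) \<in> eta S L \<and> x \<in> A}"
 have I: "Inf X = enat n" using assms by (simp add: return_time_def X_def)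
 have "X \<noteq> {}" using I by (auto simp: top_enat_def)
 then obtain k where "k \<in> X" by blast
 hence "enat n \<in> X" using wellorder_InfI[of k X] I by simp
 thus ?thesis using that by (auto simp: X_def)
qed

lemma activeI:
 assumes "(V, i) \<in> stages S L" "i \<le> l" "w \<in> pieces S ((T ^^ i) ` V) (l - i)"
 shows "{x\<in>V. (T ^^ i) x \<in> fst w} \<in> active_pieces S L l"
 unfolding active_pieces_def iter_T by (rule CollectI, intro exI conjI, rule refl) (rule assms)+

lemma active_subset: "active_pieces S L l \<subseteq>
 (\<Union>p\<in>{p\<in>stages S L. snd p \<le> l}. (\<lambda>w. {x\<in>fst p. (T ^^ snd p) x \<in> fst w}) ` pieces S ((T ^^ snd p) ` fst p) (l - snd p))"
proof
 fix c assume "c \<in> active_pieces S L l"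
 then obtain V i w where c: "c = {x\<in>V. (T ^^ i) x \<in> fst w}" "(V, i) \<in> stages S L" "i \<le> l"
  "w \<in> pieces S ((T ^^ i) ` V) (l - i)" unfolding active_pieces_def iter_T by blast
 show "c \<in> (\<Union>p\<in>{p\<in>stages S L. snd p \<le> l}. (\<lambda>w. {x\<in>fst p. (T ^^ snd p) x \<in> fst w}) ` pieces S ((T ^^ snd p) ` fst p) (l - snd p))"
  by (rule UN_I[of "(V, i)"]) (use c in auto)
qed

lemma countable_active:
 assumes L: "L \<in> set (refs S)" shows "countable (active_pieces S L l)"
proof (rule countable_subset[OF active_subset], intro countable_UN countable_image)
 show "countable {p\<in>stages S L. snd p \<le> l}" by (rule countable_subset[OF _ countable_stages[OF L]]) blast
 fix p assume "p \<in> {p\<in>stages S L. snd p \<le> l}"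
 hence "start_ok ((T ^^ snd p) ` fst p)" using stages_ok[OF L, of "fst p" "snd p"] by (simp add: stage_ok_def)
 thus "countable (pieces S ((T ^^ snd p) ` fst p) (l - snd p))"
  by (rule inv_countable[OF pieces_inv])
qed

lemma active_interval:
 assumes L: "L \<in> set (refs S)" and c: "c \<in> active_pieces S L l"
 shows "is_interval c" "c \<subseteq> L"
proof -
 obtain V i w where V: "c = {x\<in>V. (T ^^ i) x \<in> fst w}" "(V, i) \<in> stages S L" "w \<in> pieces S ((T ^^ i) ` V) (l - i)"
  using c unfolding active_pieces_def iter_T by blast
 note st = stages_ok[OF L V(2)]
 have "piece_ok ((T ^^ i) ` V) (l - i) w" using pieces_inv[of "(T ^^ i) ` V" "l - i"] st V(3)
  by (simp add: stage_ok_def inv_pieces_def)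
 thus "is_interval c" unfolding V(1) using st by (intro regular_vimage piece_interval) (simp_all add: stage_ok_def)
 show "c \<subseteq> L" using st unfolding V(1) stage_ok_def by blast
qed

definition ref_exc :: "real set => real set" where
 "ref_exc L = stage_exc L \<union> frontier L \<union> (\<Union>p\<in>eta S L. frontier (fst p)) \<union> (\<Union>l. \<Union>c\<in>active_pieces S L l. frontier c)"

lemma countable_ref_exc:
 assumes L: "L \<in> set (refs S)" shows "countable (ref_exc L)"
proof -
 have fe: "countable (frontier (fst p))" if "p \<in> eta S L" for p
  using eta_props(4)[OF L, of "fst p" "snd p"] that
  by (intro countable_finite interval_finite_frontier) (simp add: nondeg_def)
 have fa: "countable (frontier c)" if "c \<in> active_pieces S L l" for c l
  using active_interval(1)[OF L that] by (intro countable_finite interval_finite_frontier)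
 show ?thesis unfolding ref_exc_def
  by (intro countable_Un countable_stage_exc[OF L] countable_finite[OF interval_finite_frontier[OF ref_props(1)[OF L]]]
   countable_UN countable_eta[OF L] countable_active[OF L] countableI_type fe fa)
qed

lemma eta_unique:
 assumes L: "L \<in> set (refs S)" and A: "(A, n) \<in> eta S L" "(A', n') \<in> eta S L" and x: "x \<in> A" "x \<in> A'" "x \<notin> ref_exc L"
 shows "A = A' \<and> n = n'"
proof -
 have xs: "x \<notin> stage_exc L" "x \<in> L" using x eta_props(2)[OF L A(1)] by (auto simp: ref_exc_def)
 have m: "(A, n) \<in> ret L x (max n n')" "(A', n') \<in> ret L x (max n n')" using A x by (auto simp: ret_def)
 from tag_exact[OF L xs(2,1), of "max n n'"] m obtain p where "ret L x (max n n') = {p}" by blast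
 thus ?thesis using m by auto
qed

lemma interval_meets_interior:
 assumes "nondeg A" "open W" "y \<in> W" "y \<in> A" shows "W \<inter> interior A \<noteq> {}"
proof -
 have "closure A = closure (interior A)"
  using convex_closure_interior[of A] assms(1) by (simp add: is_interval_convex_1 nondeg_def)
 hence "y \<in> closure (interior A)" using assms(4) closure_subset by blast
 thus ?thesis using assms(2,3) open_Int_closure_eq_empty by blast
qed

text \<open>Generic uniqueness extends to interior points: an overlap of the interiors contains a
  point outside the countable set \<open>ref_exc\<close>.\<close>

lemma eta_disjoint:
 assumes L: "L \<in> set (refs S)" and A: "(A, n) \<in> eta S L" "(A', n') \<in> eta S L" and y: "y \<in> interior A" "y \<in> A'"
 shows "A = A' \<and> n = n'"
proof -
 have ne: "interior A \<inter> interior A' \<noteq> {}"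
  using interval_meets_interior[OF eta_props(4)[OF L A(2)] open_interior y] by blast
 obtain x where x: "x \<in> interior A \<inter> interior A'" "x \<notin> ref_exc L"
  by (rule open_minus_countable[OF _ ne countable_ref_exc[OF L]]) auto
 thus ?thesis using eta_unique[OF L A, of x] interior_subset by blast
qed

lemma return_on_eta:
 assumes L: "L \<in> set (refs S)" and A: "(A, n) \<in> eta S L" and y: "y \<in> interior A"
 shows "Rt L y = enat n"
proof -
 have yA: "y \<in> A" using y interior_subset by blast
 have "n \<ge> 1" using eta_props(1)[OF L A] .
 hence "enat (n - 1) < Rt L y"
  unfolding return_gt_iff using eta_disjoint[OF L A _ y] by auto
 moreover have "Rt L y \<le> enat n" unfolding return_time_def using A yA by (intro Inf_lower) blast
 ultimately show ?thesis using `n \<ge> 1` by (cases "Rt L y") auto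
qed

lemma return_eq_eta:
 assumes L: "L \<in> set (refs S)" and x: "x \<notin> ref_exc L" "Rt L x = enat n"
 obtains A where "(A, n) \<in> eta S L" "x \<in> interior A"
proof -
 obtain A where A: "(A, n) \<in> eta S L" "x \<in> A" using return_eqD[OF x(2)] by blast
 have "x \<notin> frontier A" using x(1) A(1) unfolding ref_exc_def by force
 thus ?thesis using that A interior_or_frontier by blast
qed

text \<open>Supplies a whole neighbourhood on which no return has occurred. It is used twice: for
  the derivative of the tower map where it moves up, and to place a point in an element on which the
  norm bounds the density.\<close>

lemma return_gt_active:
 assumes L: "L \<in> set (refs S)" and x: "x \<in> L" "x \<notin> ref_exc L" "enat l < Rt L x"
 obtains c where "c \<in> active_pieces S L l" "x \<in> interior c" "\<And>y. y \<in> interior c ==> enat l < Rt L y"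
proof -
 have xs: "x \<notin> stage_exc L" using x(2) by (simp add: ref_exc_def)
 have "ret L x l = {}" using x(3) return_gt_ret by simp
 then obtain p where "act L x l = {p}" using tag_exact[OF L x(1) xs, of l] by blast
 then obtain V i w where V: "(V, i, w) \<in> act L x l" by (cases p) auto
 define c where "c = {x\<in>V. (T ^^ i) x \<in> fst w}"
 have c: "c \<in> active_pieces S L l" "x \<in> c" using V activeI[of V i L l w] by (auto simp: act_def c_def)
 have "x \<notin> frontier c" using x(2) c(1) unfolding ref_exc_def by blast
 hence xc: "x \<in> interior c" using c(2) interior_or_frontier by blast
 have "enat l < Rt L y" if y: "y \<in> interior c" for y
 proof (rule ccontr)
  assume "\<not> ?thesis"
  then obtain A n where A: "(A, n) \<in> eta S L" "y \<in> A" "n \<le> l" unfolding return_gt_iff by (auto simp: not_less)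
  have ne: "interior c \<inter> interior A \<noteq> {}" by (rule interval_meets_interior[OF eta_props(4)[OF L A(1)] open_interior y A(2)])
  obtain u where u: "u \<in> interior c \<inter> interior A" "u \<notin> ref_exc L"
   by (rule open_minus_countable[OF _ ne countable_ref_exc[OF L]]) auto
  hence "u \<in> c" "u \<in> A" using interior_subset by blast+
  hence "(V, i, w) \<in> act L u l" "(A, n) \<in> ret L u l" using V A by (auto simp: act_def ret_def c_def)
  moreover have "u \<in> L" "u \<notin> stage_exc L" using `u \<in> c` active_interval(2)[OF L c(1)] u(2) by (auto simp: ref_exc_def)
  ultimately show False using tag_exact[OF L, of u l] by blast
 qed
 thus ?thesis using that c(1) xc by blast
qed

end

section \<open>Change of variables on one monotone branch\<close>

lemma the_inv_into_mono_on:
 fixes g :: "real => real"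
 assumes "strict_mono_on A g" shows "mono_on (g ` A) (the_inv_into A g)"
proof (rule mono_onI)
 fix r s assume rs: "r \<in> g ` A" "s \<in> g ` A" "r \<le> s"
 then obtain x y where xy: "x \<in> A" "y \<in> A" "r = g x" "s = g y" by blast
 have inj: "inj_on g A" using assms strict_mono_on_imp_inj_on by blast
 have "x \<le> y" using assms xy rs(3) by (meson not_le strict_mono_onD)
 thus "the_inv_into A g r \<le> the_inv_into A g s" using xy inj by (simp add: the_inv_into_f_f)
qed

text \<open>Positivity is asked only in the open interval, since an iterate may have critical
  endpoints; continuity then gives the nonnegative derivative on the closed interval that the
  substitution rule wants. The inverse is measurable because it is monotone.\<close>

lemma nn_integral_increasing_branch:
 fixes g g' :: "real => real" and F :: "real => ennreal"
 assumes pq: "p < q"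
  and deriv: "\<And>x. x \<in> {p..q} ==> (g has_real_derivative g' x) (at x)" and cont: "continuous_on {p..q} g'"
  and pos: "\<And>x. x \<in> {p<..<q} ==> 0 < g' x" and F [measurable]: "F \<in> borel_measurable borel"
 defines "\<psi> \<equiv> the_inv_into {p<..<q} g"
 shows "(\<lambda>w. F (\<psi> w) / ennreal \<bar>g' (\<psi> w)\<bar> * indicator (g ` {p<..<q}) w) \<in> borel_measurable borel" (is "?f \<in> _")
  and "(\<integral>\<^sup>+w. F (\<psi> w) / ennreal \<bar>g' (\<psi> w)\<bar> * indicator (g ` {p<..<q}) w \<partial>lborel) = (\<integral>\<^sup>+x. F x * indicator {p<..<q} x \<partial>lborel)"
  and "inj_on g {p<..<q}"
proof -
 have contg: "continuous_on {p..q} g" using deriv by (meson DERIV_isCont continuous_at_imp_continuous_on)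
 have lt: "g x < g y" if "p \<le> x" "x < y" "y \<le> q" for x y
 proof (rule DERIV_pos_imp_increasing_open[OF that(2)])
  show "\<exists>d. (g has_real_derivative d) (at u) \<and> 0 < d" if "x < u" "u < y" for u
   using deriv[of u] pos[of u] that `p \<le> x` `y \<le> q` by auto
  show "continuous_on {x..y} g" by (rule continuous_on_subset[OF contg]) (use that in auto)
 qed
 have smono: "strict_mono_on {p<..<q} g" by (rule strict_mono_onI) (use lt in auto)
 thus inj: "inj_on g {p<..<q}" using strict_mono_on_imp_inj_on by blast
 have img: "g ` {p<..<q} = {g p<..<g q}"
 proof
  show "g ` {p<..<q} \<subseteq> {g p<..<g q}" using lt by auto
  show "{g p<..<g q} \<subseteq> g ` {p<..<q}"
  proof
   fix w assume w: "w \<in> {g p<..<g q}"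
   then obtain x where x: "p \<le> x" "x \<le> q" "g x = w" using IVT'[of g p w q] contg pq by auto
   hence "x \<noteq> p" "x \<noteq> q" using w by auto
   thus "w \<in> g ` {p<..<q}" using x by auto
  qed
 qed
 have \<psi>_m [measurable]: "\<psi> \<in> borel_measurable (restrict_space borel {g p<..<g q})"
  unfolding \<psi>_def img[symmetric] by (intro borel_measurable_mono_on_fnc the_inv_into_mono_on smono)
 have g'm: "(\<lambda>x. g' x * indicator {p..q} x) \<in> borel_measurable borel"
  using borel_measurable_continuous_on_indicator[OF _ cont] by (simp add: mult.commute)
 have "(\<lambda>w. F (\<psi> w) / ennreal \<bar>g' (\<psi> w) * indicator {p..q} (\<psi> w)\<bar>) \<in> borel_measurable (restrict_space borel {g p<..<g q})"
  using measurable_compose[OF \<psi>_m g'm] by measurable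
 hence m: "(\<lambda>w. F (\<psi> w) / ennreal \<bar>g' (\<psi> w) * indicator {p..q} (\<psi> w)\<bar> * indicator {g p<..<g q} w) \<in> borel_measurable borel"
  by (subst (asm) borel_measurable_restrict_space_iff_ennreal) auto
 have in_pq: "\<psi> w \<in> {p<..<q}" if "w \<in> {g p<..<g q}" for w
  using that the_inv_into_into[OF inj, of w "{p<..<q}"] unfolding \<psi>_def img by simp
 have eq: "?f = (\<lambda>w. F (\<psi> w) / ennreal \<bar>g' (\<psi> w) * indicator {p..q} (\<psi> w)\<bar> * indicator {g p<..<g q} w)"
 proof
  fix w show "?f w = F (\<psi> w) / ennreal \<bar>g' (\<psi> w) * indicator {p..q} (\<psi> w)\<bar> * indicator {g p<..<g q} w"
   unfolding img using in_pq[of w] by (auto simp: indicator_def)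
 qed
 show fm: "?f \<in> borel_measurable borel" unfolding eq by (rule m)
 have nonneg: "0 \<le> g' x" if "x \<in> {p..q}" for x
 proof -
  have "closure {p<..<q} = {p..q}" using pq by simp
  moreover have "g' ` closure {p<..<q} \<subseteq> {0..}"
   by (rule image_closure_subset) (use cont pq pos in \<open>auto intro: less_imp_le\<close>)
  ultimately have "g' x \<in> {0..}" using that by (metis image_subset_iff)
  thus ?thesis by simp
 qed
 have "(\<integral>\<^sup>+w. ?f w * indicator {g p..g q} w \<partial>lborel) = (\<integral>\<^sup>+x. ?f (g x) * g' x * indicator {p..q} x \<partial>lborel)"
  by (rule nn_integral_substitution_aux[OF fm _ deriv cont nonneg pq]) auto
 moreover have "?f w * indicator {g p..g q} w = ?f w" for w unfolding img by (auto simp: indicator_def)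
 moreover have "(\<integral>\<^sup>+x. ?f (g x) * g' x * indicator {p..q} x \<partial>lborel) = (\<integral>\<^sup>+x. F x * indicator {p<..<q} x \<partial>lborel)"
 proof (rule nn_integral_cong_AE)
  have "AE x in lborel. x \<noteq> p" "AE x in lborel. x \<noteq> q" by (rule AE_lborel_singleton)+
  thus "AE x in lborel. ?f (g x) * g' x * indicator {p..q} x = F x * indicator {p<..<q} x"
  proof eventually_elim
   case (elim x)
   show ?case
   proof (cases "x \<in> {p..q}")
    case True
    hence x: "x \<in> {p<..<q}" using elim by auto
    hence inv: "\<psi> (g x) = x" unfolding \<psi>_def using the_inv_into_f_f[OF inj] by blast
    have "F x / ennreal (g' x) * ennreal (g' x) = F x"
     
     unfolding ennreal_divide_times using pos[OF x] by (simp add: ennreal_divide_self)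
    thus ?thesis using x inv pos[OF x] by simp
   qed auto
  qed
 qed
 ultimately show "(\<integral>\<^sup>+w. ?f w \<partial>lborel) = (\<integral>\<^sup>+x. F x * indicator {p<..<q} x \<partial>lborel)" by simp
qed

lemma nn_integral_branch:
 fixes g g' :: "real => real" and F :: "real => ennreal"
 assumes pq: "p < q"
  and deriv: "\<And>x. x \<in> {p..q} ==> (g has_real_derivative g' x) (at x)" and cont: "continuous_on {p..q} g'"
  and nz: "\<And>x. x \<in> {p<..<q} ==> g' x \<noteq> 0" and F: "F \<in> borel_measurable borel"
 defines "\<psi> \<equiv> the_inv_into {p<..<q} g"
 shows "(\<lambda>w. F (\<psi> w) / ennreal \<bar>g' (\<psi> w)\<bar> * indicator (g ` {p<..<q}) w) \<in> borel_measurable borel" (is "?f \<in> _")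
  and "(\<integral>\<^sup>+w. F (\<psi> w) / ennreal \<bar>g' (\<psi> w)\<bar> * indicator (g ` {p<..<q}) w \<partial>lborel) = (\<integral>\<^sup>+x. F x * indicator {p<..<q} x \<partial>lborel)"
  and "inj_on g {p<..<q}"
proof -
 have "connected (g' ` {p<..<q})"
  by (intro connected_continuous_image continuous_on_subset[OF cont]) auto
 hence iv: "is_interval (g' ` {p<..<q})" by (simp add: is_interval_connected_1)
 have "(\<forall>x\<in>{p<..<q}. 0 < g' x) \<or> (\<forall>x\<in>{p<..<q}. g' x < 0)"
 proof (rule ccontr)
  assume "\<not> ?thesis"
  then obtain x y where "x \<in> {p<..<q}" "y \<in> {p<..<q}" "g' x \<le> 0" "0 \<le> g' y" by force
  hence "0 \<in> g' ` {p<..<q}" using interval_mem[OF iv, of "g' x" "g' y" 0] by blast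
  thus False using nz by auto
 qed
 hence "?f \<in> borel_measurable borel \<and> (\<integral>\<^sup>+w. ?f w \<partial>lborel) = (\<integral>\<^sup>+x. F x * indicator {p<..<q} x \<partial>lborel) \<and> inj_on g {p<..<q}"
 proof
  assume "\<forall>x\<in>{p<..<q}. 0 < g' x"
  thus ?thesis unfolding \<psi>_def using nn_integral_increasing_branch[OF pq deriv cont _ F] by simp
 next
  assume neg: "\<forall>x\<in>{p<..<q}. g' x < 0"
  let ?h = "\<lambda>x. - g x"
  have dh: "(?h has_real_derivative - g' x) (at x)" if "x \<in> {p..q}" for x using deriv[OF that] by (rule DERIV_minus)
  note * = nn_integral_increasing_branch[OF pq dh continuous_on_minus[OF cont] _ F]
  let ?F = "\<lambda>w. F (the_inv_into {p<..<q} ?h w) / ennreal \<bar>- g' (the_inv_into {p<..<q} ?h w)\<bar> * indicator (?h ` {p<..<q}) w"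
  have m: "?F \<in> borel_measurable borel" and i: "(\<integral>\<^sup>+w. ?F w \<partial>lborel) = (\<integral>\<^sup>+x. F x * indicator {p<..<q} x \<partial>lborel)"
   and j: "inj_on ?h {p<..<q}" using * neg by auto
  have inv: "the_inv_into {p<..<q} ?h (- w) = \<psi> w" for w unfolding \<psi>_def the_inv_into_def by simp
  have ind: "indicator (?h ` {p<..<q}) (- w) = (indicator (g ` {p<..<q}) w :: ennreal)" for w
   by (auto simp: indicator_def image_iff)
  have eq: "?F (- w) = ?f w" for w unfolding inv ind by simp
  have "(\<lambda>w. ?F (- w)) \<in> borel_measurable borel" using m by (rule measurable_compose[rotated]) simp
  hence fm: "?f \<in> borel_measurable borel" unfolding eq .
  have "(\<integral>\<^sup>+w. ?F w \<partial>lborel) = (\<integral>\<^sup>+w. ?F (- w) \<partial>lborel)"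
   using nn_integral_real_affine[OF m, of "-1" 0] by simp
  hence "(\<integral>\<^sup>+w. ?f w \<partial>lborel) = (\<integral>\<^sup>+x. F x * indicator {p<..<q} x \<partial>lborel)" using i unfolding eq by simp
  moreover have "inj_on g {p<..<q}" using j by (simp add: inj_on_def)
  ultimately show ?thesis using fm by blast
 qed
 thus "?f \<in> borel_measurable borel" "(\<integral>\<^sup>+w. ?f w \<partial>lborel) = (\<integral>\<^sup>+x. F x * indicator {p<..<q} x \<partial>lborel)"
  "inj_on g {p<..<q}" by auto
qed

text \<open>Finiteness makes \<open>f\<close> summable and so excludes the default value 0 of
  \<open>infsum\<close>.\<close>

lemma ennreal_infsum:
 fixes f :: "'b => real"
 assumes "\<And>y. y \<in> Y ==> 0 \<le> f y" "(\<integral>\<^sup>+y. ennreal (f y) \<partial>count_space Y) < \<infinity>"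
 shows "ennreal (infsum f Y) = (\<integral>\<^sup>+y. ennreal (f y) \<partial>count_space Y)"
proof -
 have "Infinite_Set_Sum.abs_summable_on f Y"
  unfolding Infinite_Set_Sum.abs_summable_on_def by (rule integrableI_nonneg) (use assms in auto)
 thus ?thesis using nn_integral_conv_infsetsum[of f Y] infsetsum_infsum[of f Y] assms(1) by simp
qed

section \<open>Change of variables on the tower\<close>

lemma bounded_interval_cases:
 fixes L :: "real set"
 assumes "nondeg L" "bounded L"
 shows "Inf L < Sup L" "{Inf L<..<Sup L} \<subseteq> L" "L \<subseteq> {Inf L..Sup L}" "interior L = {Inf L<..<Sup L}" "len L = Sup L - Inf L"
proof -
 have L: "is_interval L" "L \<noteq> {}" using assms by (auto simp: nondeg_def)
 have b: "bdd_below L" "bdd_above L" using assms(2) bounded_imp_bdd_below bounded_imp_bdd_above by auto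
 show sub: "L \<subseteq> {Inf L..Sup L}" using b by (auto intro: cInf_lower cSup_upper)
 obtain x y where "x < y" "x \<in> L" "y \<in> L" using nondeg_obtain[OF assms(1)] by metis
 thus lt: "Inf L < Sup L" using subsetD[OF sub, of x] subsetD[OF sub, of y] by simp
 show sup: "{Inf L<..<Sup L} \<subseteq> L"
 proof
  fix z assume z: "z \<in> {Inf L<..<Sup L}"
  obtain x where "x \<in> L" "x < z" using z cInf_lessD[OF L(2), of z] by auto
  moreover obtain y where "y \<in> L" "z < y" using z less_cSupD[OF L(2), of z] by auto
  ultimately show "z \<in> L" using interval_mem[OF L(1), of x y z] by auto
 qed
 show "interior L = {Inf L<..<Sup L}"
  using interior_mono[OF sub] interior_maximal[OF sup] by auto
 have "L \<in> fmeasurable lborel"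
  by (rule fmeasurableI2[OF fmeasurable_Icc sub]) (simp add: real_interval_borel_measurable[OF L(1)])
 hence "len {Inf L<..<Sup L} \<le> len L" "len L \<le> len {Inf L..Sup L}"
  using measure_mono_fmeasurable[OF sup, of lborel] measure_mono_fmeasurable[OF sub, of lborel] by (auto dest: fmeasurableD)
 thus "len L = Sup L - Inf L" using lt by simp
qed

context mis_scheme
begin

abbreviation "nref \<equiv> length (refs S)"
abbreviation "rf i \<equiv> refs S ! i"

definition xat :: "nat => real => real" where
 "xat i z = Inf (rf i) + (z - real i) * len (rf i)"

definition coord :: "nat => real => real" where
 "coord i x = real i + (x - Inf (rf i)) / len (rf i)"

lemma rf_in: "i < nref ==> rf i \<in> set (refs S)" by simp

lemma rf_facts:
 assumes "i < nref"
 shows "rf i \<subseteq> {-1..1} - H" "\<epsilon> \<le> len (rf i)" "0 < len (rf i)" "Inf (rf i) < Sup (rf i)"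
  "interior (rf i) = {Inf (rf i)<..<Sup (rf i)}" "len (rf i) = Sup (rf i) - Inf (rf i)" "rf i \<subseteq> {Inf (rf i)..Sup (rf i)}"
proof -
 note p = ref_props[OF rf_in[OF assms]]
 have "bounded (rf i)" using p(2) bounded_subset[OF bounded_closed_interval[of "-1" 1]] by blast
 note b = bounded_interval_cases[OF p(4) this]
 show "rf i \<subseteq> {-1..1} - H" "\<epsilon> \<le> len (rf i)" "0 < len (rf i)" "Inf (rf i) < Sup (rf i)"
  "interior (rf i) = {Inf (rf i)<..<Sup (rf i)}" "len (rf i) = Sup (rf i) - Inf (rf i)" "rf i \<subseteq> {Inf (rf i)..Sup (rf i)}"
  using p b eps_pos by auto
qed

lemma base_cell_floor: "z \<in> base_cell i ==> \<lfloor>z\<rfloor> = int i"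
 by (simp add: base_cell_def floor_eq_iff)

lemma base_cell_unique: "z \<in> base_cell i ==> z \<in> base_cell j ==> i = j"
 using base_cell_floor[of z i] base_cell_floor[of z j] by simp

lemma base_ref_cell: "z \<in> base_cell i ==> base_ref S z = rf i"
 by (simp add: base_ref_def base_cell_floor)

lemma base_proj_cell: "z \<in> base_cell i ==> base_proj S z = xat i z"
 by (simp add: base_proj_def xat_def base_ref_cell base_cell_floor)

lemma base_return_cell: "z \<in> base_cell i ==> base_return S z = Rt (rf i) (xat i z)"
 by (simp add: base_return_def base_ref_cell base_proj_cell)

lemma coord_xat: "i < nref ==> coord i (xat i z) = z" "i < nref ==> xat i (coord i x) = x"
 using rf_facts(3)[of i] by (auto simp: xat_def coord_def)

lemma xat_cell: assumes "i < nref" shows "z \<in> base_cell i \<longleftrightarrow> xat i z \<in> interior (rf i)"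
proof -
 note f = rf_facts[OF assms]
 have "xat i z < Sup (rf i) \<longleftrightarrow> (z - real i) * len (rf i) < 1 * len (rf i)"
 proof -
  have "Sup (rf i) = Inf (rf i) + len (rf i)" using f(6) by simp
  thus ?thesis unfolding xat_def by linarith
 qed
 also have "\<dots> \<longleftrightarrow> z - real i < 1" using f(3) mult_less_cancel_right_pos by blast
 finally have 1: "xat i z < Sup (rf i) \<longleftrightarrow> z - real i < 1" .
 have "Inf (rf i) < xat i z \<longleftrightarrow> 0 < z - real i" using f(3) by (auto simp: xat_def zero_less_mult_iff)
 thus ?thesis using 1 unfolding f(5) by (auto simp: base_cell_def)
qed

lemma coord_cell: "i < nref ==> x \<in> interior (rf i) ==> coord i x \<in> base_cell i"
 using xat_cell coord_xat by simp

lemma base_obtain: assumes "z \<in> base S" obtains i where "i < nref" "z \<in> base_cell i"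
 using assms by (auto simp: base_def)

lemma base_cellI: "i < nref ==> z \<in> base_cell i ==> z \<in> base S"
 by (auto simp: base_def)

lemma rf_unique: assumes "i < nref" "k < nref" "x \<in> rf i" "x \<in> rf k" shows "i = k"
proof -
 have "rf i = rf k" using refs_disjoint[of "rf i" "rf k" x] assms by simp
 moreover have "distinct (refs S)" using refs by (simp add: reference_family_def)
 ultimately show ?thesis using assms nth_eq_iff_index_eq by blast
qed

lemma base_proj_unique:
 assumes "w \<in> base S" "base_proj S w = x" "k < nref" "x \<in> rf k"
 shows "w = coord k x \<and> w \<in> base_cell k"
proof -
 obtain i where i: "i < nref" "w \<in> base_cell i" using assms(1) by (rule base_obtain)
 have "xat i w \<in> interior (rf i)" using i xat_cell by blast
 hence "x \<in> interior (rf i)" unfolding assms(2)[symmetric] base_proj_cell[OF i(2)] .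
 hence "i = k" using rf_unique[OF i(1) assms(3) _ assms(4)] interior_subset by blast
 thus ?thesis using i assms(2) base_proj_cell coord_xat(1) by auto
qed

lemma base_proj_coord: "k < nref ==> x \<in> interior (rf k) ==> base_proj S (coord k x) = x"
 using coord_cell[of k x] base_proj_cell[of "coord k x" k] coord_xat(2)[of k x] by simp

lemma tower_map_up: "enat (l + 1) < base_return S z ==> tower_map S (z, l) = Some (z, l + 1)"
 by (simp add: tower_map_def)

lemma tower_map_return:
 assumes "\<not> enat (l + 1) < base_return S z" "k < nref" "iter S (l + 1) (base_proj S z) \<in> interior (rf k)"
 shows "tower_map S (z, l) = Some (coord k (iter S (l + 1) (base_proj S z)), 0)"
proof -
 let ?x = "iter S (l + 1) (base_proj S z)"
 have w: "coord k ?x \<in> base S" "base_proj S (coord k ?x) = ?x"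
  using coord_cell[OF assms(2,3)] base_cellI[OF assms(2)] base_proj_coord[OF assms(2,3)] by auto
 have xk: "?x \<in> rf k" using assms(3) interior_subset by blast
 have "(THE w. w \<in> base S \<and> base_proj S w = ?x) = coord k ?x"
 proof (rule the_equality)
  show "coord k ?x \<in> base S \<and> base_proj S (coord k ?x) = ?x" using w ..
  show "w' = coord k ?x" if "w' \<in> base S \<and> base_proj S w' = ?x" for w'
   using base_proj_unique[of w', OF _ _ assms(2) xk] that by blast
 qed
 moreover have "\<exists>w\<in>base S. base_proj S w = ?x" using w by blast
 ultimately show ?thesis unfolding tower_map_def prod.case using assms(1) by (simp only: if_True if_False)
qed

lemma tower_map_Some:
 assumes "tower_map S (z, l) = Some (w, m)"
 shows "m \<noteq> 0 ==> w = z \<and> m = l + 1"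
  "m = 0 ==> \<not> enat (l + 1) < base_return S z \<and> w \<in> base S \<and> base_proj S w = iter S (l + 1) (base_proj S z)"
proof -
 show "m \<noteq> 0 ==> w = z \<and> m = l + 1" using assms by (auto simp: tower_map_def split: if_splits)
 assume m: "m = 0"
 let ?x = "iter S (l + 1) (base_proj S z)"
 have n: "\<not> enat (l + 1) < base_return S z" using assms m by (auto simp: tower_map_def)
 hence ex: "\<exists>w\<in>base S. base_proj S w = ?x" and w: "w = (THE w. w \<in> base S \<and> base_proj S w = ?x)"
  using assms by (auto simp: tower_map_def split: if_splits)
 then obtain w' where w': "w' \<in> base S" "base_proj S w' = ?x" by blast
 obtain k where k: "k < nref" "w' \<in> base_cell k" using w'(1) by (rule base_obtain)
 have "xat k w' \<in> interior (rf k)" using k xat_cell by blast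
 hence xi: "?x \<in> interior (rf k)" unfolding w'(2)[symmetric] base_proj_cell[OF k(2)] .
 hence "tower_map S (z, l) = Some (coord k ?x, 0)" by (rule tower_map_return[OF n k(1)])
 hence "w = coord k ?x" using assms by simp
 thus "\<not> enat (l + 1) < base_return S z \<and> w \<in> base S \<and> base_proj S w = ?x"
  using n coord_cell[OF k(1) xi] base_cellI[OF k(1)] base_proj_coord[OF k(1) xi] by auto
qed

definition bad :: "real set" where
 "bad = {z\<in>base S. base_proj S z \<in> ref_exc (base_ref S z)}"

lemma countable_bad: "countable bad"
proof -
 have "bad \<subseteq> (\<Union>i<nref. coord i ` ref_exc (rf i))"
 proof
  fix z assume z: "z \<in> bad"
  then obtain i where i: "i < nref" "z \<in> base_cell i" unfolding bad_def by (blast elim: base_obtain)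
  hence "xat i z \<in> ref_exc (rf i)" using z by (simp add: bad_def base_proj_cell base_ref_cell)
  hence "coord i (xat i z) \<in> coord i ` ref_exc (rf i)" by (rule imageI)
  thus "z \<in> (\<Union>i<nref. coord i ` ref_exc (rf i))" using i(1) unfolding coord_xat(1)[OF i(1)] by blast
 qed
 moreover have "countable (\<Union>i<nref. coord i ` ref_exc (rf i))"
  by (intro countable_UN countable_image countable_ref_exc) auto
 ultimately show ?thesis by (rule countable_subset)
qed

definition landing_idx :: "real set => nat => nat" where
 "landing_idx A n = (SOME k. k < nref \<and> (T ^^ n) ` A \<subseteq> rf k)"

definition branches :: "(nat \<times> real set \<times> nat) set" where
 "branches = {(i, A, n). i < nref \<and> (A, n) \<in> eta S (rf i) \<and> (\<exists>k<nref. (T ^^ n) ` A \<subseteq> rf k)}"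

definition bdom :: "nat \<times> real set \<times> nat => real set" where
 "bdom = (\<lambda>(i, A, n). {z. xat i z \<in> interior A})"

definition ret_map :: "nat \<times> real set \<times> nat => real => real" where
 "ret_map = (\<lambda>(i, A, n) z. coord (landing_idx A n) ((T ^^ n) (xat i z)))"

definition ret_deriv :: "nat \<times> real set \<times> nat => real => real" where
 "ret_deriv = (\<lambda>(i, A, n) z. D n (xat i z) * len (rf i) / len (rf (landing_idx A n)))"

abbreviation rtime :: "nat \<times> real set \<times> nat => nat" where "rtime v \<equiv> snd (snd v)"

lemma countable_branches: "countable branches"
proof -
 have "branches \<subseteq> (\<Union>i<nref. Pair i ` eta S (rf i))" by (auto simp: branches_def)
 moreover have "countable (\<Union>i<nref. Pair i ` eta S (rf i))" by (intro countable_UN countable_image countable_eta) auto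
 ultimately show ?thesis by (rule countable_subset)
qed

lemma landing_idx:
 assumes "(i, A, n) \<in> branches" shows "landing_idx A n < nref" "(T ^^ n) ` A \<subseteq> rf (landing_idx A n)"
proof -
 have "\<exists>k. k < nref \<and> (T ^^ n) ` A \<subseteq> rf k" using assms by (auto simp: branches_def)
 from someI_ex[OF this] show "landing_idx A n < nref" "(T ^^ n) ` A \<subseteq> rf (landing_idx A n)" unfolding landing_idx_def by auto
qed

lemma xat_deriv: "(xat i has_real_derivative len (rf i)) (at z)"
 unfolding xat_def by (auto intro!: derivative_eq_intros)

lemma ret_map_deriv: "(ret_map v has_real_derivative ret_deriv v z) (at z)"
proof -
 obtain i A n where e: "v = (i, A, n)" by (rule prod_cases3)
 have 2: "(coord k has_real_derivative 1 / len (rf k)) (at x)" for k x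
  unfolding coord_def divide_inverse by (auto intro!: derivative_eq_intros)
 show ?thesis unfolding e ret_map_def ret_deriv_def prod.case
  using DERIV_chain2[OF 2 DERIV_chain2[OF has_derivative_iter xat_deriv]] by simp
qed

lemma ret_deriv_continuous: "continuous_on X (ret_deriv v)"
proof -
 obtain i A n where e: "v = (i, A, n)" by (rule prod_cases3)
 have "continuous_on X (\<lambda>z. (T ^^ m) (xat i z))" for m
  by (rule continuous_on_compose2[OF continuous_iter[of UNIV]]) (auto simp: xat_def intro!: continuous_intros)
 thus ?thesis unfolding e ret_deriv_def prod.case iter_deriv_def divide_inverse by (intro continuous_intros)
qed

lemma branch_facts:
 assumes e: "v \<in> branches" "v = (i, A, n)"
 shows "i < nref" "(A, n) \<in> eta S (rf i)" "1 \<le> n" "A \<subseteq> rf i" "regular n A" "nondeg A"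
proof -
 show i: "i < nref" "(A, n) \<in> eta S (rf i)" using e by (auto simp: branches_def)
 from eta_props[OF rf_in[OF i(1)] i(2)] show "1 \<le> n" "A \<subseteq> rf i" "regular n A" "nondeg A" by auto
qed

lemma bdom_eq:
 assumes e: "v \<in> branches"
 obtains p q where "p < q" "bdom v = {p<..<q}" "bdom v \<subseteq> base_cell (fst v)"
proof -
 obtain i A n where e': "v = (i, A, n)" by (rule prod_cases3)
 note f = branch_facts[OF e e']
 have "bounded A" using f(4) rf_facts(1)[OF f(1)] bounded_subset[OF bounded_closed_interval[of "-1" 1]] by blast
 note b = bounded_interval_cases[OF f(6) this]
 have l: "0 < len (rf i)" using rf_facts(3)[OF f(1)] .
 have "z \<in> bdom v \<longleftrightarrow> z \<in> {coord i (Inf A)<..<coord i (Sup A)}" for z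
  unfolding e' bdom_def prod.case mem_Collect_eq b(4) using l by (auto simp: xat_def coord_def field_simps)
 hence eq: "bdom v = {coord i (Inf A)<..<coord i (Sup A)}" by blast
 have lt: "coord i (Inf A) < coord i (Sup A)" using b(1) l by (simp add: coord_def divide_strict_right_mono)
 have sub: "bdom v \<subseteq> base_cell (fst v)"
  using xat_cell[OF f(1)] interior_mono[OF f(4)] by (auto simp: e' bdom_def)
 show ?thesis by (rule that[OF lt eq sub])
qed

lemma bdom_facts:
 assumes e: "v \<in> branches" and z: "z \<in> bdom v"
 defines "k \<equiv> landing_idx (fst (snd v)) (rtime v)"
 shows "z \<in> base_cell (fst v)" "fst v < nref" "base_return S z = enat (rtime v)" "1 \<le> rtime v" "ret_deriv v z \<noteq> 0"
  "k < nref" "(T ^^ rtime v) (base_proj S z) \<in> interior (rf k)"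
  "tower_map S (z, rtime v - 1) = Some (ret_map v z, 0)" "ret_map v z \<in> base_cell k"
  "base_proj S (ret_map v z) = (T ^^ rtime v) (base_proj S z)"
proof -
 obtain i A n where e': "v = (i, A, n)" by (rule prod_cases3)
 note f = branch_facts[OF e e']
 have zA: "xat i z \<in> interior A" using z by (simp add: e' bdom_def)
 hence "xat i z \<in> interior (rf i)" using interior_mono[OF f(4)] by blast
 hence zi: "z \<in> base_cell i" using xat_cell[OF f(1)] by simp
 thus "z \<in> base_cell (fst v)" "fst v < nref" using f(1) by (auto simp: e')
 have R: "base_return S z = enat n"
  unfolding base_return_cell[OF zi] by (rule return_on_eta[OF rf_in[OF f(1)] f(2) zA])
 thus "base_return S z = enat (rtime v)" "1 \<le> rtime v" using f(3) by (auto simp: e')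
 have bp: "base_proj S z = xat i z" by (rule base_proj_cell[OF zi])
 have k: "k < nref" "(T ^^ n) ` A \<subseteq> rf k" using landing_idx[of i A n] e by (auto simp: k_def e')
 thus "k < nref" by simp
 have "D n (xat i z) \<noteq> 0" 
 proof (rule D_nz)
  fix j assume "j < n"
  moreover have "xat i z \<in> A" using zA interior_subset by blast
  ultimately show "(T ^^ j) (xat i z) \<noteq> 0" using f(5) by (simp add: regular_def)
 qed
 thus "ret_deriv v z \<noteq> 0" using rf_facts(3)[OF f(1)] rf_facts(3)[OF k(1)] by (simp add: e' ret_deriv_def k_def)
 \<comment> \<open>An injective continuous map of the line is open on open sets, so the interior of
   an element lands in the interior of a reference interval, where base coordinates exist.\<close>
 have "open ((T ^^ n) ` interior A)"
 proof -
  show ?thesis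
   by (rule injective_into_1d_imp_open_map_UNIV[OF open_interior continuous_iter
    inj_on_subset[OF regular_inj[OF f(5)] interior_subset] order_refl])
 qed
 hence "(T ^^ n) ` interior A \<subseteq> interior (rf k)"
  using k(2) interior_subset by (intro interior_maximal) blast+
 hence x: "(T ^^ n) (base_proj S z) \<in> interior (rf k)" using zA bp by auto
 thus "(T ^^ rtime v) (base_proj S z) \<in> interior (rf k)" by (simp add: e')
 have n1: "n - 1 + 1 = n" using f(3) by simp
 have rm: "ret_map v z = coord k ((T ^^ n) (base_proj S z))" unfolding e' ret_map_def by (simp add: bp k_def e')
 have "tower_map S (z, n - 1) = Some (coord k (iter S (n - 1 + 1) (base_proj S z)), 0)"
 proof (rule tower_map_return[OF _ k(1)])
  show "\<not> enat (n - 1 + 1) < base_return S z" unfolding n1 R by simp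
  show "iter S (n - 1 + 1) (base_proj S z) \<in> interior (rf k)" unfolding n1 iter_T by (rule x)
 qed
 thus "tower_map S (z, rtime v - 1) = Some (ret_map v z, 0)" unfolding rm n1 iter_T by (simp add: e')
 show "ret_map v z \<in> base_cell k" unfolding rm by (rule coord_cell[OF k(1) x])
 show "base_proj S (ret_map v z) = (T ^^ rtime v) (base_proj S z)" unfolding rm using base_proj_coord[OF k(1) x] by (simp add: e')
qed

lemma tower_deriv_return:
 assumes e: "v \<in> branches" and z: "z \<in> bdom v"
 shows "tower_deriv S (z, rtime v - 1) = ret_deriv v z"
proof -
 obtain p q where "bdom v = {p<..<q}" using bdom_eq[OF e] by metis
 hence op: "open (bdom v)" by simp
 have "((\<lambda>u. fst (the (tower_map S (u, rtime v - 1)))) has_real_derivative ret_deriv v z) (at z)"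
  by (rule has_field_derivative_transform_within_open[OF ret_map_deriv op z])
   (simp only: bdom_facts(8)[OF e] option.sel fst_conv)
 thus ?thesis unfolding tower_deriv_def prod.case by (rule DERIV_imp_deriv)
qed

lemma tower_deriv_up:
 assumes z: "z \<in> base S" "z \<notin> bad" and R: "enat (l + 1) < base_return S z"
 shows "tower_deriv S (z, l) = 1"
proof -
 obtain i where i: "i < nref" "z \<in> base_cell i" using z(1) by (rule base_obtain)
 have x: "xat i z \<in> interior (rf i)" using xat_cell[OF i(1)] i(2) by simp
 have "xat i z \<notin> ref_exc (rf i)" using z i by (simp add: bad_def base_proj_cell base_ref_cell)
 moreover have "enat (l + 1) < Rt (rf i) (xat i z)" using R base_return_cell[OF i(2)] by simp
 moreover have "xat i z \<in> rf i" using x interior_subset by blast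
 ultimately obtain c where c: "xat i z \<in> interior c" "\<And>y. y \<in> interior c ==> enat (l + 1) < Rt (rf i) y"
  using return_gt_active[OF rf_in[OF i(1)], of "xat i z" "l + 1" thesis] by blast
 let ?W = "{u \<in> base_cell i. xat i u \<in> interior c}"
 have W: "?W = base_cell i \<inter> xat i -` interior c" by auto
 have op: "open ?W" unfolding W
  by (intro open_Int open_vimage) (auto simp: base_cell_def xat_def intro!: continuous_intros)
 have zW: "z \<in> ?W" using i c(1) by simp
 have eq: "u = fst (the (tower_map S (u, l)))" if "u \<in> ?W" for u
  using tower_map_up[of l u] c(2)[of "xat i u"] that base_return_cell[of u i] by simp
 have "((\<lambda>u. fst (the (tower_map S (u, l)))) has_real_derivative 1) (at z)"
  by (rule has_field_derivative_transform_within_open[OF DERIV_ident op zW eq])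
 thus ?thesis unfolding tower_deriv_def prod.case by (rule DERIV_imp_deriv)
qed

end

lemma nn_integral_count_single:
 fixes f :: "'b => ennreal"
 assumes "a \<in> A" "\<And>x. x \<in> A ==> x \<noteq> a ==> f x = 0"
 shows "(\<integral>\<^sup>+x. f x \<partial>count_space A) = f a"
proof -
 have "(\<integral>\<^sup>+x. f x \<partial>count_space A) = (\<integral>\<^sup>+x. f x \<partial>count_space {a})"
  by (rule nn_integral_count_space_eq) (use assms in auto)
 thus ?thesis by (simp add: nn_integral_count_space_finite)
qed

lemma suminf_head: "(\<Sum>l. f l) = f 0 + (\<Sum>l. f (Suc l) :: ennreal)"
 using suminf_offset[of f 1] by (simp add: add.commute)

section \<open>Levels of the tower, and the transfer operator in terms of branches\<close>

context mis_scheme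
begin

lemma nbase_cell [measurable]: "base_cell i \<in> sets borel" by (simp add: base_cell_def)

lemma base_borel [measurable]: "base S \<in> sets borel" unfolding base_def by measurable

lemma xat_measurable [measurable]: "xat i \<in> borel_measurable borel"
 unfolding xat_def by measurable

lemma base_proj_measurable [measurable]: "base_proj S \<in> borel_measurable borel"
proof -
 have "(\<lambda>z. (\<lambda>k z. Inf (refs S ! nat k) + (z - real_of_int k) * len (refs S ! nat k)) \<lfloor>z\<rfloor> z) \<in> borel_measurable borel"
  by (rule measurable_compose_countable) measurable
 thus ?thesis unfolding base_proj_def base_ref_def .
qed

definition slice :: "nat => real set" where
 "slice l = {z\<in>base S. enat l < base_return S z}"

lemma tower_slice: "(z, l) \<in> tower S \<longleftrightarrow> z \<in> slice l"
 by (simp add: tower_def slice_def)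

lemma eta_borel: "L \<in> set (refs S) ==> p \<in> eta S L ==> fst p \<in> sets borel"
 using eta_props(4)[of L "fst p" "snd p"] by (simp add: nondeg_def real_interval_borel_measurable)

lemma slice_borel [measurable]: "slice l \<in> sets borel"
proof -
 have eq: "slice l = (\<Union>i<nref. base_cell i - (\<Union>p\<in>{p\<in>eta S (rf i). snd p \<le> l}. xat i -` fst p))"
 proof (rule set_eqI)
  fix z
  have cell: "enat l < base_return S z \<longleftrightarrow> z \<notin> (\<Union>p\<in>{p\<in>eta S (rf i). snd p \<le> l}. xat i -` fst p)" if "z \<in> base_cell i" for i
   unfolding base_return_cell[OF that] return_gt_iff by (auto simp: not_less[symmetric])
  have "z \<in> slice l \<longleftrightarrow> (\<exists>i<nref. z \<in> base_cell i \<and> enat l < base_return S z)" unfolding slice_def base_def by auto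
  thus "z \<in> slice l \<longleftrightarrow> z \<in> (\<Union>i<nref. base_cell i - (\<Union>p\<in>{p\<in>eta S (rf i). snd p \<le> l}. xat i -` fst p))"
   using cell by auto
 qed
 have "xat i -` fst p \<in> sets borel" if "i < nref" "p \<in> eta S (rf i)" for i p
  using measurable_sets[OF xat_measurable eta_borel[OF rf_in[OF that(1)] that(2)], of i] by simp
 moreover have "countable {p\<in>eta S (rf i). snd p \<le> l}" if "i < nref" for i
  by (rule countable_subset[OF _ countable_eta[OF rf_in[OF that]]]) blast
 ultimately show ?thesis unfolding eq 
  by (intro sets.countable_UN'' sets.Diff countable_finite[of "{..<nref}"]) auto
qed

abbreviation TP :: "(real \<times> nat) measure" where "TP \<equiv> lborel \<Otimes>\<^sub>M count_space UNIV"

lemma TP_sigma: "pair_sigma_finite lborel (count_space (UNIV :: nat set))"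
 by (simp add: pair_sigma_finite_def sigma_finite_measure_count_space_countable sigma_finite_lborel)

lemma tower_sets [measurable]: "tower S \<in> sets TP"
proof -
 have "tower S = (\<Union>l. slice l \<times> {l})" by (auto simp: tower_slice)
 moreover have "slice l \<times> {l} \<in> sets TP" for l by (intro pair_measureI) auto
 ultimately show ?thesis by auto
qed

lemma tower_proj_measurable [measurable]: "tower_proj S \<in> borel_measurable TP"
proof -
 have "(\<lambda>p. (\<lambda>l p. (T ^^ l) (base_proj S (fst p))) (snd p) p) \<in> borel_measurable TP"
  by (rule measurable_compose_countable) measurable
 thus ?thesis unfolding tower_proj_def iter_T case_prod_beta .
qed

lemma nn_integral_tower:
 assumes f: "f \<in> borel_measurable (tower_measure S)"
 shows "(\<integral>\<^sup>+y. f y \<partial>tower_measure S) = (\<Sum>l. \<integral>\<^sup>+z. f (z, l) * indicator (slice l) z \<partial>lborel)"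
  and "(\<lambda>z. f (z, l) * indicator (slice l) z) \<in> borel_measurable borel"
proof -
 interpret pair_sigma_finite lborel "count_space (UNIV :: nat set)" by (rule TP_sigma)
 have ts: "tower S \<inter> space TP \<in> sets TP" using tower_sets by (simp add: space_pair_measure)
 have m: "(\<lambda>y. f y * indicator (tower S) y) \<in> borel_measurable TP"
  using f unfolding tower_measure_def borel_measurable_restrict_space_iff_ennreal[OF ts] .
 have i: "indicator (tower S) (z, l) = (indicator (slice l) z :: ennreal)" for z l by (simp add: indicator_def tower_slice)
 have "(\<integral>\<^sup>+y. f y \<partial>tower_measure S) = (\<integral>\<^sup>+y. f y * indicator (tower S) y \<partial>TP)"
  unfolding tower_measure_def by (rule nn_integral_restrict_space[OF ts])
 also have "\<dots> = (\<integral>\<^sup>+l. \<integral>\<^sup>+z. f (z, l) * indicator (tower S) (z, l) \<partial>lborel \<partial>count_space UNIV)"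
  by (rule nn_integral_snd[OF m, symmetric])
 finally show "(\<integral>\<^sup>+y. f y \<partial>tower_measure S) = (\<Sum>l. \<integral>\<^sup>+z. f (z, l) * indicator (slice l) z \<partial>lborel)"
  unfolding i nn_integral_count_space_nat .
 have "(\<lambda>z. (\<lambda>y. f y * indicator (tower S) y) (z, l)) \<in> borel_measurable borel"
  using measurable_compose[OF _ m, of "\<lambda>z. (z, l)" borel] by simp
 thus "(\<lambda>z. f (z, l) * indicator (slice l) z) \<in> borel_measurable borel" unfolding i .
qed

lemma AE_tower_slice:
 assumes "AE y in tower_measure S. Q y" shows "AE z in lborel. \<forall>l. z \<in> slice l --> Q (z, l)"
proof -
 interpret pair_sigma_finite lborel "count_space (UNIV :: nat set)" by (rule TP_sigma)
 have ts: "tower S \<inter> space TP \<in> sets TP" using tower_sets by (simp add: space_pair_measure)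
 have "AE y in TP. y \<in> tower S --> Q y"
  using assms unfolding tower_measure_def AE_restrict_space_iff[OF ts] .
 from AE_pair[OF this] show ?thesis by (simp add: AE_count_space tower_slice)
qed

lemma AE_not_bad: "AE z in lborel. z \<notin> bad"
 using countable_bad by (intro AE_not_in countable_imp_null_set_lborel)

text \<open>A point of level \<open>l\<close> makes its next move at time \<open>l + 1\<close>, so
  return time \<open>l + 1\<close> means leaving the tower from level \<open>l\<close>.\<close>

definition hole_set :: "nat => real set" where
 "hole_set l = {z\<in>base S. base_return S z = enat (l + 1) \<and> (T ^^ (l + 1)) (base_proj S z) \<in> H}"

definition return_set :: "nat => real set" where
 "return_set l = (\<Union>v\<in>{v\<in>branches. rtime v = l + 1}. bdom v)"

lemma return_set_borel [measurable]: "return_set l \<in> sets borel"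
proof -
 have "open (bdom v)" if "v \<in> branches" for v using bdom_eq[OF that] by (metis open_greaterThanLessThan)
 thus ?thesis unfolding return_set_def by (intro borel_open open_UN) auto
qed

lemma return_set_eq: "z \<in> return_set l ==> z \<in> base S \<and> base_return S z = enat (l + 1) \<and> (T ^^ (l + 1)) (base_proj S z) \<notin> H"
proof -
 assume "z \<in> return_set l"
 then obtain v where b: "v \<in> branches" "rtime v = l + 1" "z \<in> bdom v" by (auto simp: return_set_def)
 note f = bdom_facts[OF b(1,3)]
 show ?thesis using f(1,2,3,6,7) b(2) base_cellI rf_facts(1)[OF f(6)] interior_subset by (metis DiffE subsetD)
qed

lemma hole_set_borel [measurable]: "hole_set l \<in> sets borel"
proof -
 have "hole_set l = (slice l - slice (l + 1)) \<inter> {z. (T ^^ (l + 1)) (base_proj S z) \<in> H}"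
  unfolding hole_set_def slice_def
 proof (rule set_eqI)
  fix z
  have "base_return S z = enat (l + 1) \<longleftrightarrow> enat l < base_return S z \<and> \<not> enat (l + 1) < base_return S z"
   by (cases "base_return S z") auto
  thus "z \<in> {z\<in>base S. base_return S z = enat (l + 1) \<and> (T ^^ (l + 1)) (base_proj S z) \<in> H} \<longleftrightarrow>
   z \<in> ({z\<in>base S. enat l < base_return S z} - {z\<in>base S. enat (l + 1) < base_return S z}) \<inter> {z. (T ^^ (l + 1)) (base_proj S z) \<in> H}"
   by blast
 qed
 moreover have "{z. (T ^^ (l + 1)) (base_proj S z) \<in> H} \<in> sets borel"
  using measurable_sets[OF measurable_compose[OF base_proj_measurable measurable_iter] borel_open[OF hole_open], of "l + 1" a]
  by (simp add: vimage_def del: funpow.simps)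
 ultimately show ?thesis by auto
qed

lemma branch_at:
 assumes z: "z \<in> base S" "z \<notin> bad" "base_return S z = enat (l + 1)" "(T ^^ (l + 1)) (base_proj S z) \<notin> H"
 obtains v where "v \<in> branches" "rtime v = l + 1" "z \<in> bdom v"
proof -
 obtain i where i: "i < nref" "z \<in> base_cell i" using z(1) by (rule base_obtain)
 have x: "xat i z \<notin> ref_exc (rf i)" using z i by (simp add: bad_def base_proj_cell base_ref_cell)
 have "Rt (rf i) (xat i z) = enat (l + 1)" using z(3) base_return_cell[OF i(2)] by simp
 then obtain A where A: "(A, l + 1) \<in> eta S (rf i)" "xat i z \<in> interior A"
  using return_eq_eta[OF rf_in[OF i(1)] x, of "l + 1" thesis] by blast
 have "xat i z \<in> A" using A(2) interior_subset by blast
 hence "\<not> (T ^^ (l + 1)) ` A \<subseteq> H" using z(4) unfolding base_proj_cell[OF i(2)] by blast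
 then obtain L' where "L' \<in> set (refs S)" "(T ^^ (l + 1)) ` A \<subseteq> L'" using eta_props(5)[OF rf_in[OF i(1)] A(1)] by blast
 hence "\<exists>k<nref. (T ^^ (l + 1)) ` A \<subseteq> rf k" by (metis in_set_conv_nth)
 hence "(i, A, l + 1) \<in> branches" using i(1) A(1) by (simp add: branches_def del: funpow.simps)
 thus ?thesis using that[of "(i, A, l + 1)"] A(2) by (simp add: bdom_def)
qed

lemma branch_unique:
 assumes b: "v \<in> branches" "v' \<in> branches" and z: "z \<in> bdom v" "z \<in> bdom v'"
 shows "v = v'"
proof -
 obtain i A n where e: "v = (i, A, n)" by (rule prod_cases3)
 obtain i' A' n' where e': "v' = (i', A', n')" by (rule prod_cases3)
 have "i = i'" using base_cell_unique[OF bdom_facts(1)[OF b(1) z(1)] bdom_facts(1)[OF b(2) z(2)]] by (simp add: e e')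
 moreover have "A = A' \<and> n = n'"
  using eta_disjoint[OF rf_in[OF branch_facts(1)[OF b(1) e]] branch_facts(2)[OF b(1) e], of A' n' "xat i z"]
   branch_facts(2)[OF b(2) e'] z interior_subset `i = i'` by (auto simp: e e' bdom_def)
 ultimately show ?thesis by (simp add: e e')
qed

text \<open>From level \<open>l\<close> a good point moves up, returns to the base, or falls into
  the hole; this is the bookkeeping behind \<open>duality\<close>.\<close>

lemma slice_split:
 assumes "z \<notin> bad"
 shows "indicator (slice l) z = (indicator (slice (Suc l)) z + indicator (return_set l) z + indicator (hole_set l) z :: ennreal)"
proof -
 have dj: "base_return S z = enat (l + 1) \<longleftrightarrow> enat l < base_return S z \<and> \<not> enat (Suc l) < base_return S z"
  by (cases "base_return S z") auto
 have R: "z \<in> return_set l \<longleftrightarrow> z \<in> base S \<and> base_return S z = enat (l + 1) \<and> (T ^^ (l + 1)) (base_proj S z) \<notin> H"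
 proof
  assume "z \<in> base S \<and> base_return S z = enat (l + 1) \<and> (T ^^ (l + 1)) (base_proj S z) \<notin> H"
  then obtain v where "v \<in> branches" "rtime v = l + 1" "z \<in> bdom v" using branch_at[of z l thesis] assms by blast
  thus "z \<in> return_set l" unfolding return_set_def by blast
 qed (rule return_set_eq)
 have up: "z \<in> slice (Suc l) ==> z \<in> slice l" by (auto simp: slice_def intro: less_trans[of "enat l" "enat (Suc l)"])
 show ?thesis
  using R up dj unfolding hole_set_def by (auto simp: indicator_def slice_def simp del: funpow.simps)
qed

text \<open>Branch domains are disjoint, and each belongs to the single level below its return time;
  the interchange of sums and integrals is Tonelli over countably many branches.\<close>

lemma branch_sum:
 fixes X :: "nat => real => ennreal"
 assumes X [measurable]: "\<And>l. X l \<in> borel_measurable borel"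
 shows "(\<integral>\<^sup>+v. \<integral>\<^sup>+z. X (rtime v - 1) z * indicator (bdom v) z \<partial>lborel \<partial>count_space branches) =
  (\<Sum>l. \<integral>\<^sup>+z. X l z * indicator (return_set l) z \<partial>lborel)"
proof -
 define Y where "Y l v z = (if rtime v = l + 1 then X l z * indicator (bdom v) z else 0)" for l and v :: "nat \<times> real set \<times> nat" and z
 have Ym: "Y l v \<in> borel_measurable lborel" if "v \<in> branches" for l v
 proof -
  have "open (bdom v)" using bdom_eq[OF that] by (metis open_greaterThanLessThan)
  hence [measurable]: "bdom v \<in> sets borel" by simp
  show ?thesis unfolding Y_def by measurable
 qed
 have "X l z * indicator (return_set l) z = (\<integral>\<^sup>+v. Y l v z \<partial>count_space branches)" for l z
 proof (cases "z \<in> return_set l")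
  case True
  then obtain v where b: "v \<in> branches" "rtime v = l + 1" "z \<in> bdom v" by (auto simp: return_set_def)
  have "(\<integral>\<^sup>+v. Y l v z \<partial>count_space branches) = Y l v z"
   by (rule nn_integral_count_single[OF b(1)]) (use branch_unique[OF b(1) _ b(3)] in \<open>auto simp: Y_def indicator_def\<close>)
  thus ?thesis using True b by (simp add: Y_def)
 next
  case False
  hence "Y l v z = 0" if "v \<in> branches" for v
   using that by (cases v) (auto simp: Y_def return_set_def indicator_def)
  thus ?thesis using False by (simp add: nn_integral_0_iff_AE AE_count_space)
 qed
 hence "(\<Sum>l. \<integral>\<^sup>+z. X l z * indicator (return_set l) z \<partial>lborel) = (\<Sum>l. \<integral>\<^sup>+z. \<integral>\<^sup>+v. Y l v z \<partial>count_space branches \<partial>lborel)"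
  by simp
 also have "\<dots> = (\<Sum>l. \<integral>\<^sup>+v. \<integral>\<^sup>+z. Y l v z \<partial>lborel \<partial>count_space branches)"
  by (intro suminf_cong nn_integral_count_space_nn_integral countable_branches Ym)
 also have "\<dots> = (\<integral>\<^sup>+v. (\<Sum>l. \<integral>\<^sup>+z. Y l v z \<partial>lborel) \<partial>count_space branches)"
  by (rule nn_integral_suminf[symmetric]) simp
 also have "\<dots> = (\<integral>\<^sup>+v. \<integral>\<^sup>+z. X (rtime v - 1) z * indicator (bdom v) z \<partial>lborel \<partial>count_space branches)"
 proof (rule nn_integral_cong)
  fix v assume "v \<in> space (count_space branches)"
  hence b: "v \<in> branches" by simp
  have n: "1 \<le> rtime v" using branch_facts(3)[OF b] by (metis prod_cases3 snd_conv)
  have "(\<Sum>l. \<integral>\<^sup>+z. Y l v z \<partial>lborel) = (\<integral>\<^sup>+l. \<integral>\<^sup>+z. Y l v z \<partial>lborel \<partial>count_space UNIV)" by (simp add: nn_integral_count_space_nat)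
  also have "\<dots> = (\<integral>\<^sup>+z. Y (rtime v - 1) v z \<partial>lborel)"
  proof (rule nn_integral_count_single)
   fix l assume "l \<noteq> rtime v - 1"
   hence "rtime v \<noteq> l + 1" by simp
   thus "(\<integral>\<^sup>+z. Y l v z \<partial>lborel) = 0" by (simp only: Y_def if_False nn_integral_const mult_zero_left)
  qed simp
  finally show "(\<Sum>l. \<integral>\<^sup>+z. Y l v z \<partial>lborel) = (\<integral>\<^sup>+z. X (rtime v - 1) z * indicator (bdom v) z \<partial>lborel)"
   using n by (simp add: Y_def)
 qed
 finally show ?thesis by (rule sym)
qed

lemma transfer_up:
 assumes z: "z \<in> slice (Suc l)" "z \<notin> bad" shows "transfer_op S f (z, Suc l) = f (z, l)"
proof -
 have R: "z \<in> base S" "enat (l + 1) < base_return S z" using z by (auto simp: slice_def)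
 have "z \<in> slice l" using R by (auto simp: slice_def intro: less_trans[of "enat l" "enat (l + 1)"])
 hence "{y \<in> tower S. tower_map S y = Some (z, Suc l)} = {(z, l)}"
  using tower_map_up[OF R(2)] tower_map_Some(1)[of _ _ z "Suc l"] by (auto simp: tower_slice)
 thus ?thesis unfolding transfer_op_def using tower_deriv_up[OF R(1) z(2) R(2)] by simp
qed

text \<open>Off this null set every preimage of a base point is a good point and so lies in the
  domain of a branch.\<close>

definition bad_img :: "real set" where
 "bad_img = (\<lambda>(z, l). fst (the (tower_map S (z, l)))) ` (bad \<times> UNIV)"

lemma AE_not_bad_img: "AE w in lborel. w \<notin> bad_img"
 unfolding bad_img_def using countable_bad
 by (intro AE_not_in countable_imp_null_set_lborel countable_image countable_SIGMA) auto

definition wt :: "(real \<times> nat => real) => nat => real => ennreal" where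
 "wt f l z = ennreal (f (z, l)) * indicator (slice l) z"

definition psi :: "nat \<times> real set \<times> nat => real => real" where
 "psi v = the_inv_into (bdom v) (ret_map v)"

text \<open>The contribution of the branch \<open>v\<close> to the transfer operator at the base
  point \<open>w\<close>, applied to the level densities \<open>X\<close>.\<close>

definition push :: "(nat => real => ennreal) => nat \<times> real set \<times> nat => real => ennreal" where
 "push X v w = X (rtime v - 1) (psi v w) / ennreal \<bar>ret_deriv v (psi v w)\<bar> * indicator (ret_map v ` bdom v) w"

lemma push_integral:
 assumes X: "\<And>l. X l \<in> borel_measurable borel" and b: "v \<in> branches"
 shows "push X v \<in> borel_measurable borel"
  "(\<integral>\<^sup>+w. push X v w \<partial>lborel) = (\<integral>\<^sup>+z. X (rtime v - 1) z * indicator (bdom v) z \<partial>lborel)"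
  "inj_on (ret_map v) (bdom v)"
proof -
 obtain p q where pq: "p < q" "bdom v = {p<..<q}" using bdom_eq[OF b] by metis
 have nz: "ret_deriv v z \<noteq> 0" if "z \<in> {p<..<q}" for z using bdom_facts(5)[OF b] that pq(2) by simp
 note * = nn_integral_branch[OF pq(1) ret_map_deriv[of v] ret_deriv_continuous[of _ v] nz X[of "rtime v - 1"],
  folded pq(2), folded psi_def]
 show "push X v \<in> borel_measurable borel" unfolding push_def using *(1) by simp
 show "(\<integral>\<^sup>+w. push X v w \<partial>lborel) = (\<integral>\<^sup>+z. X (rtime v - 1) z * indicator (bdom v) z \<partial>lborel)"
  unfolding push_def using *(2) by simp
 show "inj_on (ret_map v) (bdom v)" using *(3) by simp
qed

lemma psi_facts:
 assumes b: "v \<in> branches"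
 shows "z \<in> bdom v ==> psi v (ret_map v z) = z"
  "w \<in> ret_map v ` bdom v ==> psi v w \<in> bdom v \<and> ret_map v (psi v w) = w"
proof -
 have inj: "inj_on (ret_map v) (bdom v)" using push_integral(3)[OF _ b, of "\<lambda>_ _. 0"] by simp
 show "z \<in> bdom v ==> psi v (ret_map v z) = z" unfolding psi_def by (rule the_inv_into_f_f[OF inj])
 show "w \<in> ret_map v ` bdom v ==> psi v w \<in> bdom v \<and> ret_map v (psi v w) = w"
  unfolding psi_def using the_inv_into_into[OF inj _ order_refl] f_the_inv_into_f[OF inj] by blast
qed

lemma bdom_slice: "v \<in> branches ==> z \<in> bdom v ==> z \<in> slice (rtime v - 1)"
proof -
 assume b: "v \<in> branches" and z: "z \<in> bdom v"
 note f = bdom_facts[OF b z]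
 have "z \<in> base S" by (rule base_cellI[OF f(2) f(1)])
 thus ?thesis unfolding slice_def using f(3,4) by simp
qed

text \<open>Good preimages of a base point correspond one to one to the branches whose image
  contains it, and on a branch the derivative of the tower map is \<open>ret_deriv\<close>.\<close>

lemma transfer_base:
 assumes w: "w \<in> base S" "w \<notin> bad_img" and f: "\<And>y. y \<in> tower S ==> 0 \<le> f y"
 shows "(\<integral>\<^sup>+y. ennreal (f y / \<bar>tower_deriv S y\<bar>) \<partial>count_space {y \<in> tower S. tower_map S y = Some (w, 0)}) =
  (\<integral>\<^sup>+v. push (wt f) v w \<partial>count_space branches)"
proof -
 let ?Y = "{y \<in> tower S. tower_map S y = Some (w, 0)}" and ?B = "{v\<in>branches. w \<in> ret_map v ` bdom v}"
 let ?g = "\<lambda>v. (psi v w, rtime v - 1)"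
 have pb: "psi v w \<in> bdom v" "ret_map v (psi v w) = w" if "v \<in> ?B" for v
  using that psi_facts(2)[of v w] by auto
 have bij: "bij_betw ?g ?B ?Y"
  unfolding bij_betw_def
 proof
  show "inj_on ?g ?B"
  proof (rule inj_onI)
   fix v v' assume h: "v \<in> ?B" "v' \<in> ?B" "?g v = ?g v'"
   hence "psi v w \<in> bdom v" "psi v w \<in> bdom v'" using pb(1)[OF h(1)] pb(1)[OF h(2)] by simp_all
   thus "v = v'" using branch_unique[of v v' "psi v w"] h by simp
  qed
  show "?g ` ?B = ?Y"
  proof
   show "?g ` ?B \<subseteq> ?Y"
   proof
    fix y assume "y \<in> ?g ` ?B"
    then obtain v where b: "v \<in> ?B" "y = ?g v" by blast
    hence "v \<in> branches" by simp
    thus "y \<in> ?Y" using bdom_facts(8)[of v "psi v w"] bdom_slice[of v "psi v w"] pb[OF b(1)] b(2) by (simp add: tower_slice)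
   qed
   show "?Y \<subseteq> ?g ` ?B"
   proof
    fix y assume y: "y \<in> ?Y"
    obtain z l where zl: "y = (z, l)" by (cases y)
    have t: "z \<in> slice l" "tower_map S (z, l) = Some (w, 0)" using y zl by (auto simp: tower_slice)
    note s = tower_map_Some(2)[OF t(2) refl]
    have R: "base_return S z = enat (l + 1)"
    proof (cases "base_return S z")
     case (enat m) thus ?thesis using s t(1) by (auto simp: slice_def)
    qed (use s in auto)
    have zb: "z \<notin> bad"
    proof
     assume "z \<in> bad"
     hence "(\<lambda>(z, l). fst (the (tower_map S (z, l)))) (z, l) \<in> bad_img" unfolding bad_img_def by blast
     thus False using w(2) t(2) by simp
    qed
    obtain k where k: "k < nref" "w \<in> base_cell k" using w(1) by (rule base_obtain)
    have "xat k w \<in> interior (rf k)" using k xat_cell by blast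
    hence "(T ^^ (l + 1)) (base_proj S z) \<in> rf k"
     using s interior_subset[of "rf k"] unfolding base_proj_cell[OF k(2)] iter_T by (metis subsetD)
    hence nH: "(T ^^ (l + 1)) (base_proj S z) \<notin> H" using rf_facts(1)[OF k(1)] by blast
    have zS: "z \<in> base S" using t(1) by (simp add: slice_def)
    obtain v where b: "v \<in> branches" "rtime v = l + 1" "z \<in> bdom v" by (rule branch_at[OF zS zb R nH])
    have "tower_map S (z, l) = Some (ret_map v z, 0)" using bdom_facts(8)[OF b(1,3)] b(2) by simp
    hence wz: "w = ret_map v z" using t(2) by simp
    hence "?g v = y" using psi_facts(1)[OF b(1,3)] b(2) zl by simp
    moreover have "v \<in> ?B" using b wz by blast
    ultimately show "y \<in> ?g ` ?B" by blast
   qed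
  qed
 qed
 have "(\<integral>\<^sup>+y. ennreal (f y / \<bar>tower_deriv S y\<bar>) \<partial>count_space ?Y) = (\<integral>\<^sup>+v. ennreal (f (?g v) / \<bar>tower_deriv S (?g v)\<bar>) \<partial>count_space ?B)"
  by (rule nn_integral_bij_count_space[OF bij, symmetric])
 also have "\<dots> = (\<integral>\<^sup>+v. push (wt f) v w \<partial>count_space ?B)"
 proof (rule nn_integral_cong)
  fix v assume "v \<in> space (count_space ?B)"
  hence b: "v \<in> ?B" by simp
  hence bb: "v \<in> branches" by simp
  note p = pb[OF b]
  have sl: "psi v w \<in> slice (rtime v - 1)" by (rule bdom_slice[OF bb p(1)])
  have "0 \<le> f (?g v)" using f[of "?g v"] sl by (simp add: tower_slice)
  moreover have "ret_deriv v (psi v w) \<noteq> 0" by (rule bdom_facts(5)[OF bb p(1)])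
  ultimately show "ennreal (f (?g v) / \<bar>tower_deriv S (?g v)\<bar>) = push (wt f) v w"
   unfolding push_def wt_def tower_deriv_return[OF bb p(1)] using sl b by (simp add: divide_ennreal)
 qed
 also have "\<dots> = (\<integral>\<^sup>+v. push (wt f) v w \<partial>count_space branches)"
  by (rule nn_integral_count_space_eq) (auto simp: push_def indicator_def)
 finally show ?thesis .
qed

end

section \<open>The projected measure for one fixed hole\<close>

locale mis_density = mis_scheme +
 fixes \<phi> :: "real \<times> nat => real" and \<theta> Mb C Dc :: real
 assumes \<phi>_class: "\<phi> \<in> density_class S (- ln \<theta> / 2) Mb"
  and \<phi>_inv: "AE y in tower_measure S. transfer_normalized S \<phi> y = \<phi> y"
  and tail: "tail_consts S C \<theta> Dc"
begin

abbreviation "\<Phi> \<equiv> wt \<phi>"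
abbreviation "\<mu> \<equiv> projected_measure S \<phi>"

lemma \<theta>: "0 < \<theta>" "\<theta> < 1" and C_pos: "0 < C" and Dc_pos: "0 < Dc"
 using tail by (auto simp: tail_consts_def)

lemma \<phi>_nonneg: "y \<in> tower S ==> 0 \<le> \<phi> y" and \<phi>_int: "(\<integral>y. \<phi> y \<partial>tower_measure S) = 1"
 using \<phi>_class by (auto simp: density_class_def)

lemma \<phi>_integrable: "integrable (tower_measure S) \<phi>"
 using \<phi>_int not_integrable_integral_eq by fastforce

lemma space_tower: "space (tower_measure S) = tower S"
 by (simp add: tower_measure_def space_restrict_space space_pair_measure)

lemma \<phi>_meas [measurable]: "\<phi> \<in> borel_measurable (tower_measure S)"
 using \<phi>_integrable by simp

lemma nn_\<phi>: "(\<integral>\<^sup>+y. ennreal (\<phi> y) \<partial>tower_measure S) = 1"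
proof -
 have "AE y in tower_measure S. 0 \<le> \<phi> y" by (rule AE_I2) (simp add: space_tower \<phi>_nonneg)
 thus ?thesis using nn_integral_eq_integral[OF \<phi>_integrable] \<phi>_int by simp
qed

lemma \<Phi>_meas [measurable]: "\<Phi> l \<in> borel_measurable borel"
 using nn_integral_tower(2)[of "\<lambda>y. ennreal (\<phi> y)" l] unfolding wt_def[abs_def] by measurable

lemma \<mu>_integral:
 assumes h [measurable]: "h \<in> borel_measurable borel"
 shows "(\<integral>\<^sup>+x. h x \<partial>\<mu>) = (\<Sum>l. \<integral>\<^sup>+z. h ((T ^^ l) (base_proj S z)) * \<Phi> l z \<partial>lborel)"
proof -
 have tp [measurable]: "tower_proj S \<in> borel_measurable (tower_measure S)"
  unfolding tower_measure_def by (rule measurable_restrict_space1) measurable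
 have "(\<integral>\<^sup>+x. h x \<partial>\<mu>) = (\<integral>\<^sup>+y. ennreal (\<phi> y) * h (tower_proj S y) \<partial>tower_measure S)"
  unfolding projected_measure_def by (subst nn_integral_distr; (subst nn_integral_density)?) measurable
 also have "\<dots> = (\<Sum>l. \<integral>\<^sup>+z. (ennreal (\<phi> (z, l)) * h (tower_proj S (z, l))) * indicator (slice l) z \<partial>lborel)"
  by (rule nn_integral_tower(1)) measurable
 finally show ?thesis by (simp add: tower_proj_def wt_def ac_simps)
qed

lemma sum_\<Phi>: "(\<Sum>l. \<integral>\<^sup>+z. \<Phi> l z \<partial>lborel) = 1"
proof -
 have "(\<integral>\<^sup>+y. ennreal (\<phi> y) \<partial>tower_measure S) = (\<Sum>l. \<integral>\<^sup>+z. ennreal (\<phi> (z, l)) * indicator (slice l) z \<partial>lborel)"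
  by (rule nn_integral_tower(1)) measurable
 thus ?thesis using nn_\<phi> by (simp add: wt_def)
qed

lemma eigenvalue:
 obtains c where "0 \<le> c" "AE z in lborel. \<forall>l. z \<in> slice l --> transfer_op S \<phi> (z, l) = c * \<phi> (z, l)"
proof -
 define c where "c = (\<integral>y. \<bar>transfer_op S \<phi> y\<bar> \<partial>tower_measure S)"
 \<comment> \<open>Division by zero yields 0, so \<open>c = 0\<close> would make \<phi> vanish
   almost everywhere although its integral is 1.\<close>
 have "c \<noteq> 0"
 proof
  assume "c = 0"
  hence "AE y in tower_measure S. \<phi> y = 0" using \<phi>_inv by (auto simp: transfer_normalized_def c_def)
  hence "(\<integral>y. \<phi> y \<partial>tower_measure S) = 0" using integral_cong_AE[of \<phi> "tower_measure S" "\<lambda>_. 0"] by simp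
  thus False using \<phi>_int by simp
 qed
 hence "AE y in tower_measure S. transfer_op S \<phi> y = c * \<phi> y"
  using \<phi>_inv by (auto simp: transfer_normalized_def c_def[symmetric] field_simps)
 thus ?thesis using that[of c] AE_tower_slice by (auto simp: c_def)
qed

text \<open>Mass moving up from level \<open>l\<close> is \<open>c\<close> times the mass of the
  next level, and all returning mass together is \<open>c\<close> times that of the base, because
  \<phi> is an eigenfunction with factor \<open>c\<close>. What remains is the mass sent into the
  hole.\<close>

lemma duality:
 obtains c :: ennreal where "\<And>h. h \<in> borel_measurable borel ==>
  (\<integral>\<^sup>+x. h (T x) \<partial>\<mu>) = c * (\<integral>\<^sup>+x. h x \<partial>\<mu>) +
   (\<Sum>l. \<integral>\<^sup>+z. h ((T ^^ Suc l) (base_proj S z)) * \<Phi> l z * indicator (hole_set l) z \<partial>lborel)"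
proof -
 obtain c where c: "0 \<le> c" "AE z in lborel. \<forall>l. z \<in> slice l --> transfer_op S \<phi> (z, l) = c * \<phi> (z, l)"
  by (rule eigenvalue)
 \<comment> \<open>The total mass pushed to the base is at most 1, so the series is finite almost
   everywhere and \<open>infsum\<close> in \<open>transfer_op\<close> is a genuine sum
   there.\<close>
 have fin: "AE w in lborel. (\<integral>\<^sup>+v. push \<Phi> v w \<partial>count_space branches) \<noteq> \<infinity>"
 proof (rule nn_integral_noteq_infinite)
  show "(\<lambda>w. \<integral>\<^sup>+v. push \<Phi> v w \<partial>count_space branches) \<in> borel_measurable lborel"
  proof -
   interpret sigma_finite_measure "count_space branches"
    by (rule sigma_finite_measure_count_space_countable[OF countable_branches])
   have "(\<lambda>p. push \<Phi> (snd p) (fst p)) \<in> borel_measurable (lborel \<Otimes>\<^sub>M count_space branches)"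
    by (rule measurable_compose_countable'[OF _ _ countable_branches, of "\<lambda>v p. push \<Phi> v (fst p)"])
     (use push_integral(1)[of \<Phi>] in \<open>auto intro!: measurable_compose[OF measurable_fst]\<close>)
   thus ?thesis by (intro borel_measurable_nn_integral) (simp add: case_prod_beta)
  qed
  have "(\<integral>\<^sup>+w. \<integral>\<^sup>+v. push \<Phi> v w \<partial>count_space branches \<partial>lborel) = (\<integral>\<^sup>+v. \<integral>\<^sup>+w. push \<Phi> v w \<partial>lborel \<partial>count_space branches)"
   by (rule nn_integral_count_space_nn_integral[OF countable_branches]) (use push_integral(1)[of \<Phi>] in simp)
  also have "\<dots> = (\<integral>\<^sup>+v. \<integral>\<^sup>+z. \<Phi> (rtime v - 1) z * indicator (bdom v) z \<partial>lborel \<partial>count_space branches)"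
   by (rule nn_integral_cong) (use push_integral(2)[of \<Phi>] in simp)
  also have "\<dots> = (\<Sum>l. \<integral>\<^sup>+z. \<Phi> l z * indicator (return_set l) z \<partial>lborel)" by (rule branch_sum) measurable
  also have "\<dots> \<le> (\<Sum>l. \<integral>\<^sup>+z. \<Phi> l z \<partial>lborel)"
   by (intro suminf_le nn_integral_mono) (auto simp: indicator_def)
  also have "\<dots> = 1" by (rule sum_\<Phi>)
  finally have "(\<integral>\<^sup>+w. \<integral>\<^sup>+v. push \<Phi> v w \<partial>count_space branches \<partial>lborel) \<le> 1" .
  thus "(\<integral>\<^sup>+w. \<integral>\<^sup>+v. push \<Phi> v w \<partial>count_space branches \<partial>lborel) \<noteq> \<infinity>" by (auto simp: top_unique)
 qed
 have base_eq: "AE w in lborel. w \<in> slice 0 --> ennreal c * \<Phi> 0 w = (\<integral>\<^sup>+v. push \<Phi> v w \<partial>count_space branches)"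
  using c(2) fin AE_not_bad_img
 proof eventually_elim
  case (elim w)
  show ?case
  proof
   assume w: "w \<in> slice 0"
   let ?Y = "{y \<in> tower S. tower_map S y = Some (w, 0)}"
   have wb: "w \<in> base S" using w by (simp add: slice_def)
   have tb: "(\<integral>\<^sup>+y. ennreal (\<phi> y / \<bar>tower_deriv S y\<bar>) \<partial>count_space ?Y) = (\<integral>\<^sup>+v. push \<Phi> v w \<partial>count_space branches)"
    by (rule transfer_base[OF wb elim(3)]) (rule \<phi>_nonneg)
   have "ennreal (infsum (\<lambda>y. \<phi> y / \<bar>tower_deriv S y\<bar>) ?Y) = (\<integral>\<^sup>+y. ennreal (\<phi> y / \<bar>tower_deriv S y\<bar>) \<partial>count_space ?Y)"
    by (rule ennreal_infsum) (use elim(2) tb \<phi>_nonneg in \<open>auto simp: top.not_eq_extremum\<close>)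
   hence "ennreal (transfer_op S \<phi> (w, 0)) = (\<integral>\<^sup>+v. push \<Phi> v w \<partial>count_space branches)"
    unfolding transfer_op_def tb .
   moreover have "transfer_op S \<phi> (w, 0) = c * \<phi> (w, 0)" using elim(1) w by blast
   moreover have "0 \<le> \<phi> (w, 0)" using \<phi>_nonneg w by (simp add: tower_slice)
   ultimately show "ennreal c * \<Phi> 0 w = (\<integral>\<^sup>+v. push \<Phi> v w \<partial>count_space branches)"
    using w c(1) by (simp add: wt_def ennreal_mult)
  qed
 qed
 have push_slice: "push X v w = 0" if "w \<notin> slice 0" "v \<in> branches" for X v w
 proof -
  have "w \<notin> ret_map v ` bdom v"
  proof
   assume "w \<in> ret_map v ` bdom v"
   then obtain z where z: "z \<in> bdom v" "w = ret_map v z" by blast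
   note f = bdom_facts[OF that(2) z(1)]
   have "w \<in> base S" using base_cellI[OF f(6)] f(9) z(2) by simp
   moreover have "enat 0 < base_return S w"
    using f(6,9) z(2) base_return_cell[of w] return_gt_iff eta_props(1)[OF rf_in[OF f(6)]]
    by (metis less_eq_Suc_le One_nat_def)
   ultimately show False using that(1) by (simp add: slice_def)
  qed
  thus ?thesis by (simp add: push_def)
 qed
 have up_eq: "AE z in lborel. \<forall>l. z \<in> slice (Suc l) --> ennreal c * \<Phi> (Suc l) z = \<Phi> l z"
  using c(2) AE_not_bad
 proof eventually_elim
  case (elim z)
  show ?case
  proof (intro allI impI)
   fix l assume z: "z \<in> slice (Suc l)"
   have "z \<in> slice l" using z by (auto simp: slice_def intro: less_trans[of "enat l" "enat (Suc l)"])
   moreover have "c * \<phi> (z, Suc l) = \<phi> (z, l)" using elim(1) z transfer_up[OF z elim(2), of \<phi>] by metis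
   moreover have "0 \<le> \<phi> (z, Suc l)" using \<phi>_nonneg z by (simp add: tower_slice)
   ultimately show "ennreal c * \<Phi> (Suc l) z = \<Phi> l z" using z c(1) by (simp add: wt_def ennreal_mult[symmetric])
  qed
 qed
 show ?thesis
 proof (rule that[of "ennreal c"])
  fix h :: "real => ennreal" assume h [measurable]: "h \<in> borel_measurable borel"
  define X where "X l z = h ((T ^^ Suc l) (base_proj S z)) * \<Phi> l z" for l z
  have Xm [measurable]: "X l \<in> borel_measurable borel" for l unfolding X_def by measurable
  define P where "P l = (\<integral>\<^sup>+z. h ((T ^^ l) (base_proj S z)) * \<Phi> l z \<partial>lborel)" for l
  have P_Suc: "ennreal c * P (Suc l) = (\<integral>\<^sup>+z. X l z * indicator (slice (Suc l)) z \<partial>lborel)" for l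
  proof -
   have "ennreal c * P (Suc l) = (\<integral>\<^sup>+z. ennreal c * (h ((T ^^ Suc l) (base_proj S z)) * \<Phi> (Suc l) z) \<partial>lborel)"
    unfolding P_def by (rule nn_integral_cmult[symmetric]) measurable
   also have "\<dots> = (\<integral>\<^sup>+z. X l z * indicator (slice (Suc l)) z \<partial>lborel)"
   proof (rule nn_integral_cong_AE, use up_eq in eventually_elim)
    case (elim z)
    show ?case
    proof (cases "z \<in> slice (Suc l)")
     case True
     hence "ennreal c * \<Phi> (Suc l) z = \<Phi> l z" using elim by blast
     thus ?thesis using True unfolding X_def mult.left_commute[of "ennreal c"] by (simp del: funpow.simps)
    qed (simp add: wt_def)
   qed
   finally show ?thesis .
  qed
  have P_0: "ennreal c * P 0 = (\<Sum>l. \<integral>\<^sup>+z. X l z * indicator (return_set l) z \<partial>lborel)"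
  proof -
   have "ennreal c * P 0 = (\<integral>\<^sup>+w. ennreal c * (h (base_proj S w) * \<Phi> 0 w) \<partial>lborel)"
    unfolding P_def by (subst nn_integral_cmult[symmetric]) simp_all
   also have "\<dots> = (\<integral>\<^sup>+w. \<integral>\<^sup>+v. push X v w \<partial>count_space branches \<partial>lborel)"
   proof (rule nn_integral_cong_AE, use base_eq in eventually_elim)
    case (elim w)
    have eq: "push X v w = h (base_proj S w) * push \<Phi> v w" if b: "v \<in> branches" for v
    proof (cases "w \<in> ret_map v ` bdom v")
     case True
     note p = psi_facts(2)[OF b True]
     note f = bdom_facts[OF b conjunct1[OF p]]
     have "Suc (rtime v - 1) = rtime v" using f(4) by simp
     hence "(T ^^ Suc (rtime v - 1)) (base_proj S (psi v w)) = base_proj S w" using f(10) p by simp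
     thus ?thesis using True by (simp add: push_def X_def ennreal_times_divide del: funpow.simps)
    qed (simp add: push_def)
    show ?case
    proof (cases "w \<in> slice 0")
     case True
     have "(\<integral>\<^sup>+v. push X v w \<partial>count_space branches) = (\<integral>\<^sup>+v. h (base_proj S w) * push \<Phi> v w \<partial>count_space branches)"
      by (rule nn_integral_cong) (use eq in simp)
     also have "\<dots> = h (base_proj S w) * (\<integral>\<^sup>+v. push \<Phi> v w \<partial>count_space branches)"
      by (rule nn_integral_cmult) simp
     finally have "(\<integral>\<^sup>+v. push X v w \<partial>count_space branches) = h (base_proj S w) * (\<integral>\<^sup>+v. push \<Phi> v w \<partial>count_space branches)" .
     thus ?thesis using elim True unfolding mult.left_commute[of "ennreal c"] by simp
    next
     case False
     hence "(\<integral>\<^sup>+v. push X v w \<partial>count_space branches) = 0" using push_slice by (simp add: nn_integral_0_iff_AE AE_count_space)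
     thus ?thesis using False by (simp add: wt_def)
    qed
   qed
   also have "\<dots> = (\<integral>\<^sup>+v. \<integral>\<^sup>+w. push X v w \<partial>lborel \<partial>count_space branches)"
    by (rule nn_integral_count_space_nn_integral[OF countable_branches]) (use push_integral(1)[of X] Xm in simp)
   also have "\<dots> = (\<integral>\<^sup>+v. \<integral>\<^sup>+z. X (rtime v - 1) z * indicator (bdom v) z \<partial>lborel \<partial>count_space branches)"
    by (rule nn_integral_cong) (use push_integral(2)[of X] Xm in simp)
   also have "\<dots> = (\<Sum>l. \<integral>\<^sup>+z. X l z * indicator (return_set l) z \<partial>lborel)" by (rule branch_sum) measurable
   finally show ?thesis .
  qed
  have "(\<integral>\<^sup>+x. h (T x) \<partial>\<mu>) = (\<Sum>l. \<integral>\<^sup>+z. X l z \<partial>lborel)"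
  proof -
   have "(\<lambda>x. h (T x)) \<in> borel_measurable borel" using measurable_iter[of 1 a] by simp
   from \<mu>_integral[OF this] show ?thesis by (simp add: X_def)
  qed
  also have "\<dots> = (\<Sum>l. (\<integral>\<^sup>+z. X l z * indicator (slice (Suc l)) z \<partial>lborel) +
    (\<integral>\<^sup>+z. X l z * indicator (return_set l) z \<partial>lborel) + (\<integral>\<^sup>+z. X l z * indicator (hole_set l) z \<partial>lborel))"
  proof (rule suminf_cong)
   fix l
   have "(\<integral>\<^sup>+z. X l z \<partial>lborel) = (\<integral>\<^sup>+z. X l z * indicator (slice (Suc l)) z + X l z * indicator (return_set l) z + X l z * indicator (hole_set l) z \<partial>lborel)"
   proof (rule nn_integral_cong_AE, use AE_not_bad in eventually_elim)
    case (elim z)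
    have "X l z = X l z * indicator (slice l) z" by (auto simp: X_def wt_def indicator_def)
    also have "\<dots> = X l z * (indicator (slice (Suc l)) z + indicator (return_set l) z + indicator (hole_set l) z)"
     by (simp only: slice_split[OF elim, of l])
    finally show ?case by (simp only: distrib_left)
   qed
   also have "\<dots> = (\<integral>\<^sup>+z. X l z * indicator (slice (Suc l)) z \<partial>lborel) +
    (\<integral>\<^sup>+z. X l z * indicator (return_set l) z \<partial>lborel) + (\<integral>\<^sup>+z. X l z * indicator (hole_set l) z \<partial>lborel)"
   proof -
    have m: "(\<lambda>z. X l z * indicator (slice (Suc l)) z) \<in> borel_measurable lborel"
     "(\<lambda>z. X l z * indicator (return_set l) z) \<in> borel_measurable lborel"
     "(\<lambda>z. X l z * indicator (hole_set l) z) \<in> borel_measurable lborel" by measurable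
    show ?thesis by (simp only: nn_integral_add[OF borel_measurable_add[OF m(1,2)] m(3)] nn_integral_add[OF m(1,2)])
   qed
   finally show "(\<integral>\<^sup>+z. X l z \<partial>lborel) = (\<integral>\<^sup>+z. X l z * indicator (slice (Suc l)) z \<partial>lborel) +
    (\<integral>\<^sup>+z. X l z * indicator (return_set l) z \<partial>lborel) + (\<integral>\<^sup>+z. X l z * indicator (hole_set l) z \<partial>lborel)" .
  qed
  also have "\<dots> = (\<Sum>l. \<integral>\<^sup>+z. X l z * indicator (slice (Suc l)) z \<partial>lborel) +
    (\<Sum>l. \<integral>\<^sup>+z. X l z * indicator (return_set l) z \<partial>lborel) + (\<Sum>l. \<integral>\<^sup>+z. X l z * indicator (hole_set l) z \<partial>lborel)"
   by (simp add: suminf_add[symmetric])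
  also have "(\<Sum>l. \<integral>\<^sup>+z. X l z * indicator (slice (Suc l)) z \<partial>lborel) +
    (\<Sum>l. \<integral>\<^sup>+z. X l z * indicator (return_set l) z \<partial>lborel) = ennreal c * (\<Sum>l. P l)"
   unfolding P_Suc[symmetric] P_0[symmetric] suminf_head[of P] distrib_left ennreal_suminf_cmult by (rule add.commute)
  also have "(\<Sum>l. P l) = (\<integral>\<^sup>+x. h x \<partial>\<mu>)" unfolding P_def by (rule \<mu>_integral[OF h, symmetric])
  finally show "(\<integral>\<^sup>+x. h (T x) \<partial>\<mu>) = ennreal c * (\<integral>\<^sup>+x. h x \<partial>\<mu>) +
   (\<Sum>l. \<integral>\<^sup>+z. h ((T ^^ Suc l) (base_proj S z)) * \<Phi> l z * indicator (hole_set l) z \<partial>lborel)"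
   unfolding X_def .
 qed
qed

end

section \<open>Almost invariance and uniform absolute continuity\<close>

context mis_scheme
begin

lemma card_refs: "real nref * \<epsilon> \<le> 2"
proof -
 have fm: "rf i \<in> fmeasurable lborel" if "i < nref" for i
  using rf_facts(1)[OF that] ref_props(1)[OF rf_in[OF that]]
  by (intro fmeasurableI2[OF fmeasurable_Icc[of "-1" 1]]) (auto simp: real_interval_borel_measurable)
 have dj: "disjoint_family_on rf {..<nref}" unfolding disjoint_family_on_def using rf_unique by blast
 have "real nref * \<epsilon> \<le> (\<Sum>i<nref. len (rf i))"
  using sum_mono[of "{..<nref}" "\<lambda>_. \<epsilon>" "\<lambda>i. len (rf i)"] rf_facts(2) by simp
 also have "\<dots> = len (\<Union>i<nref. rf i)"
  by (rule measure_finite_Union[symmetric]) (use fm dj in \<open>auto simp: fmeasurable_def less_top\<close>)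
 also have "\<dots> \<le> len {-1..1}"
 proof (rule measure_mono_fmeasurable)
  show "(\<Union>i<nref. rf i) \<subseteq> {-1..1}" using rf_facts(1) by blast
 qed (use fm in \<open>auto simp: fmeasurable_def\<close>)
 finally show ?thesis by simp
qed

lemma cell_measure:
 assumes i: "i < nref" and X [measurable]: "X \<in> sets borel"
 shows "emeasure lborel {z\<in>base_cell i. xat i z \<in> X} \<le> emeasure lborel (X \<inter> rf i) / ennreal \<epsilon>"
proof -
 note f = rf_facts[OF i]
 let ?Y = "X \<inter> interior (rf i)"
 have Y [measurable]: "?Y \<in> sets borel" by auto
 have rb: "rf i \<in> sets borel" using ref_props(1)[OF rf_in[OF i]] by (rule real_interval_borel_measurable)
 have "emeasure lborel ?Y = (\<integral>\<^sup>+x. indicator ?Y x \<partial>lborel)" by simp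
 also have "\<dots> = ennreal \<bar>len (rf i)\<bar> * (\<integral>\<^sup>+z. indicator ?Y ((Inf (rf i) - real i * len (rf i)) + len (rf i) * z) \<partial>lborel)"
  by (rule nn_integral_real_affine) (use f(3) in auto)
 also have "(\<lambda>z. indicator ?Y ((Inf (rf i) - real i * len (rf i)) + len (rf i) * z)) = (indicator {z\<in>base_cell i. xat i z \<in> X} :: real => ennreal)"
 proof
  fix z
  have "(Inf (rf i) - real i * len (rf i)) + len (rf i) * z = xat i z" by (simp add: xat_def algebra_simps)
  thus "indicator ?Y ((Inf (rf i) - real i * len (rf i)) + len (rf i) * z) = (indicator {z\<in>base_cell i. xat i z \<in> X} z :: ennreal)"
   using xat_cell[OF i, of z] by (auto simp: indicator_def)
 qed
 also have "(\<integral>\<^sup>+z. indicator {z\<in>base_cell i. xat i z \<in> X} z \<partial>lborel) = emeasure lborel {z\<in>base_cell i. xat i z \<in> X}"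
 proof -
  have "{z\<in>base_cell i. xat i z \<in> X} = base_cell i \<inter> xat i -` X" by auto
  hence "{z\<in>base_cell i. xat i z \<in> X} \<in> sets borel"
   using measurable_sets[OF xat_measurable X, of i] by (auto intro!: sets.Int)
  thus ?thesis by simp
 qed
 finally have eq: "emeasure lborel ?Y = ennreal (len (rf i)) * emeasure lborel {z\<in>base_cell i. xat i z \<in> X}" using f(3) by simp
 have "ennreal \<epsilon> * emeasure lborel {z\<in>base_cell i. xat i z \<in> X} \<le> emeasure lborel ?Y"
  unfolding eq by (intro mult_right_mono ennreal_leI f(2)) simp
 also have "\<dots> \<le> emeasure lborel (X \<inter> rf i)" by (rule emeasure_mono) (use interior_subset rb in auto)
 finally have "ennreal \<epsilon> * emeasure lborel {z\<in>base_cell i. xat i z \<in> X} / ennreal \<epsilon> \<le> emeasure lborel (X \<inter> rf i) / ennreal \<epsilon>"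
  by (rule divide_right_mono_ennreal)
 moreover have "ennreal \<epsilon> * emeasure lborel {z\<in>base_cell i. xat i z \<in> X} / ennreal \<epsilon> = emeasure lborel {z\<in>base_cell i. xat i z \<in> X}"
  unfolding mult.commute[of "ennreal \<epsilon>"] using eps_pos by (intro mult_divide_eq_ennreal) auto
 ultimately show ?thesis by simp
qed

text \<open>There are at most 2 / \<epsilon> reference intervals, and each is stretched to unit
  length by a factor of at most 1 / \<epsilon>.\<close>

lemma base_measure:
 assumes X: "\<And>i. i < nref ==> X i \<in> sets borel" "\<And>i. i < nref ==> emeasure lborel (X i \<inter> rf i) \<le> v"
  and Y: "Y \<subseteq> (\<Union>i<nref. {z\<in>base_cell i. xat i z \<in> X i})"
 shows "emeasure lborel Y \<le> ennreal (2 / \<epsilon>\<^sup>2) * v"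
proof -
 have m: "{z\<in>base_cell i. xat i z \<in> X i} \<in> sets borel" if "i < nref" for i
 proof -
  have "{z\<in>base_cell i. xat i z \<in> X i} = base_cell i \<inter> xat i -` X i" by auto
  thus ?thesis using measurable_sets[OF xat_measurable X(1)[OF that], of i] by (auto intro!: sets.Int)
 qed
 have "emeasure lborel Y \<le> emeasure lborel (\<Union>i<nref. {z\<in>base_cell i. xat i z \<in> X i})"
  by (rule emeasure_mono[OF Y]) (use m in auto)
 also have "\<dots> \<le> (\<Sum>i<nref. emeasure lborel {z\<in>base_cell i. xat i z \<in> X i})"
  by (rule emeasure_subadditive_finite) (use m in auto)
 also have "\<dots> \<le> (\<Sum>i<nref. v / ennreal \<epsilon>)"
 proof (rule sum_mono)
  fix i assume "i \<in> {..<nref}"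
  hence i: "i < nref" by simp
  show "emeasure lborel {z\<in>base_cell i. xat i z \<in> X i} \<le> v / ennreal \<epsilon>"
   using cell_measure[OF i X(1)[OF i]] divide_right_mono_ennreal[OF X(2)[OF i], of "ennreal \<epsilon>"] by (rule order_trans)
 qed
 also have "\<dots> = ennreal (real nref / \<epsilon>) * v"
 proof -
  have "(1 / ennreal \<epsilon>) = ennreal (1 / \<epsilon>)" using eps_pos by (simp add: divide_ennreal[symmetric])
  hence "v / ennreal \<epsilon> = ennreal (1 / \<epsilon>) * v" by (metis ennreal_times_divide mult.commute mult.right_neutral)
  hence "(\<Sum>i<nref. v / ennreal \<epsilon>) = ennreal (real nref) * (ennreal (1 / \<epsilon>) * v)" by (simp add: ennreal_of_nat_eq_real_of_nat)
  thus ?thesis by (simp add: mult.assoc[symmetric] ennreal_mult'[symmetric])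
 qed
 also have "\<dots> \<le> ennreal (2 / \<epsilon>\<^sup>2) * v"
 proof (intro mult_right_mono ennreal_leI)
  have "real nref / \<epsilon> = (real nref * \<epsilon>) / \<epsilon>\<^sup>2" using eps_pos by (simp add: power2_eq_square)
  also have "\<dots> \<le> 2 / \<epsilon>\<^sup>2" by (intro divide_right_mono card_refs) simp
  finally show "real nref / \<epsilon> \<le> 2 / \<epsilon>\<^sup>2" .
 qed simp
 finally show ?thesis .
qed

lemma ret_gt_borel:
 assumes i: "i < nref" shows "{x\<in>rf i. enat l < Rt (rf i) x} \<in> sets borel"
proof -
 have "{x\<in>rf i. enat l < Rt (rf i) x} = rf i - (\<Union>p\<in>{p\<in>eta S (rf i). snd p \<le> l}. fst p)"
  unfolding return_gt_iff by (auto simp: not_less[symmetric])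
 moreover have "countable {p\<in>eta S (rf i). snd p \<le> l}" by (rule countable_subset[OF _ countable_eta[OF rf_in[OF i]]]) blast
 moreover have "rf i \<in> sets borel" using ref_props(1)[OF rf_in[OF i]] by (rule real_interval_borel_measurable)
 ultimately show ?thesis using eta_borel[OF rf_in[OF i]] by (auto intro!: sets.countable_UN'' sets.Diff)
qed

lemma rf_finite_measure:
 assumes "i < nref" "X \<subseteq> rf i" "X \<in> sets borel" shows "emeasure lborel X = ennreal (len X)"
proof -
 have "X \<in> fmeasurable lborel" 
  by (rule fmeasurableI2[OF fmeasurable_Icc[of "-1" 1]]) (use assms rf_facts(1)[OF assms(1)] in auto)
 thus ?thesis by (simp add: emeasure_eq_measure2)
qed

end

context mis_density
begin

abbreviation "q \<equiv> sqrt \<theta>"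

lemma q: "0 < q" "q < 1" "q * q = \<theta>" using \<theta> by auto

text \<open>The weight \<open>exp (- \<xi> * real l)\<close> of the norm is \<open>q ^ l\<close>, as
  \<xi> is minus half the logarithm of \<theta>. Good points lie in some element by
  \<open>return_gt_active\<close>, and only there does the norm say anything.\<close>

lemma \<phi>_bound:
 assumes z: "z \<in> slice l" "z \<notin> bad" shows "q ^ l * \<phi> (z, l) \<le> Mb"
proof -
 obtain i where i: "i < nref" "z \<in> base_cell i" using z(1) base_obtain unfolding slice_def by blast
 have "\<exists>J\<in>tower_elements S l. z \<in> J"
 proof (cases "l = 0")
  case True
  thus ?thesis using i by (auto simp: tower_elements_def)
 next
  case False
  have x: "xat i z \<in> rf i" using xat_cell[OF i(1), of z] i(2) interior_subset by blast
  have "xat i z \<notin> ref_exc (rf i)" using z i base_cellI[OF i] by (simp add: bad_def base_proj_cell base_ref_cell)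
  moreover have "enat l < Rt (rf i) (xat i z)" using z(1) base_return_cell[OF i(2)] by (simp add: slice_def)
  ultimately obtain c where c: "c \<in> active_pieces S (rf i) l" "xat i z \<in> interior c"
   using return_gt_active[OF rf_in[OF i(1)] x, of l thesis] by blast
  have "z \<in> {z \<in> base_cell i. base_proj S z \<in> c}" using i(2) c(2) interior_subset base_proj_cell[OF i(2)] by auto
  thus ?thesis using False i(1) c(1) unfolding tower_elements_def by auto
 qed
 then obtain J where J: "J \<in> tower_elements S l" "z \<in> J" by blast
 have "tower_norm S (- ln \<theta> / 2) \<phi> \<le> ereal Mb" using \<phi>_class by (simp add: density_class_def)
 hence "(SUP l. SUP J\<in>tower_elements S l. SUP z\<in>J. ereal (exp (- (- ln \<theta> / 2) * real l) * \<bar>\<phi> (z, l)\<bar>)) \<le> ereal Mb"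
  unfolding tower_norm_def by simp
 hence "ereal (exp (- (- ln \<theta> / 2) * real l) * \<bar>\<phi> (z, l)\<bar>) \<le> ereal Mb"
  using J by (simp only: SUP_le_iff UNIV_I)
 moreover have "exp (- (- ln \<theta> / 2) * real l) = q ^ l"
 proof -
  have "exp (- (- ln \<theta> / 2) * real l) = exp (ln q * real l)" using \<theta> by (simp add: ln_sqrt)
  thus ?thesis using q(1) by (simp add: exp_of_nat2_mult)
 qed
 ultimately have "q ^ l * \<bar>\<phi> (z, l)\<bar> \<le> Mb" by simp
 thus ?thesis using q(1) by (smt (verit) mult_left_mono zero_le_power)
qed

lemma \<Phi>_bound: "z \<notin> bad ==> \<Phi> l z \<le> ennreal (Mb / q ^ l) * indicator (slice l) z"
 using \<phi>_bound[of z l] q(1) by (auto simp: wt_def indicator_def field_simps intro!: ennreal_leI)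

text \<open>A negative bound would be turned into 0 by \<open>ennreal\<close> and make the density
  vanish, against total mass 1.\<close>

lemma Mb_nonneg: "0 \<le> Mb"
proof (rule ccontr)
 assume M: "\<not> 0 \<le> Mb"
 have "AE z in lborel. \<forall>l. \<Phi> l z = 0"
  using AE_not_bad
 proof eventually_elim
  case (elim z)
  have "Mb / q ^ l \<le> 0" for l using M q(1) by (simp add: divide_nonpos_pos)
  hence "ennreal (Mb / q ^ l) = 0" for l by (simp add: ennreal_neg)
  thus ?case using \<Phi>_bound[OF elim] by simp
 qed
 hence "(\<integral>\<^sup>+z. \<Phi> l z \<partial>lborel) = 0" for l by (subst nn_integral_0_iff_AE) auto
 thus False using sum_\<Phi> by simp
qed

lemma \<Phi>_integral_bound:
 assumes Y [measurable]: "Y \<in> sets borel" and v: "emeasure lborel (slice l \<inter> Y) \<le> ennreal (2 / \<epsilon>\<^sup>2) * ennreal v" and "0 \<le> v"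
 shows "(\<integral>\<^sup>+z. \<Phi> l z * indicator Y z \<partial>lborel) \<le> ennreal (2 * Mb / \<epsilon>\<^sup>2 * (v / q ^ l))"
proof -
 have "(\<integral>\<^sup>+z. \<Phi> l z * indicator Y z \<partial>lborel) \<le> (\<integral>\<^sup>+z. ennreal (Mb / q ^ l) * indicator (slice l \<inter> Y) z \<partial>lborel)"
 proof (rule nn_integral_mono_AE, use AE_not_bad in eventually_elim)
  case (elim z)
  show ?case using \<Phi>_bound[OF elim, of l] by (auto simp: indicator_def)
 qed
 also have "\<dots> = ennreal (Mb / q ^ l) * emeasure lborel (slice l \<inter> Y)" by (simp add: nn_integral_cmult)
 also have "\<dots> \<le> ennreal (Mb / q ^ l) * (ennreal (2 / \<epsilon>\<^sup>2) * ennreal v)" by (intro mult_left_mono v) simp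
 also have "\<dots> = ennreal (Mb / q ^ l * (2 / \<epsilon>\<^sup>2 * v))"
  using Mb_nonneg q(1) `0 \<le> v` eps_pos by (simp add: ennreal_mult[symmetric] del: times_divide_eq_left times_divide_eq_right)
 also have "Mb / q ^ l * (2 / \<epsilon>\<^sup>2 * v) = 2 * Mb / \<epsilon>\<^sup>2 * (v / q ^ l)" by (simp add: field_simps)
 finally show ?thesis .
qed

lemma slice_cover: "slice l \<subseteq> (\<Union>i<nref. {z\<in>base_cell i. xat i z \<in> {x\<in>rf i. enat l < Rt (rf i) x}})"
proof
 fix z assume z: "z \<in> slice l"
 then obtain i where i: "i < nref" "z \<in> base_cell i" using base_obtain unfolding slice_def by blast
 have "xat i z \<in> rf i" using xat_cell[OF i(1), of z] i(2) interior_subset by blast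
 thus "z \<in> (\<Union>i<nref. {z\<in>base_cell i. xat i z \<in> {x\<in>rf i. enat l < Rt (rf i) x}})"
  using z i base_return_cell[OF i(2)] by (auto simp: slice_def)
qed

text \<open>The level has measure of order \<theta>^l and the density is of order q^(-l); as q^2 =
  \<theta>, a factor q^l is left over and the levels are summable.\<close>

lemma level_bound: "(\<integral>\<^sup>+z. \<Phi> l z \<partial>lborel) \<le> ennreal (2 * Mb * C / \<epsilon>\<^sup>2 * q ^ l)"
proof -
 have "emeasure lborel (slice l \<inter> UNIV) \<le> ennreal (2 / \<epsilon>\<^sup>2) * ennreal (C * \<theta> ^ l)"
 proof (rule base_measure[OF ret_gt_borel])
  fix i assume i: "i < nref"
  have "len {x\<in>rf i. enat l < Rt (rf i) x} \<le> C * \<theta> ^ l" using tail rf_in[OF i] by (auto simp: tail_consts_def)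
  moreover have "{x\<in>rf i. enat l < Rt (rf i) x} \<inter> rf i = {x\<in>rf i. enat l < Rt (rf i) x}" by blast
  ultimately show "emeasure lborel ({x\<in>rf i. enat l < Rt (rf i) x} \<inter> rf i) \<le> ennreal (C * \<theta> ^ l)"
   using rf_finite_measure[OF i _ ret_gt_borel[OF i, of l]] by (auto intro: ennreal_leI)
 qed (use slice_cover in auto)
 from \<Phi>_integral_bound[OF _ this] have "(\<integral>\<^sup>+z. \<Phi> l z \<partial>lborel) \<le> ennreal (2 * Mb / \<epsilon>\<^sup>2 * (C * \<theta> ^ l / q ^ l))"
  using C_pos \<theta> by simp
 also have "\<theta> ^ l / q ^ l = q ^ l" using q by (simp add: power_mult_distrib[symmetric] field_simps)
 hence "2 * Mb / \<epsilon>\<^sup>2 * (C * \<theta> ^ l / q ^ l) = 2 * Mb * C / \<epsilon>\<^sup>2 * q ^ l"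
  unfolding times_divide_eq_right[symmetric] by (simp add: ac_simps)
 finally show ?thesis .
qed

text \<open>As for \<open>level_bound\<close>, with the second tail estimate, which carries the
  factor m(H); the return time \<open>l + 1\<close> supplies one more factor \<theta>, which is
  dropped.\<close>

lemma hole_bound: "(\<integral>\<^sup>+z. \<Phi> l z * indicator (hole_set l) z \<partial>lborel) \<le> ennreal (2 * Mb * Dc * len H / \<epsilon>\<^sup>2 * q ^ l)"
proof -
 let ?X = "\<lambda>i. {x\<in>rf i. Rt (rf i) x = enat (l + 1) \<and> iter S (l + 1) x \<in> H}"
 have Xb: "?X i \<in> sets borel" if i: "i < nref" for i
 proof -
  have "Rt (rf i) x = enat (l + 1) \<longleftrightarrow> enat l < Rt (rf i) x \<and> \<not> enat (l + 1) < Rt (rf i) x" for x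
   by (cases "Rt (rf i) x") auto
  hence "?X i = ({x\<in>rf i. enat l < Rt (rf i) x} - {x\<in>rf i. enat (l + 1) < Rt (rf i) x}) \<inter> (T ^^ (l + 1)) -` H"
   unfolding iter_T by blast
  moreover have "(T ^^ (l + 1)) -` H \<in> sets borel"
   using measurable_sets[OF measurable_iter borel_open[OF hole_open], of "l + 1" a] by (simp del: funpow.simps)
  ultimately show ?thesis using ret_gt_borel[OF i] by (auto simp del: funpow.simps)
 qed
 have "emeasure lborel (slice l \<inter> hole_set l) \<le> ennreal (2 / \<epsilon>\<^sup>2) * ennreal (Dc * len H * \<theta> ^ (l + 1))"
 proof (rule base_measure[OF Xb])
  fix i assume i: "i < nref"
  have "len (?X i) \<le> Dc * len H * \<theta> ^ (l + 1)" using tail rf_in[OF i] unfolding tail_consts_def by blast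
  moreover have "?X i \<inter> rf i = ?X i" by blast
  ultimately show "emeasure lborel (?X i \<inter> rf i) \<le> ennreal (Dc * len H * \<theta> ^ (l + 1))"
   using rf_finite_measure[OF i _ Xb[OF i]] by (metis (no_types, lifting) ennreal_leI inf.cobounded2)
 next
  show "slice l \<inter> hole_set l \<subseteq> (\<Union>i<nref. {z\<in>base_cell i. xat i z \<in> ?X i})"
  proof
   fix z assume z: "z \<in> slice l \<inter> hole_set l"
   then obtain j where j: "j < nref" "z \<in> base_cell j" using base_obtain unfolding slice_def by blast
   have "xat j z \<in> rf j" using xat_cell[OF j(1), of z] j(2) interior_subset by blast
   moreover have "Rt (rf j) (xat j z) = enat (l + 1)" "iter S (l + 1) (xat j z) \<in> H"
    using z base_return_cell[OF j(2)] base_proj_cell[OF j(2)] unfolding hole_set_def iter_T by auto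
   ultimately show "z \<in> (\<Union>i<nref. {z\<in>base_cell i. xat i z \<in> ?X i})" using j by blast
  qed
 qed simp_all
 hence "(\<integral>\<^sup>+z. \<Phi> l z * indicator (hole_set l) z \<partial>lborel) \<le> ennreal (2 * Mb / \<epsilon>\<^sup>2 * (Dc * len H * \<theta> ^ (l + 1) / q ^ l))"
  by (rule \<Phi>_integral_bound[rotated]) (use Dc_pos \<theta> in auto)
 also have "\<dots> \<le> ennreal (2 * Mb * Dc * len H / \<epsilon>\<^sup>2 * q ^ l)"
 proof (rule ennreal_leI)
  have "\<theta> ^ (l + 1) / q ^ l = q ^ l * \<theta>" using q by (simp add: power_mult_distrib[symmetric] field_simps)
  hence "\<theta> ^ (l + 1) / q ^ l \<le> q ^ l" using \<theta> q(1) by (simp add: mult_left_le)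
  hence "2 * Mb / \<epsilon>\<^sup>2 * (Dc * len H * (\<theta> ^ (l + 1) / q ^ l)) \<le> 2 * Mb / \<epsilon>\<^sup>2 * (Dc * len H * q ^ l)"
   using Mb_nonneg Dc_pos by (intro mult_left_mono) auto
  thus "2 * Mb / \<epsilon>\<^sup>2 * (Dc * len H * \<theta> ^ (l + 1) / q ^ l) \<le> 2 * Mb * Dc * len H / \<epsilon>\<^sup>2 * q ^ l" by (simp add: field_simps)
 qed
 finally show ?thesis .
qed

lemma sum_geometric: "0 \<le> v ==> (\<Sum>l. ennreal (v * q ^ (l + n))) = ennreal (v * q ^ n / (1 - q))"
proof -
 assume v: "0 \<le> v"
 have "(\<lambda>l. v * q ^ n * q ^ l) sums (v * q ^ n * (1 / (1 - q)))"
  by (intro sums_mult geometric_sums) (use q in auto)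
 hence "(\<lambda>l. ennreal (v * q ^ n * q ^ l)) sums ennreal (v * q ^ n * (1 / (1 - q)))"
  by (subst sums_ennreal) (use q v in auto)
 thus ?thesis by (simp add: sums_iff power_add ac_simps)
qed

lemma \<mu>_sets: "sets \<mu> = sets borel" "space \<mu> = UNIV" by (simp_all add: projected_measure_def)

lemma \<mu>_emeasure:
 assumes B: "B \<in> sets borel"
 shows "emeasure \<mu> B = (\<Sum>l. \<integral>\<^sup>+z. \<Phi> l z * indicator ((\<lambda>z. (T ^^ l) (base_proj S z)) -` B) z \<partial>lborel)"
proof -
 have "emeasure \<mu> B = (\<integral>\<^sup>+x. indicator B x \<partial>\<mu>)" using B \<mu>_sets by simp
 also have "\<dots> = (\<Sum>l. \<integral>\<^sup>+z. indicator B ((T ^^ l) (base_proj S z)) * \<Phi> l z \<partial>lborel)"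
  by (rule \<mu>_integral) (use B in measurable)
 finally show ?thesis by (simp add: mult.commute indicator_vimage)
qed

lemma \<mu>_prob: "prob_space \<mu>"
 by (rule prob_spaceI) (use \<mu>_emeasure[of UNIV] sum_\<Phi> \<mu>_sets in simp)

lemma proj_range: "z \<in> slice l ==> base_proj S z \<in> {-1..1}"
proof -
 assume "z \<in> slice l"
 then obtain i where i: "i < nref" "z \<in> base_cell i" using base_obtain unfolding slice_def by blast
 have "xat i z \<in> rf i" using xat_cell[OF i(1), of z] i(2) interior_subset by blast
 thus ?thesis using rf_facts(1)[OF i(1)] base_proj_cell[OF i(2)] by auto
qed

lemma \<mu>_support: "emeasure \<mu> (- {-1..1}) = 0"
proof -
 have "\<Phi> l z * indicator ((\<lambda>z. (T ^^ l) (base_proj S z)) -` (- {-1..1})) z = 0" for l z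
  using iter_range[OF proj_range[of z l], of l] by (auto simp: wt_def indicator_def)
 moreover have "emeasure \<mu> (- {-1..1}) = (\<Sum>l. \<integral>\<^sup>+z. \<Phi> l z * indicator ((\<lambda>z. (T ^^ l) (base_proj S z)) -` (- {-1..1})) z \<partial>lborel)"
  by (rule \<mu>_emeasure) auto
 ultimately show ?thesis by (simp only: nn_integral_const mult_zero_left suminf_zero)
qed

text \<open>The first \<open>n\<close> levels are controlled by their density bounds, all higher
  ones by \<open>level_bound\<close>. Since \<open>n\<close> is free and the constants are shared by
  all holes of the family, this is uniform absolute continuity.\<close>

lemma \<mu>_bound:
 assumes B: "B \<in> sets borel"
 shows "emeasure \<mu> B \<le> ennreal (2 * Mb / \<epsilon>\<^sup>2 * (\<Sum>l<n. len ({-1..1} \<inter> (T ^^ l) -` B) / q ^ l) + 2 * Mb * C / \<epsilon>\<^sup>2 * q ^ n / (1 - q))"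
proof -
 let ?Y = "\<lambda>l. (\<lambda>z. (T ^^ l) (base_proj S z)) -` B"
 let ?f = "\<lambda>l. \<integral>\<^sup>+z. \<Phi> l z * indicator (?Y l) z \<partial>lborel"
 let ?v = "\<lambda>l. len ({-1..1} \<inter> (T ^^ l) -` B)"
 have TB: "(T ^^ l) -` B \<in> sets borel" for l using measurable_sets[OF measurable_iter B, of l a] by simp
 have Ym: "?Y l \<in> sets borel" for l
  using measurable_sets[OF measurable_compose[OF base_proj_measurable measurable_iter] B, of l a] by simp
 have low: "?f l \<le> ennreal (2 * Mb / \<epsilon>\<^sup>2 * (?v l / q ^ l))" for l
 proof (rule \<Phi>_integral_bound[OF Ym])
  show "emeasure lborel (slice l \<inter> ?Y l) \<le> ennreal (2 / \<epsilon>\<^sup>2) * ennreal (?v l)"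
  proof (rule base_measure[of "\<lambda>_. (T ^^ l) -` B"])
   fix i assume i: "i < nref"
   show "(T ^^ l) -` B \<in> sets borel" by (rule TB)
   have "emeasure lborel ((T ^^ l) -` B \<inter> rf i) \<le> emeasure lborel ({-1..1} \<inter> (T ^^ l) -` B)"
    by (rule emeasure_mono) (use rf_facts(1)[OF i] TB in auto)
   also have "\<dots> = ennreal (?v l)"
   proof -
    have "{-1..1} \<inter> (T ^^ l) -` B \<in> fmeasurable lborel"
     by (rule fmeasurableI2[OF fmeasurable_Icc[of "-1" 1]]) (use TB in auto)
    thus ?thesis by (simp add: emeasure_eq_measure2)
   qed
   finally show "emeasure lborel ((T ^^ l) -` B \<inter> rf i) \<le> ennreal (?v l)" .
  next
   show "slice l \<inter> ?Y l \<subseteq> (\<Union>i<nref. {z\<in>base_cell i. xat i z \<in> (T ^^ l) -` B})"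
   proof
    fix z assume z: "z \<in> slice l \<inter> ?Y l"
    then obtain i where i: "i < nref" "z \<in> base_cell i" using base_obtain unfolding slice_def by blast
    thus "z \<in> (\<Union>i<nref. {z\<in>base_cell i. xat i z \<in> (T ^^ l) -` B})" using z base_proj_cell[OF i(2)] by auto
   qed
  qed
 qed simp
 have "emeasure \<mu> B = (\<Sum>l. ?f (l + n)) + (\<Sum>l<n. ?f l)"
  unfolding \<mu>_emeasure[OF B] by (rule suminf_offset) simp
 also have "(\<Sum>l. ?f (l + n)) \<le> (\<Sum>l. ennreal (2 * Mb * C / \<epsilon>\<^sup>2 * q ^ (l + n)))"
 proof (intro suminf_le summableI)
  fix l
  have "?f (l + n) \<le> (\<integral>\<^sup>+z. \<Phi> (l + n) z \<partial>lborel)" by (rule nn_integral_mono) (simp add: indicator_def)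
  thus "?f (l + n) \<le> ennreal (2 * Mb * C / \<epsilon>\<^sup>2 * q ^ (l + n))" using level_bound[of "l + n"] by (rule order_trans)
 qed
 also have "\<dots> = ennreal (2 * Mb * C / \<epsilon>\<^sup>2 * q ^ n / (1 - q))" by (rule sum_geometric) (use Mb_nonneg C_pos in simp)
 also have "(\<Sum>l<n. ?f l) \<le> (\<Sum>l<n. ennreal (2 * Mb / \<epsilon>\<^sup>2 * (?v l / q ^ l)))" by (intro sum_mono low)
 also have "\<dots> = ennreal (2 * Mb / \<epsilon>\<^sup>2 * (\<Sum>l<n. ?v l / q ^ l))"
  unfolding sum_distrib_left by (rule sum_ennreal) (use Mb_nonneg q in auto)
 finally have "emeasure \<mu> B \<le> ennreal (2 * Mb * C / \<epsilon>\<^sup>2 * q ^ n / (1 - q)) + ennreal (2 * Mb / \<epsilon>\<^sup>2 * (\<Sum>l<n. ?v l / q ^ l))"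
  by (simp add: add_mono)
 moreover have "0 \<le> (\<Sum>l<n. ?v l / q ^ l)" using q by (intro sum_nonneg) simp
 hence "0 \<le> 2 * Mb * C / \<epsilon>\<^sup>2 * q ^ n / (1 - q)" "0 \<le> 2 * Mb / \<epsilon>\<^sup>2 * (\<Sum>l<n. ?v l / q ^ l)"
  using Mb_nonneg q C_pos by simp_all
 ultimately show ?thesis by (simp only: ennreal_plus add.commute)
qed

text \<open>Testing \<open>duality\<close> with the constant 1 gives c = 1 - l1, where l1 is the
  escaped mass. For g between 0 and 1 the difference of the integrals is lg - l1 B with lg between 0
  and l1 and B between 0 and 1, hence at most l1 in modulus.\<close>

lemma \<mu>_defect:
 fixes g :: "real => real"
 assumes g: "g \<in> borel_measurable borel" "\<And>x. 0 \<le> g x" "\<And>x. g x \<le> 1"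
 shows "\<bar>(\<integral>x. g (T x) \<partial>\<mu>) - (\<integral>x. g x \<partial>\<mu>)\<bar> \<le> 2 * Mb * Dc / \<epsilon>\<^sup>2 / (1 - q) * len H"
proof -
 interpret \<mu>: prob_space \<mu> by (rule \<mu>_prob)
 let ?K = "2 * Mb * Dc / \<epsilon>\<^sup>2 / (1 - q) * len H"
 let ?L = "\<lambda>h. \<Sum>l. \<integral>\<^sup>+z. h ((T ^^ Suc l) (base_proj S z)) * \<Phi> l z * indicator (hole_set l) z \<partial>lborel"
 obtain c where c: "\<And>h. h \<in> borel_measurable borel ==> (\<integral>\<^sup>+x. h (T x) \<partial>\<mu>) = c * (\<integral>\<^sup>+x. h x \<partial>\<mu>) + ?L h"
  by (rule duality) blast
 have Tm: "T \<in> borel_measurable borel" using measurable_iter[of 1 a] by simp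
 let ?h = "\<lambda>x. ennreal (g x)"
 have Lg: "?L ?h \<le> ?L (\<lambda>_. 1)"
  by (intro suminf_le summableI nn_integral_mono) (use g(3) ennreal_leI[OF g(3)] mult_right_mono[of "ennreal (g _)" 1] in \<open>auto simp: indicator_def\<close>)
 have L1: "?L (\<lambda>_. 1) \<le> ennreal ?K"
 proof -
  have "?L (\<lambda>_. 1) \<le> (\<Sum>l. ennreal (2 * Mb * Dc * len H / \<epsilon>\<^sup>2 * q ^ (l + 0)))"
   by (intro suminf_le summableI) (use hole_bound in simp)
  also have "\<dots> = ennreal (2 * Mb * Dc * len H / \<epsilon>\<^sup>2 * q ^ 0 / (1 - q))" by (rule sum_geometric) (use Mb_nonneg Dc_pos in simp)
  finally show ?thesis by (simp add: field_simps)
 qed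
 have one: "1 = c + ?L (\<lambda>_. 1)" using c[of "\<lambda>_. 1"] \<mu>.emeasure_space_1 \<mu>_sets by simp
 have int: "integrable \<mu> g" "integrable \<mu> (\<lambda>x. g (T x))"
  using g Tm \<mu>_sets by (auto intro!: \<mu>.integrable_const_bound[where B=1] simp: measurable_cong_sets[OF \<mu>_sets(1) refl] intro: measurable_compose)
 define A where "A = (\<integral>x. g (T x) \<partial>\<mu>)"
 define B where "B = (\<integral>x. g x \<partial>\<mu>)"
 have AB: "0 \<le> A" "0 \<le> B" "B \<le> 1"
  unfolding A_def B_def using g int(1) \<mu>.integral_ge_const[OF int(1)] \<mu>.integral_le_const[OF int(1), of 1] by auto
 have eA: "(\<integral>\<^sup>+x. ?h (T x) \<partial>\<mu>) = ennreal A" unfolding A_def by (rule nn_integral_eq_integral[OF int(2)]) (use g in simp)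
 have eB: "(\<integral>\<^sup>+x. ?h x \<partial>\<mu>) = ennreal B" unfolding B_def by (rule nn_integral_eq_integral[OF int(1)]) (use g in simp)
 have K0: "0 \<le> ?K" using Mb_nonneg Dc_pos q by simp
 have Lfin: "?L (\<lambda>_. 1) \<noteq> \<top>" "?L ?h \<noteq> \<top>" using L1 Lg by (auto simp: top_unique)
 obtain l1 where l1: "0 \<le> l1" "?L (\<lambda>_. 1) = ennreal l1" using Lfin(1) by (cases "?L (\<lambda>_. 1)") auto
 obtain lg where lg: "0 \<le> lg" "?L ?h = ennreal lg" using Lfin(2) by (cases "?L ?h") auto
 have "c \<noteq> \<top>" using one by auto
 then obtain c' where c': "0 \<le> c'" "c = ennreal c'" by (cases c) auto
 have "ennreal A = c * ennreal B + ?L ?h" using c[of ?h] g(1) eA eB by simp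
 hence "ennreal A = ennreal (c' * B + lg)" using c' lg AB by (simp add: ennreal_mult)
 hence Aeq: "A = c' * B + lg" using AB c' lg by (subst (asm) ennreal_inj) auto
 have "ennreal 1 = ennreal (c' + l1)" using one c' l1 by simp
 hence "1 = c' + l1" using c' l1 by (subst (asm) ennreal_inj) auto
 hence c1: "c' = 1 - l1" by simp
 have "lg \<le> l1" "l1 \<le> ?K" using Lg L1 lg l1 K0 by (auto simp: ennreal_le_iff)
 moreover have "A - B = lg - l1 * B" unfolding Aeq c1 by (simp add: algebra_simps)
 moreover have "0 \<le> l1 * B" "l1 * B \<le> l1" using l1 AB by (auto intro: mult_left_le)
 ultimately show ?thesis unfolding A_def[symmetric] B_def[symmetric] using lg(1) by linarith
qed

end

section \<open>Weak limits\<close>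

context mis_map
begin

text \<open>The assumptions say that the \<open>\<nu> j\<close> are asymptotically invariant and uniformly
 absolutely continuous.\<close>

context
 fixes \<nu> :: "nat => real measure" and d :: "nat => real" and K1 K2 \<rho> :: real
 assumes prob: "\<And>j. prob_space (\<nu> j)" and sets_\<nu>: "\<And>j. sets (\<nu> j) = sets borel"
  and supp: "\<And>j. emeasure (\<nu> j) (- {-1..1}) = 0"
  and defect: "\<And>j g. g \<in> borel_measurable borel ==> (\<And>x. 0 \<le> g x) ==> (\<And>x. g x \<le> 1) ==>
   \<bar>(\<integral>x. g (T x) \<partial>\<nu> j) - (\<integral>x. g x \<partial>\<nu> j)\<bar> \<le> d j"
  and d0: "d \<longlonglongrightarrow> 0"
  and bound: "\<And>j B n. B \<in> sets borel ==>
   emeasure (\<nu> j) B \<le> ennreal (K1 * (\<Sum>l<n. len ({-1..1} \<inter> (T ^^ l) -` B) / \<rho> ^ l) + K2 * \<rho> ^ n)"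
  and K: "0 \<le> K1" "0 \<le> K2" "0 < \<rho>" "\<rho> < 1"
begin

lemma \<nu>_real: "real_distribution (\<nu> j)"
 by (simp add: real_distribution_def real_distribution_axioms_def prob sets_\<nu>)

lemma \<nu>_tight: "tight \<nu>"
 unfolding tight_def
proof (intro conjI allI impI)
 show "real_distribution (\<nu> n)" for n by (rule \<nu>_real)
 fix e :: real assume e: "e > 0"
 have "measure (\<nu> n) {-2<..1} = 1" for n
 proof -
  interpret p: prob_space "\<nu> n" by (rule prob)
  have sp: "space (\<nu> n) = UNIV" using sets_eq_imp_space_eq[OF sets_\<nu>[of n]] by simp
  have "measure (\<nu> n) (- {-1..1}) = 0" using supp[of n] by (simp add: measure_def)
  hence "measure (\<nu> n) {-1..1} = 1" using p.prob_compl[of "{-1..1}"] sp sets_\<nu>[of n] by (simp add: Compl_eq_Diff_UNIV)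
  moreover have "measure (\<nu> n) {-1..1} \<le> measure (\<nu> n) {-2<..1}"
   by (rule p.finite_measure_mono) (auto simp: sets_\<nu>)
  ultimately show ?thesis using p.prob_le_1[of "{-2<..1}"] by linarith
 qed
 thus "\<exists>a b. a < b \<and> (\<forall>n. 1 - e < measure (\<nu> n) {a<..b})" using e by (intro exI[of _ "-2"] exI[of _ 1]) simp
qed

text \<open>Invariance passes to the limit for bounded continuous test functions. Absolute
  continuity does not follow from weak convergence alone: compact null sets are enclosed in
  shrinking closed neighbourhoods, to which the uniform bound applies, and inner regularity does the
  rest.\<close>

lemma limit_acip:
 assumes s: "strict_mono s" and \<mu>: "real_distribution \<mu>" and conv: "weak_conv_m (\<nu> \<circ> s) \<mu>"
 shows "acip a \<mu>"
proof -
 interpret m: real_distribution \<mu> by (rule \<mu>)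
 have real: "real_distribution ((\<nu> \<circ> s) n)" for n using \<nu>_real by simp
 have lim: "(\<lambda>n. \<integral>x. f x \<partial>\<nu> (s n)) \<longlonglongrightarrow> (\<integral>x. f x \<partial>\<mu>)" if "\<And>x. isCont f x" "\<And>x. norm (f x) \<le> B" for f :: "real => real" and B
  using weak_conv_imp_integral_bdd_continuous_conv[OF real \<mu> conv that] by simp
 have Tc: "isCont T x" for x using DERIV_isCont[OF has_derivative_iter[of 1 a x]] by simp
 have Tm: "T \<in> borel_measurable borel" using measurable_iter[of 1 a] by simp
 have inv: "(\<integral>x. f (T x) \<partial>\<mu>) = (\<integral>x. f x \<partial>\<mu>)" if c: "\<And>x. isCont f x" and b: "\<And>x. \<bar>f x\<bar> \<le> 1" for f :: "real => real"
 proof -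
  \<comment> \<open>Rescaled to values between 0 and 1, the range for which the defect is
    controlled.\<close>
  define g where "g x = (1 + f x) / 2" for x
  have g: "isCont g x" "0 \<le> g x" "g x \<le> 1" for x
   using c[of x] b[of x] by (auto simp: g_def[abs_def] abs_le_iff intro!: continuous_intros)
  have gm: "g \<in> borel_measurable borel" using g(1) by (intro borel_measurable_continuous_onI) (simp add: continuous_at_imp_continuous_on)
  have gb: "norm (g x) \<le> 1" for x using g(2,3)[of x] by simp
  have "(\<lambda>n. \<bar>(\<integral>x. g (T x) \<partial>\<nu> (s n)) - (\<integral>x. g x \<partial>\<nu> (s n))\<bar>) \<longlonglongrightarrow> \<bar>(\<integral>x. g (T x) \<partial>\<mu>) - (\<integral>x. g x \<partial>\<mu>)\<bar>"
   by (intro tendsto_intros lim isCont_o2[OF Tc] g(1)) (rule gb)+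
  moreover have "(\<lambda>n. \<bar>(\<integral>x. g (T x) \<partial>\<nu> (s n)) - (\<integral>x. g x \<partial>\<nu> (s n))\<bar>) \<longlonglongrightarrow> 0"
  proof (rule tendsto_sandwich[of "\<lambda>_. 0" _ _ "d \<circ> s"])
   show "(d \<circ> s) \<longlonglongrightarrow> 0" by (rule LIMSEQ_subseq_LIMSEQ[OF d0 s])
   show "eventually (\<lambda>n. \<bar>(\<integral>x. g (T x) \<partial>\<nu> (s n)) - (\<integral>x. g x \<partial>\<nu> (s n))\<bar> \<le> (d \<circ> s) n) sequentially"
    using defect[OF gm g(2,3)] by simp
  qed auto
  ultimately have "(\<integral>x. g (T x) \<partial>\<mu>) = (\<integral>x. g x \<partial>\<mu>)" using LIMSEQ_unique by fastforce
  moreover have fm: "f \<in> borel_measurable borel" using c by (intro borel_measurable_continuous_onI) (simp add: continuous_at_imp_continuous_on)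
  have "integrable \<mu> f" "integrable \<mu> (\<lambda>x. f (T x))"
   using b fm measurable_compose[OF Tm fm] by (auto intro!: m.integrable_const_bound[where B=1])
  hence "(\<integral>x. g x \<partial>\<mu>) = (1 + (\<integral>x. f x \<partial>\<mu>)) / 2" "(\<integral>x. g (T x) \<partial>\<mu>) = (1 + (\<integral>x. f (T x) \<partial>\<mu>)) / 2"
   unfolding g_def using m.prob_space by simp_all
  ultimately show ?thesis by simp
 qed
 have rd: "real_distribution (distr \<mu> borel T)"
  unfolding real_distribution_def real_distribution_axioms_def by (simp add: m.prob_space_distr Tm)
 \<comment> \<open>Equality of integrals of continuous functions is read as weak convergence of a
   constant sequence; characteristic functions then identify the two measures.\<close>
 have "weak_conv_m (\<lambda>_. distr \<mu> borel T) \<mu>"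
 proof (rule integral_bdd_continuous_conv_imp_weak_conv)
  show "real_distribution (distr \<mu> borel T)" for n :: nat by (rule rd)
  fix f :: "real => real" assume f: "\<And>x. isCont f x" "\<And>x. \<bar>f x\<bar> \<le> 1"
  have fm: "f \<in> borel_measurable borel" using f(1) by (intro borel_measurable_continuous_onI) (simp add: continuous_at_imp_continuous_on)
  have "(\<integral>x. f x \<partial>distr \<mu> borel T) = (\<integral>x. f x \<partial>\<mu>)" using inv[OF f] fm Tm by (subst integral_distr) auto
  thus "(\<lambda>n. \<integral>x. f x \<partial>distr \<mu> borel T) \<longlonglongrightarrow> (\<integral>x. f x \<partial>\<mu>)" by simp
 qed (rule \<mu>)
 hence "(\<lambda>_ :: nat. char (distr \<mu> borel T) t) \<longlonglongrightarrow> char \<mu> t" for t by (rule levy_continuity1[OF rd \<mu>])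
 hence "char (distr \<mu> borel T) = char \<mu>" using LIMSEQ_const_iff by blast
 hence invariant: "distr \<mu> borel T = \<mu>" by (rule Levy_uniqueness[OF rd \<mu>])
 have outside: "emeasure \<mu> (- {-1..1}) = 0"
 proof -
  define f where "f x = min 1 (max 0 (\<bar>x\<bar> - 1))" for x :: real
  have f: "isCont f x" "norm (f x) \<le> 1" "0 \<le> f x" for x unfolding f_def[abs_def] by (auto intro!: continuous_intros)
  have fm: "f \<in> borel_measurable borel" unfolding f_def[abs_def] by measurable
  have "(\<integral>x. f x \<partial>\<nu> (s n)) = 0" for n
  proof -
   have "AE x in \<nu> (s n). x \<notin> - {-1..1}" by (rule AE_not_in) (use supp sets_\<nu> in \<open>auto simp: null_sets_def\<close>)
   hence "AE x in \<nu> (s n). f x = 0" by eventually_elim (auto simp: f_def abs_le_iff)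
   thus ?thesis using integral_cong_AE[of f "\<nu> (s n)" "\<lambda>_. 0"] fm sets_\<nu> by (simp add: measurable_cong_sets[OF sets_\<nu> refl])
  qed
  hence "(\<integral>x. f x \<partial>\<mu>) = 0" using lim[OF f(1,2)] LIMSEQ_unique[OF _ tendsto_const] by simp
  moreover have "integrable \<mu> f" using f fm by (auto intro!: m.integrable_const_bound[where B=1])
  ultimately have "AE x in \<mu>. f x = 0" using integral_nonneg_eq_0_iff_AE[of \<mu> f] f(3) by simp
  hence "AE x in \<mu>. x \<notin> - {-1..1}"
  proof eventually_elim
   case (elim x)
   thus ?case by (auto simp: f_def min_def max_def split: if_splits)
  qed
  hence "- {-1..1} \<in> null_sets \<mu>" by (subst AE_iff_null_sets) auto
  thus ?thesis by auto
 qed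
 have compact_null: "emeasure \<mu> X = 0" if X: "compact X" "X \<in> null_sets lborel" for X
 proof (cases "X = {}")
  case False
  define W where "W j = {x. infdist x X \<le> 1 / real (Suc j)}" for j
  have cX: "closed X" using X(1) compact_imp_closed by blast
  have Wb: "W j \<in> sets borel" for j unfolding W_def by (intro borel_closed closed_Collect_le continuous_intros)
  have small: "measure \<mu> X \<le> K1 * (\<Sum>l<n. len ({-1..1} \<inter> (T ^^ l) -` W j) / \<rho> ^ l) + K2 * \<rho> ^ n" (is "_ \<le> ?b n j") for n j
  proof -
   \<comment> \<open>A continuous cutoff between the indicators of \<open>X\<close> and of its
     neighbourhood \<open>W j\<close>, so that weak convergence can be used.\<close>
   define g where "g x = max 0 (1 - real (Suc j) * infdist x X)" for x
   have g: "isCont g x" "norm (g x) \<le> 1" "0 \<le> g x" "g x \<le> indicator (W j) x" "indicator X x \<le> g x" for x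
    unfolding g_def[abs_def] W_def
    by (auto simp: indicator_def infdist_nonneg field_simps intro!: continuous_intros)
   have gm: "g \<in> borel_measurable borel" using g(1) by (intro borel_measurable_continuous_onI) (simp add: continuous_at_imp_continuous_on)
   have b0: "0 \<le> ?b n j" using K by (auto intro!: add_nonneg_nonneg mult_nonneg_nonneg sum_nonneg)
   have "(\<integral>x. g x \<partial>\<nu> (s i)) \<le> ?b n j" for i
   proof -
    interpret p: prob_space "\<nu> (s i)" by (rule prob)
    have "(\<integral>x. g x \<partial>\<nu> (s i)) \<le> (\<integral>x. indicator (W j) x \<partial>\<nu> (s i))"
     using g gm Wb sets_\<nu> by (intro integral_mono p.integrable_const_bound[where B=1])
      (auto simp: measurable_cong_sets[OF sets_\<nu> refl])
    also have "\<dots> = measure (\<nu> (s i)) (W j)" using Wb sets_\<nu> by simp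
    also have "\<dots> \<le> ?b n j" using bound[OF Wb, of "s i" j n] b0 by (simp add: p.emeasure_eq_measure)
    finally show ?thesis .
   qed
   hence "(\<integral>x. g x \<partial>\<mu>) \<le> ?b n j" using lim[OF g(1,2)] by (intro LIMSEQ_le_const2) auto
   moreover have "measure \<mu> X = (\<integral>x. indicator X x \<partial>\<mu>)" using cX by simp
   moreover have "(\<integral>x. indicator X x \<partial>\<mu>) \<le> (\<integral>x. g x \<partial>\<mu>)"
    using g gm cX by (intro integral_mono m.integrable_const_bound[where B=1]) auto
   ultimately show ?thesis by linarith
  qed
  have len0: "(\<lambda>j. len ({-1..1} \<inter> (T ^^ l) -` W j)) \<longlonglongrightarrow> 0" for l
  proof -
   let ?A = "\<lambda>j. {-1..1} \<inter> (T ^^ l) -` W j"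
   have Ab: "?A j \<in> sets borel" for j using measurable_sets[OF measurable_iter Wb, of l a j] by auto
   have Af: "?A j \<in> fmeasurable lborel" for j by (rule fmeasurableI2[OF fmeasurable_Icc[of "-1" 1]]) (use Ab in auto)
   have "(\<lambda>j. len (?A j)) \<longlonglongrightarrow> len (\<Inter>j. ?A j)"
   proof (rule Lim_measure_decseq)
    show "range ?A \<subseteq> sets lborel" using Ab by auto
    show "emeasure lborel (?A i) \<noteq> \<infinity>" for i using Af[of i] by (auto simp: fmeasurable_def less_top)
    have "W (Suc i) \<subseteq> W i" for i
    proof
     fix x assume "x \<in> W (Suc i)"
     moreover have "1 / real (Suc (Suc i)) \<le> 1 / real (Suc i)" by (simp add: frac_le)
     ultimately show "x \<in> W i" unfolding W_def by (auto intro: order_trans)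
    qed
    thus "decseq ?A" by (intro decseq_SucI) auto
   qed
   moreover have "(\<Inter>j. W j) = X"
   proof
    show "(\<Inter>j. W j) \<subseteq> X"
    proof
     fix x assume x: "x \<in> (\<Inter>j. W j)"
     have "infdist x X \<le> 0"
     proof (rule LIMSEQ_le_const[OF LIMSEQ_inverse_real_of_nat])
      show "\<exists>N. \<forall>n\<ge>N. infdist x X \<le> inverse (real (Suc n))" using x by (auto simp: W_def inverse_eq_divide)
     qed
     thus "x \<in> X" using in_closed_iff_infdist_zero[OF cX False] infdist_nonneg[of x X] by simp
    qed
   qed (auto simp: W_def)
   hence "(\<Inter>j. ?A j) = {-1..1} \<inter> (T ^^ l) -` X" by blast
   moreover have "len ({-1..1} \<inter> (T ^^ l) -` X) = 0"
   proof -
    have Xb: "X \<in> sets borel" using cX by simp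
    have "negligible {x. (T ^^ l) x \<in> X}"
     by (rule negligible_vimage_iter) (use negligible_borel_iff[OF Xb] X(2) in simp)
    hence "negligible ({-1..1} \<inter> (T ^^ l) -` X)" by (rule negligible_subset) auto
    hence "{-1..1} \<inter> (T ^^ l) -` X \<in> null_sets lborel"
     using negligible_borel_iff[of "{-1..1} \<inter> (T ^^ l) -` X"] measurable_sets[OF measurable_iter Xb, of l a] by auto
    thus ?thesis by (simp add: measure_eq_0_null_sets)
   qed
   ultimately show ?thesis by simp
  qed
  have "measure \<mu> X \<le> K2 * \<rho> ^ n" for n
  proof -
   \<comment> \<open>First \<open>j\<close> tends to infinity with \<open>n\<close> fixed, which
     removes the finite sum; only then does \<open>n\<close> tend to infinity.\<close>
   have "(\<lambda>j. K1 * (\<Sum>l<n. len ({-1..1} \<inter> (T ^^ l) -` W j) / \<rho> ^ l) + K2 * \<rho> ^ n) \<longlonglongrightarrow> K1 * (\<Sum>l<n. 0 / \<rho> ^ l) + K2 * \<rho> ^ n"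
    by (intro tendsto_intros len0) (use K in auto)
   thus ?thesis using small by (intro LIMSEQ_le_const) (auto simp: )
  qed
  moreover have "(\<lambda>n. K2 * \<rho> ^ n) \<longlonglongrightarrow> K2 * 0" by (intro tendsto_intros LIMSEQ_realpow_zero) (use K in auto)
  ultimately have "measure \<mu> X \<le> 0" by (intro LIMSEQ_le_const[of "\<lambda>n. K2 * \<rho> ^ n" 0]) auto
  thus ?thesis using measure_nonneg[of \<mu> X] by (simp add: m.emeasure_eq_measure)
 qed simp
 have "B \<in> null_sets \<mu>" if B: "B \<in> null_sets lborel" for B
 proof -
  have Bb: "B \<in> sets borel" using B by auto
  have "emeasure \<mu> X = 0" if "X \<subseteq> B" "compact X" for X
  proof (rule compact_null[OF that(2)])
   have "X \<in> sets lborel" using borel_closed[OF compact_imp_closed[OF that(2)]] by simp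
   thus "X \<in> null_sets lborel" using null_sets_subset[OF B _ that(1)] by simp
  qed
  hence "emeasure \<mu> B = 0"
   using inner_regular[OF m.events_eq_borel _ Bb] by (simp add: bot_ennreal[symmetric])
  thus ?thesis using Bb by (simp add: null_sets_def)
 qed
 thus ?thesis
  unfolding acip_def absolutely_continuous_def using m.prob_space_axioms outside invariant by auto
qed

text \<open>By tightness every subsequence has a convergent one, and uniqueness of the invariant
  measure makes all these limits equal, so the whole sequence converges.\<close>

lemma limit_exists: "\<exists>\<mu>. acip a \<mu> \<and> weak_conv_m \<nu> \<mu>"
proof -
 obtain r \<mu> where r: "strict_mono r" "real_distribution \<mu>" "weak_conv_m (\<nu> \<circ> id \<circ> r) \<mu>"
  using tight_imp_convergent_subsubsequence[OF \<nu>_tight, of id] by (auto simp: strict_mono_def)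
 have \<mu>: "acip a \<mu>" using limit_acip[OF r(1,2)] r(3) by simp
 have "weak_conv_m \<nu> \<mu>"
 proof (rule tight_subseq_weak_converge[OF \<nu>_real r(2) \<nu>_tight])
  fix s \<mu>' assume s: "strict_mono s" "real_distribution \<mu>'" "weak_conv_m (\<nu> \<circ> s) \<mu>'"
  hence "\<mu>' = \<mu>" using acip_unique[OF \<mu> limit_acip[OF s]] by simp
  thus "weak_conv_m (\<nu> \<circ> s) \<mu>" using s(3) by simp
 qed
 thus ?thesis using \<mu> by blast
qed

end

end

section \<open>Choice of the depth, and the final assembly\<close>

lemma exp_neg_nat_less:
 assumes "0 < (\<eta> :: real)" obtains n :: nat where "\<And>k. n \<le> k ==> exp (- real k) < \<eta>"
proof -
 obtain n :: nat where n: "- ln \<eta> < real n" using reals_Archimedean2 by blast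
 show ?thesis
 proof (rule that[of n])
  fix k assume "n \<le> k"
  hence "- real k < ln \<eta>" using n by linarith
  hence "exp (- real k) < exp (ln \<eta>)" by simp
  thus "exp (- real k) < \<eta>" using assms by simp
 qed
qed

lemma crit_dist_le:
 assumes "r = crit_dist a \<delta>0 H" "0 < r"
 shows "r \<le> \<delta>0" "n \<ge> 1 ==> x \<in> H ==> r \<le> \<bar>x - (logistic a ^^ n) 0\<bar>"
proof -
 let ?X = "insert \<delta>0 {dist ((logistic a ^^ n) 0) x | n x. 1 \<le> n \<and> x \<in> H}"
 have bdd: "bdd_below ?X" by (rule bdd_belowI[of _ "min \<delta>0 0"]) (auto simp: min_le_iff_disj)
 show "r \<le> \<delta>0" unfolding assms(1) crit_dist_def by (rule cInf_lower[OF _ bdd]) simp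
 show "r \<le> \<bar>x - (logistic a ^^ n) 0\<bar>" if "n \<ge> 1" "x \<in> H"
 proof -
  have "r \<le> dist ((logistic a ^^ n) 0) x"
   unfolding assms(1) crit_dist_def by (rule cInf_lower[OF _ bdd]) (use that in auto)
  thus ?thesis by (simp add: dist_real_def abs_minus_commute)
 qed
qed

context mis_map
begin

text \<open>Each term yields one smallness condition of \<open>mis_scheme\<close>: 1 and r/8 those
  relating \<delta> to \<open>r\<close>, the other two \<open>eps_delta\<close> and
  \<open>eps_rad\<close>, once 4^8 \<epsilon> is known to be at most \<delta>^2 / (4
  \<kappa>).\<close>

definition depth_bound :: "real => real => real" where
 "depth_bound \<kappa> r = min (min 1 (r / 8)) (min (\<kappa> / shadow_const) (r * \<kappa> / (144 * shadow_const\<^sup>2)))"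

text \<open>The lower bound \<kappa> / \<delta>^2 for the distortion constant makes \<epsilon> of
  order \<delta>^2, small against \<delta>. Cell growth is assumed for the hole \<open>H\<close> and
  passes to \<open>H'\<close> because bound periods depend only on the map and on
  \<open>rad\<close>.\<close>

lemma small_scheme:
 assumes hole: "is_hole H" "is_hole H'" "H' \<subseteq> H" and r: "0 < r" "r = crit_dist a \<delta>0 H"
  and \<kappa>: "0 < \<kappa>" and k0: "0 < k0" "exp (- real k0) < depth_bound \<kappa> r" "exp (- real k0) < \<delta>0"
  and Ct: "\<kappa> / (exp (- real k0))\<^sup>2 \<le> Ct" and \<epsilon>0: "0 < \<epsilon>0"
  and eps: "4 ^ 8 * \<epsilon> = min \<epsilon>' (min \<epsilon>0 (1 / (4 * Ct)))"
  and growth: "growth_const \<lparr>crit_par = a, rad = r, depth = k0, eps = \<epsilon>, hole = H, refs = \<Lambda>\<rparr> \<epsilon>'"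
  and refs: "reference_family \<lparr>crit_par = a, rad = r, depth = k0, eps = \<epsilon>, hole = H', refs = \<Lambda>'\<rparr>"
 shows "mis_scheme a \<delta>0 lam M0 c0 \<lparr>crit_par = a, rad = r, depth = k0, eps = \<epsilon>, hole = H', refs = \<Lambda>'\<rparr>"
  (is "mis_scheme _ _ _ _ _ ?S")
proof -
 let ?\<delta> = "exp (- real k0)" and ?K = shadow_const
 let ?SH = "\<lparr>crit_par = a, rad = r, depth = k0, eps = \<epsilon>, hole = H, refs = \<Lambda>\<rparr>"
 have \<delta>: "?\<delta> < 1" "?\<delta> < r / 8" "?\<delta> < \<kappa> / ?K" "?\<delta> < r * \<kappa> / (144 * ?K\<^sup>2)"
  using k0(2) by (simp_all add: depth_bound_def)
 have K: "1 \<le> ?K" by (rule shadow_const_ge)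
 have sq: "?\<delta>\<^sup>2 \<le> ?\<delta>" using \<delta>(1) by (simp add: power2_eq_square mult_left_le)
 have Ct0: "0 < Ct" using Ct \<kappa> by (smt (verit) divide_pos_pos exp_gt_zero zero_less_power)
 have \<epsilon>': "0 < \<epsilon>'" using growth by (simp add: growth_const_def)
 have "0 < 4 ^ 8 * \<epsilon>" unfolding eps using Ct0 \<epsilon>' \<epsilon>0 by simp
 hence \<epsilon>: "0 < \<epsilon>" by simp
 have "1 / (4 * Ct) \<le> ?\<delta>\<^sup>2 / (4 * \<kappa>)"
 proof -
  have "\<kappa> \<le> Ct * ?\<delta>\<^sup>2" using Ct by (simp add: divide_le_eq)
  thus ?thesis using Ct0 \<kappa> by (simp add: field_simps)
 qed
 hence small: "4 ^ 8 * \<epsilon> \<le> ?\<delta>\<^sup>2 / (4 * \<kappa>)" unfolding eps by simp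
 have bt: "bound_time ?S k = bound_time ?SH k" for k by (simp add: bound_time_def)
 have h1: "rad ?S \<le> \<delta>0" using crit_dist_le(1)[OF r(2,1)] by simp
 have h2: "open (hole ?S)" "hole ?S \<subseteq> {- 1..1}" "finite (components (hole ?S))" using hole(2) by (auto simp: is_hole_def)
 have h3: "rad ?S \<le> \<bar>x - crit n\<bar>" if "1 \<le> n" "x \<in> hole ?S" for n x
  using crit_dist_le(2)[OF r(2,1) that(1)] that(2) hole(3) by auto
 have h4: "4 ^ 8 * eps ?S \<le> len ((T ^^ bound_time ?S k) ` cell k)" if "int (depth ?S) \<le> \<bar>k\<bar>" for k
 proof -
  have "\<epsilon>' \<le> len ((T ^^ bound_time ?SH k) ` cell k)" using growth that by (simp add: growth_const_def)
  thus ?thesis unfolding bt using eps by simp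
 qed
 have h5: "8 * (delta ?S)\<^sup>2 < rad ?S" "delta ?S \<le> rad ?S / 2" using sq \<delta>(2) r(1) by (simp_all add: delta_def)
 have h6: "3 * ?K * (4 ^ 8 * eps ?S) < delta ?S"
 proof -
  have "3 * ?K * (4 ^ 8 * \<epsilon>) \<le> 3 * ?K * (?\<delta>\<^sup>2 / (4 * \<kappa>))" using K by (intro mult_left_mono small) simp
  also have "\<dots> = ?\<delta> * (3 / 4 * (?\<delta> * ?K / \<kappa>))" by (simp add: power2_eq_square)
  also have "\<dots> < ?\<delta> * 1"
  proof (rule mult_strict_left_mono)
   have "?\<delta> * ?K / \<kappa> < 1" using \<delta>(3) K \<kappa> by (simp add: field_simps)
   thus "3 / 4 * (?\<delta> * ?K / \<kappa>) < 1" by linarith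
  qed simp
  finally show ?thesis by (simp add: delta_def)
 qed
 have h7: "576 * ?K\<^sup>2 * eps ?S < rad ?S"
 proof -
  have "\<epsilon> \<le> ?\<delta>\<^sup>2 / (4 * \<kappa>)" using small \<epsilon> by simp
  also have "\<dots> \<le> ?\<delta> / (4 * \<kappa>)" using sq \<kappa> by (intro divide_right_mono) auto
  finally have "576 * ?K\<^sup>2 * \<epsilon> \<le> 576 * ?K\<^sup>2 * (?\<delta> / (4 * \<kappa>))" by (intro mult_left_mono) auto
  also have "\<dots> < r" using \<delta>(4) K \<kappa> by (simp add: field_simps)
  finally show ?thesis by simp
 qed
 have h0: "crit_par ?S = a" "0 < rad ?S" "0 < eps ?S" "0 < depth ?S" "reference_family ?S" "delta ?S < \<delta>0"
  using r k0 \<epsilon> refs by (simp_all add: delta_def)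
 show ?thesis
  by (intro mis_scheme.intro mis_map_axioms mis_scheme_axioms.intro; (rule h0 | rule h1 | rule h2 | rule h3 | rule h4 | rule h5 | rule h6 | rule h7); assumption?)
qed

end

theorem theorem2p4:
  fixes lam0 :: real
  assumes "lam0 > 0"
  shows
    "\<exists>m_min::nat. \<forall>a \<delta>0 M0 c0 m0 \<epsilon>0 r \<kappa>1 \<kappa>2.
       class_M a \<delta>0 lam0 M0 c0 \<and> 0 < m0 \<and> m_min \<le> m0 \<and> 0 < \<epsilon>0 \<and> 0 < r \<and> 0 < \<kappa>1 \<and> 0 < \<kappa>2 \<longrightarrow>
       (\<exists>k_min::nat. \<forall>k0 \<delta>. 0 < k0 \<and> k_min \<le> k0 \<and> \<delta> = exp (- real k0) \<and> \<delta> < \<delta>0 \<longrightarrow>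
         (\<forall>H n0 \<epsilon>' Ctil \<epsilon> C'' \<theta> D t Hs \<Lambda> S \<phi>.
            is_hole H \<and> assm_A1 a \<delta>0 r H \<and> assm_A2 a m0 \<epsilon>0 H \<and>
            assm_A3 \<epsilon> \<theta> D H \<and> covering_time a \<epsilon>0 n0 \<and> assm_A4 a n0 H \<and>
            shrinking_family \<delta> t H Hs \<and>
            S = (\<lambda>s. \<lparr>crit_par = a, rad = r, depth = k0, eps = \<epsilon>, hole = Hs s, refs = \<Lambda> s\<rparr>) \<and>
            growth_const (S t) \<epsilon>' \<and>
            \<kappa>1 / \<delta>\<^sup>2 \<le> Ctil \<and> Ctil \<le> \<kappa>2 / \<delta>\<^sup>2 \<and>
            4 ^ 8 * \<epsilon> = min \<epsilon>' (min \<epsilon>0 (1 / (4 * Ctil))) \<and>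
            (\<forall>s\<in>{0<..t}.
               reference_family (S s) \<and> distortion_const (S s) Ctil \<and> tail_consts (S s) C'' \<theta> D \<and>
               cond_inv_density (S s) Ctil \<theta> (\<phi> s)) \<longrightarrow>
            (\<exists>\<mu>. acip a \<mu> \<and> (\<forall>\<nu>. acip a \<nu> \<longrightarrow> \<nu> = \<mu>) \<and>
               (\<forall>\<sigma>::nat \<Rightarrow> real. (\<forall>j. \<sigma> j \<in> {0<..t}) \<and> \<sigma> \<longlonglongrightarrow> 0 \<longrightarrow>
                  weak_conv_m (\<lambda>j. projected_measure (S (\<sigma> j)) (\<phi> (\<sigma> j))) \<mu>))))"
proof (rule exI[of _ 0], intro allI impI, elim conjE, goal_cases)
 case (1 a \<delta>0 M0 c0 m0 \<epsilon>0 r \<kappa>1 \<kappa>2)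
 interpret mis_map a \<delta>0 lam0 M0 c0 by unfold_locales (rule 1)
 have "0 < depth_bound \<kappa>1 r" using 1 shadow_const_ge by (simp add: depth_bound_def)
 then obtain k_min where k_min: "\<And>k. k_min \<le> k ==> exp (- real k) < depth_bound \<kappa>1 r" by (rule exp_neg_nat_less) blast
 show ?case
 proof (rule exI[of _ k_min], intro allI impI, elim conjE, goal_cases)
  case prems: (1 k0 \<delta> H n0 \<epsilon>' Ctil \<epsilon> C'' \<theta> Dc t Hs \<Lambda> S \<phi>)
  note H = `is_hole H` `assm_A1 a \<delta>0 r H` `shrinking_family \<delta> t H Hs`
  note S = `S = _`
  note fam = `\<forall>s\<in>{0<..t}. reference_family (S s) \<and> _`
  define Mb where "Mb = (1 + 2 * Ctil * \<epsilon>) / (1 - sqrt \<theta>)"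
  have t: "0 < t" "Hs t = H" using H(3) by (auto simp: shrinking_family_def)
  have dens: "mis_density a \<delta>0 lam0 M0 c0 (S s) (\<phi> s) \<theta> Mb C'' Dc" if s: "s \<in> {0<..t}" for s
  proof (rule mis_density.intro)
   have "is_hole (Hs s)" "Hs s \<subseteq> H" using H(3) s by (auto simp: shrinking_family_def)
   thus "mis_scheme a \<delta>0 lam0 M0 c0 (S s)"
    unfolding S using prems 1 k_min fam s t(2)
    by (intro small_scheme[of H _ r \<kappa>1 k0 Ctil \<epsilon>0 \<epsilon> \<epsilon>' "\<Lambda> t"]) (auto simp: assm_A1_def S)
   have "eps (S s) = \<epsilon>" by (simp add: S)
   thus "mis_density_axioms (S s) (\<phi> s) \<theta> Mb C'' Dc"
    using fam s by (intro mis_density_axioms.intro) (auto simp: cond_inv_density_def Mb_def)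
  qed
  have small: "len (Hs s) \<le> s" if "s \<in> {0<..t}" for s using H(3) that by (auto simp: shrinking_family_def)
  have tt: "t \<in> {0<..t}" using t by simp
  \<comment> \<open>The constants are common to all s; their signs are read off from the instance s
    = t.\<close>
  interpret d: mis_density a \<delta>0 lam0 M0 c0 "S t" "\<phi> t" \<theta> Mb C'' Dc by (rule dens[OF tt])
  have epsS: "eps (S s) = \<epsilon>" "hole (S s) = Hs s" for s by (simp_all add: S)
  have limit: "\<exists>\<mu>. acip a \<mu> \<and> weak_conv_m (\<lambda>j. projected_measure (S (\<sigma> j)) (\<phi> (\<sigma> j))) \<mu>"
   if \<sigma>: "\<And>j. \<sigma> j \<in> {0<..t}" "\<sigma> \<longlonglongrightarrow> 0" for \<sigma> :: "nat => real"
  proof (rule limit_exists)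
   let ?c = "2 * Mb * Dc / \<epsilon>\<^sup>2 / (1 - sqrt \<theta>)"
   have c: "0 \<le> ?c" using d.Mb_nonneg d.Dc_pos d.q(2) by simp
   note E = dens[OF \<sigma>(1)]
   show "prob_space (projected_measure (S (\<sigma> j)) (\<phi> (\<sigma> j)))" for j by (rule mis_density.\<mu>_prob[OF E])
   show "sets (projected_measure (S (\<sigma> j)) (\<phi> (\<sigma> j))) = sets borel" for j by (rule mis_density.\<mu>_sets(1)[OF E])
   show "emeasure (projected_measure (S (\<sigma> j)) (\<phi> (\<sigma> j))) (- {-1..1}) = 0" for j by (rule mis_density.\<mu>_support[OF E])
   show "\<bar>(\<integral>x. g (T x) \<partial>projected_measure (S (\<sigma> j)) (\<phi> (\<sigma> j))) - (\<integral>x. g x \<partial>projected_measure (S (\<sigma> j)) (\<phi> (\<sigma> j)))\<bar> \<le> ?c * \<sigma> j"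
    if g: "g \<in> borel_measurable borel" "\<And>x. 0 \<le> g x" "\<And>x. g x \<le> 1" for j and g :: "real => real"
    using mis_density.\<mu>_defect[OF E g, unfolded epsS, of j] mult_left_mono[OF small[OF \<sigma>(1)[of j]] c] by (rule order_trans)
   show "(\<lambda>j. ?c * \<sigma> j) \<longlonglongrightarrow> 0" using tendsto_mult_right_zero[OF \<sigma>(2), of ?c] .
   show "emeasure (projected_measure (S (\<sigma> j)) (\<phi> (\<sigma> j))) B \<le> ennreal (2 * Mb / \<epsilon>\<^sup>2 *
     (\<Sum>l<n. len ({-1..1} \<inter> (T ^^ l) -` B) / sqrt \<theta> ^ l) + (2 * Mb * C'' / \<epsilon>\<^sup>2 / (1 - sqrt \<theta>)) * sqrt \<theta> ^ n)"
    if "B \<in> sets borel" for j B n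
    using mis_density.\<mu>_bound[OF E that, unfolded epsS, of j n] by (simp only: times_divide_eq_left)
   show "0 \<le> 2 * Mb / \<epsilon>\<^sup>2" "0 \<le> 2 * Mb * C'' / \<epsilon>\<^sup>2 / (1 - sqrt \<theta>)" "0 < sqrt \<theta>" "sqrt \<theta> < 1"
    using d.Mb_nonneg d.C_pos d.q by simp_all
  qed
  \<comment> \<open>Any null sequence of parameters will do to produce the invariant
    measure.\<close>
  have "(\<lambda>j. t / real (Suc j)) \<longlonglongrightarrow> 0" by real_asymp
  then obtain \<mu> where \<mu>: "acip a \<mu>"
   using limit[of "\<lambda>j. t / real (Suc j)"] t by (auto simp: field_simps)
  show ?case
  proof (intro exI[of _ \<mu>] conjI allI impI \<mu>)
   show "\<nu> = \<mu>" if "acip a \<nu>" for \<nu> by (rule acip_unique[OF \<mu> that])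
   fix \<sigma> :: "nat => real" assume \<sigma>: "(\<forall>j. \<sigma> j \<in> {0<..t}) \<and> \<sigma> \<longlonglongrightarrow> 0"
   then obtain \<mu>' where "acip a \<mu>'" "weak_conv_m (\<lambda>j. projected_measure (S (\<sigma> j)) (\<phi> (\<sigma> j))) \<mu>'"
    using limit[of \<sigma>] by blast
   thus "weak_conv_m (\<lambda>j. projected_measure (S (\<sigma> j)) (\<phi> (\<sigma> j))) \<mu>" using acip_unique[OF \<mu>, of \<mu>'] by simp
  qed
 qed
qed

end
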